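(* Let $t_1,t_2,t_3,t_4$ be any four triangles in $\mathbb{R}^3$ (not assumed to be in general position or disjoint). Then the set of lines in $\mathbb{R}^3$ tangent to all four triangles has at most $162$ connected components. If the four triangles are (pairwise) disjoint, then the number of connected components is at most $156$.
   Context: A triangle in $\mathbb{R}^3$ is the convex hull of three distinct non-collinear points of $\mathbb{R}^3$; its three edges are the (closed) segments joining pairs of these points. A line in $\mathbb{R}^3$ is tangent to a triangle if it meets an edge of the triangle; a common tangent of four triangles is a line tangent to each of them. Two common tangents are in the same connected component if one may move continuously (in the space of lines of $\mathbb{R}^3$ with its usual topology) from one line to the other while staying tangent to all four triangles. *)

theory Defs
  imports "HOL-Analysis.Analysis"
begin

definition triangle :: "(real^3) set \<Rightarrow> bool" where
  "triangle T \<longleftrightarrow>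
     (\<exists>a b c. distinct [a, b, c] \<and> \<not> collinear {a, b, c} \<and> T = convex hull {a, b, c})"

text \<open>
  The edges are read off from the point set \<open>T\<close>: the vertices are determined by \<open>T\<close> (they are its
  extreme points), so this yields exactly the three sides; see \<open>triangle_edges_convex_hull\<close> below.
\<close>
definition triangle_edges :: "(real^3) set \<Rightarrow> (real^3) set set" where
  "triangle_edges T =
     {closed_segment a b | a b c.
        distinct [a, b, c] \<and> \<not> collinear {a, b, c} \<and> T = convex hull {a, b, c}}"

definition line_through :: "real^3 \<Rightarrow> real^3 \<Rightarrow> (real^3) set" where
  "line_through p v = range (\<lambda>s. p + s *\<^sub>R v)"

definition lines :: "(real^3) set set" where
  "lines = {line_through p v | p v. v \<noteq> 0}"

text \<open>
  The usual topology on the space of lines (the affine Grassmannian) is the quotient topology under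
  the surjection sending a point \<open>p\<close> and a direction \<open>v \<noteq> 0\<close> to the line through \<open>p\<close> along \<open>v\<close>.
\<close>
definition line_topology :: "(real^3) set topology" where
  "line_topology = topology (\<lambda>U. U \<subseteq> lines \<and> open {(p, v). v \<noteq> 0 \<and> line_through p v \<in> U})"

text \<open>
  Tangency to a triangle means meeting its relative boundary; a line that crosses an edge within
  the plane of the triangle, or even contains an edge, counts as tangent.
\<close>
definition tangent_to :: "(real^3) set \<Rightarrow> (real^3) set \<Rightarrow> bool" where
  "tangent_to L T \<longleftrightarrow> (\<exists>e\<in>triangle_edges T. L \<inter> e \<noteq> {})"

definition common_tangents :: "nat set \<Rightarrow> (nat \<Rightarrow> (real^3) set) \<Rightarrow> (real^3) set set" where
  "common_tangents I t = {L \<in> lines. \<forall>i\<in>I. tangent_to L (t i)}"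

text \<open>
  Two lines lie in the same component iff one can be moved continuously to the other within \<open>S\<close>,
  so these are the path components of \<open>S\<close> in the subspace topology.
\<close>
definition line_components :: "(real^3) set set \<Rightarrow> (real^3) set set set" where
  "line_components S = path_components_of (subtopology line_topology S)"

lemma triangle_edges_convex_hull:
  assumes nc: "\<not> collinear {a, b, c}"
  shows "triangle_edges (convex hull {a, b, c}) =
           {closed_segment a b, closed_segment b c, closed_segment c a}"
proof -
  have vertices: "{x. x extreme_point_of (convex hull {p, q, r})} = {p, q, r}"
    if "\<not> collinear {p, q, r}" for p q r :: "real^3"
    using that extreme_point_of_convex_hull_affine_independent[of "{p, q, r}"]
      affine_dependent_imp_collinear_3 by blast
  have d: "a \<noteq> b" "b \<noteq> c" "a \<noteq> c"
    using nc by (auto simp: insert_commute)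
  have eq: "{p, q, r} = {a, b, c}"
    if "\<not> collinear {p, q, r}" "convex hull {a, b, c} = convex hull {p, q, r}" for p q r
    using vertices[OF that(1)] vertices[OF nc] that(2) by simp
  show ?thesis
  proof
    show "triangle_edges (convex hull {a, b, c}) \<subseteq>
            {closed_segment a b, closed_segment b c, closed_segment c a}"
    proof
      fix e assume "e \<in> triangle_edges (convex hull {a, b, c})"
      then obtain p q r where e: "e = closed_segment p q" and pqr: "distinct [p, q, r]"
        "\<not> collinear {p, q, r}" "convex hull {a, b, c} = convex hull {p, q, r}"
        unfolding triangle_edges_def by blast
      have "p \<in> {a, b, c}" "q \<in> {a, b, c}" "p \<noteq> q"
        using eq[OF pqr(2,3)] pqr(1) by auto
      then show "e \<in> {closed_segment a b, closed_segment b c, closed_segment c a}"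
        unfolding e by (auto simp: closed_segment_commute)
    qed
    have "closed_segment x y \<in> triangle_edges (convex hull {a, b, c})"
      if "distinct [x, y, z]" "{x, y, z} = {a, b, c}" for x y z
      unfolding triangle_edges_def using that nc by (intro CollectI exI[of _ x] exI[of _ y] exI[of _ z]) auto
    from this[of a b c] this[of b c a] this[of c a b]
    show "{closed_segment a b, closed_segment b c, closed_segment c a} \<subseteq>
            triangle_edges (convex hull {a, b, c})"
      using d by auto
  qed
qed

lemma openin_line_topology:
  "openin line_topology U \<longleftrightarrow>
     U \<subseteq> lines \<and> open {(p, v). v \<noteq> 0 \<and> line_through p v \<in> U}"
proof -
  let ?P = "\<lambda>U. {(p, v). v \<noteq> 0 \<and> line_through p v \<in> U}"
  have "istopology (\<lambda>U. U \<subseteq> lines \<and> open (?P U))"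
    unfolding istopology_def
  proof (intro conjI allI impI)
    fix S T assume "S \<subseteq> lines \<and> open (?P S)" "T \<subseteq> lines \<and> open (?P T)"
    moreover have "?P (S \<inter> T) = ?P S \<inter> ?P T" by auto
    ultimately show "S \<inter> T \<subseteq> lines" "open (?P (S \<inter> T))" by (auto intro: open_Int)
  next
    fix K assume K: "\<forall>S\<in>K. S \<subseteq> lines \<and> open (?P S)"
    moreover have "?P (\<Union>K) = (\<Union>S\<in>K. ?P S)" by auto
    ultimately show "\<Union>K \<subseteq> lines" "open (?P (\<Union>K))" by auto
  qed
  then show ?thesis
    unfolding line_topology_def by simp
qed

lemma topspace_line_topology: "topspace line_topology = lines"
proof
  show "topspace line_topology \<subseteq> lines"
    using openin_line_topology openin_topspace by blast
  have "{(p, v). v \<noteq> 0 \<and> line_through p v \<in> lines} = UNIV \<times> - {0}"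
    unfolding lines_def by auto
  then have "openin line_topology lines"
    by (simp add: openin_line_topology open_Times open_Compl)
  then show "lines \<subseteq> topspace line_topology"
    by (rule openin_subset)
qed

lemma quotient_map_line_topology:
  "quotient_map (top_of_set {(p, v). v \<noteq> 0}) line_topology (\<lambda>(p, v). line_through p v)"
proof -
  have o: "open {(p :: real^3, v :: real^3). v \<noteq> 0}"
  proof -
    have "{(p :: real^3, v :: real^3). v \<noteq> 0} = UNIV \<times> - {0}" by auto
    then show ?thesis by (simp add: open_Times open_Compl)
  qed
  have pre: "{x \<in> {(p, v). v \<noteq> 0}. (case x of (p, v) \<Rightarrow> line_through p v) \<in> U} =
               {(p, v). v \<noteq> 0 \<and> line_through p v \<in> U}" for U
    by auto
  have img: "(\<lambda>(p, v). line_through p v) ` {(p, v). v \<noteq> 0} = lines"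
    unfolding lines_def by auto
  have sub: "{(p, v). v \<noteq> 0 \<and> line_through p v \<in> U} \<subseteq> {(p, v). v \<noteq> 0}" for U
    by auto
  show ?thesis
    unfolding quotient_map_def topspace_line_topology topspace_euclidean_subtopology
  proof (intro conjI allI impI)
    fix U assume "U \<subseteq> lines"
    then show "openin (top_of_set {(p, v). v \<noteq> 0})
                 {x \<in> {(p, v). v \<noteq> 0}. (case x of (p, v) \<Rightarrow> line_through p v) \<in> U} =
               openin line_topology U"
      unfolding pre openin_open_eq[OF o] openin_line_topology using sub by blast
  qed (rule img)
qed

end

theory Submission
  imports Defs
begin

text \<open>
  A common tangent meets one edge of each triangle, so the set of common tangents is the union, over the
  \<open>81\<close> choices of edges, of the sets of transversals of four segments. The transversals of four segments are
  covered by path-connected pieces of total weight at most \<open>8\<close>: pairwise skew segments lead to at most four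
  intervals in a ruling of a quadric, coplanar segments to lines in a plane that are classified by sign patterns.
  A piece of weight less than \<open>4\<close> contains a line through a vertex, which also realises a neighbouring choice.
  Hence every component collects weight at least \<open>4\<close>, and there are at most \<open>81 * 8 / 4 = 162\<close> components.

  For disjoint triangles, if two edges of different triangles are coplanar, then the lines in their plane are
  few and can be counted separately. Otherwise three choices can be discarded, which leaves \<open>78 * 8 / 4 = 156\<close>:
  in general position one finds three choices \<open>e\<close>, each with an edge \<open>e i\<close> such that no plane through the line
  of this edge meets the other three edges. Perturbing the triangles and passing to the limit, a
  transversal for such a choice passes through vertices of two further triangles and so realises at least two
  choices that have not been discarded.
\<close>

section \<open>Paths of lines\<close>

text \<open>A vertex lies on two edges of its triangle, so a common tangent through vertices of r
  different triangles realises at least 2^r choices. This fixes the exchange rate: a piece may weigh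
  4, 2 or 1 once it contains a line through vertices of 0, 1 or 2 triangles. The budget 8 can be
  used up by 2 isolated lines of weight 4, by 4 intervals of weight 2 or by 8 sign patterns of
  weight 1. The obstacle is degeneracy: coplanar, concurrent and collinear edges mix planar families
  with lines that leave the plane, and these lines have to be attached to pieces that are already
  paid for.

  A choice accounts for 8 / 4 = 2 components, so three discarded choices save the required 6. The
  count itself is not perturbed, because components may vanish when the triangles move. Only the
  certificates are perturbed: a certified choice has no transversal, and in the limit it can only
  acquire transversals that touch vertices of two further triangles.\<close>

lemma path_connectedin_lines:
  fixes p v :: "'a::topological_space \<Rightarrow> real^3"
  assumes X: "path_connected X" and cp: "continuous_on X p" and cv: "continuous_on X v"
    and nz: "\<And>x. x \<in> X \<Longrightarrow> v x \<noteq> 0"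
  shows "path_connectedin line_topology ((\<lambda>x. line_through (p x) (v x)) ` X)"
proof -
  have q: "continuous_map (top_of_set {(p, v). v \<noteq> 0}) line_topology (\<lambda>(p, v). line_through p v)"
    by (rule quotient_imp_continuous_map[OF quotient_map_line_topology])
  have "continuous_map (top_of_set X) (top_of_set {(p, v). v \<noteq> 0}) (\<lambda>x. (p x, v x))"
    using nz by (auto intro!: continuous_on_Pair cp cv)
  from continuous_map_compose[OF this q]
  have c: "continuous_map (top_of_set X) line_topology (\<lambda>x. line_through (p x) (v x))"
    by (simp add: o_def)
  have "path_connectedin (top_of_set X) X"
    using X by (simp add: path_connectedin_subtopology)
  from path_connectedin_continuous_map_image[OF c this] show ?thesis by simp
qed

lemma path_connectedin_sing_line:
  assumes "L \<in> lines"
  shows "path_connectedin line_topology {L}"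
  using assms by (simp add: topspace_line_topology)

lemma path_component_superset:
  assumes K: "K \<in> path_components_of (subtopology X S)"
    and P: "path_connectedin X P" "P \<subseteq> S" and L: "L \<in> P" "L \<in> K"
  shows "P \<subseteq> K"
proof -
  have P': "path_connectedin (subtopology X S) P"
    using P by (simp add: path_connectedin_subtopology)
  then show ?thesis
    using K L path_components_of_maximal[OF K P'] by (auto simp: disjnt_def)
qed

text \<open>Nonempty pieces inside different components are different, so the weights collected by
  the components add up to at most the total weight. A component is determined by the pieces that it
  contains, which yields finiteness along the way.\<close>

lemma card_path_components_le:
  fixes w :: "'i \<Rightarrow> nat"
  assumes fin: "finite A"
    and P: "\<And>\<alpha>. \<alpha> \<in> A \<Longrightarrow> path_connectedin X (P \<alpha>) \<and> P \<alpha> \<subseteq> S"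
    and heavy: "\<And>K. K \<in> path_components_of (subtopology X S) \<Longrightarrow>
        n \<le> (\<Sum>\<alpha> | \<alpha> \<in> A \<and> P \<alpha> \<noteq> {} \<and> P \<alpha> \<subseteq> K. w \<alpha>)"
    and n: "0 < n"
  shows "finite (path_components_of (subtopology X S))"
    "n * card (path_components_of (subtopology X S)) \<le> (\<Sum>\<alpha>\<in>A. w \<alpha>)"
proof -
  let ?C = "path_components_of (subtopology X S)"
  let ?B = "\<lambda>K. {\<alpha>. \<alpha> \<in> A \<and> P \<alpha> \<noteq> {} \<and> P \<alpha> \<subseteq> K}"
  have disj: "?B K \<inter> ?B K' = {}" if "K \<in> ?C" "K' \<in> ?C" "K \<noteq> K'" for K K'
    using pairwise_disjoint_path_components_of[of "subtopology X S"] that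
    unfolding pairwise_def disjnt_def by blast
  have ne: "?B K \<noteq> {}" if "K \<in> ?C" for K
    using heavy[OF that] n by (intro notI) simp
  have inj: "inj_on ?B ?C"
  proof (rule inj_onI, rule ccontr)
    fix K K' assume h: "K \<in> ?C" "K' \<in> ?C" "?B K = ?B K'" "K \<noteq> K'"
    show False using disj[OF h(1,2,4)] ne[OF h(1)] unfolding h(3) by simp
  qed
  have "finite (?B ` ?C)"
    by (rule finite_subset[of _ "Pow A"]) (use fin in auto)
  then show fC: "finite ?C"
    using inj by (rule finite_imageD)
  have "n * card ?C = (\<Sum>K\<in>?C. n)" by simp
  also have "\<dots> \<le> (\<Sum>K\<in>?C. \<Sum>\<alpha>\<in>?B K. w \<alpha>)"
    using heavy by (rule sum_mono)
  also have "\<dots> = (\<Sum>\<alpha>\<in>(\<Union>K\<in>?C. ?B K). w \<alpha>)"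
    by (rule sum.UNION_disjoint[symmetric]) (use fC fin disj in \<open>simp_all\<close>)
  also have "\<dots> \<le> (\<Sum>\<alpha>\<in>A. w \<alpha>)"
    using fin by (intro sum_mono2) auto
  finally show "n * card ?C \<le> (\<Sum>\<alpha>\<in>A. w \<alpha>)" .
qed

lemma path_connectedin_pairwise:
  assumes "P \<subseteq> topspace X"
    and "\<And>x y. x \<in> P \<Longrightarrow> y \<in> P \<Longrightarrow> \<exists>Q. path_connectedin X Q \<and> Q \<subseteq> P \<and> x \<in> Q \<and> y \<in> Q"
  shows "path_connectedin X P"
proof -
  have "path_component_of (subtopology X P) x y" if xy: "x \<in> P" "y \<in> P" for x y
  proof -
    obtain Q where Q: "path_connectedin X Q" "Q \<subseteq> P" "x \<in> Q" "y \<in> Q"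
      using assms(2)[OF xy] by (elim exE conjE)
    then have "path_connectedin (subtopology X P) Q"
      by (simp add: path_connectedin_subtopology)
    then show ?thesis
      unfolding path_component_of using Q(3,4) by (intro exI[of _ Q]) simp
  qed
  then show ?thesis
    using assms(1) unfolding path_connectedin_def path_connected_space_iff_path_component
    by (auto simp: Int_absorb1)
qed

section \<open>Elementary geometry of lines and normals in space\<close>

unbundle cross3_syntax

lemma mem_line_through: "x \<in> line_through p v \<longleftrightarrow> (\<exists>s. x = p + s *\<^sub>R v)"
  unfolding line_through_def by auto

lemma line_through_base: "p \<in> line_through p v"
  unfolding mem_line_through by (intro exI[of _ 0]) simp

lemma line_through_in_lines: "v \<noteq> 0 \<Longrightarrow> line_through p v \<in> lines"
  unfolding lines_def by auto

lemma line_through_rebase: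
  assumes "x \<in> line_through p v"
  shows "line_through x v = line_through p v"
proof -
  obtain s where s: "x = p + s *\<^sub>R v" using assms mem_line_through by blast
  have "y \<in> line_through x v \<longleftrightarrow> y \<in> line_through p v" for y
    unfolding mem_line_through s
    by (metis (no_types, opaque_lifting) add.assoc add_diff_cancel_left' diff_add_cancel scaleR_left.add scaleR_left.diff)
  then show ?thesis by blast
qed

lemma line_through_scale:
  assumes "c \<noteq> 0"
  shows "line_through p (c *\<^sub>R v) = line_through p v"
proof -
  have "y \<in> line_through p (c *\<^sub>R v) \<longleftrightarrow> y \<in> line_through p v" for y
  proof
    show "y \<in> line_through p (c *\<^sub>R v) \<Longrightarrow> y \<in> line_through p v"
      unfolding mem_line_through by auto
    assume "y \<in> line_through p v"
    then obtain s where "y = p + s *\<^sub>R v" unfolding mem_line_through by blast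
    then have "y = p + (s / c) *\<^sub>R (c *\<^sub>R v)" using assms by simp
    then show "y \<in> line_through p (c *\<^sub>R v)" unfolding mem_line_through by blast
  qed
  then show ?thesis by blast
qed

lemma lines_point_direction:
  assumes "L \<in> lines" "x \<in> L"
  obtains v where "v \<noteq> 0" "L = line_through x v"
proof -
  obtain p v where "L = line_through p v" "v \<noteq> 0" using assms(1) unfolding lines_def by blast
  then show ?thesis using assms(2) line_through_rebase that by metis
qed

lemma line_two_points:
  assumes "L \<in> lines" "x \<in> L" "y \<in> L" "x \<noteq> y"
  shows "L = line_through x (y - x)"
proof -
  obtain v where v: "v \<noteq> 0" "L = line_through x v" using lines_point_direction assms by metis
  then obtain s where s: "y = x + s *\<^sub>R v" using assms(3) mem_line_through by blast
  then have "s \<noteq> 0" "y - x = s *\<^sub>R v" using assms(4) by auto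
  then show ?thesis using v line_through_scale by metis
qed

lemma lines_eq_if_two_points:
  assumes "L \<in> lines" "M \<in> lines" "x \<in> L" "y \<in> L" "x \<in> M" "y \<in> M" "x \<noteq> y"
  shows "L = M"
  using line_two_points assms by metis

lemma lines_obtain_other:
  assumes "L \<in> lines"
  obtains y where "y \<in> L" "y \<noteq> x"
proof -
  obtain p v where L: "L = line_through p v" "v \<noteq> 0" using assms unfolding lines_def by blast
  have "p \<in> L" "p + 1 *\<^sub>R v \<in> L" unfolding L(1) mem_line_through by (intro exI[of _ 0], simp) blast
  moreover have "p \<noteq> p + 1 *\<^sub>R v" using L(2) by simp
  ultimately show ?thesis using that by metis
qed

lemma lines_subset_eq:
  assumes "L \<in> lines" "M \<in> lines" "L \<subseteq> M"
  shows "L = M"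
proof -
  obtain x where "x \<in> L" using lines_obtain_other[OF assms(1)] by metis
  moreover obtain y where "y \<in> L" "y \<noteq> x" using lines_obtain_other[OF assms(1)] by metis
  ultimately show ?thesis using lines_eq_if_two_points assms by (metis subsetD)
qed

lemma perp_two:
  fixes n m x :: "real^3"
  assumes "n \<bullet> x = 0" "m \<bullet> x = 0" "n \<times> m \<noteq> 0"
  obtains c where "x = c *\<^sub>R (n \<times> m)"
proof -
  have "(n \<times> m) \<times> x = (n \<bullet> x) *\<^sub>R m - (m \<bullet> x) *\<^sub>R n"
    using Lagrange[of x n m] by (simp add: cross_skew[of "n \<times> m" x] inner_commute)
  then have "(n \<times> m) \<times> x = 0" using assms by simp
  then have "collinear {0, n \<times> m, x}" by (simp add: cross_eq_0)
  then show ?thesis using that assms(3) unfolding collinear_lemma by (metis scaleR_zero_left)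
qed

lemma cross_perp_nonzero:
  fixes n m :: "real^3"
  assumes "m \<bullet> n = 0" "m \<noteq> 0" "n \<noteq> 0"
  shows "n \<times> m \<noteq> 0"
  using assms norm_and_cross_eq_0[of n m] by (auto simp: inner_commute)

section \<open>Lines in a plane\<close>

text \<open>The line \<open>{x. n \<bullet> (x - o) = 0 \<and> m \<bullet> (x - o) = k}\<close> of the plane through \<open>o\<close> with normal \<open>n\<close>.\<close>

definition zero_line :: "real^3 \<Rightarrow> real^3 \<Rightarrow> real^3 \<Rightarrow> real \<Rightarrow> (real^3) set" where
  "zero_line n ob m k = line_through (ob + (k / (m \<bullet> m)) *\<^sub>R m) (n \<times> m)"

lemma mem_zero_line:
  assumes "m \<bullet> n = 0" "m \<noteq> 0" "n \<noteq> 0"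
  shows "x \<in> zero_line n ob m k \<longleftrightarrow> n \<bullet> (x - ob) = 0 \<and> m \<bullet> (x - ob) = k"
proof
  assume "x \<in> zero_line n ob m k"
  then obtain s where "x = ob + (k / (m \<bullet> m)) *\<^sub>R m + s *\<^sub>R (n \<times> m)"
    unfolding zero_line_def mem_line_through by blast
  then have "x - ob = (k / (m \<bullet> m)) *\<^sub>R m + s *\<^sub>R (n \<times> m)" by simp
  then show "n \<bullet> (x - ob) = 0 \<and> m \<bullet> (x - ob) = k"
    using assms by (simp add: inner_add_right dot_cross_self inner_commute)
next
  assume h: "n \<bullet> (x - ob) = 0 \<and> m \<bullet> (x - ob) = k"
  let ?y = "x - ob - (k / (m \<bullet> m)) *\<^sub>R m"
  have "n \<bullet> ?y = 0" "m \<bullet> ?y = 0"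
    using h assms by (simp_all add: inner_diff_right inner_commute)
  then obtain c where "?y = c *\<^sub>R (n \<times> m)"
    using perp_two cross_perp_nonzero[OF assms] by metis
  then have "x = (ob + (k / (m \<bullet> m)) *\<^sub>R m) + c *\<^sub>R (n \<times> m)"
    by (simp add: algebra_simps)
  then show "x \<in> zero_line n ob m k"
    unfolding zero_line_def mem_line_through by blast
qed

lemma zero_line_in_lines:
  assumes "m \<bullet> n = 0" "m \<noteq> 0" "n \<noteq> 0"
  shows "zero_line n ob m k \<in> lines"
  unfolding zero_line_def using cross_perp_nonzero[OF assms] line_through_in_lines by blast

lemma line_in_plane_zero_line:
  assumes L: "L \<in> lines" "\<And>x. x \<in> L \<Longrightarrow> n \<bullet> (x - ob) = 0" and n: "n \<noteq> 0"
  obtains m k where "m \<bullet> n = 0" "m \<noteq> 0" "L = zero_line n ob m k"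
proof -
  obtain p v where pv: "L = line_through p v" "v \<noteq> 0" using L unfolding lines_def by blast
  have p: "n \<bullet> (p - ob) = 0" using L(2) line_through_base pv by blast
  have "p + 1 *\<^sub>R v \<in> L" unfolding pv mem_line_through by blast
  then have "n \<bullet> (p + 1 *\<^sub>R v - ob) = 0" using L(2) by blast
  then have nv: "n \<bullet> v = 0" using p by (simp add: algebra_simps inner_add_right inner_diff_right)
  let ?m = "n \<times> v" let ?k = "?m \<bullet> (p - ob)"
  have m: "?m \<bullet> n = 0" "?m \<noteq> 0"
    using cross_perp_nonzero[of v n] nv n pv by (simp_all add: dot_cross_self inner_commute)
  have "L \<subseteq> zero_line n ob ?m ?k"
  proof
    fix x assume x: "x \<in> L"
    then obtain s where s: "x = p + s *\<^sub>R v" unfolding pv mem_line_through by blast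
    have "?m \<bullet> (x - ob) = ?k"
      unfolding s by (simp add: inner_add_right inner_diff_right dot_cross_self)
    then show "x \<in> zero_line n ob ?m ?k" using mem_zero_line[OF m n] L(2)[OF x] by blast
  qed
  then have "L = zero_line n ob ?m ?k"
    using lines_subset_eq L(1) zero_line_in_lines[OF m n] by blast
  then show ?thesis using that m by blast
qed

section \<open>Affine functionals on a plane and their zero lines\<close>

definition sign_cone :: "real^3 \<Rightarrow> real^3 \<Rightarrow> (real \<times> (real^3)) set \<Rightarrow> ((real^3) \<times> real) set" where
  "sign_cone n ob G = {(m, k). m \<bullet> n = 0 \<and> (\<forall>(\<sigma>, x)\<in>G. 0 \<le> \<sigma> * (m \<bullet> (x - ob) - k))}"

text \<open>A pair \<open>(m, k)\<close> stands for the functional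
  \<open>m \<bullet> (x - ob) - k\<close> on the plane. Prescribing weak signs makes the admissible
  functionals a convex cone, so that two lines can be joined by a segment of functionals; a point
  that carries both signs is forced onto the line.\<close>

definition cone_lines :: "real^3 \<Rightarrow> real^3 \<Rightarrow> (real \<times> (real^3)) set \<Rightarrow> (real^3) set set" where
  "cone_lines n ob G = {zero_line n ob m k | m k. m \<noteq> 0 \<and> (m, k) \<in> sign_cone n ob G}"

lemma sign_cone_convex_comb:
  assumes "(m, k) \<in> sign_cone n ob G" "(m', k') \<in> sign_cone n ob G" "0 \<le> s" "0 \<le> t"
  shows "(s *\<^sub>R m + t *\<^sub>R m', s * k + t * k') \<in> sign_cone n ob G"
  unfolding sign_cone_def
proof (clarify, intro conjI ballI)
  show "(s *\<^sub>R m + t *\<^sub>R m') \<bullet> n = 0" using assms unfolding sign_cone_def by (simp add: inner_add_left)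
  fix g assume g: "g \<in> G"
  obtain \<sigma> x where gx: "g = (\<sigma>, x)" by (cases g)
  have "0 \<le> \<sigma> * (m \<bullet> (x - ob) - k)" "0 \<le> \<sigma> * (m' \<bullet> (x - ob) - k')"
    using assms(1,2) g gx unfolding sign_cone_def by auto
  then have "0 \<le> s * (\<sigma> * (m \<bullet> (x - ob) - k)) + t * (\<sigma> * (m' \<bullet> (x - ob) - k'))"
    using assms(3,4) by simp
  then show "case g of (\<sigma>, x) \<Rightarrow> 0 \<le> \<sigma> * ((s *\<^sub>R m + t *\<^sub>R m') \<bullet> (x - ob) - (s * k + t * k'))"
    unfolding gx by (simp add: inner_add_left algebra_simps)
qed

lemma zero_line_scale:
  assumes "c \<noteq> 0" "m \<bullet> n = 0" "m \<noteq> 0" "n \<noteq> 0"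
  shows "zero_line n ob (c *\<^sub>R m) (c * k) = zero_line n ob m k"
proof -
  have "x \<in> zero_line n ob (c *\<^sub>R m) (c * k) \<longleftrightarrow> x \<in> zero_line n ob m k" for x
    using mem_zero_line[of "c *\<^sub>R m" n x ob "c * k"] mem_zero_line[of m n x ob k] assms by simp
  then show ?thesis by blast
qed

text \<open>The segment joining two functionals can only pass through a functional that is constant on the
  plane; the sign conditions force that constant to be \<open>0\<close>, and then the two lines coincide.\<close>

lemma path_connectedin_cone_lines:
  assumes n: "n \<noteq> 0" and G: "(1, x) \<in> G" "(-1, y) \<in> G"
  shows "path_connectedin line_topology (cone_lines n ob G)"
proof (rule path_connectedin_pairwise)
  show "cone_lines n ob G \<subseteq> topspace line_topology"
    unfolding topspace_line_topology cone_lines_def sign_cone_def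
    using zero_line_in_lines n by auto
  fix L M assume "L \<in> cone_lines n ob G" "M \<in> cone_lines n ob G"
  then obtain m k m' k' where L: "L = zero_line n ob m k" "m \<noteq> 0" "(m, k) \<in> sign_cone n ob G"
    and M: "M = zero_line n ob m' k'" "m' \<noteq> 0" "(m', k') \<in> sign_cone n ob G"
    unfolding cone_lines_def by blast
  have mn: "m \<bullet> n = 0" "m' \<bullet> n = 0" using L M unfolding sign_cone_def by auto
  show "\<exists>Q. path_connectedin line_topology Q \<and> Q \<subseteq> cone_lines n ob G \<and> L \<in> Q \<and> M \<in> Q"
  proof (cases "\<exists>t\<in>{0..1}. (1 - t) *\<^sub>R m + t *\<^sub>R m' = 0")
    case True
    then obtain t where t: "0 \<le> t" "t \<le> 1" "(1 - t) *\<^sub>R m + t *\<^sub>R m' = 0" by auto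
    have t1: "t \<noteq> 0" "t \<noteq> 1" using t L(2) M(2) by auto
    have c: "((1 - t) *\<^sub>R m + t *\<^sub>R m', (1 - t) * k + t * k') \<in> sign_cone n ob G"
      using sign_cone_convex_comb[OF L(3) M(3), of "1 - t" t] t by simp
    have "0 \<le> \<sigma> * (0 - ((1 - t) * k + t * k'))" if "(\<sigma>, z) \<in> G" for \<sigma> z
      using c that unfolding t(3) sign_cone_def by fastforce
    from this[OF G(1)] this[OF G(2)] have kk: "(1 - t) * k + t * k' = 0" by simp
    let ?c = "- (1 - t) / t"
    have "t *\<^sub>R m' = t *\<^sub>R (?c *\<^sub>R m)" using t(3) t1(1) by (simp add: add_eq_0_iff eq_neg_iff_add_eq_0 scaleR_left_diff_distrib)
    then have "m' = ?c *\<^sub>R m" using t1 by (metis scaleR_cancel_left)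
    moreover have "k' = ?c * k" using kk t1(1) by (simp add: field_simps)
    ultimately have "M = L" using zero_line_scale[of ?c m n ob k] t1 mn L M n by simp
    then have "path_connectedin line_topology {L} \<and> {L} \<subseteq> cone_lines n ob G \<and> L \<in> {L} \<and> M \<in> {L}"
      using \<open>L \<in> cone_lines n ob G\<close> path_connectedin_sing_line zero_line_in_lines[OF mn(1) L(2) n] L(1)
      by simp
    then show ?thesis by blast
  next
    case False
    let ?m = "\<lambda>t. (1 - t) *\<^sub>R m + t *\<^sub>R m'" and ?k = "\<lambda>t. (1 - t) * k + t * k'"
    let ?f = "\<lambda>t. line_through (ob + (?k t / (?m t \<bullet> ?m t)) *\<^sub>R ?m t) (n \<times> ?m t)"
    have mt: "?m t \<noteq> 0" "?m t \<bullet> n = 0" if "t \<in> {0..1}" for t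
      using False that mn by (auto simp: inner_add_left)
    have "path_connectedin line_topology (?f ` {0..1})"
    proof (rule path_connectedin_lines)
      show "continuous_on {0..1} (\<lambda>t. ob + (?k t / (?m t \<bullet> ?m t)) *\<^sub>R ?m t)"
        using mt by (intro continuous_intros) auto
      show "continuous_on {0..1} (\<lambda>t. n \<times> ?m t)" by (intro continuous_on_cross continuous_intros)
      show "n \<times> ?m t \<noteq> 0" if "t \<in> {0..1}" for t using cross_perp_nonzero mt[OF that] n by blast
    qed simp
    moreover have "?f ` {0..1} \<subseteq> cone_lines n ob G"
    proof clarify
      fix t :: real assume t: "t \<in> {0..1}"
      have "(?m t, ?k t) \<in> sign_cone n ob G" using sign_cone_convex_comb L(3) M(3) t by simp
      then show "?f t \<in> cone_lines n ob G"
        using mt[OF t] unfolding cone_lines_def zero_line_def by blast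
    qed
    moreover have "L \<in> ?f ` {0..1}" unfolding L zero_line_def by (rule image_eqI[of _ _ 0]) auto
    moreover have "M \<in> ?f ` {0..1}" unfolding M zero_line_def by (rule image_eqI[of _ _ 1]) auto
    ultimately show ?thesis by blast
  qed
qed

text \<open>The ratio test of linear programming: walk in the direction in which \<open>b g0\<close>
  decreases and stop at the smallest ratio, where the first constraint becomes tight. The choice of
  the direction guarantees that the walk is blocked at all.\<close>

lemma first_hit:
  fixes a b :: "'i \<Rightarrow> real"
  assumes fin: "finite G" and a: "\<And>g. g \<in> G \<Longrightarrow> 0 \<le> a g" and b: "g0 \<in> G" "b g0 \<noteq> 0"
  obtains t g where "\<And>h. h \<in> G \<Longrightarrow> 0 \<le> a h + t * b h" "g \<in> G" "b g \<noteq> 0" "a g + t * b g = 0"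
proof -
  define s where "s = - sgn (b g0)"
  define H where "H = {g \<in> G. s * b g < 0}"
  have s: "s * b g0 < 0" "s * s = 1" using b(2) by (auto simp: s_def sgn_if)
  have H: "finite H" "H \<noteq> {}" using fin b s unfolding H_def by auto
  obtain g where g: "g \<in> H" "\<And>h. h \<in> H \<Longrightarrow> a g / (- (s * b g)) \<le> a h / (- (s * b h))"
    using ex_min_if_finite[of "(\<lambda>h. a h / (- (s * b h))) ` H"] H by (auto simp: not_less)
  define r where "r = a g / (- (s * b g))"
  have g': "g \<in> G" "s * b g < 0" using g unfolding H_def by auto
  have r: "0 \<le> r" unfolding r_def using a g' by (simp add: divide_nonneg_neg)
  have "0 \<le> a h + (s * r) * b h" if h: "h \<in> G" for h
  proof (cases "s * b h < 0")
    case True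
    then have "r \<le> a h / (- (s * b h))" unfolding r_def using g(2) h unfolding H_def by blast
    moreover have "0 < - (s * b h)" using True by simp
    ultimately have "r * (- (s * b h)) \<le> a h" by (simp only: pos_le_divide_eq)
    then show ?thesis by (simp add: algebra_simps)
  next
    case False
    then have "0 \<le> r * (s * b h)" using r by (intro mult_nonneg_nonneg[of r "s * b h"]) linarith+
    then show ?thesis using a[OF h] by (simp add: algebra_simps)
  qed
  moreover have "a g + (s * r) * b g = 0"
    using g' unfolding r_def by (auto simp: field_simps)
  moreover have "b g \<noteq> 0" using g'(2) by auto
  ultimately show ?thesis using that[of "s * r" g] g'(1) by blast
qed

text \<open>The direction of motion is nonzero at the point \<open>y\<close> that stops it. For the
  translation \<open>(0, 1)\<close> this says nothing; for a rotation about a point it makes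
  \<open>y\<close> different from that point.\<close>

lemma sign_cone_move:
  assumes f: "(m, k) \<in> sign_cone n ob G" and G: "finite G" and h: "m' \<bullet> n = 0"
    and g: "(\<sigma>, x) \<in> G" "\<sigma> * (m' \<bullet> (x - ob) - k') \<noteq> 0"
  obtains t \<sigma>' y where "(m + t *\<^sub>R m', k + t * k') \<in> sign_cone n ob G" "(\<sigma>', y) \<in> G"
    "m' \<bullet> (y - ob) \<noteq> k'" "(m + t *\<^sub>R m') \<bullet> (y - ob) = k + t * k'"
proof -
  let ?a = "\<lambda>(\<sigma>, x). \<sigma> * (m \<bullet> (x - ob) - k)" and ?b = "\<lambda>(\<sigma>, x). \<sigma> * (m' \<bullet> (x - ob) - k')"
  have "0 \<le> ?a g" if "g \<in> G" for g using f that unfolding sign_cone_def by auto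
  moreover have "?b (\<sigma>, x) \<noteq> 0" using g by simp
  ultimately obtain t g where t: "\<And>h. h \<in> G \<Longrightarrow> 0 \<le> ?a h + t * ?b h" "g \<in> G" "?b g \<noteq> 0" "?a g + t * ?b g = 0"
    using first_hit[OF G, of ?a "(\<sigma>, x)" ?b] g(1) by metis
  obtain \<sigma>' y where gy: "g = (\<sigma>', y)" by (cases g)
  have e: "\<sigma> * ((m + t *\<^sub>R m') \<bullet> (x - ob) - (k + t * k')) = ?a (\<sigma>, x) + t * ?b (\<sigma>, x)" for \<sigma> x
    by (simp add: inner_add_left algebra_simps)
  have "(m + t *\<^sub>R m', k + t * k') \<in> sign_cone n ob G"
    unfolding sign_cone_def
  proof (clarify, intro conjI ballI)
    show "(m + t *\<^sub>R m') \<bullet> n = 0" using f h unfolding sign_cone_def by (simp add: inner_add_left)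
    fix h assume "h \<in> G"
    then show "case h of (\<sigma>, x) \<Rightarrow> 0 \<le> \<sigma> * ((m + t *\<^sub>R m') \<bullet> (x - ob) - (k + t * k'))"
      using t(1)[of h] by (cases h) (simp only: e prod.case)
  qed
  moreover have "\<sigma>' * ((m + t *\<^sub>R m') \<bullet> (y - ob) - (k + t * k')) = 0" "\<sigma>' \<noteq> 0" "m' \<bullet> (y - ob) \<noteq> k'"
    using t(3,4) unfolding e gy by auto
  ultimately show ?thesis using that t(2) gy by auto
qed

lemma cone_lines_translate:
  assumes f: "(m, k) \<in> sign_cone n ob G" and G: "finite G" "(\<sigma>, x) \<in> G" "\<sigma> \<noteq> 0"
  obtains k' \<sigma>' y where "(m, k') \<in> sign_cone n ob G" "(\<sigma>', y) \<in> G" "m \<bullet> (y - ob) = k'"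
  using sign_cone_move[OF f G(1), of 0 \<sigma> x 1] G that by auto

text \<open>Adding multiples of a functional that vanishes at \<open>w\<close> keeps
  \<open>w\<close> on the line, so the move is a rotation about \<open>w\<close> that ends at
  another point of \<open>G\<close>.\<close>

lemma cone_lines_rotate:
  assumes f: "(m, k) \<in> sign_cone n ob G" "m \<noteq> 0" and n: "n \<noteq> 0" and G: "finite G" "(\<sigma>, x) \<in> G" "\<sigma> \<noteq> 0"
    and w: "m \<bullet> (w - ob) = k" and x: "n \<bullet> (x - w) = 0" "x \<noteq> w"
  obtains m' k' \<sigma>' y where "(m', k') \<in> sign_cone n ob G" "m' \<noteq> 0" "m' \<bullet> (w - ob) = k'"
    "(\<sigma>', y) \<in> G" "y \<noteq> w" "m' \<bullet> (y - ob) = k'"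
proof -
  have mn: "m \<bullet> n = 0" using f unfolding sign_cone_def by auto
  let ?d = "n \<times> m"
  have d0: "?d \<noteq> 0" using cross_perp_nonzero mn f n by blast
  have dn: "?d \<bullet> n = 0" "?d \<bullet> m = 0" by (simp_all add: dot_cross_self inner_commute)
  have nz: "m \<bullet> (x - w) \<noteq> 0 \<or> ?d \<bullet> (x - w) \<noteq> 0"
  proof (rule ccontr)
    assume "\<not> ?thesis"
    then have z: "m \<bullet> (x - w) = 0" "?d \<bullet> (x - w) = 0" by auto
    obtain c where c: "x - w = c *\<^sub>R ?d"
      using perp_two[of n "x - w" m] x(1) z(1) d0 by blast
    then have "c * (?d \<bullet> ?d) = 0" using z(2) by simp
    then show False using c x(2) d0 by simp
  qed
  show ?thesis
  proof (cases "m \<bullet> (x - w) = 0")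
    case True
    then have "m \<bullet> (x - ob) = k" using w by (simp add: inner_diff_right)
    then show ?thesis using that[of m k \<sigma> x] f w G x by blast
  next
    case False
    \<comment> \<open>\<open>?d\<close> is the part that turns the line, and \<open>m\<close> is
      added only if \<open>?d\<close> does not see \<open>x\<close>. A move along \<open>m\<close>
      alone could end at a constant functional.\<close>
    obtain c :: real where c: "c = 0 \<or> c = 1" "(?d + c *\<^sub>R m) \<bullet> (x - w) \<noteq> 0"
    proof (cases "?d \<bullet> (x - w) = 0")
      case True then show ?thesis using False that[of 1] by (simp add: inner_add_left)
    next
      case f: False then show ?thesis using that[of 0] by (simp add: inner_add_left)
    qed
    let ?h = "?d + c *\<^sub>R m"
    have hn: "?h \<bullet> n = 0" using dn mn by (simp add: inner_add_left)
    have hx: "\<sigma> * (?h \<bullet> (x - ob) - ?h \<bullet> (w - ob)) \<noteq> 0"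
      using c(2) G(3) by (simp add: inner_diff_right)
    obtain t \<sigma>' y where t: "(m + t *\<^sub>R ?h, k + t * (?h \<bullet> (w - ob))) \<in> sign_cone n ob G" "(\<sigma>', y) \<in> G"
      "?h \<bullet> (y - ob) \<noteq> ?h \<bullet> (w - ob)" "(m + t *\<^sub>R ?h) \<bullet> (y - ob) = k + t * (?h \<bullet> (w - ob))"
      using sign_cone_move[OF f(1) G(1) hn G(2) hx] by metis
    have "m + t *\<^sub>R ?h \<noteq> 0"
    proof
      assume z: "m + t *\<^sub>R ?h = 0"
      then have "(m + t *\<^sub>R ?h) \<bullet> ?d = 0" by simp
      moreover have "m \<bullet> ?d = 0" using dn by (simp add: inner_commute)
      ultimately have "t * (?d \<bullet> ?d) = 0" by (simp only: inner_add_left inner_scaleR_left) simp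
      then have "t = 0" using d0 by simp
      then show False using z f(2) by simp
    qed
    moreover have "(m + t *\<^sub>R ?h) \<bullet> (w - ob) = k + t * (?h \<bullet> (w - ob))"
      using w by (simp add: inner_add_left)
    moreover have "y \<noteq> w" using t(3) by auto
    ultimately show ?thesis using that t by blast
  qed
qed

lemma zero_line_meets_segment:
  assumes m: "m \<bullet> n = 0" "m \<noteq> 0" "n \<noteq> 0" and xy: "n \<bullet> (x - ob) = 0" "n \<bullet> (y - ob) = 0"
  shows "zero_line n ob m k \<inter> closed_segment x y \<noteq> {} \<longleftrightarrow>
    (m \<bullet> (x - ob) - k) * (m \<bullet> (y - ob) - k) \<le> 0" (is "?l \<longleftrightarrow> ?A * ?B \<le> 0")
proof
  assume ?l
  then obtain u where u: "0 \<le> u" "u \<le> 1" "(1 - u) *\<^sub>R x + u *\<^sub>R y \<in> zero_line n ob m k"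
    unfolding closed_segment_def by blast
  then have "m \<bullet> ((1 - u) *\<^sub>R x + u *\<^sub>R y - ob) = k" using mem_zero_line[OF m] by blast
  then have e: "(1 - u) * ?A + u * ?B = 0" by (simp add: algebra_simps inner_add_right inner_diff_right)
  show "?A * ?B \<le> 0"
  proof (rule ccontr)
    assume "\<not> ?A * ?B \<le> 0"
    then consider "0 < ?A" "0 < ?B" | "?A < 0" "?B < 0" by (auto simp: not_le zero_less_mult_iff)
    then show False
    proof cases
      case 1
      then have "0 < (1 - u) * ?A + u * ?B" using u
        by (cases "u = 0") (auto intro: add_nonneg_pos)
      then show False using e by simp
    next
      case 2
      have "0 < (1 - u) * (- ?A) + u * (- ?B)" using u 2
        by (cases "u = 0") (auto intro: add_nonneg_pos)
      then show False using e by (simp add: algebra_simps)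
    qed
  qed
next
  assume ab: "?A * ?B \<le> 0"
  obtain u where u: "0 \<le> u" "u \<le> 1" "(1 - u) * ?A + u * ?B = 0"
  proof (cases "?A = ?B")
    case True
    then have "?A = 0" using ab by (auto simp: mult_le_0_iff)
    then show ?thesis using that[of 0] by simp
  next
    case False
    let ?u = "?A / (?A - ?B)"
    have "0 \<le> ?u" "?u \<le> 1" using ab False
      by (auto simp: divide_simps mult_le_0_iff)
    moreover have "(1 - ?u) * ?A + ?u * ?B = 0" using False by (simp add: field_simps)
    ultimately show ?thesis using that by blast
  qed
  let ?z = "(1 - u) *\<^sub>R x + u *\<^sub>R y"
  have z: "?z - ob = (1 - u) *\<^sub>R (x - ob) + u *\<^sub>R (y - ob)" by (simp add: algebra_simps)
  have "n \<bullet> (?z - ob) = 0" "m \<bullet> (?z - ob) = k"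
    unfolding z using xy u(3) by (simp_all add: inner_add_right algebra_simps)
  then have "?z \<in> zero_line n ob m k" using mem_zero_line[OF m] by blast
  moreover have "?z \<in> closed_segment x y" unfolding closed_segment_def using u by blast
  ultimately show ?l by blast
qed

section \<open>Sign patterns of segments in a plane\<close>

definition transversals :: "nat set \<Rightarrow> (nat \<Rightarrow> real^3) \<Rightarrow> (nat \<Rightarrow> real^3) \<Rightarrow> (real^3) set set" where
  "transversals I p q = {L \<in> lines. \<forall>i\<in>I. L \<inter> closed_segment (p i) (q i) \<noteq> {}}"

definition plane_lines :: "real^3 \<Rightarrow> real^3 \<Rightarrow> (real^3) set \<Rightarrow> ((real^3) \<times> (real^3)) list \<Rightarrow> (real^3) set set" where
  "plane_lines n ob W ss = {L \<in> lines. (\<forall>x\<in>L. n \<bullet> (x - ob) = 0) \<and> W \<subseteq> L \<and>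
     (\<forall>s\<in>set ss. L \<inter> closed_segment (fst s) (snd s) \<noteq> {})}"

definition seg_signs :: "real \<Rightarrow> (real^3) \<times> (real^3) \<Rightarrow> (real \<times> (real^3)) set" where
  "seg_signs \<sigma> s = {(\<sigma>, fst s), (- \<sigma>, snd s)}"

text \<open>The functionals \<open>(m, k)\<close> and \<open>(- m, - k)\<close> have the same zero
  line. Fixing the sign of \<open>s0\<close> removes this ambiguity, so that only the signs of
  \<open>ss\<close> are free and there are \<open>2 ^ length ss\<close> patterns. The points of
  \<open>W\<close> get both signs and thus lie on the line.\<close>

definition pattern :: "(real^3) set \<Rightarrow> (real^3) \<times> (real^3) \<Rightarrow> ((real^3) \<times> (real^3)) list \<Rightarrow> real list \<Rightarrow> (real \<times> (real^3)) set" where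
  "pattern W s0 ss \<sigma>s = seg_signs 1 s0 \<union> (\<Union>(\<sigma>, s)\<in>set (zip \<sigma>s ss). seg_signs \<sigma> s) \<union> Pair 1 ` W \<union> Pair (-1) ` W"

definition signs :: "nat \<Rightarrow> real list list" where
  "signs m = product_lists (replicate m [1, -1])"

lemma set_signs: "\<sigma>s \<in> set (signs m) \<longleftrightarrow> length \<sigma>s = m \<and> (\<forall>\<sigma>\<in>set \<sigma>s. \<sigma> = 1 \<or> \<sigma> = -1)"
  unfolding signs_def product_lists_set
  by (auto simp: list_all2_conv_all_nth all_set_conv_all_nth)

lemma length_signs: "length (signs m) = 2 ^ m"
  unfolding signs_def length_product_lists by (induction m) auto

lemma distinct_signs: "distinct (signs m)"
  unfolding signs_def by (rule distinct_product_lists) auto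

lemma zero_line_mem_cone_lines:
  assumes m: "m \<bullet> n = 0" "m \<noteq> 0" and G: "\<And>\<sigma> x. (\<sigma>, x) \<in> G \<Longrightarrow> 0 \<le> \<sigma> * (m \<bullet> (x - ob) - k)"
  shows "zero_line n ob m k \<in> cone_lines n ob G"
proof -
  have "(m, k) \<in> sign_cone n ob G" using m(1) G unfolding sign_cone_def by auto
  then show ?thesis using m(2) unfolding cone_lines_def by blast
qed

lemma pattern_cases:
  assumes "(\<tau>, x) \<in> pattern W s0 ss \<sigma>s"
  obtains "\<tau> = 1" "x = fst s0" | "\<tau> = -1" "x = snd s0" | "\<tau> = 1 \<or> \<tau> = -1" "x \<in> W"
  | j where "j < length \<sigma>s" "j < length ss" "\<tau> = \<sigma>s ! j" "x = fst (ss ! j)"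
  | j where "j < length \<sigma>s" "j < length ss" "\<tau> = - \<sigma>s ! j" "x = snd (ss ! j)"
  using assms unfolding pattern_def seg_signs_def by (auto simp: in_set_zip)

lemma pattern_nth:
  assumes "j < length \<sigma>s" "j < length ss"
  shows "(\<sigma>s ! j, fst (ss ! j)) \<in> pattern W s0 ss \<sigma>s" "(- \<sigma>s ! j, snd (ss ! j)) \<in> pattern W s0 ss \<sigma>s"
proof -
  have "(\<sigma>s ! j, ss ! j) \<in> set (zip \<sigma>s ss)" using assms by (auto simp: in_set_zip)
  then show "(\<sigma>s ! j, fst (ss ! j)) \<in> pattern W s0 ss \<sigma>s" "(- \<sigma>s ! j, snd (ss ! j)) \<in> pattern W s0 ss \<sigma>s"
    unfolding pattern_def seg_signs_def by force+
qed

lemma pattern_basic: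
  "(1, fst s0) \<in> pattern W s0 ss \<sigma>s" "(-1, snd s0) \<in> pattern W s0 ss \<sigma>s"
  "w \<in> W \<Longrightarrow> (1, w) \<in> pattern W s0 ss \<sigma>s" "w \<in> W \<Longrightarrow> (-1, w) \<in> pattern W s0 ss \<sigma>s"
  unfolding pattern_def seg_signs_def by auto

lemma finite_pattern: "finite W \<Longrightarrow> finite (pattern W s0 ss \<sigma>s)"
  unfolding pattern_def seg_signs_def by auto

text \<open>The segment \<open>s0\<close> has two tasks. Its opposite signs exclude nonzero constant
  functionals, which makes the pieces path-connected, and its two different ends guarantee that a
  rotation about any point is stopped.\<close>

locale plane_segments =
  fixes n ob :: "real^3" and W :: "(real^3) set" and s0 :: "(real^3) \<times> (real^3)" and ss :: "((real^3) \<times> (real^3)) list"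
  assumes n0: "n \<noteq> 0" and finW: "finite W"
    and W_plane: "\<And>w. w \<in> W \<Longrightarrow> n \<bullet> (w - ob) = 0"
    and s_plane: "\<And>s. s \<in> set (s0 # ss) \<Longrightarrow> n \<bullet> (fst s - ob) = 0 \<and> n \<bullet> (snd s - ob) = 0"
    and s0_ne: "fst s0 \<noteq> snd s0"
begin

abbreviation "piece \<sigma>s \<equiv> cone_lines n ob (pattern W s0 ss \<sigma>s)"

lemma piece_path_connected: "path_connectedin line_topology (piece \<sigma>s)"
  by (rule path_connectedin_cone_lines[OF n0 pattern_basic(1,2)])

lemma piece_subset:
  assumes "\<sigma>s \<in> set (signs (length ss))"
  shows "piece \<sigma>s \<subseteq> plane_lines n ob W (s0 # ss)"
proof
  fix L assume "L \<in> piece \<sigma>s"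
  then obtain m k where L: "L = zero_line n ob m k" "m \<noteq> 0" and c: "(m, k) \<in> sign_cone n ob (pattern W s0 ss \<sigma>s)"
    unfolding cone_lines_def by blast
  have m: "m \<bullet> n = 0" "m \<noteq> 0" "n \<noteq> 0" using c L(2) n0 unfolding sign_cone_def by auto
  have cs: "0 \<le> \<sigma> * (m \<bullet> (x - ob) - k)" if "(\<sigma>, x) \<in> pattern W s0 ss \<sigma>s" for \<sigma> x
    using c that unfolding sign_cone_def by blast
  have len: "length \<sigma>s = length ss" and sg: "\<And>j. j < length ss \<Longrightarrow> \<sigma>s ! j = 1 \<or> \<sigma>s ! j = -1"
    using assms unfolding set_signs by auto
  have "L \<inter> closed_segment (fst s) (snd s) \<noteq> {}" if s: "s \<in> set (s0 # ss)" for s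
  proof -
    have "(m \<bullet> (fst s - ob) - k) * (m \<bullet> (snd s - ob) - k) \<le> 0"
    proof (cases "s = s0")
      case True
      then show ?thesis using cs[OF pattern_basic(1)] cs[OF pattern_basic(2)] by (simp add: mult_le_0_iff)
    next
      case False
      then obtain j where j: "j < length ss" "s = ss ! j" using s by (auto simp: in_set_conv_nth)
      then show ?thesis using cs[OF pattern_nth(1), of j] cs[OF pattern_nth(2), of j] sg[of j] len
        by (auto simp: mult_le_0_iff)
    qed
    then show ?thesis unfolding L using zero_line_meets_segment[OF m] s_plane[OF s] by blast
  qed
  moreover have "w \<in> L" if w: "w \<in> W" for w
    unfolding L using mem_zero_line[OF m] W_plane[OF w] cs[OF pattern_basic(3)[OF w]] cs[OF pattern_basic(4)[OF w]] by auto
  ultimately show "L \<in> plane_lines n ob W (s0 # ss)"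
    using zero_line_in_lines[OF m] mem_zero_line[OF m] unfolding plane_lines_def L by auto
qed

lemma plane_lines_covered:
  assumes "L \<in> plane_lines n ob W (s0 # ss)"
  obtains \<sigma>s where "\<sigma>s \<in> set (signs (length ss))" "L \<in> piece \<sigma>s"
proof -
  have L: "L \<in> lines" "\<And>x. x \<in> L \<Longrightarrow> n \<bullet> (x - ob) = 0" "W \<subseteq> L"
    "\<And>s. s \<in> set (s0 # ss) \<Longrightarrow> L \<inter> closed_segment (fst s) (snd s) \<noteq> {}"
    using assms unfolding plane_lines_def by auto
  obtain m' k' where mk': "m' \<bullet> n = 0" "m' \<noteq> 0" "L = zero_line n ob m' k'"
    using line_in_plane_zero_line[OF L(1,2) n0] by metis
  have pr': "(m' \<bullet> (fst s - ob) - k') * (m' \<bullet> (snd s - ob) - k') \<le> 0" if s: "s \<in> set (s0 # ss)" for s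
    using zero_line_meets_segment[OF mk'(1,2) n0] s_plane[OF s] L(4)[OF s] mk'(3) by blast
  \<comment> \<open>Of the two opposite functionals with zero line \<open>L\<close>, take one with
    the sign at \<open>s0\<close> that \<open>pattern\<close> prescribes.\<close>
  obtain m k where mk: "m \<bullet> n = 0" "m \<noteq> 0" "L = zero_line n ob m k"
    and s0: "0 \<le> m \<bullet> (fst s0 - ob) - k" "m \<bullet> (snd s0 - ob) - k \<le> 0"
  proof (cases "0 \<le> m' \<bullet> (fst s0 - ob) - k' \<and> m' \<bullet> (snd s0 - ob) - k' \<le> 0")
    case True then show ?thesis using that mk' by blast
  next
    case False
    then have "m' \<bullet> (fst s0 - ob) - k' \<le> 0" "0 \<le> m' \<bullet> (snd s0 - ob) - k'"
      using pr'[of s0] by (auto simp: mult_le_0_iff)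
    moreover have "L = zero_line n ob (- m') (- k')"
      using zero_line_scale[of "-1" m' n ob k'] mk' n0 by simp
    ultimately show ?thesis using that[of "- m'" "- k'"] mk' by simp
  qed
  have pr: "(m \<bullet> (fst s - ob) - k) * (m \<bullet> (snd s - ob) - k) \<le> 0" if s: "s \<in> set (s0 # ss)" for s
    using zero_line_meets_segment[OF mk(1,2) n0] s_plane[OF s] L(4)[OF s] mk(3) by blast
  define \<sigma>s where "\<sigma>s = map (\<lambda>s. if 0 \<le> m \<bullet> (fst s - ob) - k \<and> m \<bullet> (snd s - ob) - k \<le> 0 then 1 else - 1 :: real) ss"
  have "\<sigma>s \<in> set (signs (length ss))" unfolding set_signs \<sigma>s_def by auto
  moreover have "L \<in> piece \<sigma>s"
    unfolding mk(3)
  proof (rule zero_line_mem_cone_lines[OF mk(1,2)])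
    fix \<tau> x assume "(\<tau>, x) \<in> pattern W s0 ss \<sigma>s"
    then show "0 \<le> \<tau> * (m \<bullet> (x - ob) - k)"
    proof (cases rule: pattern_cases)
      case 3
      then show ?thesis using L(3) mem_zero_line[OF mk(1,2) n0] unfolding mk(3) by auto
    next
      case (4 j)
      then show ?thesis using pr[of "ss ! j"] unfolding \<sigma>s_def by (auto simp: mult_le_0_iff)
    next
      case (5 j)
      then show ?thesis using pr[of "ss ! j"] unfolding \<sigma>s_def by (auto simp: mult_le_0_iff)
    qed (use s0 in auto)
  qed
  ultimately show ?thesis using that by blast
qed

lemma pattern_plane:
  assumes "(\<tau>, x) \<in> pattern W s0 ss \<sigma>s"
  shows "n \<bullet> (x - ob) = 0"
  using assms s_plane[of s0] s_plane[OF list.set_intros(2), OF nth_mem] W_plane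
  by (cases rule: pattern_cases) auto

lemma pattern_endpoint:
  assumes "(\<tau>, x) \<in> pattern W s0 ss \<sigma>s" "x \<notin> W"
  shows "\<exists>s\<in>set (s0 # ss). x = fst s \<or> x = snd s"
  using assms by (cases rule: pattern_cases) (auto intro: nth_mem)

lemma plane_diff: "n \<bullet> (x - ob) = 0 \<Longrightarrow> n \<bullet> (y - ob) = 0 \<Longrightarrow> n \<bullet> (x - y) = 0"
  by (simp add: inner_diff_right)

lemma piece_rotate:
  assumes L: "zero_line n ob m k \<in> piece \<sigma>s" "(m, k) \<in> sign_cone n ob (pattern W s0 ss \<sigma>s)" "m \<noteq> 0"
    and w: "m \<bullet> (w - ob) = k" "n \<bullet> (w - ob) = 0"
  obtains L' \<tau> y where "L' \<in> piece \<sigma>s" "w \<in> L'" "y \<in> L'" "y \<noteq> w" "(\<tau>, y) \<in> pattern W s0 ss \<sigma>s"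
proof -
  obtain \<tau> x where x: "(\<tau>, x) \<in> pattern W s0 ss \<sigma>s" "\<tau> \<noteq> 0" "x \<noteq> w"
    using pattern_basic(1,2)[of s0 W ss \<sigma>s] s0_ne by (metis zero_neq_neg_one zero_neq_one)
  have nx: "n \<bullet> (x - w) = 0" using plane_diff[OF pattern_plane[OF x(1)] w(2)] .
  obtain m' k' \<sigma>' y where h: "(m', k') \<in> sign_cone n ob (pattern W s0 ss \<sigma>s)" "m' \<noteq> 0" "m' \<bullet> (w - ob) = k'"
    "(\<sigma>', y) \<in> pattern W s0 ss \<sigma>s" "y \<noteq> w" "m' \<bullet> (y - ob) = k'"
    using cone_lines_rotate[OF L(2,3) n0 finite_pattern[OF finW] x(1,2) w(1) nx x(3)] by metis
  have m': "m' \<bullet> n = 0" using h(1) unfolding sign_cone_def by auto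
  have "zero_line n ob m' k' \<in> piece \<sigma>s" using h(1,2) unfolding cone_lines_def by blast
  moreover have "w \<in> zero_line n ob m' k'" "y \<in> zero_line n ob m' k'"
    using mem_zero_line[OF m' h(2) n0] h w pattern_plane[OF h(4)] by auto
  ultimately show ?thesis using that h by blast
qed

lemma piece_obtain:
  assumes "L \<in> piece \<sigma>s"
  obtains m k where "L = zero_line n ob m k" "(m, k) \<in> sign_cone n ob (pattern W s0 ss \<sigma>s)" "m \<noteq> 0" "m \<bullet> n = 0"
  using assms unfolding cone_lines_def sign_cone_def by auto

text \<open>Rotating about \<open>w\<close> leads to an end of a segment. This is why the pieces of
  a pencil may have weight 2 instead of 4.\<close>

lemma piece_pencil_endpoint:
  assumes L: "L \<in> piece \<sigma>s" and W: "W = {w}"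
  obtains L' s where "L' \<in> piece \<sigma>s" "s \<in> set (s0 # ss)" "fst s \<in> L' \<or> snd s \<in> L'"
proof -
  obtain m k where mk: "L = zero_line n ob m k" "(m, k) \<in> sign_cone n ob (pattern W s0 ss \<sigma>s)" "m \<noteq> 0" "m \<bullet> n = 0"
    using piece_obtain L by metis
  have "0 \<le> 1 * (m \<bullet> (w - ob) - k)" "0 \<le> -1 * (m \<bullet> (w - ob) - k)"
    using mk(2) pattern_basic(3,4)[of w W s0 ss \<sigma>s] W unfolding sign_cone_def by blast+
  then have w: "m \<bullet> (w - ob) = k" by simp
  obtain L' \<tau> y where "L' \<in> piece \<sigma>s" "y \<in> L'" "y \<noteq> w" "(\<tau>, y) \<in> pattern W s0 ss \<sigma>s"
    using piece_rotate[of m k \<sigma>s w] L mk w W_plane W by blast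
  moreover from this obtain s where "s \<in> set (s0 # ss)" "y = fst s \<or> y = snd s"
    using pattern_endpoint[of \<tau> y \<sigma>s] W by blast
  ultimately show ?thesis using that by blast
qed

text \<open>Without a prescribed point there are two degrees of freedom: a translation reaches
  \<open>x\<close>, and a rotation about \<open>x\<close> reaches \<open>y\<close>. Both may be ends
  of the same segment, a case that \<open>piece_flip\<close> compensates.\<close>

lemma piece_two_endpoints:
  assumes L: "L \<in> piece \<sigma>s" and W: "W = {}"
  obtains L' x y s s' where "L' \<in> piece \<sigma>s" "x \<in> L'" "y \<in> L'" "x \<noteq> y"
    "s \<in> set (s0 # ss)" "s' \<in> set (s0 # ss)" "x = fst s \<or> x = snd s" "y = fst s' \<or> y = snd s'"
proof -
  obtain m k where mk: "L = zero_line n ob m k" "(m, k) \<in> sign_cone n ob (pattern W s0 ss \<sigma>s)" "m \<noteq> 0" "m \<bullet> n = 0"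
    using piece_obtain L by metis
  obtain k' \<tau> x where x: "(m, k') \<in> sign_cone n ob (pattern W s0 ss \<sigma>s)" "(\<tau>, x) \<in> pattern W s0 ss \<sigma>s" "m \<bullet> (x - ob) = k'"
    using cone_lines_translate[OF mk(2) finite_pattern[OF finW] pattern_basic(1)] by auto
  have "zero_line n ob m k' \<in> piece \<sigma>s" using x(1) mk(3) unfolding cone_lines_def by blast
  then obtain L' \<tau>' y where "L' \<in> piece \<sigma>s" "x \<in> L'" "y \<in> L'" "y \<noteq> x" "(\<tau>', y) \<in> pattern W s0 ss \<sigma>s"
    using piece_rotate[OF _ x(1) mk(3) x(3) pattern_plane[OF x(2)]] by metis
  moreover from this obtain s where "s \<in> set (s0 # ss)" "y = fst s \<or> y = snd s"
    using pattern_endpoint[of \<tau>' y \<sigma>s] W by blast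
  moreover obtain s' where "s' \<in> set (s0 # ss)" "x = fst s' \<or> x = snd s'"
    using pattern_endpoint[OF x(2)] W by blast
  ultimately show ?thesis using that by blast
qed

text \<open>A line containing a whole segment does not see the sign attached to this segment; changing the
  sign of \<open>s0\<close> amounts to changing all the others.\<close>

lemma piece_flip:
  assumes L: "L \<in> piece \<sigma>s" and sg: "\<sigma>s \<in> set (signs (length ss))" and ss: "ss \<noteq> []"
    and s: "s \<in> set (s0 # ss)" "fst s \<in> L" "snd s \<in> L"
  obtains \<sigma>s' where "\<sigma>s' \<in> set (signs (length ss))" "\<sigma>s' \<noteq> \<sigma>s" "L \<in> piece \<sigma>s'"
proof -
  obtain m k where mk: "L = zero_line n ob m k" "(m, k) \<in> sign_cone n ob (pattern W s0 ss \<sigma>s)" "m \<noteq> 0" "m \<bullet> n = 0"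
    using piece_obtain L by metis
  have cs: "0 \<le> \<sigma> * (m \<bullet> (x - ob) - k)" if "(\<sigma>, x) \<in> pattern W s0 ss \<sigma>s" for \<sigma> x
    using mk(2) that unfolding sign_cone_def by blast
  have z: "m \<bullet> (fst s - ob) = k" "m \<bullet> (snd s - ob) = k"
    using s(2,3) mem_zero_line[OF mk(4,3) n0] unfolding mk(1) by auto
  have len: "length \<sigma>s = length ss" and sgs: "\<And>j. j < length ss \<Longrightarrow> \<sigma>s ! j = 1 \<or> \<sigma>s ! j = -1"
    using sg unfolding set_signs by auto
  show ?thesis
  proof (cases "s = s0")
    case True
    let ?t = "map uminus \<sigma>s"
    have "zero_line n ob (- m) (- k) \<in> piece ?t"
    proof (rule zero_line_mem_cone_lines)
      fix \<tau> x assume "(\<tau>, x) \<in> pattern W s0 ss ?t"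
      then show "0 \<le> \<tau> * (- m \<bullet> (x - ob) - - k)"
      proof (cases rule: pattern_cases)
        case 3
        then show ?thesis using cs[OF pattern_basic(3), of x] cs[OF pattern_basic(4), of x] by auto
      next
        case (4 j)
        then show ?thesis using cs[OF pattern_nth(1), of j] len by (simp add: algebra_simps)
      next
        case (5 j)
        then show ?thesis using cs[OF pattern_nth(2), of j] len by (simp add: algebra_simps)
      qed (use z True in auto)
    qed (use mk in auto)
    moreover have "zero_line n ob (- m) (- k) = L"
      using zero_line_scale[of "-1" m n ob k] mk n0 by simp
    moreover have "?t \<noteq> \<sigma>s"
    proof
      assume e: "?t = \<sigma>s"
      have "0 < length \<sigma>s" using ss len by simp
      then have "- (\<sigma>s ! 0) = \<sigma>s ! 0" using e by (metis nth_map)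
      then show False using sgs[of 0] ss by auto
    qed
    moreover have "?t \<in> set (signs (length ss))" using sg unfolding set_signs by auto
    ultimately show ?thesis using that by metis
  next
    case False
    then obtain j where j: "j < length ss" "s = ss ! j" using s(1) by (auto simp: in_set_conv_nth)
    let ?t = "\<sigma>s[j := - \<sigma>s ! j]"
    have "L \<in> piece ?t"
      unfolding mk(1)
    proof (rule zero_line_mem_cone_lines)
      fix \<tau> x assume "(\<tau>, x) \<in> pattern W s0 ss ?t"
      then show "0 \<le> \<tau> * (m \<bullet> (x - ob) - k)"
      proof (cases rule: pattern_cases)
        case (4 i)
        then show ?thesis using cs[OF pattern_nth(1), of i] len z j by (cases "i = j") auto
      next
        case (5 i)
        then show ?thesis using cs[OF pattern_nth(2), of i] len z j by (cases "i = j") auto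
      next
        case 1 then show ?thesis using cs[OF pattern_basic(1)] by simp
      next
        case 2 then show ?thesis using cs[OF pattern_basic(2)] by simp
      next
        case 3 then show ?thesis using cs[OF pattern_basic(3), of x] cs[OF pattern_basic(4), of x] by auto
      qed
    qed (use mk in auto)
    moreover have "?t \<noteq> \<sigma>s"
    proof
      assume e: "?t = \<sigma>s"
      have "- \<sigma>s ! j = ?t ! j" using j len by simp
      then show False unfolding e using sgs[OF j(1)] by auto
    qed
    moreover have "?t \<in> set (signs (length ss))"
      using sg sgs[OF j(1)] set_update_subset_insert[of \<sigma>s j "- \<sigma>s ! j"] unfolding set_signs by auto
    ultimately show ?thesis using that by metis
  qed
qed

end

section \<open>Transversals of four segments\<close>

text \<open>A family of path-connected sets of transversals, each with a weight; the weights are chosen such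
  that the lines of one component of all common tangents collect a total weight of at least \<open>4\<close>,
  while the total weight for one choice of four edges is at most \<open>8\<close>.\<close>

definition weight_at :: "((real^3) set set \<times> nat) list \<Rightarrow> (real^3) set \<Rightarrow> nat" where
  "weight_at xs L = (\<Sum>x\<leftarrow>xs. if L \<in> fst x then snd x else 0)"

definition pieces_of :: "nat set \<Rightarrow> (nat \<Rightarrow> real^3) \<Rightarrow> (nat \<Rightarrow> real^3) \<Rightarrow> ((real^3) set set \<times> nat) list \<Rightarrow> bool" where
  "pieces_of I p q xs \<longleftrightarrow> (\<forall>x\<in>set xs. fst x \<subseteq> transversals I p q \<and>
     path_connectedin line_topology (fst x) \<and> 1 \<le> snd x)"

definition through_end :: "(nat \<Rightarrow> real^3) \<Rightarrow> (nat \<Rightarrow> real^3) \<Rightarrow> nat \<Rightarrow> (real^3) set \<Rightarrow> bool" where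
  "through_end p q i L \<longleftrightarrow> p i \<in> L \<or> q i \<in> L"

text \<open>The convenient special case of \<open>capped_by\<close> in which a single piece already
  has the required weight. It is assembled from parts by appending lists.\<close>

definition covering :: "nat set \<Rightarrow> (nat \<Rightarrow> real^3) \<Rightarrow> (nat \<Rightarrow> real^3) \<Rightarrow> (real^3) set set \<Rightarrow> ((real^3) set set \<times> nat) list \<Rightarrow> bool" where
  "covering I p q X xs \<longleftrightarrow> pieces_of I p q xs \<and> (\<forall>L\<in>X. \<exists>x\<in>set xs. L \<in> fst x \<and>
     (4 \<le> snd x \<or> 2 \<le> snd x \<and> (\<exists>L'\<in>fst x. \<exists>i\<in>I. through_end p q i L')))"

text \<open>The three alternatives are weight times number of choices: 4 * 1, 2 * 2 and 1 * 4. The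
  weights at \<open>L'\<close> are added over all pieces, because a planar line that contains a
  whole segment may touch no end of another segment, but lies on two pieces of weight 1.\<close>

definition capped_by :: "nat set \<Rightarrow> (nat \<Rightarrow> real^3) \<Rightarrow> (nat \<Rightarrow> real^3) \<Rightarrow> ((real^3) set set \<times> nat) list \<Rightarrow> bool" where
  "capped_by I p q xs \<longleftrightarrow> pieces_of I p q xs \<and> (\<Sum>x\<leftarrow>xs. snd x) \<le> 8 \<and>
     (\<forall>L\<in>transversals I p q. \<exists>x\<in>set xs. L \<in> fst x \<and> (\<exists>L'\<in>fst x.
        4 \<le> weight_at xs L' \<or>
        2 \<le> weight_at xs L' \<and> (\<exists>i\<in>I. through_end p q i L') \<or>
        (\<exists>i\<in>I. \<exists>j\<in>I. i \<noteq> j \<and> through_end p q i L' \<and> through_end p q j L')))"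

definition capped :: "nat set \<Rightarrow> (nat \<Rightarrow> real^3) \<Rightarrow> (nat \<Rightarrow> real^3) \<Rightarrow> bool" where
  "capped I p q \<longleftrightarrow> (\<exists>xs. capped_by I p q xs)"

lemma weight_at_ge:
  assumes "x \<in> set xs" "L \<in> fst x"
  shows "snd x \<le> weight_at xs L"
proof -
  have "snd x \<in> set (map (\<lambda>x. if L \<in> fst x then snd x else 0) xs)"
    using assms by force
  then show ?thesis unfolding weight_at_def by (rule member_le_sum_list) simp
qed

lemma covering_empty: "covering I p q {} []"
  unfolding covering_def pieces_of_def by simp

lemma covering_append:
  assumes "covering I p q X xs" "covering I p q Y ys"
  shows "covering I p q (X \<union> Y) (xs @ ys)"
  using assms unfolding covering_def pieces_of_def by (simp add: ball_Un bex_Un)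

lemma covering_mono:
  "covering I p q X xs \<Longrightarrow> Y \<subseteq> X \<Longrightarrow> covering I p q Y xs"
  unfolding covering_def by (simp add: subset_iff)

lemma covering_capped_by:
  assumes c: "covering I p q (transversals I p q) xs" and s: "(\<Sum>x\<leftarrow>xs. snd x) \<le> 8"
  shows "capped_by I p q xs"
  unfolding capped_by_def
proof (intro conjI ballI)
  show "pieces_of I p q xs" using c unfolding covering_def by simp
  show "(\<Sum>x\<leftarrow>xs. snd x) \<le> 8" by (rule s)
  fix L assume "L \<in> transversals I p q"
  then obtain x where x: "x \<in> set xs" "L \<in> fst x"
    "4 \<le> snd x \<or> 2 \<le> snd x \<and> (\<exists>L'\<in>fst x. \<exists>i\<in>I. through_end p q i L')"
    using c unfolding covering_def by (elim conjE) (drule (1) bspec, elim bexE conjE, rule)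
  show "\<exists>x\<in>set xs. L \<in> fst x \<and> (\<exists>L'\<in>fst x. 4 \<le> weight_at xs L' \<or>
      2 \<le> weight_at xs L' \<and> (\<exists>i\<in>I. through_end p q i L') \<or>
      (\<exists>i\<in>I. \<exists>j\<in>I. i \<noteq> j \<and> through_end p q i L' \<and> through_end p q j L'))"
    using x(3)
  proof
    assume "4 \<le> snd x"
    then have "4 \<le> weight_at xs L" using weight_at_ge[OF x(1,2)] by simp
    then show ?thesis using x(1,2) by (intro bexI[of _ x] conjI bexI[of _ L]) auto
  next
    assume "2 \<le> snd x \<and> (\<exists>L'\<in>fst x. \<exists>i\<in>I. through_end p q i L')"
    then obtain L' where L': "2 \<le> snd x" "L' \<in> fst x" "\<exists>i\<in>I. through_end p q i L'" by (elim conjE bexE) (rule, auto)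
    then have "2 \<le> weight_at xs L'" using weight_at_ge[OF x(1) L'(2)] by simp
    then show ?thesis using x(1,2) L'(2,3) by (intro bexI[of _ x] conjI bexI[of _ L']) auto
  qed
qed

lemma covering_capped:
  assumes "covering I p q (transversals I p q) xs" "(\<Sum>x\<leftarrow>xs. snd x) \<le> 8"
  shows "capped I p q"
  unfolding capped_def using covering_capped_by[OF assms] by (rule exI)

lemma covering_single:
  assumes "X \<subseteq> transversals I p q" "path_connectedin line_topology X"
  shows "covering I p q X [(X, 4)]"
  using assms unfolding covering_def pieces_of_def by simp

lemma covering_le_one:
  assumes "X \<subseteq> transversals I p q" "\<And>L L'. L \<in> X \<Longrightarrow> L' \<in> X \<Longrightarrow> L = L'"
  obtains xs where "covering I p q X xs" "(\<Sum>x\<leftarrow>xs. snd x) \<le> 4"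
proof (cases "X = {}")
  case True
  show ?thesis using that[of "[]"] covering_empty unfolding True by simp
next
  case False
  then obtain L where L: "L \<in> X" by (elim ex_in_conv[THEN iffD2, THEN exE])
  then have X: "X = {L}" using assms(2) by (intro equalityI subsetI) auto
  have "L \<in> lines" using L assms(1) unfolding transversals_def by auto
  then have "path_connectedin line_topology X" unfolding X by (rule path_connectedin_sing_line)
  then show ?thesis using that[OF covering_single[OF assms(1)]] by simp
qed

text \<open>If \<open>ob\<close> is off the segment, the lines are parametrised by the points of the
  segment. Otherwise all directions occur, and space without the origin is path-connected.\<close>

lemma path_connectedin_star:
  "path_connectedin line_topology {L \<in> lines. ob \<in> L \<and> L \<inter> closed_segment a b \<noteq> {}}" (is "path_connectedin _ ?X")
proof (cases "ob \<in> closed_segment a b")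
  case True
  have "?X = (\<lambda>v. line_through ob v) ` (- {0})"
  proof (intro equalityI subsetI)
    fix L assume "L \<in> ?X"
    then obtain v where "v \<noteq> 0" "L = line_through ob v" using lines_point_direction by auto
    then show "L \<in> (\<lambda>v. line_through ob v) ` (- {0})" by simp
  next
    fix L assume "L \<in> (\<lambda>v. line_through ob v) ` (- {0})"
    then obtain v where "v \<noteq> 0" "L = line_through ob v" by auto
    then show "L \<in> ?X" using line_through_in_lines line_through_base True by auto
  qed
  moreover have "path_connectedin line_topology ((\<lambda>v. line_through ob v) ` (- {0}))"
    by (rule path_connectedin_lines) (auto intro!: path_connected_punctured_universe continuous_intros)
  ultimately show ?thesis by simp
next
  case False
  have "?X = (\<lambda>y. line_through ob (y - ob)) ` closed_segment a b"
  proof (intro equalityI subsetI)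
    fix L assume L: "L \<in> ?X"
    then obtain y where y: "y \<in> L" "y \<in> closed_segment a b" by auto
    then have "L = line_through ob (y - ob)" using L False by (intro line_two_points) auto
    then show "L \<in> (\<lambda>y. line_through ob (y - ob)) ` closed_segment a b" using y by simp
  next
    fix L assume "L \<in> (\<lambda>y. line_through ob (y - ob)) ` closed_segment a b"
    then obtain y where y: "y \<in> closed_segment a b" "L = line_through ob (y - ob)" by auto
    have "y - ob \<noteq> 0" using y False by auto
    moreover have "y \<in> L" unfolding y mem_line_through by (intro exI[of _ 1]) simp
    ultimately show "L \<in> ?X" using y line_through_in_lines line_through_base by auto
  qed
  moreover have "path_connectedin line_topology ((\<lambda>y. line_through ob (y - ob)) ` closed_segment a b)"
    by (rule path_connectedin_lines) (use False in \<open>auto intro!: continuous_intros\<close>)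
  ultimately show ?thesis by simp
qed

text \<open>Transversals that leave a plane form a path-connected star \<open>Y\<close>. They get no
  piece of their own: a planar piece that shares a line with \<open>Y\<close> takes in all of
  \<open>Y\<close> and stays path-connected, at no additional weight.\<close>

definition absorb :: "(real^3) set set \<Rightarrow> (real^3) set set \<Rightarrow> (real^3) set set" where
  "absorb Y P = (if P \<inter> Y = {} then P else P \<union> Y)"

lemma path_connectedin_absorb:
  assumes "path_connectedin line_topology P" "path_connectedin line_topology Y"
  shows "path_connectedin line_topology (absorb Y P)"
  unfolding absorb_def using path_connectedin_Un[OF assms] assms(1) by simp

lemma absorbI1: "L \<in> P \<Longrightarrow> L \<in> absorb Y P"
  unfolding absorb_def by simp

lemma absorbI2: "M \<in> P \<Longrightarrow> M \<in> Y \<Longrightarrow> L \<in> Y \<Longrightarrow> L \<in> absorb Y P"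
  unfolding absorb_def by (simp add: disjoint_iff) fast

context plane_segments
begin

lemma absorb_covered:
  assumes L: "L \<in> plane_lines n ob W (s0 # ss) \<union> Y"
    and meet: "Y = {} \<or> plane_lines n ob W (s0 # ss) \<inter> Y \<noteq> {}"
  obtains \<sigma>s where "\<sigma>s \<in> set (signs (length ss))" "piece \<sigma>s \<noteq> {}" "L \<in> absorb Y (piece \<sigma>s)"
proof (cases "L \<in> plane_lines n ob W (s0 # ss)")
  case True
  then obtain \<sigma>s where s: "\<sigma>s \<in> set (signs (length ss))" "L \<in> piece \<sigma>s" by (rule plane_lines_covered)
  have "piece \<sigma>s \<noteq> {}" using s(2) by (intro notI) simp
  then show ?thesis using that s(1) absorbI1[OF s(2)] by simp
next
  case False
  then have "L \<in> Y" using L by simp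
  then obtain M where M: "M \<in> plane_lines n ob W (s0 # ss)" "M \<in> Y" using meet by auto
  obtain \<sigma>s where s: "\<sigma>s \<in> set (signs (length ss))" "M \<in> piece \<sigma>s" using M(1) by (rule plane_lines_covered)
  have "piece \<sigma>s \<noteq> {}" using s(2) by (intro notI) simp
  then show ?thesis using that s(1) absorbI2[OF s(2) M(2) \<open>L \<in> Y\<close>] by simp
qed

lemma pieces_of_absorb:
  assumes Y: "path_connectedin line_topology Y" "Y \<subseteq> transversals I p q"
    and T: "plane_lines n ob W (s0 # ss) \<subseteq> transversals I p q" and c: "1 \<le> c"
  shows "pieces_of I p q (map (\<lambda>\<sigma>s. (absorb Y (piece \<sigma>s), c)) (signs (length ss)))"
  unfolding pieces_of_def
proof
  fix x assume "x \<in> set (map (\<lambda>\<sigma>s. (absorb Y (piece \<sigma>s), c)) (signs (length ss)))"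
  then obtain \<sigma>s where s: "\<sigma>s \<in> set (signs (length ss))" "x = (absorb Y (piece \<sigma>s), c)" by auto
  have "piece \<sigma>s \<subseteq> transversals I p q" using piece_subset[OF s(1)] T by (rule subset_trans)
  then have "absorb Y (piece \<sigma>s) \<subseteq> transversals I p q" using Y(2) unfolding absorb_def by simp
  then show "fst x \<subseteq> transversals I p q \<and> path_connectedin line_topology (fst x) \<and> 1 \<le> snd x"
    using path_connectedin_absorb[OF piece_path_connected Y(1)] c s(2) by simp
qed

lemma covering_pencil:
  assumes W: "W = {w}" and Y: "path_connectedin line_topology Y" "Y \<subseteq> transversals I p q"
    and T: "plane_lines n ob W (s0 # ss) \<subseteq> transversals I p q"
    and idx: "\<And>s. s \<in> set (s0 # ss) \<Longrightarrow> \<exists>i\<in>I. s = (p i, q i)"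
    and meet: "Y = {} \<or> plane_lines n ob W (s0 # ss) \<inter> Y \<noteq> {}"
  shows "covering I p q (plane_lines n ob W (s0 # ss) \<union> Y)
    (map (\<lambda>\<sigma>s. (absorb Y (piece \<sigma>s), 2)) (signs (length ss)))" (is "covering _ _ _ _ ?xs")
  unfolding covering_def
proof (intro conjI ballI)
  show "pieces_of I p q ?xs" by (rule pieces_of_absorb[OF Y T]) simp
  fix L assume L: "L \<in> plane_lines n ob W (s0 # ss) \<union> Y"
  obtain \<sigma>s where s: "\<sigma>s \<in> set (signs (length ss))" "piece \<sigma>s \<noteq> {}" "L \<in> absorb Y (piece \<sigma>s)"
    using absorb_covered[OF L meet] by metis
  obtain M where M: "M \<in> piece \<sigma>s" using s(2) by auto
  obtain L' s' where L': "L' \<in> piece \<sigma>s" "s' \<in> set (s0 # ss)" "fst s' \<in> L' \<or> snd s' \<in> L'"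
    using piece_pencil_endpoint[OF M W] by metis
  obtain i where i: "i \<in> I" "s' = (p i, q i)" using idx[OF L'(2)] by (elim bexE)
  have "L' \<in> absorb Y (piece \<sigma>s)" using L'(1) unfolding absorb_def by simp
  moreover have "through_end p q i L'" using L'(3) i unfolding through_end_def by simp
  ultimately show "\<exists>x\<in>set ?xs. L \<in> fst x \<and>
     (4 \<le> snd x \<or> 2 \<le> snd x \<and> (\<exists>L'\<in>fst x. \<exists>i\<in>I. through_end p q i L'))"
    using s(1,3) i(1) by (intro bexI[of _ "(absorb Y (piece \<sigma>s), 2)"] conjI disjI2 bexI[of _ L'] bexI[of _ i]) auto
qed

text \<open>Three free signs give eight pieces, so each can only weigh 1 and has to reach a line
  worth 4. Either that line passes through ends of two segments, or it contains one segment and then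
  lies on a second piece.\<close>

lemma capped_plane:
  assumes W: "W = {}" and Y: "path_connectedin line_topology Y" "Y \<subseteq> transversals I p q"
    and T: "plane_lines n ob W (s0 # ss) \<subseteq> transversals I p q"
    and cov: "transversals I p q \<subseteq> plane_lines n ob W (s0 # ss) \<union> Y"
    and idx: "\<And>s. s \<in> set (s0 # ss) \<Longrightarrow> \<exists>i\<in>I. s = (p i, q i)"
    and meet: "Y = {} \<or> plane_lines n ob W (s0 # ss) \<inter> Y \<noteq> {}"
    and len: "length ss = 3"
  shows "capped I p q"
  unfolding capped_def capped_by_def
proof (intro exI conjI ballI)
  let ?xs = "map (\<lambda>\<sigma>s. (absorb Y (piece \<sigma>s), 1::nat)) (signs (length ss))"
  show "pieces_of I p q ?xs" by (rule pieces_of_absorb[OF Y T]) simp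
  show "(\<Sum>x\<leftarrow>?xs. snd x) \<le> 8" by (simp add: o_def sum_list_triv length_signs len)
  fix L assume "L \<in> transversals I p q"
  then have L: "L \<in> plane_lines n ob W (s0 # ss) \<union> Y" using cov by (rule rev_subsetD)
  obtain \<sigma>s where s: "\<sigma>s \<in> set (signs (length ss))" "piece \<sigma>s \<noteq> {}" "L \<in> absorb Y (piece \<sigma>s)"
    using absorb_covered[OF L meet] by metis
  obtain M where M: "M \<in> piece \<sigma>s" using s(2) by auto
  obtain L' x y s1 s2 where L': "L' \<in> piece \<sigma>s" "x \<in> L'" "y \<in> L'" "x \<noteq> y"
    "s1 \<in> set (s0 # ss)" "s2 \<in> set (s0 # ss)" "x = fst s1 \<or> x = snd s1" "y = fst s2 \<or> y = snd s2"
    using piece_two_endpoints[OF M W] by metis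
  obtain i where i: "i \<in> I" "s1 = (p i, q i)" using idx[OF L'(5)] by (elim bexE)
  obtain j where j: "j \<in> I" "s2 = (p j, q j)" using idx[OF L'(6)] by (elim bexE)
  have thr: "through_end p q i L'" "through_end p q j L'"
    using L' i j unfolding through_end_def by auto
  have good: "2 \<le> weight_at ?xs L' \<and> (\<exists>i\<in>I. through_end p q i L') \<or>
      (\<exists>i\<in>I. \<exists>j\<in>I. i \<noteq> j \<and> through_end p q i L' \<and> through_end p q j L')"
  proof (cases "i = j")
    case False
    then show ?thesis using i(1) j(1) thr by auto
  next
    case True
    then have "p i \<in> L'" "q i \<in> L'" using L' i j by auto
    then obtain \<tau>s where t: "\<tau>s \<in> set (signs (length ss))" "\<tau>s \<noteq> \<sigma>s" "L' \<in> piece \<tau>s"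
    proof -
      have "ss \<noteq> []" using len by auto
      moreover have "fst s1 \<in> L'" "snd s1 \<in> L'" using i(2) \<open>p i \<in> L'\<close> \<open>q i \<in> L'\<close> by simp_all
      ultimately show ?thesis using piece_flip[OF L'(1) s(1) _ L'(5)] that by metis
    qed
    let ?f = "filter (\<lambda>\<sigma>s. L' \<in> absorb Y (piece \<sigma>s)) (signs (length ss))"
    have ff: "\<sigma>s \<in> set ?f" "\<tau>s \<in> set ?f" using s(1) t L'(1) unfolding absorb_def by auto
    have "weight_at ?xs L' = (\<Sum>\<sigma>s\<leftarrow>signs (length ss). if L' \<in> absorb Y (piece \<sigma>s) then 1 else 0)"
      unfolding weight_at_def by (simp add: o_def cong: if_cong)
    also have "\<dots> = length ?f" by (simp add: sum_list_map_filter'[symmetric] sum_list_triv)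
    also have "\<dots> = card (set ?f)" by (rule distinct_card[symmetric]) (simp add: distinct_signs)
    also have "card (set ?f) \<ge> card {\<sigma>s, \<tau>s}" by (rule card_mono) (use ff in auto)
    finally have "2 \<le> weight_at ?xs L'" using t(2) by simp
    then show ?thesis using thr i by auto
  qed
  have "L' \<in> absorb Y (piece \<sigma>s)" using L'(1) unfolding absorb_def by simp
  then show "\<exists>x\<in>set ?xs. L \<in> fst x \<and> (\<exists>L'\<in>fst x. 4 \<le> weight_at ?xs L' \<or>
      2 \<le> weight_at ?xs L' \<and> (\<exists>i\<in>I. through_end p q i L') \<or>
      (\<exists>i\<in>I. \<exists>j\<in>I. i \<noteq> j \<and> through_end p q i L' \<and> through_end p q j L'))"
    using s(1,3) disjI2[OF good] by (intro bexI[of _ "(absorb Y (piece \<sigma>s), 1)"] conjI bexI[of _ L']) simp_all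
qed

end

section \<open>Four segments, two of which are coplanar\<close>

lemma plane_segment_mem:
  fixes n :: "real^3"
  assumes "n \<bullet> (a - ob) = 0" "n \<bullet> (b - ob) = 0" "x \<in> closed_segment a b"
  shows "n \<bullet> (x - ob) = 0"
proof -
  obtain u where x: "x = (1 - u) *\<^sub>R a + u *\<^sub>R b" using assms(3) unfolding closed_segment_def by auto
  have "x - ob = (1 - u) *\<^sub>R (a - ob) + u *\<^sub>R (b - ob)" unfolding x by (simp add: algebra_simps)
  then show ?thesis using assms by (simp add: inner_add_right)
qed

lemma plane_two_points_segment:
  fixes n :: "real^3"
  assumes x: "x \<in> closed_segment a b" "n \<bullet> (x - ob) = 0" and y: "y \<in> closed_segment a b" "n \<bullet> (y - ob) = 0"
    and ne: "x \<noteq> y"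
  shows "n \<bullet> (a - ob) = 0 \<and> n \<bullet> (b - ob) = 0"
proof -
  obtain u where u: "x = (1 - u) *\<^sub>R a + u *\<^sub>R b" using x unfolding closed_segment_def by auto
  obtain v where v: "y = (1 - v) *\<^sub>R a + v *\<^sub>R b" using y unfolding closed_segment_def by auto
  have uv: "u \<noteq> v" using ne u v by auto
  have d: "x - y = (u - v) *\<^sub>R (b - a)" unfolding u v by (simp add: algebra_simps)
  have "n \<bullet> (x - y) = n \<bullet> (x - ob) - n \<bullet> (y - ob)" by (simp add: inner_diff_right)
  then have ba: "n \<bullet> (b - a) = 0" using x y d uv by simp
  have "n \<bullet> (a - ob) = n \<bullet> (x - ob) - u * (n \<bullet> (b - a))"
    unfolding u by (simp add: inner_diff_right inner_add_right algebra_simps)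
  then have a: "n \<bullet> (a - ob) = 0" using x ba by simp
  have "b - ob = (a - ob) + (b - a)" by simp
  then have "n \<bullet> (b - ob) = n \<bullet> (a - ob) + n \<bullet> (b - a)" by (simp only: inner_add_right)
  then show ?thesis using a ba by simp
qed

lemma line_in_plane_two_points:
  fixes n :: "real^3"
  assumes L: "L \<in> lines" "x \<in> L" "y \<in> L" "x \<noteq> y" and "n \<bullet> (x - ob) = 0" "n \<bullet> (y - ob) = 0" "z \<in> L"
  shows "n \<bullet> (z - ob) = 0"
proof -
  obtain s where z: "z = x + s *\<^sub>R (y - x)"
    using line_two_points[OF L] assms(7) mem_line_through by blast
  have "z - ob = (x - ob) + s *\<^sub>R ((y - ob) - (x - ob))" unfolding z by simp
  then show ?thesis using assms(5,6) by (simp add: inner_add_right inner_diff_right)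
qed

lemma line_two_points_segment:
  assumes L: "L \<in> lines" "x \<in> L" "y \<in> L" "x \<noteq> y" "x \<in> closed_segment a b" "y \<in> closed_segment a b"
  shows "a \<in> L" "b \<in> L"
proof -
  obtain u where u: "x = (1 - u) *\<^sub>R a + u *\<^sub>R b" using L(5) unfolding closed_segment_def by auto
  obtain v where v: "y = (1 - v) *\<^sub>R a + v *\<^sub>R b" using L(6) unfolding closed_segment_def by auto
  have uv: "v - u \<noteq> 0" using L(4) u v by auto
  have d: "y - x = (v - u) *\<^sub>R (b - a)" unfolding u v by (simp add: algebra_simps)
  have "L = line_through x ((v - u) *\<^sub>R (b - a))" using line_two_points[OF L(1-4)] d by simp
  then have LL: "L = line_through x (b - a)" using line_through_scale[OF uv] by simp
  have "a = x + (- u) *\<^sub>R (b - a)" "b = x + (1 - u) *\<^sub>R (b - a)" unfolding u by (simp_all add: algebra_simps)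
  then show "a \<in> L" "b \<in> L" unfolding LL mem_line_through by blast+
qed

lemma transversals_mem4:
  assumes "I = {i, j, k, l}"
  shows "L \<in> transversals I p q \<longleftrightarrow> L \<in> lines \<and> L \<inter> closed_segment (p i) (q i) \<noteq> {} \<and>
    L \<inter> closed_segment (p j) (q j) \<noteq> {} \<and> L \<inter> closed_segment (p k) (q k) \<noteq> {} \<and>
    L \<inter> closed_segment (p l) (q l) \<noteq> {}"
  unfolding transversals_def assms by simp

text \<open>A line through \<open>ob\<close> only has to meet the remaining segments
  \<open>k\<close> and \<open>l\<close>. If neither contains \<open>ob\<close> and two such lines
  exist, the plane of these lines contains both segments, and the pencil in it has one free sign,
  hence two pieces of weight 2.\<close>

lemma covering_common_point:
  assumes I: "I = {i, j, k, l}" and ne: "p k \<noteq> q k"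
    and ob: "ob \<in> closed_segment (p i) (q i)" "ob \<in> closed_segment (p j) (q j)"
  obtains xs where "covering I p q {L \<in> transversals I p q. ob \<in> L} xs" "(\<Sum>x\<leftarrow>xs. snd x) \<le> 4"
proof -
  let ?X = "{L \<in> transversals I p q. ob \<in> L}"
  let ?sk = "closed_segment (p k) (q k)" and ?sl = "closed_segment (p l) (q l)"
  have X: "L \<in> ?X \<longleftrightarrow> L \<in> lines \<and> ob \<in> L \<and> L \<inter> ?sk \<noteq> {} \<and> L \<inter> ?sl \<noteq> {}" for L
    using ob unfolding transversals_mem4[OF I] by auto
  have XT: "?X \<subseteq> transversals I p q" by auto
  have "ob \<in> ?sk \<or> ob \<in> ?sl \<or> (\<forall>L L'. L \<in> ?X \<longrightarrow> L' \<in> ?X \<longrightarrow> L = L') \<or>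
      (ob \<notin> ?sk \<and> ob \<notin> ?sl \<and> (\<exists>L L'. L \<in> ?X \<and> L' \<in> ?X \<and> L \<noteq> L'))"
    by (cases "\<exists>L L'. L \<in> ?X \<and> L' \<in> ?X \<and> L \<noteq> L'") (simp_all, argo)
  then consider "ob \<in> ?sk" | "ob \<in> ?sl" | (le_one) "\<forall>L L'. L \<in> ?X \<longrightarrow> L' \<in> ?X \<longrightarrow> L = L'"
    | (two) L L' where "ob \<notin> ?sk" "ob \<notin> ?sl" "L \<in> ?X" "L' \<in> ?X" "L \<noteq> L'"
    by (elim disjE exE conjE)
  then show ?thesis
  proof cases
    case 1
    have "?X = {L \<in> lines. ob \<in> L \<and> L \<inter> ?sl \<noteq> {}}" using X 1 by blast
    then have "path_connectedin line_topology ?X" using path_connectedin_star by simp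
    then show ?thesis using that[OF covering_single[OF XT]] by simp
  next
    case 2
    have "?X = {L \<in> lines. ob \<in> L \<and> L \<inter> ?sk \<noteq> {}}" using X 2 by blast
    then have "path_connectedin line_topology ?X" using path_connectedin_star by simp
    then show ?thesis using that[OF covering_single[OF XT]] by simp
  next
    case le_one
    obtain xs where "covering I p q ?X xs" "(\<Sum>x\<leftarrow>xs. snd x) \<le> 4"
      by (rule covering_le_one[OF XT]) (use le_one in simp_all)
    then show ?thesis by (rule that)
  next
    case two
    have LX: "L \<in> lines" "ob \<in> L" "L' \<in> lines" "ob \<in> L'" using two X by auto
    obtain v where v: "v \<noteq> 0" "L = line_through ob v" using lines_point_direction[OF LX(1,2)] .
    obtain v' where v': "v' \<noteq> 0" "L' = line_through ob v'" using lines_point_direction[OF LX(3,4)] .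
    let ?n = "v \<times> v'"
    have n0: "?n \<noteq> 0"
    proof
      assume "?n = 0"
      then have "collinear {0, v, v'}" by (simp add: cross_eq_0)
      then obtain c where c: "v' = c *\<^sub>R v" using v v' unfolding collinear_lemma by blast
      then have "c \<noteq> 0" using v' by auto
      then have "L' = L" using v v' c line_through_scale by simp
      then show False using two by simp
    qed
    have inL: "?n \<bullet> (x - ob) = 0" if "x \<in> L" for x
      using that unfolding v mem_line_through by (auto simp: dot_cross_self)
    have inL': "?n \<bullet> (x - ob) = 0" if "x \<in> L'" for x
      using that unfolding v' mem_line_through by (auto simp: dot_cross_self)
    have seg: "?n \<bullet> (a - ob) = 0 \<and> ?n \<bullet> (b - ob) = 0"
      if h: "ob \<notin> closed_segment a b" "L \<inter> closed_segment a b \<noteq> {}" "L' \<inter> closed_segment a b \<noteq> {}" for a b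
    proof -
      obtain y where y: "y \<in> L" "y \<in> closed_segment a b" using h by auto
      obtain y' where y': "y' \<in> L'" "y' \<in> closed_segment a b" using h by auto
      have "y \<noteq> ob" using y h by auto
      then have "y \<noteq> y'" using lines_eq_if_two_points[OF LX(1,3), of y ob] LX two y y' by auto
      then show ?thesis using plane_two_points_segment[OF y(2) inL[OF y(1)] y'(2) inL'[OF y'(1)]] by simp
    qed
    have sk: "?n \<bullet> (p k - ob) = 0 \<and> ?n \<bullet> (q k - ob) = 0" using seg two X by simp
    have sl: "?n \<bullet> (p l - ob) = 0 \<and> ?n \<bullet> (q l - ob) = 0" using seg two X by simp
    interpret plane_segments ?n ob "{ob}" "(p k, q k)" "[(p l, q l)]"
      by unfold_locales (use n0 sk sl ne in auto)
    let ?P = "plane_lines ?n ob {ob} ((p k, q k) # [(p l, q l)])"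
    have PX: "?P \<subseteq> ?X" unfolding plane_lines_def subset_iff X by auto
    have XP: "?X \<subseteq> ?P"
    proof
      fix M assume M: "M \<in> ?X"
      then obtain y where y: "y \<in> M" "y \<in> ?sk" using X by auto
      then have yo: "ob \<noteq> y" using two by auto
      have M': "M \<in> lines" "ob \<in> M" "M \<inter> ?sk \<noteq> {}" "M \<inter> ?sl \<noteq> {}" using M X by auto
      have "?n \<bullet> (y - ob) = 0" using plane_segment_mem[OF _ _ y(2)] sk by simp
      then have "\<forall>x\<in>M. ?n \<bullet> (x - ob) = 0"
        using line_in_plane_two_points[OF M'(1,2) y(1) yo, of ?n ob] by simp
      then show "M \<in> ?P" using M' unfolding plane_lines_def by simp
    qed
    have "covering I p q (?P \<union> {}) (map (\<lambda>\<sigma>s. (absorb {} (piece \<sigma>s), 2)) (signs (length [(p l, q l)])))"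
      by (rule covering_pencil[of ob]) (use I PX in \<open>auto simp: subset_iff\<close>)
    moreover have "?P = ?X" using PX XP by (rule subset_antisym)
    ultimately show ?thesis
      using that by (simp add: o_def sum_list_triv length_signs)
  qed
qed

text \<open>A transversal that leaves the plane \<open>H\<close> of the segments \<open>i\<close>
  and \<open>j\<close> passes through their only common point. If both other segments leave the
  plane, the planar transversals and the star at this point get weight 4 each. If one or both of
  them lie in the plane, the planar pieces may use all of the weight 8, and the star is
  absorbed.\<close>

lemma capped_coplanar:
  assumes I: "I = {i, j, k, l}" and ne: "\<And>x. x \<in> I \<Longrightarrow> p x \<noteq> q x"
    and n: "n \<noteq> 0" "n \<bullet> (p i - ob) = 0" "n \<bullet> (q i - ob) = 0" "n \<bullet> (p j - ob) = 0" "n \<bullet> (q j - ob) = 0"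
    and ncol: "\<And>L. L \<in> lines \<Longrightarrow> p i \<in> L \<Longrightarrow> q i \<in> L \<Longrightarrow> p j \<in> L \<Longrightarrow> q j \<in> L \<Longrightarrow> False"
  shows "capped I p q"
proof -
  let ?T = "transversals I p q"
  let ?s = "\<lambda>x. closed_segment (p x) (q x)"
  define H where "H = (\<lambda>x. n \<bullet> (x - ob) = 0)"
  have T4: "L \<in> ?T \<longleftrightarrow> L \<in> lines \<and> L \<inter> ?s i \<noteq> {} \<and> L \<inter> ?s j \<noteq> {} \<and> L \<inter> ?s k \<noteq> {} \<and> L \<inter> ?s l \<noteq> {}" for L
    by (rule transversals_mem4[OF I])
  have Hi: "H x" if "x \<in> ?s i" for x using plane_segment_mem[OF n(2,3) that] unfolding H_def .
  have Hj: "H x" if "x \<in> ?s j" for x using plane_segment_mem[OF n(4,5) that] unfolding H_def .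
  have Hline: "H z" if "L \<in> lines" "x \<in> L" "y \<in> L" "x \<noteq> y" "H x" "H y" "z \<in> L" for L x y z
    using line_in_plane_two_points[OF that(1-4)] that(5-7) unfolding H_def by blast
  have Hseg: "H (p x) \<and> H (q x)" if "y \<in> ?s x" "H y" "z \<in> ?s x" "H z" "y \<noteq> z" for x y z
    using plane_two_points_segment[OF that(1) _ that(3) _ that(5)] that(2,4) unfolding H_def by blast
  define TP where "TP = {L \<in> ?T. \<forall>x\<in>L. H x}"
  have off: "\<exists>c. c \<in> L \<and> c \<in> ?s i \<and> c \<in> ?s j" if L: "L \<in> ?T" "L \<notin> TP" for L
  proof -
    obtain x where x: "x \<in> L" "x \<in> ?s i" using L T4 by auto
    obtain y where y: "y \<in> L" "y \<in> ?s j" using L T4 by auto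
    have "x = y"
    proof (rule ccontr)
      assume "x \<noteq> y"
      then have "\<forall>z\<in>L. H z" using Hline[of L x y] L T4 x y Hi Hj by blast
      then show False using L unfolding TP_def by simp
    qed
    then show ?thesis using x y by auto
  qed
  \<comment> \<open>Two common points would put both segments on one line, against
    \<open>ncol\<close>.\<close>
  have uniq: "c = d" if "c \<in> ?s i" "c \<in> ?s j" "d \<in> ?s i" "d \<in> ?s j" for c d
  proof (rule ccontr)
    assume cd: "c \<noteq> d"
    have L: "line_through c (d - c) \<in> lines" using cd by (intro line_through_in_lines) simp
    have cL: "c \<in> line_through c (d - c)" by (rule line_through_base)
    have dL: "d \<in> line_through c (d - c)" unfolding mem_line_through by (intro exI[of _ 1]) simp
    show False
      using ncol[OF L] line_two_points_segment[OF L cL dL cd that(1,3)]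
        line_two_points_segment[OF L cL dL cd that(2,4)] by blast
  qed
  have TPI: "L \<in> TP \<longleftrightarrow> L \<in> ?T \<and> (\<forall>x\<in>L. n \<bullet> (x - ob) = 0)" for L unfolding TP_def H_def by simp
  have TPT: "TP \<subseteq> ?T" unfolding TP_def by auto
  have Hpq: "H (p i)" "H (q i)" "H (p j)" "H (q j)" using n unfolding H_def by auto
  have pqi: "p i \<noteq> q i" using ne I by auto
  have pqk: "p k \<noteq> q k" using ne I by auto
  have pql: "p l \<noteq> q l" using ne I by auto
  have cov_off: "\<exists>xs. covering I p q (?T - TP) xs \<and> (\<Sum>x\<leftarrow>xs. snd x) \<le> 4"
  proof (cases "?T - TP = {}")
    case True
    show ?thesis unfolding True using covering_empty by (intro exI[of _ "[]"]) simp
  next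
    case False
    then obtain L0 where "L0 \<in> ?T" "L0 \<notin> TP" by auto
    then obtain c where c: "c \<in> ?s i" "c \<in> ?s j" using off by blast
    have sub: "?T - TP \<subseteq> {L \<in> ?T. c \<in> L}" using off uniq[OF c] by blast
    obtain xs where xs: "covering I p q {L \<in> ?T. c \<in> L} xs" "(\<Sum>x\<leftarrow>xs. snd x) \<le> 4"
      using covering_common_point[where p=p and q=q, OF I pqk c] .
    show ?thesis using covering_mono[OF xs(1) sub] xs(2) by (intro exI[of _ xs]) simp
  qed
  have join: "capped I p q" if "covering I p q TP xs" "(\<Sum>x\<leftarrow>xs. snd x) \<le> 4" for xs
  proof -
    obtain ys where ys: "covering I p q (?T - TP) ys" "(\<Sum>x\<leftarrow>ys. snd x) \<le> 4" using cov_off by auto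
    have "TP \<union> (?T - TP) = ?T" using TPT by auto
    then have "covering I p q ?T (xs @ ys)" using covering_append[OF that(1) ys(1)] by simp
    then show ?thesis by (rule covering_capped) (use that ys in simp)
  qed
  \<comment> \<open>Here exactly one further segment lies in the plane. The planar transversals form
    the pencil at the point \<open>w\<close> in which the other one crosses the plane; two free
    signs give four pieces of weight 2.\<close>
  have one: "capped I p q"
    if I': "I = {i, j, k', l'}" and nk: "\<not> (H (p k') \<and> H (q k'))" and Hl: "H (p l')" "H (q l')" for k' l'
  proof -
    have T4': "L \<in> ?T \<longleftrightarrow> L \<in> lines \<and> L \<inter> ?s i \<noteq> {} \<and> L \<inter> ?s j \<noteq> {} \<and> L \<inter> ?s k' \<noteq> {} \<and> L \<inter> ?s l' \<noteq> {}" for L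
      by (rule transversals_mem4[OF I'])
    have Hl': "H x" if "x \<in> ?s l'" for x
      using plane_segment_mem[OF _ _ that] Hl unfolding H_def by blast
    show ?thesis
    proof (cases "\<exists>w. w \<in> ?s k' \<and> H w")
      case False
      have "TP = {}" unfolding TP_def using T4' False by blast
      then show ?thesis using join[of "[]"] covering_empty by simp
    next
      case True
      then obtain w where w: "w \<in> ?s k'" "H w" by blast
      have wu: "x = w" if "x \<in> ?s k'" "H x" for x using Hseg[OF that w] nk by blast
      interpret plane_segments n ob "{w}" "(p i, q i)" "[(p j, q j), (p l', q l')]"
        by unfold_locales (use n w Hl pqi in \<open>auto simp: H_def\<close>)
      let ?P = "plane_lines n ob {w} ((p i, q i) # [(p j, q j), (p l', q l')])"
      have PT: "?P \<subseteq> TP"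
        unfolding plane_lines_def subset_iff TPI T4' using w(1) by auto
      have TPP: "TP \<subseteq> ?P"
      proof
        fix L assume L: "L \<in> TP"
        then obtain x where x: "x \<in> L" "x \<in> ?s k'" using TPT T4' by blast
        then have "w \<in> L" using wu L unfolding TP_def by blast
        then show "L \<in> ?P" using L T4' unfolding plane_lines_def TPI by auto
      qed
      have PTP: "?P = TP" using PT TPP by (rule subset_antisym)
      have PT': "?P \<subseteq> ?T" using PTP TPT by simp
      have fin: "capped I p q" if "covering I p q ?T (map (\<lambda>\<sigma>s. (absorb Y (piece \<sigma>s), 2)) (signs (length [(p j, q j), (p l', q l')])))" for Y
        using that by (rule covering_capped) (simp add: o_def sum_list_triv length_signs)
      have idx: "\<exists>x\<in>I. s = (p x, q x)" if "s \<in> set ((p i, q i) # [(p j, q j), (p l', q l')])" for s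
        using that I' by auto
      show ?thesis
      proof (cases "\<exists>c. c \<in> ?s i \<and> c \<in> ?s j \<and> c \<in> ?s l'")
        case False
        have "?T \<subseteq> TP"
        proof (rule subsetI, rule ccontr)
          fix L assume L: "L \<in> ?T" "L \<notin> TP"
          then obtain c where c: "c \<in> L" "c \<in> ?s i" "c \<in> ?s j" using off by blast
          obtain y where y: "y \<in> L" "y \<in> ?s l'" using L T4' by blast
          have "c \<noteq> y" using c y False by blast
          then have "\<forall>z\<in>L. H z" using Hline[of L c y] L T4' c y Hi Hl' by blast
          then show False using L unfolding TP_def by simp
        qed
        then have e: "?P \<union> {} = ?T" using PTP TPT by simp
        have "covering I p q (?P \<union> {}) (map (\<lambda>\<sigma>s. (absorb {} (piece \<sigma>s), 2)) (signs (length [(p j, q j), (p l', q l')])))"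
          by (rule covering_pencil[of w, OF refl _ _ PT' idx]) simp_all
        then show ?thesis unfolding e by (rule fin)
      next
        case True
        then obtain c where c: "c \<in> ?s i" "c \<in> ?s j" "c \<in> ?s l'" by blast
        define Y where "Y = {L \<in> lines. c \<in> L \<and> L \<inter> ?s k' \<noteq> {}}"
        have Ypc: "path_connectedin line_topology Y" unfolding Y_def by (rule path_connectedin_star)
        have YT: "Y \<subseteq> ?T" unfolding Y_def subset_iff T4' using c by blast
        have offY: "?T - TP \<subseteq> Y"
        proof
          fix L assume L: "L \<in> ?T - TP"
          then obtain d where d: "d \<in> L" "d \<in> ?s i" "d \<in> ?s j" using off by blast
          then have "c \<in> L" using uniq[OF c(1,2) d(2,3)] by simp
          then show "L \<in> Y" unfolding Y_def using L T4' by simp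
        qed
        show ?thesis
        proof (cases "w = c")
          case True
          have "TP \<subseteq> Y" unfolding PTP[symmetric] plane_lines_def Y_def using True w(1) by auto
          then have "?T = Y" using offY YT by blast
          then have "covering I p q ?T [(Y, 4)]" using covering_single[OF YT Ypc] by simp
          then show ?thesis by (rule covering_capped) simp
        next
          case False
          \<comment> \<open>This line is planar and belongs to the star at \<open>c\<close>, so the
            star can be attached to its piece.\<close>
          let ?M = "line_through c (w - c)"
          have M: "?M \<in> lines" using False by (intro line_through_in_lines) simp
          have cM: "c \<in> ?M" by (rule line_through_base)
          have wM: "w \<in> ?M" unfolding mem_line_through by (intro exI[of _ 1]) simp
          have MY: "?M \<in> Y" unfolding Y_def using M cM wM w(1) by blast
          have "\<forall>z\<in>?M. H z" using Hline[OF M cM wM _ Hi[OF c(1)] w(2)] False by blast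
          then have "?M \<in> TP" using MY YT unfolding TP_def by blast
          then have meet: "?P \<inter> Y \<noteq> {}" unfolding PTP using MY by blast
          have "covering I p q (?P \<union> Y) (map (\<lambda>\<sigma>s. (absorb Y (piece \<sigma>s), 2)) (signs (length [(p j, q j), (p l', q l')])))"
            by (rule covering_pencil[of w, OF refl Ypc YT PT' idx]) (use meet in simp_all)
          moreover have "?P \<union> Y = ?T" unfolding PTP using TPT YT offY by blast
          ultimately show ?thesis using fin by simp
        qed
      qed
    qed
  qed
  consider "\<not> (H (p k) \<and> H (q k))" "\<not> (H (p l) \<and> H (q l))"
    | "\<not> (H (p k) \<and> H (q k))" "H (p l)" "H (q l)"
    | "\<not> (H (p l) \<and> H (q l))" "H (p k)" "H (q k)"
    | "H (p k)" "H (q k)" "H (p l)" "H (q l)" by blast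
  then show ?thesis
  proof cases
    case 1
    show ?thesis
    proof (cases "\<exists>L L'. L \<in> TP \<and> L' \<in> TP \<and> L \<noteq> L'")
      case False
      then have le_one: "L = L'" if "L \<in> TP" "L' \<in> TP" for L L' using that by simp
      obtain xs where "covering I p q TP xs" "(\<Sum>x\<leftarrow>xs. snd x) \<le> 4"
        by (rule covering_le_one[OF TPT le_one])
      then show ?thesis by (rule join)
    next
      case True
      then obtain L L' where LL: "L \<in> TP" "L' \<in> TP" "L \<noteq> L'" by (elim exE conjE)
      have pt: "\<exists>y. y \<in> L \<and> y \<in> L' \<and> y \<in> ?s x" if x: "x = k \<or> x = l" "\<not> (H (p x) \<and> H (q x))" for x
      proof -
        obtain y where y: "y \<in> L" "y \<in> ?s x" using LL TPT T4 x by blast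
        obtain y' where y': "y' \<in> L'" "y' \<in> ?s x" using LL TPT T4 x by blast
        have "H y" "H y'" using LL y y' unfolding TP_def by auto
        then have "y = y'" using Hseg[OF y(2) _ y'(2)] x by blast
        then show ?thesis using y y' by blast
      qed
      obtain w where w: "w \<in> L" "w \<in> L'" "w \<in> ?s k" using pt 1 by blast
      obtain z where z: "z \<in> L" "z \<in> L'" "z \<in> ?s l" using pt 1 by blast
      have lin: "L \<in> lines" "L' \<in> lines" using LL TPT T4 by blast+
      have "z = w" using lines_eq_if_two_points[OF lin z(1) w(1) z(2) w(2)] LL by blast
      have Hw: "H w" using LL w unfolding TP_def by blast
      interpret plane_segments n ob "{w}" "(p i, q i)" "[(p j, q j)]"
        by unfold_locales (use n Hw pqi in \<open>auto simp: H_def\<close>)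
      let ?P = "plane_lines n ob {w} ((p i, q i) # [(p j, q j)])"
      have PT: "?P \<subseteq> ?T"
        unfolding plane_lines_def subset_iff T4 using w(3) z(3) \<open>z = w\<close> by auto
      have TPP: "TP \<subseteq> ?P"
      proof
        fix M assume M: "M \<in> TP"
        then obtain x where x: "x \<in> M" "x \<in> ?s k" using TPT T4 by blast
        have "H x" using M x unfolding TP_def by blast
        then have "x = w" using Hseg[OF x(2) _ w(3) Hw] 1 by blast
        then show "M \<in> ?P" using M x T4 unfolding plane_lines_def TPI by auto
      qed
      have "covering I p q (?P \<union> {}) (map (\<lambda>\<sigma>s. (absorb {} (piece \<sigma>s), 2)) (signs (length [(p j, q j)])))"
        by (rule covering_pencil[of w, OF refl _ _ PT]) (use I in auto)
      then have "covering I p q TP (map (\<lambda>\<sigma>s. (absorb {} (piece \<sigma>s), 2)) (signs (length [(p j, q j)])))"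
        by (rule covering_mono) (use TPP in simp)
      then show ?thesis by (rule join) (simp add: o_def sum_list_triv length_signs)
    qed
  next
    case 2 then show ?thesis using one[OF I] by blast
  next
    case 3
    have "I = {i, j, l, k}" using I by auto
    then show ?thesis using one[of l k] 3 by blast
  next
    case 4
    interpret plane_segments n ob "{}" "(p i, q i)" "[(p j, q j), (p k, q k), (p l, q l)]"
      by unfold_locales (use n 4 pqi in \<open>auto simp: H_def\<close>)
    let ?P = "plane_lines n ob {} ((p i, q i) # [(p j, q j), (p k, q k), (p l, q l)])"
    have PTP: "?P = TP"
      unfolding plane_lines_def set_eq_iff TPI T4 by auto
    have PT: "?P \<subseteq> ?T" using PTP TPT by simp
    have Hx: "H y" if "x = k \<or> x = l" "y \<in> ?s x" for x y
      using plane_segment_mem[OF _ _ that(2)] 4 that(1) unfolding H_def by blast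
    have idx: "\<exists>x\<in>I. s = (p x, q x)" if "s \<in> set ((p i, q i) # [(p j, q j), (p k, q k), (p l, q l)])" for s
      using that I by auto
    show ?thesis
    proof (cases "?T \<subseteq> TP")
      case True
      show ?thesis by (rule capped_plane[OF refl _ _ PT _ idx, of "{}"]) (use True PTP in simp_all)
    next
      case False
      then obtain L0 where L0: "L0 \<in> ?T" "L0 \<notin> TP" by blast
      then obtain c where c: "c \<in> L0" "c \<in> ?s i" "c \<in> ?s j" using off by blast
      have ck: "c \<in> ?s x" if x: "x = k \<or> x = l" for x
      proof -
        obtain y where y: "y \<in> L0" "y \<in> ?s x" using L0 T4 x by blast
        have "c = y"
        proof (rule ccontr)
          assume "c \<noteq> y"
          then have "\<forall>z\<in>L0. H z" using Hline[of L0 c y] L0 T4 c y Hi Hx[OF x y(2)] by blast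
          then show False using L0 unfolding TP_def by simp
        qed
        then show ?thesis using y by simp
      qed
      define Y where "Y = {L \<in> lines. c \<in> L \<and> L \<inter> ?s k \<noteq> {}}"
      have Ypc: "path_connectedin line_topology Y" unfolding Y_def by (rule path_connectedin_star)
      have YT: "Y \<subseteq> ?T" unfolding Y_def subset_iff T4 using c ck by blast
      have offY: "?T - TP \<subseteq> Y"
      proof
        fix L assume L: "L \<in> ?T - TP"
        then obtain d where d: "d \<in> L" "d \<in> ?s i" "d \<in> ?s j" using off by blast
        then have "c \<in> L" using uniq[OF c(2,3) d(2,3)] by simp
        then show "L \<in> Y" unfolding Y_def using L T4 by simp
      qed
      \<comment> \<open>All four segments pass through \<open>c\<close>, so the line that carries
        segment \<open>i\<close> belongs both to the plane and to the star.\<close>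
      let ?M = "line_through (p i) (q i - p i)"
      have M: "?M \<in> lines" using pqi by (intro line_through_in_lines) simp
      have pM: "p i \<in> ?M" by (rule line_through_base)
      have qM: "q i \<in> ?M" unfolding mem_line_through by (intro exI[of _ 1]) simp
      have "c = p i + u *\<^sub>R (q i - p i)" if "c = (1 - u) *\<^sub>R p i + u *\<^sub>R q i" for u
        using that by (simp add: algebra_simps)
      then have cM: "c \<in> ?M" using c(2) unfolding closed_segment_def mem_line_through by blast
      have MY: "?M \<in> Y" unfolding Y_def using M cM ck by blast
      have "\<forall>z\<in>?M. H z" using Hline[OF M pM qM pqi Hpq(1,2)] by blast
      then have "?M \<in> TP" using MY YT unfolding TP_def by blast
      then have meet: "?P \<inter> Y \<noteq> {}" unfolding PTP using MY by blast
      have "?T \<subseteq> ?P \<union> Y" unfolding PTP using offY by blast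
      then show ?thesis
        by (rule capped_plane[OF refl Ypc YT PT _ idx]) (use meet in simp_all)
    qed
  qed
qed

section \<open>Skew segments and the ruling of a quadric\<close>

lemma perp_parallel:
  fixes N M V x :: "real^3"
  assumes "N \<times> M \<noteq> 0" "N \<bullet> V = 0" "M \<bullet> V = 0" "V \<noteq> 0" "N \<bullet> x = 0" "M \<bullet> x = 0"
  obtains c where "x = c *\<^sub>R V"
proof -
  obtain c where c: "x = c *\<^sub>R (N \<times> M)" by (rule perp_two[OF assms(5,6,1)])
  obtain d where d: "V = d *\<^sub>R (N \<times> M)" by (rule perp_two[OF assms(2,3,1)])
  have "d \<noteq> 0" using d assms(4) by auto
  then have "x = (c / d) *\<^sub>R V" using c d by simp
  then show ?thesis by (rule that)
qed

lemma det_zero_if_perp: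
  fixes n a b c :: "real^3"
  assumes "n \<noteq> 0" "n \<bullet> a = 0" "n \<bullet> b = 0" "n \<bullet> c = 0"
  shows "a \<bullet> (b \<times> c) = 0"
proof (cases "b \<times> c = 0")
  case False
  have "b \<bullet> n = 0" "c \<bullet> n = 0" using assms by (simp_all add: inner_commute)
  then obtain t where t: "n = t *\<^sub>R (b \<times> c)" using perp_two False by metis
  have "t \<noteq> 0" using t assms(1) by auto
  moreover have "t * (a \<bullet> (b \<times> c)) = 0" using t assms(2) by (simp add: inner_commute)
  ultimately show ?thesis by simp
qed simp

lemma convex_zero_imp:
  fixes A B u :: real
  assumes "0 \<le> u" "u \<le> 1" "(1 - u) * A + u * B = 0"
  shows "A * B \<le> 0"
proof (rule ccontr)
  assume "\<not> A * B \<le> 0"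
  then have "0 < A \<and> 0 < B \<or> A < 0 \<and> B < 0" by (auto simp: not_le zero_less_mult_iff)
  moreover have "0 < (1 - u) * a + u * b" if "0 < a" "0 < b" for a b
    using assms(1,2) that by (cases "u = 0") (auto intro: add_nonneg_pos)
  from this[of A B] this[of "- A" "- B"] have "0 < A \<and> 0 < B \<longrightarrow> False" "A < 0 \<and> B < 0 \<longrightarrow> False"
    using assms(3) by auto
  ultimately show False by blast
qed

lemma convex_zero_ex:
  fixes A B :: real
  assumes "A * B \<le> 0"
  obtains u where "0 \<le> u" "u \<le> 1" "(1 - u) * A + u * B = 0"
proof (cases "A = B")
  case True
  then have "A = 0" using assms by (auto simp: mult_le_0_iff)
  then show ?thesis using that[of 0] by simp
next
  case False
  let ?u = "A / (A - B)"
  have "0 \<le> ?u" "?u \<le> 1" using assms False by (auto simp: divide_simps mult_le_0_iff)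
  moreover have "(1 - ?u) * A + ?u * B = 0" using False by (simp add: field_simps)
  ultimately show ?thesis using that by blast
qed

text \<open>The line is the intersection of the planes through \<open>P\<close> with normals
  \<open>N\<close> and \<open>M\<close>. The segment lies in the first plane, so it is crossed as
  soon as the second plane separates its ends.\<close>

lemma line_meets_segment_iff:
  assumes "N \<times> M \<noteq> 0" "N \<bullet> V = 0" "M \<bullet> V = 0" "V \<noteq> 0" "N \<bullet> (a - P) = 0" "N \<bullet> (b - P) = 0"
  shows "line_through P V \<inter> closed_segment a b \<noteq> {} \<longleftrightarrow> (M \<bullet> (a - P)) * (M \<bullet> (b - P)) \<le> 0"
proof
  assume "line_through P V \<inter> closed_segment a b \<noteq> {}"
  then obtain y where y: "y \<in> line_through P V" "y \<in> closed_segment a b" by auto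
  obtain u where u: "0 \<le> u" "u \<le> 1" "y = (1 - u) *\<^sub>R a + u *\<^sub>R b" using y(2) unfolding closed_segment_def by auto
  obtain s where "y = P + s *\<^sub>R V" using y(1) mem_line_through by blast
  then have "M \<bullet> (y - P) = 0" using assms(3) by simp
  moreover have "y - P = (1 - u) *\<^sub>R (a - P) + u *\<^sub>R (b - P)" unfolding u by (simp add: algebra_simps)
  ultimately have "(1 - u) * (M \<bullet> (a - P)) + u * (M \<bullet> (b - P)) = 0" by (simp add: inner_add_right)
  then show "(M \<bullet> (a - P)) * (M \<bullet> (b - P)) \<le> 0" using convex_zero_imp u by blast
next
  assume "(M \<bullet> (a - P)) * (M \<bullet> (b - P)) \<le> 0"
  then obtain u where u: "0 \<le> u" "u \<le> 1" "(1 - u) * (M \<bullet> (a - P)) + u * (M \<bullet> (b - P)) = 0"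
    by (rule convex_zero_ex)
  let ?y = "(1 - u) *\<^sub>R a + u *\<^sub>R b"
  have y: "?y - P = (1 - u) *\<^sub>R (a - P) + u *\<^sub>R (b - P)" by (simp add: algebra_simps)
  have "N \<bullet> (?y - P) = 0" "M \<bullet> (?y - P) = 0" unfolding y using assms(5,6) u(3) by (simp_all add: inner_add_right)
  then obtain c where "?y - P = c *\<^sub>R V" using perp_parallel[OF assms(1-4)] by blast
  then have "?y = P + c *\<^sub>R V" by (simp add: algebra_simps)
  then have "?y \<in> line_through P V" unfolding mem_line_through by blast
  moreover have "?y \<in> closed_segment a b" unfolding closed_segment_def using u by blast
  ultimately show "line_through P V \<inter> closed_segment a b \<noteq> {}" by blast
qed

text \<open>Every interval of a set cut out of \<open>{0..1}\<close> by conditions \<open>quadratic \<le> 0\<close> starts at \<open>0\<close> or at a left root of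
  one of the quadratics, and each quadratic has at most one left root; this bounds the number of intervals.\<close>

definition left_root :: "real \<Rightarrow> real \<Rightarrow> real \<Rightarrow> real \<Rightarrow> bool" where
  "left_root a b c x \<longleftrightarrow> a * x\<^sup>2 + b * x + c = 0 \<and> (\<forall>\<delta>>0. \<exists>y. x - \<delta> < y \<and> y < x \<and> 0 < a * y\<^sup>2 + b * y + c)"

text \<open>With roots x < x' the quadratic is a (y - x) (y - x'). Positivity to the left of x
  forces a > 0, whereas positivity between x and x' contradicts this.\<close>

lemma left_root_unique:
  assumes "left_root a b c x" "left_root a b c x'"
  shows "x = x'"
proof -
  have "\<not> x < x'" if r: "left_root a b c x" "left_root a b c x'" for x x'
  proof
    assume lt: "x < x'"
    have e: "a * x\<^sup>2 + b * x + c = 0" "a * x'\<^sup>2 + b * x' + c = 0" using r unfolding left_root_def by auto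
    have "(x' - x) * (a * (x + x') + b) = 0" using e by (simp add: algebra_simps power2_eq_square)
    then have b: "b = - a * (x + x')" using lt by (simp add: add_eq_0_iff)
    have c: "c = a * x * x'" using e(1) unfolding b by (simp add: algebra_simps power2_eq_square)
    have q: "a * y\<^sup>2 + b * y + c = a * ((y - x) * (y - x'))" for y
      unfolding b c by (simp add: algebra_simps power2_eq_square)
    obtain y where y: "y < x" "0 < a * ((y - x) * (y - x'))"
      using r(1) unfolding left_root_def q by (metis zero_less_one)
    have "0 < (y - x) * (y - x')" using y lt by (intro mult_neg_neg) auto
    then have a: "0 < a" using y(2) zero_less_mult_pos2 by blast
    obtain z where z: "x' - (x' - x) < z" "z < x'" "0 < a * ((z - x) * (z - x'))"
      using r(2) lt unfolding left_root_def q by (meson diff_gt_0_iff_gt)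
    have "(z - x) * (z - x') < 0" using z by (intro mult_pos_neg) auto
    then show False using zero_less_mult_pos[OF z(3) a] by simp
  qed
  from this[OF assms] this[OF assms(2,1)] show ?thesis by simp
qed

lemma left_root_between:
  assumes "y \<le> s" "0 < a * y\<^sup>2 + b * y + c" "a * s\<^sup>2 + b * s + c \<le> 0"
  obtains z where "y < z" "z \<le> s" "left_root a b c z"
proof -
  let ?q = "\<lambda>x. a * x\<^sup>2 + b * x + c"
  have cont: "continuous_on A ?q" for A by (intro continuous_intros)
  have cpt: "compact ({y..s} \<inter> {x. ?q x \<le> 0})"
    by (intro compact_Int_closed compact_Icc closed_Collect_le continuous_intros)
  have nonempty: "{y..s} \<inter> {x. ?q x \<le> 0} \<noteq> {}" using assms by auto
  obtain z where "z \<in> {y..s} \<inter> {x. ?q x \<le> 0}" "\<forall>x\<in>{y..s} \<inter> {x. ?q x \<le> 0}. z \<le> x"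
    by (rule bexE[OF compact_attains_inf[OF cpt nonempty]])
  then have z: "y \<le> z" "z \<le> s" "?q z \<le> 0" "\<And>x. y \<le> x \<Longrightarrow> x \<le> s \<Longrightarrow> ?q x \<le> 0 \<Longrightarrow> z \<le> x" by auto
  have yz: "y < z" using z(1,3) assms(2) by (cases "y = z") auto
  have pos: "0 < ?q w" if "y \<le> w" "w < z" for w
    using z(4)[of w] z(2) that by linarith
  have "?q z = 0"
  proof (rule ccontr)
    assume "?q z \<noteq> 0"
    then have "?q z < 0" using z(3) by auto
    then obtain w where "y \<le> w" "w \<le> z" "?q w = 0"
      using IVT2'[of ?q z 0 y] assms(2) yz cont by auto
    then show False using pos[of w] \<open>?q z \<noteq> 0\<close> by (cases "w = z") auto
  qed
  moreover have "\<exists>w. z - \<delta> < w \<and> w < z \<and> 0 < ?q w" if "0 < \<delta>" for \<delta>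
    using pos[of "max y (z - \<delta> / 2)"] that yz by (intro exI[of _ "max y (z - \<delta> / 2)"]) auto
  ultimately have "left_root a b c z" unfolding left_root_def by blast
  then show ?thesis using that yz z(2) by blast
qed

lemma quadratic_intervals:
  fixes a b c :: "nat \<Rightarrow> real"
  defines "Z \<equiv> {s. 0 \<le> s \<and> s \<le> 1 \<and> (\<forall>e<3. a e * s\<^sup>2 + b e * s + c e \<le> 0)}"
  shows "\<exists>X. finite X \<and> card X \<le> 4 \<and> (\<forall>x\<in>X. x \<in> Z \<and> (x = 0 \<or> (\<exists>e<3. a e * x\<^sup>2 + b e * x + c e = 0))) \<and>
    (\<forall>s\<in>Z. \<exists>x\<in>X. x \<le> s \<and> {x..s} \<subseteq> Z)"
proof -
  let ?R = "\<lambda>e. {x. left_root (a e) (b e) (c e) x}"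
  have R: "finite (?R e) \<and> card (?R e) \<le> 1" for e
  proof (cases "?R e = {}")
    case False
    then obtain x where "left_root (a e) (b e) (c e) x" by auto
    then have "?R e = {x}" using left_root_unique by auto
    then show ?thesis by simp
  qed simp
  define C where "C = insert 0 (\<Union>e\<in>{..<3}. ?R e)"
  have fC: "finite C" unfolding C_def using R by auto
  have "card (\<Union>e\<in>{..<3::nat}. ?R e) \<le> (\<Sum>e<3. card (?R e))" by (rule card_UN_le) simp
  also have "\<dots> \<le> (\<Sum>e<3::nat. 1)" by (rule sum_mono) (use R in simp)
  finally have "card (\<Union>e\<in>{..<3::nat}. ?R e) \<le> 3" by simp
  then have cC: "card C \<le> 4" unfolding C_def by (intro card_insert_le_m1) simp_all
  show ?thesis
  proof (intro exI[of _ "C \<inter> Z"] conjI ballI)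
    show "finite (C \<inter> Z)" using fC by simp
    show "card (C \<inter> Z) \<le> 4" using cC card_mono[OF fC, of "C \<inter> Z"] by simp
    fix x assume "x \<in> C \<inter> Z"
    then show "x \<in> Z" "x = 0 \<or> (\<exists>e<3. a e * x\<^sup>2 + b e * x + c e = 0)"
      unfolding C_def left_root_def by auto
  next
    fix s assume s: "s \<in> Z"
    \<comment> \<open>The last candidate not beyond \<open>s\<close>: if a condition failed between
      \<open>?x\<close> and \<open>s\<close>, a left root would follow the failure and be a later
      candidate.\<close>
    let ?x = "Max {x \<in> C. x \<le> s}"
    have D: "finite {x \<in> C. x \<le> s}" "0 \<in> {x \<in> C. x \<le> s}"
      using fC s unfolding C_def Z_def by auto
    have x: "?x \<in> C" "?x \<le> s" using Max_in[OF D(1)] D(2) by auto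
    have x0: "0 \<le> ?x" using Max_ge[OF D] .
    have "y \<in> Z" if y: "?x \<le> y" "y \<le> s" for y
    proof -
      have "a e * y\<^sup>2 + b e * y + c e \<le> 0" if e: "e < 3" for e
      proof (rule ccontr)
        assume "\<not> ?thesis"
        then obtain z where z: "y < z" "z \<le> s" "left_root (a e) (b e) (c e) z"
          using left_root_between[of y s "a e" "b e" "c e"] s y e unfolding Z_def by auto
        then have "z \<in> {x \<in> C. x \<le> s}" using e unfolding C_def by auto
        then have "z \<le> ?x" by (rule Max_ge[OF D(1)])
        then show False using z y by simp
      qed
      then show ?thesis using y x0 s unfolding Z_def by auto
    qed
    then show "\<exists>x\<in>C \<inter> Z. x \<le> s \<and> {x..s} \<subseteq> Z"
      using x by (intro bexI[of _ ?x]) auto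
  qed
qed

definition skew :: "(nat \<Rightarrow> real^3) \<Rightarrow> (nat \<Rightarrow> real^3) \<Rightarrow> nat \<Rightarrow> nat \<Rightarrow> bool" where
  "skew p q i j \<longleftrightarrow> (q i - p i) \<bullet> ((q j - p j) \<times> (p j - p i)) \<noteq> 0"

lemma quadratic_three_roots:
  fixes c0 c1 c2 :: real
  assumes "c0 + c1 * x + c2 * x\<^sup>2 = 0" "c0 + c1 * y + c2 * y\<^sup>2 = 0" "c0 + c1 * z + c2 * z\<^sup>2 = 0"
    and "x \<noteq> y" "x \<noteq> z" "y \<noteq> z"
  shows "c0 = 0 \<and> c1 = 0 \<and> c2 = 0"
proof -
  have "(y - x) * (c1 + c2 * (x + y)) = 0" "(z - x) * (c1 + c2 * (x + z)) = 0"
    using assms(1-3) by (simp_all add: algebra_simps power2_eq_square)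
  then have e: "c1 + c2 * (x + y) = 0" "c1 + c2 * (x + z) = 0" using assms by auto
  have "c2 * (y - z) = (c1 + c2 * (x + y)) - (c1 + c2 * (x + z))" by (simp add: algebra_simps)
  then have "c2 * (y - z) = 0" using e by simp
  then show ?thesis using e assms by auto
qed

text \<open>The point \<open>P s\<close> of the line \<open>i\<close> spans planes with the lines
  \<open>j\<close> and \<open>k\<close>, with normals \<open>N j s\<close> and \<open>N k s\<close>;
  a transversal through \<open>P s\<close> is their intersection, with direction \<open>V s\<close>.
  It can meet segment \<open>l\<close> only if \<open>F s = 0\<close>, where \<open>F\<close> is
  quadratic. If \<open>F\<close> has at most two roots, there are at most two transversals, of
  weight 4 each. Otherwise \<open>F\<close> vanishes, the line of \<open>l\<close> meets the whole
  ruling, and being a transversal amounts to three quadratic conditions on \<open>s\<close>; this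
  gives at most four intervals of weight 2, each starting at a line through an end.\<close>

lemma covering_skew:
  assumes I: "I = {i, j, k, l}" and ij: "skew p q i j" and ik: "skew p q i k" and jk: "skew p q j k"
    and il: "skew p q i l" and jl: "skew p q j l"
  shows "\<exists>xs. covering I p q (transversals I p q) xs \<and> (\<Sum>x\<leftarrow>xs. snd x) \<le> 8"
proof -
  let ?T = "transversals I p q"
  let ?s = "\<lambda>x. closed_segment (p x) (q x)"
  have T4: "L \<in> ?T \<longleftrightarrow> L \<in> lines \<and> L \<inter> ?s i \<noteq> {} \<and> L \<inter> ?s j \<noteq> {} \<and> L \<inter> ?s k \<noteq> {} \<and> L \<inter> ?s l \<noteq> {}" for L
    by (rule transversals_mem4[OF I])
  define u where "u = q i - p i"
  define P where "P = (\<lambda>s. p i + s *\<^sub>R u)"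
  define v where "v = (\<lambda>x. q x - p x)"
  define N where "N = (\<lambda>x s. (p x - P s) \<times> v x)"
  define V where "V = (\<lambda>s. N j s \<times> N k s)"
  have Np: "N x s \<bullet> (p x - P s) = 0" and Nv: "N x s \<bullet> v x = 0" for x s
    unfolding N_def by (simp_all add: dot_cross_self)
  have Nq: "N x s \<bullet> (q x - P s) = 0" for x s
  proof -
    have "N x s \<bullet> (q x - P s) = N x s \<bullet> (p x - P s) + N x s \<bullet> v x"
      by (simp add: v_def inner_diff_right)
    then show ?thesis by (simp add: Np Nv)
  qed
  have uN: "u \<bullet> N x s = - (u \<bullet> (v x \<times> (p x - p i)))" for x s
  proof -
    have "N x s = - (v x \<times> (p x - p i)) + s *\<^sub>R (v x \<times> u)"
      unfolding N_def P_def by (simp add: cross_skew[of _ "v x"] cross_add_right cross_mult_right left_diff_distrib Cross3.right_diff_distrib algebra_simps)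
    then show ?thesis by (simp add: inner_add_right inner_diff_right dot_cross_self)
  qed
  have N0: "N x s \<noteq> 0" if "skew p q i x" for x s
    using that uN[of x s] unfolding skew_def u_def v_def by auto
  have Nind: "N x s \<times> N y s \<noteq> 0" if sk: "skew p q i x" "skew p q i y" "skew p q x y" for x y s
  proof
    assume "N x s \<times> N y s = 0"
    then have "collinear {0, N x s, N y s}" by (simp add: cross_eq_0)
    then obtain c where c: "N y s = c *\<^sub>R N x s" using N0 sk unfolding collinear_lemma by blast
    then have "c \<noteq> 0" using N0[OF sk(2), of s] by auto
    have z: "N x s \<bullet> w = 0" if "N y s \<bullet> w = 0" for w
      using that \<open>c \<noteq> 0\<close> unfolding c by simp
    have "N x s \<bullet> v y = 0" using z Nv by simp
    have "N x s \<bullet> (p y - P s) = 0" using z Np by simp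
    then have "N x s \<bullet> (p y - p x) = 0" using Np[of x s] by (simp add: inner_diff_right)
    then have "v x \<bullet> (v y \<times> (p y - p x)) = 0"
      using det_zero_if_perp[OF N0[OF sk(1)] Nv _ _] \<open>N x s \<bullet> v y = 0\<close> by blast
    then show False using sk(3) unfolding skew_def v_def by simp
  qed
  have V0: "V s \<noteq> 0" for s unfolding V_def by (rule Nind[OF ij ik jk])
  have NjV: "N j s \<bullet> V s = 0" and NkV: "N k s \<bullet> V s = 0" for s
    unfolding V_def by (simp_all add: dot_cross_self)
  have notin: "y \<noteq> P s" if h: "y \<in> ?s x" "skew p q i x" for x y s
  proof
    assume y: "y = P s"
    obtain t where "y = (1 - t) *\<^sub>R p x + t *\<^sub>R q x" using h(1) unfolding closed_segment_def by auto
    then have "p x - P s = (- t) *\<^sub>R v x" unfolding y[symmetric] v_def by (simp add: algebra_simps)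
    then have "N x s = 0" unfolding N_def by (simp add: cross_mult_left)
    then show False using N0 h(2) by blast
  qed
  have Ny: "N x s \<bullet> (y - P s) = 0" if "y \<in> ?s x" for x y s
    using plane_segment_mem[OF Np Nq that] .
  define F where "F = (\<lambda>s. N l s \<bullet> V s)"
  let ?L = "\<lambda>s. line_through (P s) (V s)"
  have Llines: "?L s \<in> lines" for s using V0 by (rule line_through_in_lines)
  have param: "\<exists>s. 0 \<le> s \<and> s \<le> 1 \<and> L = ?L s" if L: "L \<in> ?T" for L
  proof -
    obtain x where x: "x \<in> L" "x \<in> ?s i" using L T4 by blast
    obtain s where s: "0 \<le> s" "s \<le> 1" "x = (1 - s) *\<^sub>R p i + s *\<^sub>R q i" using x(2) unfolding closed_segment_def by auto
    then have xP: "x = P s" unfolding P_def u_def by (simp add: algebra_simps)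
    obtain y where y: "y \<in> L" "y \<in> ?s j" using L T4 by blast
    obtain z where z: "z \<in> L" "z \<in> ?s k" using L T4 by blast
    have yP: "P s \<noteq> y" using notin[OF y(2) ij] by blast
    have zP: "P s \<noteq> z" using notin[OF z(2) ik] by blast
    have L1: "L \<in> lines" using L T4 by blast
    have Ly: "L = line_through (P s) (y - P s)" using line_two_points[OF L1 _ y(1) yP] x xP by simp
    obtain c where "z = P s + c *\<^sub>R (y - P s)" using z(1) Ly mem_line_through by blast
    then have c: "z - P s = c *\<^sub>R (y - P s)" by simp
    have "c \<noteq> 0" using c zP by auto
    then have "N k s \<bullet> (y - P s) = 0" using Ny[OF z(2), of s] unfolding c by simp
    then obtain d where d: "y - P s = d *\<^sub>R V s"
      using perp_parallel[OF V0[unfolded V_def] NjV NkV V0 Ny[OF y(2)]] by blast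
    then have "d \<noteq> 0" using yP by auto
    then have "L = ?L s" using Ly d line_through_scale by simp
    then show ?thesis using s by blast
  qed
  have mi: "?L s \<inter> ?s i \<noteq> {}" if "0 \<le> s" "s \<le> 1" for s
  proof -
    have "P s = (1 - s) *\<^sub>R p i + s *\<^sub>R q i" unfolding P_def u_def by (simp add: algebra_simps)
    then have "P s \<in> ?s i" using that unfolding closed_segment_def by blast
    then show ?thesis using line_through_base by blast
  qed
  have mj: "?L s \<inter> ?s j \<noteq> {} \<longleftrightarrow> (N k s \<bullet> (p j - P s)) * (N k s \<bullet> (q j - P s)) \<le> 0" for s
    by (rule line_meets_segment_iff[OF Nind[OF ij ik jk] NjV NkV V0 Np Nq])
  have kj: "N k s \<times> N j s \<noteq> 0" for s using Nind[OF ij ik jk, of s] cross_skew[of "N k s" "N j s"] by auto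
  have mk: "?L s \<inter> ?s k \<noteq> {} \<longleftrightarrow> (N j s \<bullet> (p k - P s)) * (N j s \<bullet> (q k - P s)) \<le> 0" for s
    by (rule line_meets_segment_iff[OF kj NkV NjV V0 Np Nq])
  have lj: "N l s \<times> N j s \<noteq> 0" for s using Nind[OF ij il jl, of s] cross_skew[of "N l s" "N j s"] by auto
  have ml: "?L s \<inter> ?s l \<noteq> {} \<longleftrightarrow> (N j s \<bullet> (p l - P s)) * (N j s \<bullet> (q l - P s)) \<le> 0" if "F s = 0" for s
    by (rule line_meets_segment_iff[OF lj that[unfolded F_def] NjV V0 Np Nq])
  have F0: "F s = 0" if m: "?L s \<inter> ?s l \<noteq> {}" for s
  proof -
    obtain y where y: "y \<in> ?L s" "y \<in> ?s l" using m by blast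
    obtain c where "y = P s + c *\<^sub>R V s" using y(1) mem_line_through by blast
    then have c: "y - P s = c *\<^sub>R V s" by simp
    have "c \<noteq> 0" using c notin[OF y(2) il, of s] by auto
    then show ?thesis using Ny[OF y(2), of s] unfolding c F_def by simp
  qed
  define A where "A = (\<lambda>x. (p x - p i) \<times> v x)"
  define B where "B = (\<lambda>x. u \<times> v x)"
  have NAB: "N x s = A x - s *\<^sub>R B x" for x s
    unfolding N_def A_def B_def P_def by (simp add: Cross3.left_diff_distrib cross_add_left cross_mult_left algebra_simps)
  have u0: "u \<noteq> 0" using ij unfolding skew_def u_def by auto
  have Bu: "B x \<bullet> u = 0" "u \<bullet> B x = 0" for x unfolding B_def by (simp_all add: dot_cross_self)
  \<comment> \<open>Since \<open>N x s = A x - s *\<^sub>R B x\<close>, this is the coefficient of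
    the cube of \<open>s\<close> in \<open>F\<close>, up to sign. It vanishes because all
    \<open>B x\<close> are orthogonal to \<open>u\<close>.\<close>
  have B3: "B l \<bullet> (B j \<times> B k) = 0" using det_zero_if_perp[OF u0] Bu by blast
  obtain c0 c1 c2 where Fq: "\<And>s. F s = c0 + c1 * s + c2 * s\<^sup>2"
  proof
    fix s
    show "F s = A l \<bullet> (A j \<times> A k) + (- (B l \<bullet> (A j \<times> A k)) - A l \<bullet> (B j \<times> A k) - A l \<bullet> (A j \<times> B k)) * s
       + (A l \<bullet> (B j \<times> B k) + B l \<bullet> (B j \<times> A k) + B l \<bullet> (A j \<times> B k)) * s\<^sup>2"
      using B3 unfolding F_def V_def NAB
      by (simp add: Cross3.left_diff_distrib Cross3.right_diff_distrib cross_mult_left cross_mult_right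
          inner_diff_left inner_diff_right algebra_simps power2_eq_square)
  qed
  have lin: "N x s \<bullet> (r - P s) = A x \<bullet> (r - p i) - (A x \<bullet> u + B x \<bullet> (r - p i)) * s" for x r s
    using Bu(1)[of x] unfolding NAB P_def by (simp add: inner_diff_left inner_diff_right inner_add_right algebra_simps)
  show ?thesis
  proof (cases "\<exists>s1 s2 s3. s1 \<noteq> s2 \<and> s1 \<noteq> s3 \<and> s2 \<noteq> s3 \<and> F s1 = 0 \<and> F s2 = 0 \<and> F s3 = 0")
    case False
    obtain r1 r2 where r: "\<And>s. F s = 0 \<Longrightarrow> s = r1 \<or> s = r2" using False by metis
    define X where "X = (\<lambda>r. {L \<in> ?T. L = ?L r})"
    have "\<exists>xs. covering I p q (X r) xs \<and> (\<Sum>x\<leftarrow>xs. snd x) \<le> 4" for r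
    proof -
      obtain xs where "covering I p q (X r) xs" "(\<Sum>x\<leftarrow>xs. snd x) \<le> 4"
        by (rule covering_le_one[of "X r"]) (auto simp: X_def)
      then show ?thesis by blast
    qed
    then obtain xs1 xs2 where xs: "covering I p q (X r1) xs1" "(\<Sum>x\<leftarrow>xs1. snd x) \<le> 4"
      "covering I p q (X r2) xs2" "(\<Sum>x\<leftarrow>xs2. snd x) \<le> 4" by metis
    have "?T \<subseteq> X r1 \<union> X r2"
    proof
      fix L assume L: "L \<in> ?T"
      then obtain s where s: "L = ?L s" using param by blast
      then have "F s = 0" using F0 L T4 by blast
      then show "L \<in> X r1 \<union> X r2" using r L s unfolding X_def by blast
    qed
    then have "covering I p q ?T (xs1 @ xs2)" by (rule covering_mono[OF covering_append[OF xs(1,3)]])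
    then show ?thesis by (intro exI[of _ "xs1 @ xs2"]) (use xs in simp)
  next
    case True
    then obtain s1 s2 s3 where "s1 \<noteq> s2" "s1 \<noteq> s3" "s2 \<noteq> s3" "F s1 = 0" "F s2 = 0" "F s3 = 0" by blast
    then have "c0 = 0 \<and> c1 = 0 \<and> c2 = 0" using quadratic_three_roots[of c0 c1 s1 c2 s2 s3] unfolding Fq by blast
    then have Fz: "F s = 0" for s unfolding Fq by simp
    \<comment> \<open>Each entry consists of the index of a separating plane and the two ends that
      it has to separate. The two values at the ends are affine in \<open>s\<close>, so their
      product \<open>\<alpha> e\<close> is quadratic.\<close>
    define pts where "pts = (\<lambda>e::nat. if e = 0 then (k, p j, q j) else if e = 1 then (j, p k, q k) else (j, p l, q l))"
    define f where "f = (\<lambda>e r s. N (fst (pts e)) s \<bullet> (r - P s))"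
    define \<alpha> where "\<alpha> = (\<lambda>e s. f e (fst (snd (pts e))) s * f e (snd (snd (pts e))) s)"
    have "\<exists>a b c. \<forall>s. \<alpha> e s = a * s\<^sup>2 + b * s + c" for e
    proof -
      have *: "\<exists>a b c. \<forall>s. (x0 - x1 * s) * (y0 - y1 * s) = a * s\<^sup>2 + b * s + (c :: real)" for x0 x1 y0 y1 :: real
        by (intro exI[of _ "x1 * y1"] exI[of _ "- (x0 * y1 + x1 * y0)"] exI[of _ "x0 * y0"])
          (simp add: algebra_simps power2_eq_square)
      show ?thesis unfolding \<alpha>_def f_def lin by (rule *)
    qed
    then obtain a b c where abc: "\<And>e s. \<alpha> e s = a e * s\<^sup>2 + b e * s + c e" by metis
    define Z where "Z = {s. 0 \<le> s \<and> s \<le> 1 \<and> (\<forall>e<3. a e * s\<^sup>2 + b e * s + c e \<le> 0)}"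
    have all3: "(\<forall>e<3. Q e) \<longleftrightarrow> Q 0 \<and> Q 1 \<and> Q (2::nat)" for Q by (auto simp: less_Suc_eq numeral_3_eq_3 numeral_2_eq_2)
    have LT: "?L s \<in> ?T \<longleftrightarrow> s \<in> Z" if "0 \<le> s" "s \<le> 1" for s
      unfolding T4 mj mk ml[OF Fz] Z_def abc[symmetric] all3 \<alpha>_def f_def pts_def
      using mi[OF that] Llines that by simp
    obtain X where X: "finite X" "card X \<le> 4"
      "\<forall>x\<in>X. x \<in> Z \<and> (x = 0 \<or> (\<exists>e<3. a e * x\<^sup>2 + b e * x + c e = 0))"
      "\<forall>s\<in>Z. \<exists>x\<in>X. x \<le> s \<and> {x..s} \<subseteq> Z"
      using quadratic_intervals[of a b c, folded Z_def] by (elim exE conjE)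
    obtain xl where xl: "set xl = X" "distinct xl" using finite_distinct_list[OF X(1)] by blast
    have lenx: "length xl \<le> 4" using X(2) distinct_card[OF xl(2)] xl(1) by simp
    define S where "S = (\<lambda>x. {s. x \<le> s \<and> {x..s} \<subseteq> Z})"
    have SZ: "s \<in> Z" if "s \<in> S x" for s x using that unfolding S_def by auto
    have Spc: "path_connected (S x)" for x
    proof -
      have "is_interval (S x)" unfolding is_interval_1 S_def by auto
      then show ?thesis by (simp add: is_interval_path_connected)
    qed
    let ?xs = "map (\<lambda>x. (?L ` S x, 2::nat)) xl"
    have ends: "\<exists>y\<in>I. through_end p q y (?L x)" if x: "x \<in> X" for x
    proof -
      consider "x = 0" | e where "e < 3" "\<alpha> e x = 0" using bspec[OF X(3) x] unfolding abc by blast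
      then show ?thesis
      proof cases
        case 1
        have "p i \<in> ?L 0" using line_through_base[of "P 0" "V 0"] unfolding P_def by simp
        then show ?thesis using 1 I unfolding through_end_def by blast
      next
        case 2
        have on: "r \<in> ?L x" if h: "M \<times> M' \<noteq> 0" "M \<bullet> V x = 0" "M' \<bullet> V x = 0" "M \<bullet> (r - P x) = 0" "M' \<bullet> (r - P x) = 0" for M M' r
        proof -
          obtain d where "r - P x = d *\<^sub>R V x" by (rule perp_parallel[OF h(1-3) V0 h(4,5)])
          then have "r = P x + d *\<^sub>R V x" by (simp add: algebra_simps)
          then show ?thesis unfolding mem_line_through by blast
        qed
        have "e = 0 \<or> e = 1 \<or> e = 2" using 2(1) by auto
        then show ?thesis
        proof (elim disjE)
          assume "e = 0"
          then have "N k x \<bullet> (p j - P x) = 0 \<or> N k x \<bullet> (q j - P x) = 0"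
            using 2(2) unfolding \<alpha>_def f_def pts_def by simp
          then have "p j \<in> ?L x \<or> q j \<in> ?L x"
            using on[OF Nind[OF ij ik jk] NjV NkV Np] on[OF Nind[OF ij ik jk] NjV NkV Nq] by blast
          then show ?thesis using I unfolding through_end_def by blast
        next
          assume "e = 1"
          then have "N j x \<bullet> (p k - P x) = 0 \<or> N j x \<bullet> (q k - P x) = 0"
            using 2(2) unfolding \<alpha>_def f_def pts_def by simp
          then have "p k \<in> ?L x \<or> q k \<in> ?L x"
            using on[OF kj NkV NjV Np] on[OF kj NkV NjV Nq] by blast
          then show ?thesis using I unfolding through_end_def by blast
        next
          assume "e = 2"
          then have "N j x \<bullet> (p l - P x) = 0 \<or> N j x \<bullet> (q l - P x) = 0"
            using 2(2) unfolding \<alpha>_def f_def pts_def by simp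
          then have "p l \<in> ?L x \<or> q l \<in> ?L x"
            using on[OF lj Fz[unfolded F_def] NjV Np] on[OF lj Fz[unfolded F_def] NjV Nq] by blast
          then show ?thesis using I unfolding through_end_def by blast
        qed
      qed
    qed
    have "covering I p q ?T ?xs"
      unfolding covering_def
    proof (intro conjI ballI)
      show "pieces_of I p q ?xs"
        unfolding pieces_of_def
      proof
        fix y assume "y \<in> set ?xs"
        then obtain x where y: "y = (?L ` S x, 2)" by auto
        have "?L ` S x \<subseteq> ?T" using LT SZ unfolding Z_def by blast
        moreover have "path_connectedin line_topology (?L ` S x)"
        proof (rule path_connectedin_lines[OF Spc])
          show "continuous_on (S x) P" unfolding P_def by (intro continuous_intros)
          show "continuous_on (S x) V" unfolding V_def NAB by (intro continuous_on_cross continuous_intros)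
        qed (rule V0)
        ultimately show "fst y \<subseteq> ?T \<and> path_connectedin line_topology (fst y) \<and> 1 \<le> snd y" unfolding y by simp
      qed
      fix L assume L: "L \<in> ?T"
      then obtain s where s: "0 \<le> s" "s \<le> 1" "L = ?L s" using param by blast
      then have "s \<in> Z" using LT L by simp
      then obtain x where x: "x \<in> X" "x \<le> s" "{x..s} \<subseteq> Z" using X(4) by blast
      have "s \<in> S x" "x \<in> S x" using x bspec[OF X(3) x(1)] unfolding S_def by auto
      then show "\<exists>y\<in>set ?xs. L \<in> fst y \<and> (4 \<le> snd y \<or> 2 \<le> snd y \<and> (\<exists>L'\<in>fst y. \<exists>i\<in>I. through_end p q i L'))"
        using ends[OF x(1)] x(1) xl(1) s(3)
        by (intro bexI[of _ "(?L ` S x, 2)"] conjI disjI2 bexI[of _ "?L x"]) auto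
    qed
    then show ?thesis by (intro exI[of _ ?xs]) (use lenx in \<open>simp add: o_def sum_list_triv\<close>)
  qed
qed

lemma capped_skew:
  assumes "I = {i, j, k, l}" "skew p q i j" "skew p q i k" "skew p q j k" "skew p q i l" "skew p q j l"
  shows "capped I p q"
  using covering_skew[OF assms] by (elim exE conjE) (rule covering_capped)

lemma skew_sym: "skew p q i j \<longleftrightarrow> skew p q j i"
proof -
  have "(q i - p i) \<bullet> ((q j - p j) \<times> (p j - p i)) = (q j - p j) \<bullet> ((q i - p i) \<times> (p i - p j))"
    by (simp add: cross3_def inner_vec_def sum_3 algebra_simps)
  then show ?thesis unfolding skew_def by simp
qed

section \<open>Segments on common lines, and the case distinction for four segments\<close>

definition seg_line :: "(nat \<Rightarrow> real^3) \<Rightarrow> (nat \<Rightarrow> real^3) \<Rightarrow> nat \<Rightarrow> (real^3) set" where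
  "seg_line p q i = line_through (p i) (q i - p i)"

lemma seg_line_ends: "p i \<in> seg_line p q i" "q i \<in> seg_line p q i"
proof -
  show "p i \<in> seg_line p q i" unfolding seg_line_def by (rule line_through_base)
  show "q i \<in> seg_line p q i" unfolding seg_line_def mem_line_through by (intro exI[of _ 1]) simp
qed

lemma seg_line_in_lines: "p i \<noteq> q i \<Longrightarrow> seg_line p q i \<in> lines"
  unfolding seg_line_def by (intro line_through_in_lines) simp

lemma segment_subset_line:
  assumes "L \<in> lines" "a \<in> L" "b \<in> L" "x \<in> closed_segment a b"
  shows "x \<in> L"
proof (cases "a = b")
  case False
  obtain u where u: "x = (1 - u) *\<^sub>R a + u *\<^sub>R b" using assms(4) unfolding closed_segment_def by auto
  have "x = a + u *\<^sub>R (b - a)" unfolding u by (simp add: algebra_simps)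
  then show ?thesis using line_two_points[OF assms(1-3) False] mem_line_through by blast
qed (use assms in simp)

lemma not_skew_if_common_line:
  assumes L: "L \<in> lines" "p x \<in> L" "q x \<in> L" "p y \<in> L" "q y \<in> L"
  shows "\<not> skew p q x y"
proof -
  obtain a v where Lv: "L = line_through a v" using L(1) unfolding lines_def by blast
  obtain s1 s2 s3 s4 where s: "p x = a + s1 *\<^sub>R v" "q x = a + s2 *\<^sub>R v" "p y = a + s3 *\<^sub>R v" "q y = a + s4 *\<^sub>R v"
    using L(2-5) unfolding Lv mem_line_through by blast
  have "q x - p x = (s2 - s1) *\<^sub>R v" "q y - p y = (s4 - s3) *\<^sub>R v" "p y - p x = (s3 - s1) *\<^sub>R v"
    unfolding s by (simp_all add: algebra_simps)
  then show ?thesis unfolding skew_def by (simp add: cross_mult_left cross_mult_right)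
qed

lemma seg_line_eqI:
  assumes "L \<in> lines" "p i \<in> L" "q i \<in> L" "p i \<noteq> q i"
  shows "L = seg_line p q i"
  using line_two_points[OF assms] unfolding seg_line_def .

text \<open>The common normal is \<open>?u \<times> ?v\<close>, or \<open>?u \<times> ?d\<close> if
  the segments are parallel; \<open>nm\<close> keeps the latter from vanishing.\<close>

lemma coplanar_cases:
  assumes ns: "\<not> skew p q i j" and pi: "p i \<noteq> q i" and nm: "\<not> (p j \<in> seg_line p q i \<and> q j \<in> seg_line p q i)"
  obtains n where "n \<noteq> 0" "n \<bullet> (q i - p i) = 0" "n \<bullet> (p j - p i) = 0" "n \<bullet> (q j - p i) = 0"
proof -
  note main = that
  let ?u = "q i - p i" and ?v = "q j - p j" and ?d = "p j - p i"
  have det: "?u \<bullet> (?v \<times> ?d) = 0" using ns unfolding skew_def by simp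
  have fin: thesis if n: "n \<noteq> 0" "n \<bullet> ?u = 0" "n \<bullet> ?d = 0" "n \<bullet> ?v = 0" for n
  proof -
    have "n \<bullet> (q j - p i) = n \<bullet> ?v + n \<bullet> ?d" by (simp add: inner_diff_right)
    then show thesis using main[of n] n by simp
  qed
  show thesis
  proof (cases "?u \<times> ?v = 0")
    case False
    have "(?u \<times> ?v) \<bullet> ?d = ?u \<bullet> (?v \<times> ?d)"
      by (simp add: cross3_def inner_vec_def sum_3 algebra_simps)
    then show thesis using fin[OF False] det by (simp add: dot_cross_self)
  next
    case True
    then have "collinear {0, ?u, ?v}" by (simp add: cross_eq_0)
    then obtain c where c: "?v = c *\<^sub>R ?u" using pi unfolding collinear_lemma by (metis eq_iff_diff_eq_0 scaleR_zero_left)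
    have "?u \<times> ?d \<noteq> 0"
    proof
      assume "?u \<times> ?d = 0"
      then have "collinear {0, ?u, ?d}" by (simp add: cross_eq_0)
      then obtain e where e: "?d = e *\<^sub>R ?u" using pi unfolding collinear_lemma by (metis eq_iff_diff_eq_0 scaleR_zero_left)
      have "p j = p i + e *\<^sub>R ?u" using e by (metis add_diff_cancel_left' diff_add_cancel add.commute)
      moreover have "q j = p i + (e + c) *\<^sub>R ?u"
        using c calculation by (simp add: scaleR_left_distrib algebra_simps)
      ultimately show False using nm unfolding seg_line_def mem_line_through by blast
    qed
    then show thesis using fin[of "?u \<times> ?d"] unfolding c by (simp add: dot_cross_self)
  qed
qed

lemma skew_seg_lines_disjoint:
  assumes "skew p q i j"
  shows "seg_line p q i \<inter> seg_line p q j = {}"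
proof (rule ccontr)
  assume "seg_line p q i \<inter> seg_line p q j \<noteq> {}"
  then obtain x where x: "x \<in> seg_line p q i" "x \<in> seg_line p q j" by blast
  obtain s where s: "x = p i + s *\<^sub>R (q i - p i)" using x(1) unfolding seg_line_def mem_line_through by blast
  obtain t where t: "x = p j + t *\<^sub>R (q j - p j)" using x(2) unfolding seg_line_def mem_line_through by blast
  have "p j - p i = s *\<^sub>R (q i - p i) - t *\<^sub>R (q j - p j)" using s t by (simp add: algebra_simps)
  moreover have "a \<bullet> (b \<times> (s *\<^sub>R a - t *\<^sub>R b)) = 0" for a b :: "real^3"
    by (simp add: Cross3.right_diff_distrib cross_mult_right inner_diff_right dot_cross_self)
  ultimately have "(q i - p i) \<bullet> ((q j - p j) \<times> (p j - p i)) = 0" by simp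
  then show False using assms unfolding skew_def by simp
qed

text \<open>A transversal other than \<open>m\<close> meets \<open>m\<close> in one point only, and
  this point is common to all segments. If there are common points, they form a convex set, every
  direction is allowed at each of them, and \<open>m\<close> belongs to the same family: one piece
  suffices.\<close>

lemma capped_one_line:
  assumes I: "finite I" "I \<noteq> {}" and m: "m \<in> lines" "\<And>x. x \<in> I \<Longrightarrow> p x \<in> m \<and> q x \<in> m"
  shows "capped I p q"
proof -
  let ?T = "transversals I p q"
  define C where "C = (\<Inter>x\<in>I. closed_segment (p x) (q x))"
  have meet: "c \<in> C" if L: "L \<in> ?T" "L \<noteq> m" "c \<in> L" "x \<in> I" "c \<in> closed_segment (p x) (q x)" for L c x
  proof -
    have "c \<in> closed_segment (p y) (q y)" if y: "y \<in> I" for y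
    proof -
      obtain d where d: "d \<in> L" "d \<in> closed_segment (p y) (q y)" using L y unfolding transversals_def by blast
      have "c \<in> m" "d \<in> m" using segment_subset_line m L d y by blast+
      moreover have "L \<in> lines" using L unfolding transversals_def by blast
      ultimately have "c = d" using lines_eq_if_two_points[of L m c d] L d m by blast
      then show ?thesis using d by simp
    qed
    then show ?thesis unfolding C_def by blast
  qed
  obtain x0 where x0: "x0 \<in> I" using I by blast
  show ?thesis
  proof (cases "C = {}")
    case True
    have "L = m" if L: "L \<in> ?T" for L
    proof (rule ccontr)
      assume "L \<noteq> m"
      obtain c where "c \<in> L" "c \<in> closed_segment (p x0) (q x0)" using L x0 unfolding transversals_def by blast
      then show False using meet[OF L \<open>L \<noteq> m\<close> _ x0] True by blast
    qed
    then have le: "L = L'" if "L \<in> ?T" "L' \<in> ?T" for L L' using that by blast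
    obtain xs where "covering I p q ?T xs" "(\<Sum>x\<leftarrow>xs. snd x) \<le> 4"
      by (rule covering_le_one[OF subset_refl le])
    then show ?thesis using covering_capped by simp
  next
    case False
    then obtain c0 where c0: "c0 \<in> C" by blast
    have c0m: "c0 \<in> m" using c0 x0 segment_subset_line m unfolding C_def by blast
    have "?T = (\<lambda>z. line_through (fst z) (snd z)) ` (Sigma C (\<lambda>_. - {0}))"
    proof (intro equalityI subsetI)
      fix L assume L: "L \<in> ?T"
      then have Ll: "L \<in> lines" unfolding transversals_def by blast
      obtain c where c: "c \<in> L" "c \<in> C"
      proof (cases "L = m")
        case True then show ?thesis using that c0 c0m by blast
      next
        case False
        obtain c where "c \<in> L" "c \<in> closed_segment (p x0) (q x0)" using L x0 unfolding transversals_def by blast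
        then show ?thesis using meet[OF L False _ x0] that by blast
      qed
      obtain v where "v \<noteq> 0" "L = line_through c v" by (rule lines_point_direction[OF Ll c(1)])
      then show "L \<in> (\<lambda>z. line_through (fst z) (snd z)) ` (Sigma C (\<lambda>_. - {0}))"
        using c(2) by (intro image_eqI[of _ _ "(c, v)"]) auto
    next
      fix L assume "L \<in> (\<lambda>z. line_through (fst z) (snd z)) ` (Sigma C (\<lambda>_. - {0}))"
      then obtain z where z: "z \<in> Sigma C (\<lambda>_. - {0})" "L = line_through (fst z) (snd z)" by (rule imageE)
      define c v where "c = fst z" and "v = snd z"
      have "c \<in> C" "v \<noteq> 0" "L = line_through c v" using z unfolding c_def v_def by auto
      then show "L \<in> ?T" using line_through_in_lines line_through_base[of c v] unfolding transversals_def C_def by blast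
    qed
    moreover have "path_connectedin line_topology ((\<lambda>z. line_through (fst z) (snd z)) ` (Sigma C (\<lambda>_. - {0})))"
    proof (rule path_connectedin_lines)
      have "convex C" unfolding C_def by (intro convex_INT) simp
      then have "path_connected C" by (rule convex_imp_path_connected)
      then show "path_connected (Sigma C (\<lambda>_. - {0::real^3}))"
        by (intro path_connected_Times path_connected_punctured_universe) simp_all
    qed (auto intro!: continuous_intros)
    ultimately have "path_connectedin line_topology ?T" by simp
    then have "covering I p q ?T [(?T, 4)]" by (intro covering_single) simp_all
    then show ?thesis by (rule covering_capped) simp
  qed
qed

text \<open>Since \<open>m\<close> and \<open>m'\<close> are disjoint, neither is a transversal. A
  transversal is therefore given by its points on the two lines, which range independently over two
  convex sets.\<close>

lemma capped_two_lines:
  assumes I: "I = A \<union> B" "A \<noteq> {}" "B \<noteq> {}"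
    and m: "m \<in> lines" "\<And>x. x \<in> A \<Longrightarrow> p x \<in> m \<and> q x \<in> m"
    and m': "m' \<in> lines" "\<And>x. x \<in> B \<Longrightarrow> p x \<in> m' \<and> q x \<in> m'" and disj: "m \<inter> m' = {}"
  shows "capped I p q"
proof -
  let ?T = "transversals I p q"
  let ?C = "\<lambda>A. \<Inter>x\<in>A. closed_segment (p x) (q x)"
  have meet: "\<exists>c. c \<in> L \<and> c \<in> ?C A \<and> c \<in> m"
    if L: "L \<in> ?T" "L \<noteq> m" and A: "A \<subseteq> I" "A \<noteq> {}" and m: "m \<in> lines" "\<And>x. x \<in> A \<Longrightarrow> p x \<in> m \<and> q x \<in> m" for L A m
  proof -
    obtain x where x: "x \<in> A" using A by blast
    obtain c where c: "c \<in> L" "c \<in> closed_segment (p x) (q x)" using L x A unfolding transversals_def by blast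
    have cm: "c \<in> m" using segment_subset_line m c x by blast
    have "c \<in> closed_segment (p y) (q y)" if y: "y \<in> A" for y
    proof -
      obtain d where d: "d \<in> L" "d \<in> closed_segment (p y) (q y)" using L y A unfolding transversals_def by blast
      have "d \<in> m" using segment_subset_line m d y by blast
      moreover have "L \<in> lines" using L unfolding transversals_def by blast
      ultimately have "c = d" using lines_eq_if_two_points[of L m c d] L d m c cm by blast
      then show ?thesis using d by simp
    qed
    then show ?thesis using c cm by blast
  qed
  have on: "c \<in> m" if c: "c \<in> ?C A" and A: "A \<noteq> {}" and m: "m \<in> lines" "\<And>x. x \<in> A \<Longrightarrow> p x \<in> m \<and> q x \<in> m" for c A m
  proof -
    obtain x where x: "x \<in> A" using A by blast
    have "c \<in> closed_segment (p x) (q x)" using c x by simp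
    then show ?thesis by (rule segment_subset_line[OF m(1) conjunct1[OF m(2)[OF x]] conjunct2[OF m(2)[OF x]]])
  qed
  have ends: "L \<inter> m \<noteq> {} \<and> L \<inter> m' \<noteq> {}" if L: "L \<in> ?T" for L
  proof -
    obtain x y where xy: "x \<in> A" "y \<in> B" using I by blast
    obtain c where "c \<in> L" "c \<in> closed_segment (p x) (q x)" using L xy I unfolding transversals_def by blast
    moreover obtain d where "d \<in> L" "d \<in> closed_segment (p y) (q y)" using L xy I unfolding transversals_def by blast
    ultimately show ?thesis using segment_subset_line m m' xy by blast
  qed
  have "?T = (\<lambda>z. line_through (fst z) (snd z - fst z)) ` (Sigma (?C A) (\<lambda>_. ?C B))"
  proof (intro equalityI subsetI)
    fix L assume L: "L \<in> ?T"
    then have Ll: "L \<in> lines" unfolding transversals_def by blast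
    have "L \<noteq> m" "L \<noteq> m'" using ends[OF L] disj by blast+
    then obtain c d where c: "c \<in> L" "c \<in> ?C A" "c \<in> m" and d: "d \<in> L" "d \<in> ?C B" "d \<in> m'"
      using meet[OF L _ _ I(2) m] meet[OF L _ _ I(3) m'] I(1) by blast
    have "c \<noteq> d" using c d disj by blast
    then have "L = line_through c (d - c)" by (rule line_two_points[OF Ll c(1) d(1)])
    then show "L \<in> (\<lambda>z. line_through (fst z) (snd z - fst z)) ` (Sigma (?C A) (\<lambda>_. ?C B))"
      using c(2) d(2) by (intro image_eqI[of _ _ "(c, d)"]) simp_all
  next
    fix L assume "L \<in> (\<lambda>z. line_through (fst z) (snd z - fst z)) ` (Sigma (?C A) (\<lambda>_. ?C B))"
    then obtain z where z: "z \<in> Sigma (?C A) (\<lambda>_. ?C B)" "L = line_through (fst z) (snd z - fst z)" by (rule imageE)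
    define c d where "c = fst z" and "d = snd z"
    have cd: "c \<in> ?C A" "d \<in> ?C B" "L = line_through c (d - c)" using z unfolding c_def d_def by auto
    have "c \<in> m" "d \<in> m'" by (rule on[OF cd(1) I(2) m], assumption, rule on[OF cd(2) I(3) m'], assumption)
    then have "d - c \<noteq> 0" using disj by auto
    then have "L \<in> lines" using cd line_through_in_lines by blast
    moreover have "c \<in> L" unfolding cd by (rule line_through_base)
    moreover have "d \<in> L" unfolding cd mem_line_through by (intro exI[of _ 1]) simp
    ultimately show "L \<in> ?T" using cd(1,2) I(1) unfolding transversals_def by blast
  qed
  moreover have "path_connectedin line_topology ((\<lambda>z. line_through (fst z) (snd z - fst z)) ` (Sigma (?C A) (\<lambda>_. ?C B)))"
  proof (rule path_connectedin_lines)
    have "convex (?C A)" "convex (?C B)" by (intro convex_INT; simp)+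
    then show "path_connected (Sigma (?C A) (\<lambda>_. ?C B))"
      by (intro path_connected_Times convex_imp_path_connected)
    fix z assume "z \<in> Sigma (?C A) (\<lambda>_. ?C B)"
    then have z: "fst z \<in> ?C A" "snd z \<in> ?C B" by (auto simp: mem_Sigma_iff)
    have "fst z \<in> m" "snd z \<in> m'"
      by (rule on[OF z(1) I(2) m], assumption, rule on[OF z(2) I(3) m'], assumption)
    then show "snd z - fst z \<noteq> 0" using disj by auto
  qed (auto intro!: continuous_intros)
  ultimately have "path_connectedin line_topology ?T" by simp
  then have "covering I p q ?T [(?T, 4)]" by (intro covering_single) simp_all
  then show ?thesis by (rule covering_capped) simp
qed

theorem capped_four_segments:
  assumes I: "card I = 4" and ne: "\<And>x. x \<in> I \<Longrightarrow> p x \<noteq> q x"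
  shows "capped I p q"
proof -
  let ?l = "seg_line p q"
  let ?same = "\<lambda>x y. p y \<in> ?l x \<and> q y \<in> ?l x"
  have fin: "finite I" "I \<noteq> {}" using I by (auto intro: card_ge_0_finite)
  consider x y where "x \<in> I" "y \<in> I" "x \<noteq> y" "\<not> skew p q x y" "\<not> ?same x y"
    | x y z where "x \<in> I" "y \<in> I" "z \<in> I" "x \<noteq> y" "x \<noteq> z" "y \<noteq> z" "skew p q x y" "skew p q x z" "skew p q y z"
       "\<And>x y. x \<in> I \<Longrightarrow> y \<in> I \<Longrightarrow> x \<noteq> y \<Longrightarrow> skew p q x y \<or> ?same x y"
    | "\<And>x y z. x \<in> I \<Longrightarrow> y \<in> I \<Longrightarrow> z \<in> I \<Longrightarrow> x \<noteq> y \<Longrightarrow> x \<noteq> z \<Longrightarrow> y \<noteq> z \<Longrightarrow> skew p q x y \<Longrightarrow> skew p q x z \<Longrightarrow> \<not> skew p q y z"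
       "\<And>x y. x \<in> I \<Longrightarrow> y \<in> I \<Longrightarrow> x \<noteq> y \<Longrightarrow> skew p q x y \<or> ?same x y"
    by blast
  then show ?thesis
  proof cases
    case (1 x y)
    have "card (I - {x, y}) = 2" using I 1 fin by (simp add: card_Diff_subset)
    then obtain k l where "I - {x, y} = {k, l}" by (auto simp: card_2_iff)
    then have I': "I = {x, y, k, l}" using 1 by blast
    obtain n where n: "n \<noteq> 0" "n \<bullet> (q x - p x) = 0" "n \<bullet> (p y - p x) = 0" "n \<bullet> (q y - p x) = 0"
      by (rule coplanar_cases[OF 1(4) ne[OF 1(1)] 1(5)])
    show ?thesis
    proof (rule capped_coplanar[OF I' ne n(1) _ n(2) n(3) n(4)])
      fix L assume L: "L \<in> lines" "p x \<in> L" "q x \<in> L" "p y \<in> L" "q y \<in> L"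
      then have "L = ?l x" using ne[OF 1(1)] by (intro seg_line_eqI)
      then show False using 1(5) L by blast
    qed simp_all
  next
    case (2 x y z)
    have "card (I - {x, y, z}) = 1" using I 2 fin by (simp add: card_Diff_subset)
    then obtain w where w: "I - {x, y, z} = {w}" by (auto simp: card_1_singleton_iff)
    have w': "w \<in> I" "w \<noteq> x" "w \<noteq> y" "w \<noteq> z" using w by blast+
    have I': "I = {x, y, z, w}" "I = {x, z, y, w}" "I = {y, z, x, w}" using w 2(1-3) by blast+
    \<comment> \<open>The fourth segment may lie on the line of one of the three, but not on the
      lines of two skew ones. Hence it is skew to two of the three, and these take the roles of
      \<open>i\<close> and \<open>j\<close> in \<open>capped_skew\<close>.\<close>
    have one: "skew p q a w \<or> skew p q b w" if "skew p q a b" "a \<in> I" "b \<in> I" "a \<noteq> w" "b \<noteq> w" for a b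
    proof (rule ccontr)
      assume "\<not> ?thesis"
      then have "\<not> skew p q w a" "\<not> skew p q w b" using skew_sym by blast+
      then have "?same w a" "?same w b" using 2(10) that w' by metis+
      then show False using not_skew_if_common_line[OF seg_line_in_lines[of p w q, OF ne[OF w'(1)]]] that by blast
    qed
    have o: "skew p q x w \<or> skew p q y w" "skew p q x w \<or> skew p q z w" "skew p q y w \<or> skew p q z w"
      using one 2 w' by metis+
    then consider "skew p q x w" "skew p q y w" | "skew p q x w" "skew p q z w" | "skew p q y w" "skew p q z w" by blast
    then show ?thesis
    proof cases
      case 1 then show ?thesis using capped_skew[OF I'(1)] 2 by blast
    next
      case c: 2 then show ?thesis using capped_skew[OF I'(2)] 2 skew_sym by blast
    next
      case 3 then show ?thesis using capped_skew[OF I'(3)] 2 skew_sym by blast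
    qed
  next
    case 3
    obtain i where i: "i \<in> I" using fin by blast
    \<comment> \<open>Segments outside \<open>A\<close> are skew to \<open>i\<close>, so no two of
      them are skew to each other. They share one line, which is disjoint from the line of
      \<open>i\<close>.\<close>
    define A where "A = {x \<in> I. ?same i x}"
    have iA: "i \<in> A" using i seg_line_ends unfolding A_def by blast
    show ?thesis
    proof (cases "A = I")
      case True
      show ?thesis
        by (rule capped_one_line[OF fin seg_line_in_lines[of p i q, OF ne[OF i]]]) (use True in \<open>auto simp: A_def\<close>)
    next
      case False
      then obtain y where y: "y \<in> I" "y \<notin> A" unfolding A_def by blast
      have off: "skew p q i z" if "z \<in> I" "z \<notin> A" for z
        using 3(2)[OF i that(1)] that iA unfolding A_def by blast
      have B: "?same y z" if z: "z \<in> I - A" for z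
      proof (cases "z = y")
        case True then show ?thesis using seg_line_ends by simp
      next
        case False
        have "\<not> skew p q y z" using 3(1)[of i y z] i y z off iA False by blast
        then show ?thesis using 3(2)[of y z] y z False by blast
      qed
      show ?thesis
      proof (rule capped_two_lines[of I A "I - A" "?l i" p q "?l y"])
        show "?l i \<inter> ?l y = {}" using skew_seg_lines_disjoint off[OF y] by blast
      qed (use iA y B seg_line_in_lines ne i in \<open>auto simp: A_def\<close>)
    qed
  qed
qed

section \<open>Common tangents of four triangles\<close>

definition nxt :: "nat \<Rightarrow> nat" where "nxt k = (k + 1) mod 3"

lemma nxt_simps [simp]: "nxt 0 = 1" "nxt (Suc 0) = 2" "nxt 2 = 0"
  unfolding nxt_def by simp_all

lemma less_3_cases: "k < 3 \<Longrightarrow> k = 0 \<or> k = 1 \<or> k = (2::nat)"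
  by auto

lemma nxt_less: "nxt k < 3"
  unfolding nxt_def by simp

lemma nxt_neq: "k < 3 \<Longrightarrow> nxt k \<noteq> k"
  by (drule less_3_cases) auto

lemma nxt_nxt: "k < 3 \<Longrightarrow> nxt (nxt (nxt k)) = k \<and> nxt (nxt k) \<noteq> k"
  by (drule less_3_cases) auto

lemma four_indices:
  assumes "i \<in> {1..4}" "j \<in> {1..4}" "i \<noteq> j"
  obtains k l :: nat where "{1..4} = {i, j, k, l}" "distinct [i, j, k, l]"
proof -
  have "i \<in> {1, 2, 3, 4}" "j \<in> {1, 2, 3, 4}" "{1..4} = {1, 2, 3, 4::nat}" using assms by auto
  then show ?thesis
    using assms(3) that[of 1 2] that[of 1 3] that[of 1 4] that[of 2 3] that[of 2 4] that[of 3 4]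
    by (auto simp: insert_commute)
qed

definition choices :: "(nat \<Rightarrow> nat) set" where
  "choices = {1..4} \<rightarrow>\<^sub>E {..<3}"

locale four_triangles =
  fixes t :: "nat \<Rightarrow> (real^3) set" and V :: "nat \<Rightarrow> nat \<Rightarrow> real^3"
  assumes t_hull: "\<And>i. i \<in> {1..4} \<Longrightarrow> t i = convex hull {V i 0, V i 1, V i 2}"
    and nocol: "\<And>i. i \<in> {1..4} \<Longrightarrow> \<not> collinear {V i 0, V i 1, V i 2}"
begin

definition edge :: "nat \<Rightarrow> nat \<Rightarrow> (real^3) set" where
  "edge i k = closed_segment (V i k) (V i (nxt k))"

abbreviation edge_lines :: "(nat \<Rightarrow> nat) \<Rightarrow> (real^3) set set" where
  "edge_lines e \<equiv> transversals {1..4} (\<lambda>i. V i (e i)) (\<lambda>i. V i (nxt (e i)))"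

definition met_edges :: "(real^3) set \<Rightarrow> nat \<Rightarrow> nat set" where
  "met_edges L i = {k. k < 3 \<and> L \<inter> edge i k \<noteq> {}}"

text \<open>A product set, so that meeting a further edge of one triangle at least doubles the
  number of realised choices.\<close>

definition choices_of :: "(real^3) set \<Rightarrow> (nat \<Rightarrow> nat) set" where
  "choices_of L = (\<Pi>\<^sub>E i\<in>{1..4}. met_edges L i)"

abbreviation tangents :: "(real^3) set set" where
  "tangents \<equiv> common_tangents {1..4} t"

lemma finite_choices: "finite choices"
  unfolding choices_def by (intro finite_PiE) auto

lemma card_choices: "card choices = 81"
  unfolding choices_def by (simp add: card_PiE)

lemma V_distinct:
  assumes "i \<in> {1..4}" "k < 3" "k' < 3" "k \<noteq> k'"
  shows "V i k \<noteq> V i k'"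
  using nocol[OF assms(1)] less_3_cases[OF assms(2)] less_3_cases[OF assms(3)] assms(4)
  by (auto simp: insert_commute collinear_2)

lemma edge_ends_neq: "i \<in> {1..4} \<Longrightarrow> k < 3 \<Longrightarrow> V i k \<noteq> V i (nxt k)"
  using V_distinct nxt_less nxt_neq by metis

lemma edges_eq:
  assumes "i \<in> {1..4}"
  shows "triangle_edges (t i) = {edge i k | k. k < 3}"
proof -
  have "{edge i k | k. k < 3} = {edge i 0, edge i 1, edge i 2}"
    using less_3_cases by force
  then show ?thesis
    unfolding t_hull[OF assms] triangle_edges_convex_hull[OF nocol[OF assms]] edge_def by simp
qed

lemma tangents_iff: "L \<in> tangents \<longleftrightarrow> L \<in> lines \<and> (\<forall>i\<in>{1..4}. met_edges L i \<noteq> {})"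
proof -
  have "tangent_to L (t i) \<longleftrightarrow> met_edges L i \<noteq> {}" if "i \<in> {1..4}" for i
    unfolding tangent_to_def met_edges_def edges_eq[OF that] by auto
  then show ?thesis unfolding common_tangents_def by auto
qed

lemma choices_of_subset: "choices_of L \<subseteq> choices"
  unfolding choices_of_def choices_def met_edges_def by (intro PiE_mono) auto

lemma choices_of_iff:
  assumes "L \<in> lines" "e \<in> choices"
  shows "e \<in> choices_of L \<longleftrightarrow> L \<in> edge_lines e"
  using assms unfolding choices_of_def choices_def transversals_def met_edges_def edge_def
  by (auto simp: PiE_iff)

lemma choices_of_nonempty: "L \<in> tangents \<Longrightarrow> choices_of L \<noteq> {}"
  unfolding tangents_iff choices_of_def by (simp add: PiE_eq_empty_iff)

lemma edge_lines_subset: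
  assumes "e \<in> choices"
  shows "edge_lines e \<subseteq> tangents"
proof
  fix L assume L: "L \<in> edge_lines e"
  then have "L \<in> lines" unfolding transversals_def by simp
  then have "e \<in> choices_of L" using choices_of_iff assms L by simp
  then have "\<forall>i\<in>{1..4}. e i \<in> met_edges L i" unfolding choices_of_def by (auto simp: PiE_iff)
  then show "L \<in> tangents" unfolding tangents_iff using \<open>L \<in> lines\<close> by auto
qed

lemma choices_of_update:
  assumes "e \<in> choices_of L" "i \<in> {1..4}" "k \<in> met_edges L i"
  shows "e(i := k) \<in> choices_of L"
  using assms unfolding choices_of_def by (auto simp: PiE_iff extensional_def)

lemma vertex_other_edge:
  assumes "i \<in> {1..4}" "k < 3" and v: "V i k \<in> L \<or> V i (nxt k) \<in> L"
  obtains k' where "k' < 3" "k' \<noteq> k" "k' \<in> met_edges L i"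
proof -
  show ?thesis
    using v
  proof
    assume "V i k \<in> L"
    then show ?thesis using that[of "nxt (nxt k)"] nxt_less nxt_nxt[OF assms(2)]
      unfolding met_edges_def edge_def by auto
  next
    assume "V i (nxt k) \<in> L"
    then show ?thesis using that[of "nxt k"] nxt_less nxt_neq[OF assms(2)] unfolding met_edges_def edge_def by auto
  qed
qed

lemma through_end_update:
  assumes "e \<in> choices_of L" "i \<in> {1..4}" "through_end (\<lambda>i. V i (e i)) (\<lambda>i. V i (nxt (e i))) i L"
  obtains k where "k \<noteq> e i" "k \<in> met_edges L i"
proof -
  have "e i < 3" using assms(1,2) choices_of_subset[of L] unfolding choices_def by (auto simp: PiE_iff subset_iff)
  then obtain k' where "k' < 3" "k' \<noteq> e i" "k' \<in> met_edges L i"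
    using vertex_other_edge[OF assms(2)] assms(3) unfolding through_end_def by metis
  then show ?thesis using that by simp
qed

text \<open>What the choice \<open>e\<close> contributes to the weight of the component
  \<open>K\<close>. The sum runs over positions, so that repeated entries of a list count
  separately.\<close>

definition load :: "((nat \<Rightarrow> nat) \<Rightarrow> ((real^3) set set \<times> nat) list) \<Rightarrow> (real^3) set set \<Rightarrow> (nat \<Rightarrow> nat) \<Rightarrow> nat" where
  "load xs K e = (\<Sum>n | n < length (xs e) \<and> fst (xs e ! n) \<noteq> {} \<and> fst (xs e ! n) \<subseteq> K. snd (xs e ! n))"

abbreviation components :: "(real^3) set set set" where
  "components \<equiv> path_components_of (subtopology line_topology tangents)"

lemma component_mem_tangents: "K \<in> components \<Longrightarrow> L \<in> K \<Longrightarrow> L \<in> tangents"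
  using path_components_of_subset[of K "subtopology line_topology tangents"] by auto

lemma piece_in_component:
  assumes K: "K \<in> components" and e: "e \<in> choices" and xs: "pieces_of {1..4} (\<lambda>i. V i (e i)) (\<lambda>i. V i (nxt (e i))) ys"
    and x: "x \<in> set ys" "L \<in> fst x" "L \<in> K"
  shows "fst x \<subseteq> K"
proof (rule path_component_superset[OF K _ _ x(2,3)])
  have "fst x \<subseteq> edge_lines e" "path_connectedin line_topology (fst x)"
    using bspec[OF xs[unfolded pieces_of_def] x(1)] by simp_all
  then show "path_connectedin line_topology (fst x)" "fst x \<subseteq> tangents"
    using edge_lines_subset[OF e] by (simp_all add: subset_trans)
qed

lemma weight_le_load:
  assumes K: "K \<in> components" and e: "e \<in> choices"
    and xs: "pieces_of {1..4} (\<lambda>i. V i (e i)) (\<lambda>i. V i (nxt (e i))) (xs e)" and L: "L \<in> K"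
  shows "weight_at (xs e) L \<le> load xs K e"
proof -
  have "weight_at (xs e) L = (\<Sum>n<length (xs e). if L \<in> fst (xs e ! n) then snd (xs e ! n) else 0)"
    unfolding weight_at_def by (simp add: sum_list_sum_nth atLeast0LessThan)
  also have "\<dots> = (\<Sum>n | n \<in> {..<length (xs e)} \<and> L \<in> fst (xs e ! n). snd (xs e ! n))"
    by (rule sum.inter_filter[symmetric]) simp
  also have "\<dots> \<le> load xs K e"
    unfolding load_def
  proof (rule sum_mono2)
    show "{n. n \<in> {..<length (xs e)} \<and> L \<in> fst (xs e ! n)} \<subseteq>
        {n. n < length (xs e) \<and> fst (xs e ! n) \<noteq> {} \<and> fst (xs e ! n) \<subseteq> K}"
    proof
      fix n assume "n \<in> {n. n \<in> {..<length (xs e)} \<and> L \<in> fst (xs e ! n)}"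
      then have n: "n < length (xs e)" "L \<in> fst (xs e ! n)" by simp_all
      have "fst (xs e ! n) \<subseteq> K" by (rule piece_in_component[OF K e xs nth_mem[OF n(1)] n(2) L])
      then show "n \<in> {n. n < length (xs e) \<and> fst (xs e ! n) \<noteq> {} \<and> fst (xs e ! n) \<subseteq> K}"
        using n by (simp add: ex_in_conv[symmetric] exI[of _ L])
    qed
  qed simp_all
  finally show ?thesis .
qed

lemma load_ge_1:
  assumes K: "K \<in> components" and e: "e \<in> choices_of L"
    and xs: "capped_by {1..4} (\<lambda>i. V i (e i)) (\<lambda>i. V i (nxt (e i))) (xs e)" and L: "L \<in> K"
  shows "1 \<le> load xs K e"
proof -
  have e': "e \<in> choices" using e choices_of_subset by auto
  have "L \<in> lines" using component_mem_tangents[OF K L] unfolding tangents_iff by simp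
  then have "L \<in> edge_lines e" using choices_of_iff e e' by simp
  then obtain x where x: "x \<in> set (xs e)" "L \<in> fst x"
    using xs unfolding capped_by_def by (elim conjE) (drule (1) bspec, elim bexE conjE, rule)
  have p: "pieces_of {1..4} (\<lambda>i. V i (e i)) (\<lambda>i. V i (nxt (e i))) (xs e)" using xs unfolding capped_by_def by simp
  then have "1 \<le> snd x" using x(1) unfolding pieces_of_def by simp
  also have "snd x \<le> weight_at (xs e) L" by (rule weight_at_ge[OF x])
  also have "\<dots> \<le> load xs K e" by (rule weight_le_load[where K = K and e = e and xs = xs, OF K e' p L])
  finally show ?thesis .
qed

lemma sum_ge_subset:
  fixes f :: "'a \<Rightarrow> nat"
  assumes "finite B" "A \<subseteq> B"
  shows "sum f A \<le> sum f B"
  using assms by (intro sum_mono2) auto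

text \<open>Vertices are traded for further choices, all of which lie in \<open>Q\<close> and
  contribute to the same component. A piece of weight 2 with a line through a vertex produces a
  second choice of the same kind; a line through vertices of two triangles produces four choices
  with load at least 1.\<close>

lemma load_total:
  assumes K: "K \<in> components" and Q: "finite Q" "\<And>L. L \<in> K \<Longrightarrow> choices_of L \<subseteq> Q"
    and xs: "\<And>e. e \<in> Q \<Longrightarrow> capped_by {1..4} (\<lambda>i. V i (e i)) (\<lambda>i. V i (nxt (e i))) (xs e)"
  shows "4 \<le> (\<Sum>e\<in>Q. load xs K e)"
proof (rule ccontr)
  assume small: "\<not> ?thesis"
  \<comment> \<open>Under the assumption \<open>small\<close> only the middle alternative of
    \<open>capped_by\<close> survives, as the two others give a total of 4 at once.\<close>
  have step: "2 \<le> load xs K e \<and> (\<exists>L'. L' \<in> K \<and> e \<in> choices_of L' \<and>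
      (\<exists>i\<in>{1..4}. through_end (\<lambda>i. V i (e i)) (\<lambda>i. V i (nxt (e i))) i L'))"
    if L: "L \<in> K" and e: "e \<in> choices_of L" for L e
  proof -
    have eQ: "e \<in> Q" and e': "e \<in> choices" using e Q(2)[OF L] choices_of_subset by auto
    let ?p = "\<lambda>i. V i (e i)" and ?q = "\<lambda>i. V i (nxt (e i))"
    have p: "pieces_of {1..4} ?p ?q (xs e)" using xs[OF eQ] unfolding capped_by_def by simp
    have "L \<in> lines" using component_mem_tangents[OF K L] unfolding tangents_iff by simp
    then have "L \<in> edge_lines e" using choices_of_iff e e' by simp
    then obtain x L' where x: "x \<in> set (xs e)" "L \<in> fst x" "L' \<in> fst x"
      and L': "4 \<le> weight_at (xs e) L' \<or> 2 \<le> weight_at (xs e) L' \<and> (\<exists>i\<in>{1..4}. through_end ?p ?q i L') \<or>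
        (\<exists>i\<in>{1..4}. \<exists>j\<in>{1..4}. i \<noteq> j \<and> through_end ?p ?q i L' \<and> through_end ?p ?q j L')"
      using xs[OF eQ] unfolding capped_by_def by (elim conjE) (drule (1) bspec, elim bexE conjE, rule)
    have K': "L' \<in> K" using piece_in_component[OF K e' p x(1,2) L] x(3) by auto
    have l': "L' \<in> lines" using component_mem_tangents[OF K K'] unfolding tangents_iff by simp
    have "L' \<in> edge_lines e" using p x unfolding pieces_of_def by auto
    then have eL': "e \<in> choices_of L'" using choices_of_iff[OF l' e'] by simp
    have wl: "weight_at (xs e) L' \<le> load xs K e" by (rule weight_le_load[where K = K and e = e and xs = xs, OF K e' p K'])
    have le: "load xs K e \<le> (\<Sum>e\<in>Q. load xs K e)" using Q(1) eQ by (intro member_le_sum) auto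
    consider "4 \<le> weight_at (xs e) L'" | "2 \<le> weight_at (xs e) L'" "\<exists>i\<in>{1..4}. through_end ?p ?q i L'"
      | "\<exists>i\<in>{1..4}. \<exists>j\<in>{1..4}. i \<noteq> j \<and> through_end ?p ?q i L' \<and> through_end ?p ?q j L'"
      using L' by (elim disjE conjE)
    then show ?thesis
    proof cases
      case 1 then show ?thesis using wl le small by simp
    next
      case 2 then show ?thesis using wl K' eL' by (intro conjI exI[of _ L']) simp_all
    next
      case 3
      then obtain i j where ij: "i \<in> {1..4}" "j \<in> {1..4}" "i \<noteq> j" "through_end ?p ?q i L'" "through_end ?p ?q j L'"
        by (elim bexE conjE)
      obtain k where k: "k \<noteq> e i" "k \<in> met_edges L' i" using through_end_update[OF eL' ij(1,4)] .
      obtain m where m: "m \<noteq> e j" "m \<in> met_edges L' j" using through_end_update[OF eL' ij(2,5)] .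
      let ?F = "{e, e(i := k), e(j := m), e(i := k, j := m)}"
      have F: "?F \<subseteq> choices_of L'"
        using eL' choices_of_update ij k m by simp
      have ne: "e(i := k) \<noteq> e" "e(j := m) \<noteq> e" "e(i := k) \<noteq> e(j := m)" "e(i := k, j := m) \<noteq> e"
        "e(i := k, j := m) \<noteq> e(i := k)" "e(i := k, j := m) \<noteq> e(j := m)"
        using ij(3) k m by (auto simp: fun_eq_iff)
      then have "card ?F = 4" by auto
      moreover have "(\<Sum>e\<in>?F. 1) \<le> (\<Sum>e\<in>?F. load xs K e)"
      proof (rule sum_mono)
        fix f assume "f \<in> ?F"
        then have f: "f \<in> choices_of L'" using F by blast
        then have "f \<in> Q" using Q(2)[OF K'] by auto
        then show "1 \<le> load xs K f" using load_ge_1[where K = K and e = f and xs = xs, OF K f xs K'] by simp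
      qed
      moreover have "(\<Sum>e\<in>?F. load xs K e) \<le> (\<Sum>e\<in>Q. load xs K e)"
        by (rule sum_ge_subset[OF Q(1)]) (use F Q(2)[OF K'] in auto)
      ultimately show ?thesis using small by simp
    qed
  qed
  have "K \<noteq> {}" using K nonempty_path_components_of by auto
  then obtain L where L: "L \<in> K" by auto
  then obtain e where e: "e \<in> choices_of L" using choices_of_nonempty component_mem_tangents[OF K] by auto
  obtain L' i where L': "L' \<in> K" "e \<in> choices_of L'" "i \<in> {1..4}"
    "through_end (\<lambda>i. V i (e i)) (\<lambda>i. V i (nxt (e i))) i L'" using step[OF L e] by auto
  obtain k where k: "k \<noteq> e i" "k \<in> met_edges L' i" using through_end_update[OF L'(2-4)] .
  have f: "e(i := k) \<in> choices_of L'" by (rule choices_of_update[OF L'(2,3) k(2)])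
  have ne: "e(i := k) \<noteq> e" using k by (auto simp: fun_eq_iff)
  have "2 + 2 \<le> load xs K e + load xs K (e(i := k))" using step[OF L e] step[OF L'(1) f] by linarith
  also have "\<dots> = (\<Sum>e\<in>{e, e(i := k)}. load xs K e)" using ne by simp
  also have "\<dots> \<le> (\<Sum>e\<in>Q. load xs K e)"
    by (rule sum_ge_subset[OF Q(1)]) (use L'(1,2) f Q(2)[OF L'(1)] in auto)
  finally show False using small by simp
qed

text \<open>Choices outside \<open>Q\<close> are not booked. A component that misses their load has
  to contain one of the additional sets \<open>ys\<close>, each of which is booked with the full
  weight 4.\<close>

lemma components_bound:
  assumes Q: "Q \<subseteq> choices"
    and xs: "\<And>e. e \<in> Q \<Longrightarrow> pieces_of {1..4} (\<lambda>i. V i (e i)) (\<lambda>i. V i (nxt (e i))) (xs e) \<and> (\<Sum>x\<leftarrow>xs e. snd x) \<le> 8"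
    and ys: "\<And>Y. Y \<in> set ys \<Longrightarrow> path_connectedin line_topology Y \<and> Y \<subseteq> tangents"
    and heavy: "\<And>K. K \<in> components \<Longrightarrow> (\<exists>Y\<in>set ys. Y \<noteq> {} \<and> Y \<subseteq> K) \<or> 4 \<le> (\<Sum>e\<in>Q. load xs K e)"
  shows "finite components \<and> 4 * card components \<le> 8 * card Q + 4 * length ys"
proof -
  have fQ: "finite Q" using Q finite_choices by (rule finite_subset)
  define A1 where "A1 = Sigma Q (\<lambda>e. {..<length (xs e)})"
  define A where "A = A1 <+> {..<length ys}"
  define P where "P = case_sum (\<lambda>(e, n). fst (xs e ! n)) (\<lambda>n. ys ! n)"
  define w where "w = case_sum (\<lambda>(e, n). snd (xs e ! n)) (\<lambda>n::nat. 4)"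
  have fA1: "finite A1" unfolding A1_def using fQ by auto
  have fA: "finite A" unfolding A_def using fA1 by auto
  have P: "path_connectedin line_topology (P \<alpha>) \<and> P \<alpha> \<subseteq> tangents" if "\<alpha> \<in> A" for \<alpha>
  proof (cases \<alpha>)
    case (Inl z)
    obtain e n where z: "z = (e, n)" by (cases z)
    have en: "e \<in> Q" "n < length (xs e)" using that unfolding Inl z A_def A1_def by auto
    then have "xs e ! n \<in> set (xs e)" by simp
    then have "fst (xs e ! n) \<subseteq> edge_lines e \<and> path_connectedin line_topology (fst (xs e ! n))"
      using xs[OF en(1)] unfolding pieces_of_def by auto
    then show ?thesis using edge_lines_subset[of e] Q en(1) unfolding Inl z P_def by (auto simp: subset_iff)
  next
    case (Inr n)
    then have "ys ! n \<in> set ys" using that unfolding A_def by auto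
    then show ?thesis using ys unfolding Inr P_def by simp
  qed
  have h: "4 \<le> (\<Sum>\<alpha> | \<alpha> \<in> A \<and> P \<alpha> \<noteq> {} \<and> P \<alpha> \<subseteq> K. w \<alpha>)" if K: "K \<in> components" for K
    using heavy[OF K]
  proof
    assume "\<exists>Y\<in>set ys. Y \<noteq> {} \<and> Y \<subseteq> K"
    then obtain Y where Y: "Y \<in> set ys" "Y \<noteq> {}" "Y \<subseteq> K" by (elim bexE conjE)
    then obtain n where "n < length ys" "ys ! n = Y" by (auto simp: in_set_conv_nth)
    then have n: "n < length ys" "ys ! n \<noteq> {}" "ys ! n \<subseteq> K" using Y by simp_all
    have "(\<Sum>\<alpha>\<in>{Inr n}. w \<alpha>) \<le> (\<Sum>\<alpha> | \<alpha> \<in> A \<and> P \<alpha> \<noteq> {} \<and> P \<alpha> \<subseteq> K. w \<alpha>)"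
      by (rule sum_ge_subset) (use n fA in \<open>auto simp: A_def P_def\<close>)
    then show ?thesis unfolding w_def by simp
  next
    assume a: "4 \<le> (\<Sum>e\<in>Q. load xs K e)"
    have "(\<Sum>e\<in>Q. load xs K e) = (\<Sum>(e, n)\<in>Sigma Q (\<lambda>e. {n. n < length (xs e) \<and> fst (xs e ! n) \<noteq> {} \<and> fst (xs e ! n) \<subseteq> K}). snd (xs e ! n))"
      unfolding load_def using fQ by (intro sum.Sigma) auto
    also have "\<dots> = (\<Sum>\<alpha>\<in>Inl ` Sigma Q (\<lambda>e. {n. n < length (xs e) \<and> fst (xs e ! n) \<noteq> {} \<and> fst (xs e ! n) \<subseteq> K}). w \<alpha>)"
      by (subst sum.reindex) (auto simp: inj_on_def w_def)
    also have "\<dots> \<le> (\<Sum>\<alpha> | \<alpha> \<in> A \<and> P \<alpha> \<noteq> {} \<and> P \<alpha> \<subseteq> K. w \<alpha>)"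
      by (rule sum_ge_subset) (use fA in \<open>auto simp: A_def A1_def P_def\<close>)
    finally show ?thesis using a by simp
  qed
  have "(\<Sum>\<alpha>\<in>A. w \<alpha>) = (\<Sum>\<alpha>\<in>A1. w (Inl \<alpha>)) + (\<Sum>n<length ys. w (Inr n))"
    unfolding A_def using fA1 by (simp add: sum.Plus)
  also have "(\<Sum>\<alpha>\<in>A1. w (Inl \<alpha>)) = (\<Sum>e\<in>Q. \<Sum>n<length (xs e). snd (xs e ! n))"
    unfolding A1_def w_def using fQ by (simp add: sum.Sigma split_def)
  also have "\<dots> = (\<Sum>e\<in>Q. \<Sum>x\<leftarrow>xs e. snd x)"
    by (simp add: sum_list_sum_nth atLeast0LessThan)
  also have "\<dots> \<le> (\<Sum>e\<in>Q. 8)" by (rule sum_mono) (use xs in auto)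
  finally have total: "(\<Sum>\<alpha>\<in>A. w \<alpha>) \<le> 8 * card Q + 4 * length ys" by (simp add: w_def)
  show ?thesis
    using card_path_components_le[OF fA P h] total by simp
qed

lemma capped_choices:
  obtains xs where "\<forall>e\<in>choices. capped_by {1..4} (\<lambda>i. V i (e i)) (\<lambda>i. V i (nxt (e i))) (xs e)"
proof -
  have "\<forall>e\<in>choices. \<exists>xs. capped_by {1..4} (\<lambda>i. V i (e i)) (\<lambda>i. V i (nxt (e i))) xs"
  proof
    fix e assume e: "e \<in> choices"
    have "V i (e i) \<noteq> V i (nxt (e i))" if "i \<in> {1..4}" for i
      using edge_ends_neq[OF that] e that unfolding choices_def by (auto simp: PiE_iff)
    then show "\<exists>xs. capped_by {1..4} (\<lambda>i. V i (e i)) (\<lambda>i. V i (nxt (e i))) xs"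
      using capped_four_segments[of "{1..4}" "\<lambda>i. V i (e i)" "\<lambda>i. V i (nxt (e i))"] unfolding capped_def by simp
  qed
  then show ?thesis using that by (rule bchoice[THEN exE])
qed

lemma finite_components_162: "finite components \<and> card components \<le> 162"
proof -
  obtain xs where xs: "\<forall>e\<in>choices. capped_by {1..4} (\<lambda>i. V i (e i)) (\<lambda>i. V i (nxt (e i))) (xs e)"
    by (rule capped_choices)
  have "finite components \<and> 4 * card components \<le> 8 * card choices + 4 * length ([] :: (real^3) set set list)"
  proof (rule components_bound)
    show "(\<exists>Y\<in>set []. Y \<noteq> {} \<and> Y \<subseteq> K) \<or> 4 \<le> (\<Sum>e\<in>choices. load xs K e)" if "K \<in> components" for K
      using load_total[OF that finite_choices choices_of_subset] xs by simp
  qed (use xs in \<open>auto simp: capped_by_def\<close>)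
  then show ?thesis by (simp add: card_choices)
qed

end

section \<open>Coplanar edges\<close>

text \<open>One way in which a line of a fixed plane is tangent to a triangle: it contains given
  points and meets given segments. A segment costs a factor 2 for its sign and a point costs
  nothing, which is what \<open>option_count\<close> adds up.\<close>

type_synonym plane_option = "(real^3) set \<times> ((real^3) \<times> (real^3)) list"

definition sat_option :: "(real^3) set \<Rightarrow> plane_option \<Rightarrow> bool" where
  "sat_option L c \<longleftrightarrow> fst c \<subseteq> L \<and> (\<forall>s\<in>set (snd c). L \<inter> closed_segment (fst s) (snd s) \<noteq> {})"

definition plane_option :: "real^3 \<Rightarrow> real^3 \<Rightarrow> plane_option \<Rightarrow> bool" where
  "plane_option n ob c \<longleftrightarrow> finite (fst c) \<and> (\<forall>w\<in>fst c. n \<bullet> (w - ob) = 0) \<and>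
     (\<forall>s\<in>set (snd c). n \<bullet> (fst s - ob) = 0 \<and> n \<bullet> (snd s - ob) = 0)"

definition option_count :: "plane_option list \<Rightarrow> nat" where
  "option_count cs = (\<Sum>c\<leftarrow>cs. 2 ^ length (snd c))"

lemma sum_list_product3:
  fixes f g h :: "_ \<Rightarrow> nat"
  shows "(\<Sum>x\<leftarrow>xs. \<Sum>y\<leftarrow>ys. \<Sum>z\<leftarrow>zs. f x * g y * h z) = (\<Sum>x\<leftarrow>xs. f x) * (\<Sum>y\<leftarrow>ys. g y) * (\<Sum>z\<leftarrow>zs. h z)"
  by (simp add: sum_list_const_mult sum_list_mult_const mult.assoc)

text \<open>One option for each of three triangles, together with the base segment
  \<open>s0\<close>, gives a family of sign patterns. The sign of \<open>s0\<close> is fixed, so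
  only the options enter the count.\<close>

lemma plane_pieces:
  assumes n: "n \<noteq> 0" and s0: "fst s0 \<noteq> snd s0" "n \<bullet> (fst s0 - ob) = 0" "n \<bullet> (snd s0 - ob) = 0"
    and cs: "\<And>c. c \<in> set cs1 \<union> set cs2 \<union> set cs3 \<Longrightarrow> plane_option n ob c"
  shows "\<exists>Ys. length Ys = option_count cs1 * option_count cs2 * option_count cs3 \<and>
    (\<forall>Y\<in>set Ys. path_connectedin line_topology Y) \<and>
    \<Union>(set Ys) = {L \<in> lines. (\<forall>x\<in>L. n \<bullet> (x - ob) = 0) \<and> L \<inter> closed_segment (fst s0) (snd s0) \<noteq> {} \<and>
       (\<exists>c1\<in>set cs1. sat_option L c1) \<and> (\<exists>c2\<in>set cs2. sat_option L c2) \<and> (\<exists>c3\<in>set cs3. sat_option L c3)}"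
proof -
  define W where "W = (\<lambda>(c1 :: plane_option) (c2 :: plane_option) (c3 :: plane_option). fst c1 \<union> fst c2 \<union> fst c3)"
  define ss where "ss = (\<lambda>(c1 :: plane_option) (c2 :: plane_option) (c3 :: plane_option). snd c1 @ snd c2 @ snd c3)"
  define F where "F = (\<lambda>c1 c2 c3. map (\<lambda>\<sigma>s. cone_lines n ob (pattern (W c1 c2 c3) s0 (ss c1 c2 c3) \<sigma>s)) (signs (length (ss c1 c2 c3))))"
  define Ys where "Ys = concat (map (\<lambda>c1. concat (map (\<lambda>c2. concat (map (\<lambda>c3. F c1 c2 c3) cs3)) cs2)) cs1)"
  have ps: "plane_segments n ob (W c1 c2 c3) s0 (ss c1 c2 c3)" if "c1 \<in> set cs1" "c2 \<in> set cs2" "c3 \<in> set cs3" for c1 c2 c3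
    using cs[of c1] cs[of c2] cs[of c3] that n s0
    unfolding plane_segments_def W_def ss_def plane_option_def by auto
  have FY: "\<Union>(set (F c1 c2 c3)) = plane_lines n ob (W c1 c2 c3) (s0 # ss c1 c2 c3)"
    if c: "c1 \<in> set cs1" "c2 \<in> set cs2" "c3 \<in> set cs3" for c1 c2 c3
  proof -
    interpret plane_segments n ob "W c1 c2 c3" s0 "ss c1 c2 c3" by (rule ps[OF c])
    show ?thesis
    proof (intro equalityI subsetI)
      fix L assume "L \<in> \<Union>(set (F c1 c2 c3))"
      then obtain \<sigma>s where "\<sigma>s \<in> set (signs (length (ss c1 c2 c3)))" "L \<in> piece \<sigma>s" unfolding F_def by auto
      then show "L \<in> plane_lines n ob (W c1 c2 c3) (s0 # ss c1 c2 c3)" using piece_subset by (simp add: subset_iff)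
    next
      fix L assume "L \<in> plane_lines n ob (W c1 c2 c3) (s0 # ss c1 c2 c3)"
      then obtain \<sigma>s where "\<sigma>s \<in> set (signs (length (ss c1 c2 c3)))" "L \<in> piece \<sigma>s" by (rule plane_lines_covered)
      then show "L \<in> \<Union>(set (F c1 c2 c3))" unfolding F_def by auto
    qed
  qed
  have "length Ys = (\<Sum>c1\<leftarrow>cs1. \<Sum>c2\<leftarrow>cs2. \<Sum>c3\<leftarrow>cs3. 2 ^ length (snd c1) * 2 ^ length (snd c2) * 2 ^ length (snd c3))"
    unfolding Ys_def F_def ss_def by (simp add: length_concat o_def length_signs power_add mult.assoc)
  also have "\<dots> = option_count cs1 * option_count cs2 * option_count cs3"
    unfolding option_count_def by (rule sum_list_product3)
  finally have len: "length Ys = option_count cs1 * option_count cs2 * option_count cs3" .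
  have pc: "path_connectedin line_topology Y" if Y: "Y \<in> set Ys" for Y
  proof -
    obtain c1 c2 c3 where c: "c1 \<in> set cs1" "c2 \<in> set cs2" "c3 \<in> set cs3" "Y \<in> set (F c1 c2 c3)"
      using Y unfolding Ys_def by auto
    interpret plane_segments n ob "W c1 c2 c3" s0 "ss c1 c2 c3" by (rule ps[OF c(1-3)])
    show ?thesis using c(4) piece_path_connected unfolding F_def by auto
  qed
  have "\<Union>(set Ys) = (\<Union>c1\<in>set cs1. \<Union>c2\<in>set cs2. \<Union>c3\<in>set cs3. \<Union>(set (F c1 c2 c3)))"
    unfolding Ys_def by auto
  also have "\<dots> = (\<Union>c1\<in>set cs1. \<Union>c2\<in>set cs2. \<Union>c3\<in>set cs3. plane_lines n ob (W c1 c2 c3) (s0 # ss c1 c2 c3))"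
    using FY by simp
  also have "\<dots> = {L \<in> lines. (\<forall>x\<in>L. n \<bullet> (x - ob) = 0) \<and> L \<inter> closed_segment (fst s0) (snd s0) \<noteq> {} \<and>
       (\<exists>c1\<in>set cs1. sat_option L c1) \<and> (\<exists>c2\<in>set cs2. sat_option L c2) \<and> (\<exists>c3\<in>set cs3. sat_option L c3)}" (is "?A = ?B")
  proof -
    have "L \<in> plane_lines n ob (W c1 c2 c3) (s0 # ss c1 c2 c3) \<longleftrightarrow>
       L \<in> lines \<and> (\<forall>x\<in>L. n \<bullet> (x - ob) = 0) \<and> L \<inter> closed_segment (fst s0) (snd s0) \<noteq> {} \<and>
       sat_option L c1 \<and> sat_option L c2 \<and> sat_option L c3" for L c1 c2 c3
      unfolding plane_lines_def W_def ss_def sat_option_def by auto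
    then show ?thesis by (simp add: set_eq_iff)
  qed
  finally show ?thesis using len pc by (intro exI[of _ Ys]) simp
qed

section \<open>Tangency within a plane and the bounds for coplanar edges\<close>

context four_triangles
begin

definition in_plane :: "real^3 \<Rightarrow> real^3 \<Rightarrow> nat \<Rightarrow> bool" where
  "in_plane n ob i \<longleftrightarrow> (\<forall>k<3. n \<bullet> (V i k - ob) = 0)"

definition options_for :: "real^3 \<Rightarrow> real^3 \<Rightarrow> nat \<Rightarrow> plane_option list \<Rightarrow> bool" where
  "options_for n ob i cs \<longleftrightarrow> (\<forall>c\<in>set cs. plane_option n ob c) \<and>
     (\<forall>L\<in>lines. (\<forall>x\<in>L. n \<bullet> (x - ob) = 0) \<longrightarrow> (met_edges L i \<noteq> {} \<longleftrightarrow> (\<exists>c\<in>set cs. sat_option L c)))"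

lemma options_forD:
  assumes "options_for n ob i cs" "L \<in> lines" "\<forall>x\<in>L. n \<bullet> (x - ob) = 0"
  shows "met_edges L i \<noteq> {} \<longleftrightarrow> (\<exists>c\<in>set cs. sat_option L c)"
  using assms unfolding options_for_def by simp

definition edge_option :: "nat \<Rightarrow> nat \<Rightarrow> plane_option" where
  "edge_option i k = ({}, [(V i k, V i (nxt k))])"

lemma sat_edge_option: "k < 3 \<Longrightarrow> sat_option L (edge_option i k) \<longleftrightarrow> k \<in> met_edges L i"
  unfolding sat_option_def edge_option_def met_edges_def edge_def by simp

lemma met_edges_nonempty: "met_edges L i \<noteq> {} \<longleftrightarrow> 0 \<in> met_edges L i \<or> 1 \<in> met_edges L i \<or> 2 \<in> met_edges L i"
proof -
  have "k \<in> met_edges L i \<Longrightarrow> k = 0 \<or> k = 1 \<or> k = 2" for k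
    unfolding met_edges_def using less_3_cases by simp
  then show ?thesis by blast
qed

text \<open>A line that meets the third side weakly separates its ends, so it also meets one of the
  other two sides. Two segments suffice, with count 4 instead of 6.\<close>

lemma options_in_plane:
  assumes n: "n \<noteq> 0" and i: "in_plane n ob i"
  shows "options_for n ob i [edge_option i 0, edge_option i 1]"
  unfolding options_for_def
proof (intro conjI ballI impI)
  fix c assume "c \<in> set [edge_option i 0, edge_option i 1]"
  then show "plane_option n ob c"
    using i unfolding plane_option_def edge_option_def in_plane_def by auto
next
  fix L assume L: "L \<in> lines" "\<forall>x\<in>L. n \<bullet> (x - ob) = 0"
  obtain m k where mk: "m \<bullet> n = 0" "m \<noteq> 0" "L = zero_line n ob m k"
    by (rule line_in_plane_zero_line[OF L(1) _ n]) (use L(2) in auto)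
  define f where "f = (\<lambda>x. m \<bullet> (x - ob) - k)"
  have pl: "n \<bullet> (V i 0 - ob) = 0" "n \<bullet> (V i 1 - ob) = 0" "n \<bullet> (V i 2 - ob) = 0"
    using i unfolding in_plane_def by auto
  have e: "0 \<in> met_edges L i \<longleftrightarrow> f (V i 0) * f (V i 1) \<le> 0" "1 \<in> met_edges L i \<longleftrightarrow> f (V i 1) * f (V i 2) \<le> 0"
    "2 \<in> met_edges L i \<longleftrightarrow> f (V i 2) * f (V i 0) \<le> 0"
    using zero_line_meets_segment[OF mk(1,2) n pl(1,2)] zero_line_meets_segment[OF mk(1,2) n pl(2,3)]
      zero_line_meets_segment[OF mk(1,2) n pl(3,1)]
    unfolding met_edges_def edge_def f_def mk(3) by simp_all
  have "c * a \<le> 0 \<Longrightarrow> a * b \<le> 0 \<or> b * c \<le> 0" for a b c :: real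
    by (auto simp: mult_le_0_iff)
  then have "2 \<in> met_edges L i \<Longrightarrow> 0 \<in> met_edges L i \<or> 1 \<in> met_edges L i" unfolding e by blast
  then show "met_edges L i \<noteq> {} \<longleftrightarrow> (\<exists>c\<in>set [edge_option i 0, edge_option i 1]. sat_option L c)"
    unfolding met_edges_nonempty using sat_edge_option by auto
qed

text \<open>The plane contains at most one edge. If it contains one, it meets the boundary of the
  triangle nowhere else; otherwise it meets the boundary in at most two points.\<close>

lemma options_off_plane:
  assumes n: "n \<noteq> 0" and i: "\<not> in_plane n ob i"
  shows "\<exists>cs. options_for n ob i cs \<and> option_count cs \<le> 2"
proof -
  define g where "g = (\<lambda>x. n \<bullet> (x - ob))"
  have unique: "x = y" if "x \<in> edge i k" "g x = 0" "y \<in> edge i k" "g y = 0" "\<not> (g (V i k) = 0 \<and> g (V i (nxt k)) = 0)" for x y k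
    using plane_two_points_segment[of x _ _ n ob y] that unfolding edge_def g_def by blast
  show ?thesis
  proof (cases "\<exists>k<3. g (V i k) = 0 \<and> g (V i (nxt k)) = 0")
    case True
    then obtain k where k: "k < 3" "g (V i k) = 0" "g (V i (nxt k)) = 0" by blast
    have third: "g (V i (nxt (nxt k))) \<noteq> 0"
    proof
      assume z: "g (V i (nxt (nxt k))) = 0"
      have "g (V i c) = 0" if "c < 3" for c
        using less_3_cases[OF that] less_3_cases[OF k(1)] k(2,3) z by auto
      then show False using i unfolding in_plane_def g_def by blast
    qed
    have on: "x \<in> edge i k" if x: "x \<in> edge i c" "c < 3" "g x = 0" for x c
    proof -
      have "c = k \<or> c = nxt k \<or> c = nxt (nxt k)" using less_3_cases[OF x(2)] less_3_cases[OF k(1)] by auto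
      then show ?thesis
      proof (elim disjE)
        assume c: "c = nxt k"
        have "x = V i (nxt k)" by (rule unique[OF x(1,3)]) (use c k third in \<open>auto simp: edge_def\<close>)
        then show ?thesis unfolding edge_def by simp
      next
        assume c: "c = nxt (nxt k)"
        have "nxt c = k" using c nxt_nxt[OF k(1)] by simp
        then have "x = V i k" by (intro unique[OF x(1,3)]) (use c k third in \<open>auto simp: edge_def\<close>)
        then show ?thesis unfolding edge_def by simp
      qed (use x in simp)
    qed
    have "options_for n ob i [edge_option i k]"
      unfolding options_for_def
    proof (intro conjI ballI impI)
      show "plane_option n ob c" if "c \<in> set [edge_option i k]" for c
        using that k unfolding plane_option_def edge_option_def g_def by simp
      fix L assume L: "L \<in> lines" "\<forall>x\<in>L. n \<bullet> (x - ob) = 0"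
      have "k \<in> met_edges L i" if c: "c \<in> met_edges L i" for c
      proof -
        obtain x where "x \<in> L" "x \<in> edge i c" "c < 3" using c unfolding met_edges_def by auto
        then show ?thesis using on[of x c] L(2) k(1) unfolding met_edges_def g_def by auto
      qed
      then show "met_edges L i \<noteq> {} \<longleftrightarrow> (\<exists>c\<in>set [edge_option i k]. sat_option L c)"
        using sat_edge_option[OF k(1)] by auto
    qed
    then show ?thesis by (intro exI[of _ "[edge_option i k]"]) (simp add: option_count_def edge_option_def)
  next
    case False
    then have F: "\<not> (g (V i k) = 0 \<and> g (V i (nxt k)) = 0)" if "k < 3" for k using that by blast
    define B where "B = {x. g x = 0 \<and> (\<exists>k<3. x \<in> edge i k)}"
    have card: "finite B \<and> card B \<le> 2"
    proof -
      define w where "w = (\<lambda>k. {x. g x = 0 \<and> x \<in> edge i k})"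
      have w1: "\<exists>a. w k \<subseteq> {a}" if "k < 3" for k using unique F[OF that] unfolding w_def by blast
      have B3: "B = w 0 \<union> w 1 \<union> w 2" unfolding B_def w_def using less_3_cases by force
      obtain a0 where a0: "w 0 \<subseteq> {a0}" using w1[of 0] by auto
      obtain a1 where a1: "w 1 \<subseteq> {a1}" using w1[of 1] by auto
      obtain a2 where a2: "w 2 \<subseteq> {a2}" using w1[of 2] by auto
      have two: "finite B \<and> card B \<le> 2" if "B \<subseteq> {a, b}" for a b
      proof -
        have "card B \<le> card {a, b}" by (rule card_mono) (use that in auto)
        also have "\<dots> \<le> 2" by (simp add: card_insert_if)
        finally show ?thesis using finite_subset[OF that] by simp
      qed
      have prod: "g (V i k) * g (V i (nxt k)) \<le> 0" if h: "w k \<noteq> {}" for k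
      proof -
        obtain x where x: "g x = 0" "x \<in> closed_segment (V i k) (V i (nxt k))" using h unfolding w_def edge_def by auto
        obtain u where u: "0 \<le> u" "u \<le> 1" "x = (1 - u) *\<^sub>R V i k + u *\<^sub>R V i (nxt k)"
          using x(2) unfolding closed_segment_def by auto
        have "x - ob = (1 - u) *\<^sub>R (V i k - ob) + u *\<^sub>R (V i (nxt k) - ob)" unfolding u by (simp add: algebra_simps)
        then have "(1 - u) * g (V i k) + u * g (V i (nxt k)) = 0" using x(1) unfolding g_def by (simp add: inner_add_right)
        then show ?thesis using convex_zero_imp u by blast
      qed
      show ?thesis
      proof (cases "w 0 = {} \<or> w 1 = {} \<or> w 2 = {}")
        case True
        then show ?thesis using two[of a1 a2] two[of a0 a2] two[of a0 a1] a0 a1 a2 unfolding B3 by blast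
      next
        case f: False
        have p: "g (V i 0) * g (V i 1) \<le> 0" "g (V i 1) * g (V i 2) \<le> 0" "g (V i 2) * g (V i 0) \<le> 0"
          using prod[of 0] prod[of 1] prod[of 2] f by simp_all
        \<comment> \<open>Three strict sign changes around a cycle of three vertices are impossible.
          So a vertex lies in the plane, and the points of its two edges coincide.\<close>
        then have "g (V i 0) = 0 \<or> g (V i 1) = 0 \<or> g (V i 2) = 0" by (auto simp: mult_le_0_iff)
        then show ?thesis
        proof (elim disjE)
          assume z: "g (V i 0) = 0"
          then have "V i 0 \<in> w 0" "V i 0 \<in> w 2" unfolding w_def edge_def by auto
          then have "a0 = a2" using a0 a2 by blast
          then show ?thesis using two[of a1 a2] a0 a1 a2 unfolding B3 by blast
        next
          assume z: "g (V i 1) = 0"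
          then have "V i 1 \<in> w 0" "V i 1 \<in> w 1" unfolding w_def edge_def by auto
          then have "a0 = a1" using a0 a1 by blast
          then show ?thesis using two[of a1 a2] a0 a1 a2 unfolding B3 by blast
        next
          assume z: "g (V i 2) = 0"
          then have "V i 2 \<in> w 1" "V i 2 \<in> w 2" unfolding w_def edge_def by auto
          then have "a1 = a2" using a1 a2 by blast
          then show ?thesis using two[of a0 a2] a0 a1 a2 unfolding B3 by blast
        qed
      qed
    qed
    obtain bl where bl: "set bl = B" "distinct bl" using finite_distinct_list card by auto
    have lb: "length bl \<le> 2" using distinct_card[OF bl(2)] bl(1) card by simp
    let ?cs = "map (\<lambda>w. ({w}, []) :: plane_option) bl"
    have "options_for n ob i ?cs"
      unfolding options_for_def
    proof (intro conjI ballI impI)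
      fix c assume "c \<in> set ?cs"
      then obtain w where w: "w \<in> B" "c = ({w}, [])" using bl(1) by (metis (no_types, lifting) image_iff list.set_map)
      have "n \<bullet> (w - ob) = 0" using w(1) unfolding B_def g_def by simp
      then show "plane_option n ob c" unfolding plane_option_def w(2) by simp
    next
      fix L assume L: "L \<in> lines" "\<forall>x\<in>L. n \<bullet> (x - ob) = 0"
      have "(\<exists>c\<in>set ?cs. sat_option L c) \<longleftrightarrow> (\<exists>w\<in>B. w \<in> L)"
        unfolding set_map bl(1) sat_option_def by simp
      also have "\<dots> \<longleftrightarrow> (\<exists>k<3. \<exists>x. x \<in> L \<and> x \<in> edge i k)"
      proof
        assume "\<exists>w\<in>B. w \<in> L"
        then obtain w where "w \<in> B" "w \<in> L" by (elim bexE)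
        then obtain k where "k < 3" "w \<in> edge i k" unfolding B_def by auto
        then show "\<exists>k<3. \<exists>x. x \<in> L \<and> x \<in> edge i k" using \<open>w \<in> L\<close> by (intro exI[of _ k] conjI exI[of _ w])
      next
        assume "\<exists>k<3. \<exists>x. x \<in> L \<and> x \<in> edge i k"
        then obtain k x where x: "k < 3" "x \<in> L" "x \<in> edge i k" by (elim exE conjE)
        then have "x \<in> B" using L(2) unfolding B_def g_def by auto
        then show "\<exists>w\<in>B. w \<in> L" using x(2) by (rule bexI[rotated])
      qed
      also have "\<dots> \<longleftrightarrow> met_edges L i \<noteq> {}" unfolding met_edges_def by auto
      finally show "met_edges L i \<noteq> {} \<longleftrightarrow> (\<exists>c\<in>set ?cs. sat_option L c)" by simp
    qed
    moreover have "option_count ?cs \<le> 2" unfolding option_count_def using lb by (simp add: o_def sum_list_triv)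
    ultimately show ?thesis by blast
  qed
qed

text \<open>A component with a tangent for a choice in \<open>R\<close> contains a set of
  \<open>Ys\<close>; every other component collects its load from the choices outside
  \<open>R\<close>.\<close>

lemma planar_components_bound:
  assumes R: "R \<subseteq> choices" and Ys: "\<And>Y. Y \<in> set Ys \<Longrightarrow> path_connectedin line_topology Y \<and> Y \<subseteq> tangents"
    and cover: "\<And>L. L \<in> tangents \<Longrightarrow> choices_of L \<inter> R \<noteq> {} \<Longrightarrow> L \<in> \<Union>(set Ys)"
  shows "card components \<le> 2 * (81 - card R) + length Ys"
proof -
  obtain xs where xs: "\<forall>e\<in>choices. capped_by {1..4} (\<lambda>i. V i (e i)) (\<lambda>i. V i (nxt (e i))) (xs e)"
    by (rule capped_choices)
  have "finite components \<and> 4 * card components \<le> 8 * card (choices - R) + 4 * length Ys"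
  proof (rule components_bound[where xs = xs])
    fix K assume K: "K \<in> components"
    show "(\<exists>Y\<in>set Ys. Y \<noteq> {} \<and> Y \<subseteq> K) \<or> 4 \<le> (\<Sum>e\<in>choices - R. load xs K e)"
    proof (cases "\<exists>L\<in>K. choices_of L \<inter> R \<noteq> {}")
      case True
      then obtain L where L: "L \<in> K" "choices_of L \<inter> R \<noteq> {}" by (elim bexE)
      then obtain Y where Y: "Y \<in> set Ys" "L \<in> Y" using cover component_mem_tangents[OF K] by auto
      have "Y \<subseteq> K" using path_component_superset[OF K conjunct1[OF Ys] conjunct2[OF Ys] Y(2) L(1)] Y(1) by simp
      then show ?thesis using Y by (intro disjI1 bexI[of _ Y]) auto
    next
      case False
      have "choices_of L \<subseteq> choices - R" if "L \<in> K" for L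
        using False that choices_of_subset[of L] by auto
      then show ?thesis using load_total[OF K _ _, of "choices - R" xs] xs finite_choices by simp
    qed
  qed (use xs Ys in \<open>auto simp: capped_by_def\<close>)
  moreover have "card (choices - R) = 81 - card R"
    using card_Diff_subset[OF finite_subset[OF R finite_choices] R] card_choices by simp
  ultimately show ?thesis by simp
qed

lemma edge_subset_t:
  assumes "i \<in> {1..4}" "k < 3"
  shows "edge i k \<subseteq> t i"
proof -
  have "V i k \<in> t i" "V i (nxt k) \<in> t i"
    unfolding t_hull[OF assms(1)] using less_3_cases[OF assms(2)] by (auto intro: hull_inc)
  then show ?thesis unfolding edge_def t_hull[OF assms(1)] by (intro closed_segment_subset) simp_all
qed

lemma line_in_plane_of_edges:
  assumes disj: "t i \<inter> t j = {}" and ij: "i \<in> {1..4}" "j \<in> {1..4}" and L: "L \<in> lines"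
    and a: "a \<in> met_edges L i" "n \<bullet> (V i a - ob) = 0" "n \<bullet> (V i (nxt a) - ob) = 0"
    and b: "b \<in> met_edges L j" "n \<bullet> (V j b - ob) = 0" "n \<bullet> (V j (nxt b) - ob) = 0"
  shows "\<forall>x\<in>L. n \<bullet> (x - ob) = 0"
proof -
  obtain x where x: "x \<in> L" "x \<in> edge i a" "a < 3" using a unfolding met_edges_def by auto
  obtain y where y: "y \<in> L" "y \<in> edge j b" "b < 3" using b unfolding met_edges_def by auto
  have "x \<in> t i" using edge_subset_t[OF ij(1) x(3)] x(2) by auto
  moreover have "y \<in> t j" using edge_subset_t[OF ij(2) y(3)] y(2) by auto
  ultimately have xy: "x \<noteq> y" using disj by auto
  have "n \<bullet> (x - ob) = 0" using plane_segment_mem[OF a(2,3)] x(2) unfolding edge_def by simp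
  moreover have "n \<bullet> (y - ob) = 0" using plane_segment_mem[OF b(2,3)] y(2) unfolding edge_def by simp
  ultimately show ?thesis using line_in_plane_two_points[OF L x(1) y(1) xy] by simp
qed

text \<open>A common tangent has different points on the two disjoint coplanar triangles and hence
  lies in their plane. Two edges of triangle \<open>i\<close> as base segments, with at most 4 * 4 *
  4 patterns each, give at most 128 pieces, and these replace all choices.\<close>

lemma coplanar_triangles_bound:
  assumes disj: "t i \<inter> t j = {}" and I: "{1..4} = {i, j, k, l}"
    and n: "n \<noteq> 0" "in_plane n ob i" "in_plane n ob j"
  shows "card components \<le> 156"
proof -
  have ij: "i \<in> {1..4}" "j \<in> {1..4}" "k \<in> {1..4}" "l \<in> {1..4}" using I by auto
  have opts: "\<exists>cs. options_for n ob x cs \<and> option_count cs \<le> 4" for x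
  proof (cases "in_plane n ob x")
    case True
    show ?thesis using options_in_plane[OF n(1) True]
      by (intro exI[of _ "[edge_option x 0, edge_option x 1]"]) (simp add: option_count_def edge_option_def)
  next
    case False
    then show ?thesis using options_off_plane[OF n(1) False] by (elim exE) (rule exI, auto)
  qed
  obtain c1 where c1: "options_for n ob j c1" "option_count c1 \<le> 4" using opts[of j] by (elim exE conjE)
  obtain c2 where c2: "options_for n ob k c2" "option_count c2 \<le> 4" using opts[of k] by (elim exE conjE)
  obtain c3 where c3: "options_for n ob l c3" "option_count c3 \<le> 4" using opts[of l] by (elim exE conjE)
  have all: "\<forall>c\<in>set c1 \<union> set c2 \<union> set c3. plane_option n ob c" using c1 c2 c3 unfolding options_for_def by auto
  let ?B = "\<lambda>a. {L \<in> lines. (\<forall>x\<in>L. n \<bullet> (x - ob) = 0) \<and> L \<inter> edge i a \<noteq> {} \<and>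
       (\<exists>c\<in>set c1. sat_option L c) \<and> (\<exists>c\<in>set c2. sat_option L c) \<and> (\<exists>c\<in>set c3. sat_option L c)}"
  have ex: "\<exists>Ys. length Ys \<le> 64 \<and> (\<forall>Y\<in>set Ys. path_connectedin line_topology Y) \<and> \<Union>(set Ys) = ?B a" if a: "a < 3" for a
  proof -
    have "V i a \<noteq> V i (nxt a)" "n \<bullet> (V i a - ob) = 0" "n \<bullet> (V i (nxt a) - ob) = 0"
      using edge_ends_neq[OF ij(1) a] n(2) a nxt_less unfolding in_plane_def by auto
    then obtain Ys where Ys: "length Ys = option_count c1 * option_count c2 * option_count c3"
      "\<forall>Y\<in>set Ys. path_connectedin line_topology Y" "\<Union>(set Ys) = ?B a"
      using plane_pieces[OF n(1), of "(V i a, V i (nxt a))" ob c1 c2 c3] all unfolding edge_def by auto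
    have "option_count c1 * option_count c2 * option_count c3 \<le> 4 * 4 * 4"
      using c1 c2 c3 by (intro mult_le_mono) auto
    then show ?thesis using Ys by (intro exI[of _ Ys]) simp
  qed
  have z: "(0::nat) < 3" "(1::nat) < 3" by simp_all
  obtain Y0 where Y0: "length Y0 \<le> 64" "\<forall>Y\<in>set Y0. path_connectedin line_topology Y" "\<Union>(set Y0) = ?B 0"
    using ex[OF z(1)] by (elim exE conjE)
  obtain Y1 where Y1: "length Y1 \<le> 64" "\<forall>Y\<in>set Y1. path_connectedin line_topology Y" "\<Union>(set Y1) = ?B 1"
    using ex[OF z(2)] by (elim exE conjE)
  have cov: "L \<in> ?B 0 \<union> ?B 1 \<longleftrightarrow> L \<in> tangents" for L
  proof
    assume L: "L \<in> ?B 0 \<union> ?B 1"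
    then have i: "met_edges L i \<noteq> {}" unfolding met_edges_nonempty unfolding met_edges_def by auto
    have Ll: "L \<in> lines" and pl: "\<forall>x\<in>L. n \<bullet> (x - ob) = 0"
      and s: "\<exists>c\<in>set c1. sat_option L c" "\<exists>c\<in>set c2. sat_option L c" "\<exists>c\<in>set c3. sat_option L c"
      using L by auto
    have "met_edges L j \<noteq> {}" "met_edges L k \<noteq> {}" "met_edges L l \<noteq> {}"
      using options_forD[OF c1(1) Ll pl] options_forD[OF c2(1) Ll pl] options_forD[OF c3(1) Ll pl] s by simp_all
    then have "\<forall>x\<in>{1..4}. met_edges L x \<noteq> {}" unfolding I using i by simp
    then show "L \<in> tangents" unfolding tangents_iff using Ll by simp
  next
    assume L: "L \<in> tangents"
    then have Ll: "L \<in> lines" "met_edges L i \<noteq> {}" "met_edges L j \<noteq> {}" "met_edges L k \<noteq> {}" "met_edges L l \<noteq> {}"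
      unfolding tangents_iff using ij by auto
    obtain a b where ab: "a \<in> met_edges L i" "b \<in> met_edges L j" using Ll by auto
    then have ab3: "a < 3" "b < 3" unfolding met_edges_def by simp_all
    have on: "n \<bullet> (V i c - ob) = 0" "n \<bullet> (V j c - ob) = 0" if "c < 3" for c using n(2,3) that unfolding in_plane_def by simp_all
    have pl: "\<forall>x\<in>L. n \<bullet> (x - ob) = 0"
      by (rule line_in_plane_of_edges[OF disj ij(1,2) Ll(1) ab(1) on(1)[OF ab3(1)] on(1)[OF nxt_less] ab(2) on(2)[OF ab3(2)] on(2)[OF nxt_less]])
    have "\<exists>c\<in>set [edge_option i 0, edge_option i 1]. sat_option L c"
      using options_forD[OF options_in_plane[OF n(1,2)] Ll(1) pl] Ll(2) by simp
    then have "L \<inter> edge i 0 \<noteq> {} \<or> L \<inter> edge i 1 \<noteq> {}" using sat_edge_option unfolding met_edges_def by auto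
    moreover have "\<exists>c\<in>set c1. sat_option L c" "\<exists>c\<in>set c2. sat_option L c" "\<exists>c\<in>set c3. sat_option L c"
      using options_forD[OF c1(1) Ll(1) pl] options_forD[OF c2(1) Ll(1) pl] options_forD[OF c3(1) Ll(1) pl] Ll by simp_all
    ultimately show "L \<in> ?B 0 \<union> ?B 1" using Ll(1) pl by simp
  qed
  have "card components \<le> 2 * (81 - card choices) + length (Y0 @ Y1)"
  proof (rule planar_components_bound)
    fix Y assume Y: "Y \<in> set (Y0 @ Y1)"
    then have "Y \<subseteq> ?B 0 \<union> ?B 1" unfolding Y0(3)[symmetric] Y1(3)[symmetric] by auto
    then show "path_connectedin line_topology Y \<and> Y \<subseteq> tangents" using Y Y0(2) Y1(2) cov by (auto simp: subset_iff)
  next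
    fix L assume "L \<in> tangents"
    then have "L \<in> ?B 0 \<union> ?B 1" using cov by simp
    then show "L \<in> \<Union>(set (Y0 @ Y1))" unfolding Y0(3)[symmetric] Y1(3)[symmetric] by auto
  qed simp
  then show ?thesis using Y0(1) Y1(1) by (simp add: card_choices)
qed

lemma card_fixed_choices:
  assumes "i \<in> {1..4}" "j \<in> {1..4}" "i \<noteq> j" "a < 3" "b < 3"
  shows "card {e \<in> choices. e i = a \<and> e j = b} = 9"
proof -
  let ?A = "\<lambda>x. if x = i then {a} else if x = j then {b} else {..<3::nat}"
  have "{e \<in> choices. e i = a \<and> e j = b} = (\<Pi>\<^sub>E x\<in>{1..4}. ?A x)"
    unfolding choices_def using assms by (auto simp: PiE_iff extensional_def split: if_splits)
  then have "card {e \<in> choices. e i = a \<and> e j = b} = (\<Prod>x\<in>{1..4}. card (?A x))"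
    by (simp add: card_PiE)
  also have "\<dots> = 9"
  proof -
    obtain k l where kl: "{1..4} = {i, j, k, l}" "distinct [i, j, k, l]" by (rule four_indices[OF assms(1-3)])
    then have "k \<noteq> i" "k \<noteq> j" "l \<noteq> i" "l \<noteq> j" "k \<noteq> l" by auto
    then show ?thesis unfolding kl(1) using assms(3) by simp
  qed
  finally show ?thesis .
qed

text \<open>The 9 choices that use both coplanar edges only have planar transversals. They are
  replaced by at most 2 * 2 * 2 pieces, so the bound is 2 * 72 + 8 = 152.\<close>

lemma coplanar_edges_bound_aux:
  assumes disj: "t i \<inter> t j = {}" and I: "{1..4} = {i, j, k, l}" and ij: "i \<noteq> j" and ab: "a < 3" "b < 3"
    and n: "n \<noteq> 0" "n \<bullet> (V i a - ob) = 0" "n \<bullet> (V i (nxt a) - ob) = 0" "n \<bullet> (V j b - ob) = 0" "n \<bullet> (V j (nxt b) - ob) = 0"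
    and off: "\<not> in_plane n ob k" "\<not> in_plane n ob l"
  shows "card components \<le> 156"
proof -
  have ij': "i \<in> {1..4}" "j \<in> {1..4}" "k \<in> {1..4}" "l \<in> {1..4}" using I by auto
  obtain c2 where c2: "options_for n ob k c2" "option_count c2 \<le> 2" using options_off_plane[OF n(1) off(1)] by (elim exE conjE)
  obtain c3 where c3: "options_for n ob l c3" "option_count c3 \<le> 2" using options_off_plane[OF n(1) off(2)] by (elim exE conjE)
  let ?c1 = "[edge_option j b]"
  have c1: "plane_option n ob (edge_option j b)" using n unfolding plane_option_def edge_option_def by simp
  have all: "\<forall>c\<in>set ?c1 \<union> set c2 \<union> set c3. plane_option n ob c" using c1 c2 c3 unfolding options_for_def by auto
  let ?B = "{L \<in> lines. (\<forall>x\<in>L. n \<bullet> (x - ob) = 0) \<and> L \<inter> edge i a \<noteq> {} \<and>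
       (\<exists>c\<in>set ?c1. sat_option L c) \<and> (\<exists>c\<in>set c2. sat_option L c) \<and> (\<exists>c\<in>set c3. sat_option L c)}"
  have "V i a \<noteq> V i (nxt a)" using edge_ends_neq[OF ij'(1) ab(1)] .
  then obtain Ys where Ys: "length Ys = option_count ?c1 * option_count c2 * option_count c3"
    "\<forall>Y\<in>set Ys. path_connectedin line_topology Y" "\<Union>(set Ys) = ?B"
    using plane_pieces[OF n(1), of "(V i a, V i (nxt a))" ob ?c1 c2 c3] all n unfolding edge_def by auto
  have "option_count ?c1 = 2" unfolding option_count_def edge_option_def by simp
  moreover have "2 * option_count c2 * option_count c3 \<le> 2 * 2 * 2" using c2 c3 by (intro mult_le_mono) auto
  ultimately have len: "length Ys \<le> 8" using Ys(1) by simp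
  have BT: "L \<in> tangents" if L: "L \<in> ?B" for L
  proof -
    have "a \<in> met_edges L i" "b \<in> met_edges L j" using L sat_edge_option[OF ab(2)] ab(1) unfolding met_edges_def by auto
    then have ij: "met_edges L i \<noteq> {}" "met_edges L j \<noteq> {}" by auto
    have Ll: "L \<in> lines" and pl: "\<forall>x\<in>L. n \<bullet> (x - ob) = 0"
      and s: "\<exists>c\<in>set c2. sat_option L c" "\<exists>c\<in>set c3. sat_option L c"
      using L by auto
    have "met_edges L k \<noteq> {}" "met_edges L l \<noteq> {}"
      using options_forD[OF c2(1) Ll pl] options_forD[OF c3(1) Ll pl] s by simp_all
    then have "\<forall>x\<in>{1..4}. met_edges L x \<noteq> {}" unfolding I using ij by simp
    then show ?thesis unfolding tangents_iff using Ll by simp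
  qed
  let ?R = "{e \<in> choices. e i = a \<and> e j = b}"
  have "card components \<le> 2 * (81 - card ?R) + length Ys"
  proof (rule planar_components_bound)
    fix Y assume Y: "Y \<in> set Ys"
    then have "Y \<subseteq> ?B" unfolding Ys(3)[symmetric] by auto
    then show "path_connectedin line_topology Y \<and> Y \<subseteq> tangents" using Y Ys(2) BT by (auto simp: subset_iff)
  next
    fix L assume L: "L \<in> tangents" "choices_of L \<inter> ?R \<noteq> {}"
    then obtain e where e: "e \<in> choices_of L" "e i = a" "e j = b" by auto
    have me: "a \<in> met_edges L i" "b \<in> met_edges L j"
      using e ij' unfolding choices_of_def by (auto simp: PiE_iff)
    have Ll: "L \<in> lines" "met_edges L k \<noteq> {}" "met_edges L l \<noteq> {}" using L(1) ij' unfolding tangents_iff by auto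
    have pl: "\<forall>x\<in>L. n \<bullet> (x - ob) = 0"
      by (rule line_in_plane_of_edges[OF disj ij'(1,2) Ll(1) me(1) n(2,3) me(2) n(4,5)])
    have "\<exists>c\<in>set ?c1. sat_option L c" using me sat_edge_option[OF ab(2)] by simp
    moreover have "\<exists>c\<in>set c2. sat_option L c" "\<exists>c\<in>set c3. sat_option L c"
      using options_forD[OF c2(1) Ll(1) pl] options_forD[OF c3(1) Ll(1) pl] Ll by simp_all
    moreover have "L \<inter> edge i a \<noteq> {}" using me unfolding met_edges_def by simp
    ultimately have "L \<in> ?B" using Ll(1) pl by simp
    then show "L \<in> \<Union>(set Ys)" unfolding Ys(3) .
  qed auto
  then show ?thesis using len card_fixed_choices[OF ij'(1,2) ij ab] by simp
qed

text \<open>A tangent that meets both edges has two different points on \<open>m\<close>, so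
  \<open>m\<close> alone replaces 9 choices: 2 * 72 + 1 = 145.\<close>

lemma collinear_edges_bound:
  assumes disj: "t i \<inter> t j = {}" and ij: "i \<in> {1..4}" "j \<in> {1..4}" "i \<noteq> j" and ab: "a < 3" "b < 3"
    and m: "m \<in> lines" "V i a \<in> m" "V i (nxt a) \<in> m" "V j b \<in> m" "V j (nxt b) \<in> m"
  shows "card components \<le> 156"
proof -
  let ?R = "{e \<in> choices. e i = a \<and> e j = b}"
  let ?Ys = "[{m} \<inter> tangents]"
  have "card components \<le> 2 * (81 - card ?R) + length ?Ys"
  proof (rule planar_components_bound)
    fix Y assume "Y \<in> set ?Ys"
    then have "Y = {} \<or> Y = {m} \<and> m \<in> tangents" by auto
    then show "path_connectedin line_topology Y \<and> Y \<subseteq> tangents"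
      using path_connectedin_sing_line[OF m(1)] by auto
  next
    fix L assume L: "L \<in> tangents" "choices_of L \<inter> ?R \<noteq> {}"
    then obtain e where e: "e \<in> choices_of L" "e i = a" "e j = b" by auto
    have me: "a \<in> met_edges L i" "b \<in> met_edges L j"
      using e ij unfolding choices_of_def by (auto simp: PiE_iff)
    obtain x where x: "x \<in> L" "x \<in> edge i a" using me unfolding met_edges_def by auto
    obtain y where y: "y \<in> L" "y \<in> edge j b" using me unfolding met_edges_def by auto
    have "x \<in> t i" "y \<in> t j" using edge_subset_t[OF ij(1) ab(1)] edge_subset_t[OF ij(2) ab(2)] x y by auto
    then have xy: "x \<noteq> y" using disj by auto
    have xm: "x \<in> m" using segment_subset_line[OF m(1-3)] x(2) unfolding edge_def by simp
    have ym: "y \<in> m" using segment_subset_line[OF m(1,4,5)] y(2) unfolding edge_def by simp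
    have "L \<in> lines" using L(1) unfolding tangents_iff by simp
    then have "L = m" by (rule lines_eq_if_two_points[OF _ m(1) x(1) y(1) xm ym xy])
    then show "L \<in> \<Union>(set ?Ys)" using L by simp
  qed auto
  then show ?thesis using card_fixed_choices[OF ij ab] by simp
qed

definition edge_skew :: "nat \<Rightarrow> nat \<Rightarrow> nat \<Rightarrow> nat \<Rightarrow> bool" where
  "edge_skew i a j b \<longleftrightarrow> (V i (nxt a) - V i a) \<bullet> ((V j (nxt b) - V j b) \<times> (V j b - V i a)) \<noteq> 0"

lemma coplanar_edges_bound:
  assumes disj: "\<And>x y. x \<in> {1..4} \<Longrightarrow> y \<in> {1..4} \<Longrightarrow> x \<noteq> y \<Longrightarrow> t x \<inter> t y = {}"
    and ij: "i \<in> {1..4}" "j \<in> {1..4}" "i \<noteq> j" and ab: "a < 3" "b < 3" and ns: "\<not> edge_skew i a j b"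
  shows "card components \<le> 156"
proof -
  define e where "e = (\<lambda>x. if x = j then b else a)"
  let ?p = "\<lambda>x. V x (e x)" and ?q = "\<lambda>x. V x (nxt (e x))"
  have e: "e i = a" "e j = b" using ij unfolding e_def by auto
  have ns': "\<not> skew ?p ?q i j" using ns unfolding skew_def edge_skew_def e .
  have ends: "?p i \<noteq> ?q i" unfolding e by (rule edge_ends_neq[OF ij(1) ab(1)])
  show ?thesis
  proof (cases "?p j \<in> seg_line ?p ?q i \<and> ?q j \<in> seg_line ?p ?q i")
    case True
    have "seg_line ?p ?q i \<in> lines" using ends by (intro seg_line_in_lines)
    moreover have "V i a \<in> seg_line ?p ?q i" "V i (nxt a) \<in> seg_line ?p ?q i"
      using seg_line_ends(1)[where p = ?p and q = ?q and i = i] seg_line_ends(2)[where p = ?p and q = ?q and i = i]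
      unfolding e by simp_all
    ultimately show ?thesis
      using collinear_edges_bound[OF disj[OF ij] ij ab] True unfolding e by simp
  next
    case False
    obtain n where n: "n \<noteq> 0" "n \<bullet> (?q i - ?p i) = 0" "n \<bullet> (?p j - ?p i) = 0" "n \<bullet> (?q j - ?p i) = 0"
      by (rule coplanar_cases[OF ns' ends False])
    let ?ob = "V i a"
    have pl: "n \<bullet> (V i a - ?ob) = 0" "n \<bullet> (V i (nxt a) - ?ob) = 0" "n \<bullet> (V j b - ?ob) = 0" "n \<bullet> (V j (nxt b) - ?ob) = 0"
      using n unfolding e by simp_all
    show ?thesis
    proof (cases "\<exists>x\<in>{1..4}. \<exists>y\<in>{1..4}. x \<noteq> y \<and> in_plane n ?ob x \<and> in_plane n ?ob y")
      case True
      then obtain x y where xy: "x \<in> {1..4}" "y \<in> {1..4}" "x \<noteq> y" "in_plane n ?ob x" "in_plane n ?ob y" by blast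
      obtain k l where "{1..4} = {x, y, k, l}" "distinct [x, y, k, l]" by (rule four_indices[OF xy(1-3)])
      then show ?thesis by (intro coplanar_triangles_bound[OF disj[OF xy(1-3)] _ n(1) xy(4,5)])
    next
      case one: False
      obtain k l where kl: "{1..4} = {i, j, k, l}" "distinct [i, j, k, l]" by (rule four_indices[OF ij])
      have kl': "k \<in> {1..4}" "l \<in> {1..4}" unfolding kl(1) by simp_all
      \<comment> \<open>A triangle \<open>x\<close> inside the plane takes over the role of
        \<open>j\<close>: any of its edges is coplanar with the edge of \<open>i\<close>. No second
        triangle lies in the plane, so the two remaining ones are off it.\<close>
      have third: ?thesis if h: "x \<in> {1..4}" "x \<noteq> i" "x \<noteq> j" "in_plane n ?ob x" for x
      proof -
        have "x \<in> {i, j, k, l}" using h(1) unfolding kl(1) .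
        then have "x = k \<or> x = l" using h(2,3) by simp
        moreover have "{1..4} = {i, k, j, l}" "{1..4} = {i, l, j, k}" "l \<noteq> k" using kl by auto
        ultimately obtain m where six: "{1..4} = {i, x, j, m}" "m \<noteq> x" "m \<in> {1..4}"
          using kl' by metis
        have off: "\<not> in_plane n ?ob j" "\<not> in_plane n ?ob m"
          using one h ij(2) six(2,3) by blast+
        have x0: "n \<bullet> (V x 0 - ?ob) = 0" "n \<bullet> (V x (nxt 0) - ?ob) = 0"
          using h(4) unfolding in_plane_def by auto
        show ?thesis
          by (rule coplanar_edges_bound_aux[OF disj[OF ij(1) h(1)] six(1) _ ab(1) _ n(1) pl(1,2) x0 off]) (use h in auto)
      qed
      show ?thesis
      proof (cases "in_plane n ?ob k \<or> in_plane n ?ob l")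
        case True
        then show ?thesis using third[of k] third[of l] kl' kl(2) by auto
      next
        case off: False
        then show ?thesis
          using coplanar_edges_bound_aux[OF disj[OF ij] kl(1) ij(3) ab n(1) pl] by simp
      qed
    qed
  qed
qed

end

section \<open>Planes through an edge line\<close>

lemma pos_mult_le_0: "0 < a \<Longrightarrow> a * b \<le> 0 \<longleftrightarrow> b \<le> 0" for a b :: real
  by (auto simp: mult_le_0_iff)

lemma neg_mult_le_0: "a < 0 \<Longrightarrow> a * b \<le> 0 \<longleftrightarrow> 0 \<le> b" for a b :: real
  by (auto simp: mult_le_0_iff)

text \<open>The planes through a fixed line, other than a reference plane, are parametrised by \<open>t\<close>. If \<open>v x\<close> is the
  height of the vertex \<open>x\<close> over the reference plane and \<open>\<tau> x\<close> is the parameter of the plane through \<open>x\<close>, then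
  \<open>v x * (\<tau> x - t)\<close> tells on which side of the plane \<open>t\<close> the vertex \<open>x\<close> lies.\<close>

definition hits :: "(nat \<Rightarrow> real) \<Rightarrow> (nat \<Rightarrow> real) \<Rightarrow> nat \<Rightarrow> real \<Rightarrow> bool" where
  "hits v \<tau> c t \<longleftrightarrow> (v c * (\<tau> c - t)) * (v (nxt c) * (\<tau> (nxt c) - t)) \<le> 0"

definition same_sign :: "(nat \<Rightarrow> real) \<Rightarrow> nat \<Rightarrow> bool" where
  "same_sign v c \<longleftrightarrow> v c * v (nxt c) > 0"

definition proper :: "(nat \<Rightarrow> real) \<Rightarrow> (nat \<Rightarrow> real) \<Rightarrow> bool" where
  "proper v \<tau> \<longleftrightarrow> (\<forall>x<3. v x \<noteq> 0) \<and> inj_on \<tau> {..<3}"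

text \<open>Some plane of the pencil misses all three vertices strictly on one side. The first
  alternative is the reference plane, which corresponds to an infinite parameter.\<close>

definition missed :: "(nat \<Rightarrow> real) \<Rightarrow> (nat \<Rightarrow> real) \<Rightarrow> bool" where
  "missed v \<tau> \<longleftrightarrow> (\<forall>x<3. \<forall>y<3. v x * v y > 0) \<or>
     (\<exists>t. \<forall>x<3. \<forall>y<3. (v x * (\<tau> x - t)) * (v y * (\<tau> y - t)) > 0)"

lemma edge_of_vertices:
  assumes "p < 3" "q < 3" "p \<noteq> q"
  obtains c where "c < 3" "c = p \<and> nxt c = q \<or> c = q \<and> nxt c = p"
proof -
  have "nxt p = q \<or> nxt q = p" using less_3_cases[OF assms(1)] less_3_cases[OF assms(2)] assms(3) by auto
  then show ?thesis using that[of p] that[of q] assms by blast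
qed

lemma edge_between:
  assumes "p < 3" "q < 3" "p \<noteq> q"
  obtains c where "c < 3" "{c, nxt c} = {p, q}" "\<And>v \<tau> t. hits v \<tau> c t \<longleftrightarrow> (v p * v q) * ((\<tau> p - t) * (\<tau> q - t)) \<le> 0"
    "\<And>v. same_sign v c \<longleftrightarrow> v p * v q > 0"
proof -
  obtain c where c: "c < 3" "c = p \<and> nxt c = q \<or> c = q \<and> nxt c = p" by (rule edge_of_vertices[OF assms])
  show ?thesis
  proof (rule that[OF c(1)])
    show "{c, nxt c} = {p, q}" using c(2) by auto
    show "hits v \<tau> c t \<longleftrightarrow> (v p * v q) * ((\<tau> p - t) * (\<tau> q - t)) \<le> 0" for v \<tau> t
      using c(2) unfolding hits_def by (auto simp: ac_simps)
    show "same_sign v c \<longleftrightarrow> v p * v q > 0" for v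
      using c(2) unfolding same_sign_def by (auto simp: ac_simps)
  qed
qed

lemma hits_mirror: "hits v (\<lambda>x. - \<tau> x) c t \<longleftrightarrow> hits v \<tau> c (- t)"
  unfolding hits_def by (simp add: algebra_simps)

lemma proper_mirror: "proper v (\<lambda>x. - \<tau> x) \<longleftrightarrow> proper v \<tau>"
  unfolding proper_def inj_on_def by simp

lemma sorted_triple:
  fixes \<tau> :: "nat \<Rightarrow> real"
  assumes "inj_on \<tau> {..<3}"
  obtains x y z where "x < 3" "y < 3" "z < 3" "\<tau> x < \<tau> y" "\<tau> y < \<tau> z"
proof -
  have "\<tau> 0 \<noteq> \<tau> 1" "\<tau> 0 \<noteq> \<tau> 2" "\<tau> 1 \<noteq> \<tau> 2" by (simp_all add: inj_on_eq_iff[OF assms])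
  then consider "\<tau> 0 < \<tau> 1" "\<tau> 1 < \<tau> 2" | "\<tau> 0 < \<tau> 2" "\<tau> 2 < \<tau> 1" | "\<tau> 1 < \<tau> 0" "\<tau> 0 < \<tau> 2" | "\<tau> 1 < \<tau> 2" "\<tau> 2 < \<tau> 0" | "\<tau> 2 < \<tau> 0" "\<tau> 0 < \<tau> 1" | "\<tau> 2 < \<tau> 1" "\<tau> 1 < \<tau> 0"
    by linarith
  then show ?thesis
  proof cases
    case 1
    then show ?thesis by (rule that[rotated -2]) simp_all
  next
    case 2
    then show ?thesis by (rule that[rotated -2]) simp_all
  next
    case 3
    then show ?thesis by (rule that[rotated -2]) simp_all
  next
    case 4
    then show ?thesis by (rule that[rotated -2]) simp_all
  next
    case 5
    then show ?thesis by (rule that[rotated -2]) simp_all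
  next
    case 6
    then show ?thesis by (rule that[rotated -2]) simp_all
  qed
qed

text \<open>With equal signs the edge \<open>xy\<close> is hit exactly for \<open>t\<close> between \<open>\<tau> x\<close> and \<open>\<tau> y\<close>.\<close>

lemma linear_split:
  assumes p: "proper v \<tau>" and lin: "\<forall>x<3. \<forall>y<3. v x * v y > 0"
  obtains d d' y where "d < 3" "d' < 3" "d \<noteq> d'" "y < 3" "\<And>t. hits v \<tau> d t \<Longrightarrow> t \<le> \<tau> y" "\<And>t. hits v \<tau> d' t \<Longrightarrow> \<tau> y \<le> t"
proof -
  obtain x y z where s: "x < 3" "y < 3" "z < 3" "\<tau> x < \<tau> y" "\<tau> y < \<tau> z"
    using p sorted_triple unfolding proper_def by metis
  then have ne: "x \<noteq> y" "y \<noteq> z" "x \<noteq> z" by auto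
  obtain d where d: "d < 3" "{d, nxt d} = {x, y}" "\<And>v \<tau> t. hits v \<tau> d t \<longleftrightarrow> (v x * v y) * ((\<tau> x - t) * (\<tau> y - t)) \<le> 0"
    by (rule edge_between[OF s(1,2) ne(1)]) (rule that)
  obtain d' where d': "d' < 3" "{d', nxt d'} = {y, z}" "\<And>v \<tau> t. hits v \<tau> d' t \<longleftrightarrow> (v y * v z) * ((\<tau> y - t) * (\<tau> z - t)) \<le> 0"
    by (rule edge_between[OF s(2,3) ne(2)]) (rule that)
  have "d \<noteq> d'" using d(2) d'(2) ne by (metis doubleton_eq_iff)
  moreover have "t \<le> \<tau> y" if h: "hits v \<tau> d t" for t
  proof -
    have "v x * v y > 0" using lin s by simp
    then have "(\<tau> x - t) * (\<tau> y - t) \<le> 0" using h d(3) pos_mult_le_0 by blast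
    then show ?thesis using s(4) by (auto simp: mult_le_0_iff)
  qed
  moreover have "\<tau> y \<le> t" if h: "hits v \<tau> d' t" for t
  proof -
    have "v y * v z > 0" using lin s by simp
    then have "(\<tau> y - t) * (\<tau> z - t) \<le> 0" using h d'(3) pos_mult_le_0 by blast
    then show ?thesis using s(5) by (auto simp: mult_le_0_iff)
  qed
  ultimately show ?thesis using that[OF d(1) d'(1) _ s(2)] by metis
qed

text \<open>If two triples switch at different places, then some pair of their edges is never hit simultaneously
  on the half-line. The conditions \<open>same_sign\<close> keep track of an edge that is missed by the reference plane.\<close>

definition switch_below :: "(nat \<Rightarrow> real) \<Rightarrow> (nat \<Rightarrow> real) \<Rightarrow> real \<Rightarrow> real \<Rightarrow> nat \<Rightarrow> nat \<Rightarrow> bool" where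
  "switch_below v \<tau> \<delta> g cL cR \<longleftrightarrow> cL < 3 \<and> cR < 3 \<and> g \<in> \<tau> ` {..<3} \<and> same_sign v cL \<and>
     (\<forall>t\<le>\<delta>. (t < g \<longrightarrow> \<not> hits v \<tau> cL t) \<and> (t > g \<longrightarrow> \<not> hits v \<tau> cR t))"

definition switch_above :: "(nat \<Rightarrow> real) \<Rightarrow> (nat \<Rightarrow> real) \<Rightarrow> real \<Rightarrow> real \<Rightarrow> nat \<Rightarrow> nat \<Rightarrow> bool" where
  "switch_above v \<tau> \<delta> g cL cR \<longleftrightarrow> cL < 3 \<and> cR < 3 \<and> g \<in> \<tau> ` {..<3} \<and> same_sign v cR \<and>
     (\<forall>t\<ge>\<delta>. (t < g \<longrightarrow> \<not> hits v \<tau> cL t) \<and> (t > g \<longrightarrow> \<not> hits v \<tau> cR t))"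

lemma switch_mirror: "switch_below v (\<lambda>x. - \<tau> x) (- \<delta>) (- g) cL cR \<longleftrightarrow> switch_above v \<tau> \<delta> g cR cL"
proof -
  have "(\<forall>t\<le>- \<delta>. (t < - g \<longrightarrow> \<not> hits v \<tau> cL (- t)) \<and> (t > - g \<longrightarrow> \<not> hits v \<tau> cR (- t))) \<longleftrightarrow>
    (\<forall>t\<ge>\<delta>. (t < g \<longrightarrow> \<not> hits v \<tau> cR t) \<and> (t > g \<longrightarrow> \<not> hits v \<tau> cL t))" (is "?l \<longleftrightarrow> ?r")
  proof
    assume l: ?l
    show ?r
    proof (intro allI impI)
      fix t assume "\<delta> \<le> t"
      then show "(t < g \<longrightarrow> \<not> hits v \<tau> cR t) \<and> (t > g \<longrightarrow> \<not> hits v \<tau> cL t)" using spec[OF l, of "- t"] by simp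
    qed
  next
    assume r: ?r
    show ?l
    proof (intro allI impI)
      fix t assume "t \<le> - \<delta>"
      then show "(t < - g \<longrightarrow> \<not> hits v \<tau> cL (- t)) \<and> (t > - g \<longrightarrow> \<not> hits v \<tau> cR (- t))" using spec[OF r, of "- t"] by auto
    qed
  qed
  moreover have "- g \<in> (\<lambda>x. - \<tau> x) ` {..<3} \<longleftrightarrow> g \<in> \<tau> ` {..<3}" by auto
  ultimately show ?thesis unfolding switch_below_def switch_above_def hits_mirror by auto
qed

lemma switch_mirror': "switch_above v (\<lambda>x. - \<tau> x) (- \<delta>) (- g) cL cR \<longleftrightarrow> switch_below v \<tau> \<delta> g cR cL"
  using switch_mirror[of v "\<lambda>x. - \<tau> x" "- \<delta>" "- g" cR cL] by simp

lemma third_vertex: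
  assumes "x < 3" "y < 3" "x \<noteq> y"
  obtains z where "z < (3::nat)" "z \<noteq> x" "z \<noteq> y" "\<And>w. w < 3 \<Longrightarrow> w = x \<or> w = y \<or> w = z"
proof (rule that[of "3 - x - y"])
  show "3 - x - y < 3" "3 - x - y \<noteq> x" "3 - x - y \<noteq> y"
    using less_3_cases[OF assms(1)] less_3_cases[OF assms(2)] assms(3) by auto
  show "w = x \<or> w = y \<or> w = 3 - x - y" if "w < 3" for w
    using less_3_cases[OF assms(1)] less_3_cases[OF assms(2)] less_3_cases[OF that] assms(3) by auto
qed

text \<open>On the half-line the factors of \<open>y\<close> and \<open>z\<close> keep their signs.
  If \<open>v y\<close> and \<open>v z\<close> agree in sign, the edge \<open>yz\<close> is never
  hit. Otherwise \<open>v x\<close> agrees with exactly one of them, and when \<open>t\<close>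
  passes \<open>\<tau> x\<close>, the edge from \<open>x\<close> to that vertex stops being surely
  missed and the other edge at \<open>x\<close> starts to be missed.\<close>

lemma half_line_switch_below:
  assumes p: "proper v \<tau>" and yz: "y < 3" "z < 3" "y \<noteq> z" "\<tau> y > \<delta>" "\<tau> z > \<delta>"
  shows "(\<exists>b<3. \<forall>t\<le>\<delta>. \<not> hits v \<tau> b t) \<or> (\<exists>g bL bR. switch_below v \<tau> \<delta> g bL bR)"
proof -
  obtain x where x: "x < 3" "x \<noteq> y" "x \<noteq> z" using third_vertex[OF yz(1-3)] by metis
  have v: "v x \<noteq> 0" "v y \<noteq> 0" "v z \<noteq> 0" using p x yz unfolding proper_def by auto
  have sw: "\<exists>g bL bR. switch_below v \<tau> \<delta> g bL bR"
    if h: "y < 3" "z < 3" "x \<noteq> y" "x \<noteq> z" "\<tau> y > \<delta>" "\<tau> z > \<delta>" "v x * v y > 0" "v x * v z < 0" for y z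
  proof -
    obtain c where c: "c < 3" "{c, nxt c} = {x, y}" "\<And>v \<tau> t. hits v \<tau> c t \<longleftrightarrow> (v x * v y) * ((\<tau> x - t) * (\<tau> y - t)) \<le> 0"
      "\<And>v. same_sign v c \<longleftrightarrow> v x * v y > 0" by (rule edge_between[OF x(1) h(1,3)]) (rule that)
    obtain d where d: "d < 3" "{d, nxt d} = {x, z}" "\<And>v \<tau> t. hits v \<tau> d t \<longleftrightarrow> (v x * v z) * ((\<tau> x - t) * (\<tau> z - t)) \<le> 0"
      by (rule edge_between[OF x(1) h(2,4)]) (rule that)
    have "\<not> hits v \<tau> c t" if t: "t \<le> \<delta>" "t < \<tau> x" for t
    proof -
      have "(\<tau> x - t) * (\<tau> y - t) > 0" using t h(5) by (intro mult_pos_pos) auto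
      then show ?thesis unfolding c(3) pos_mult_le_0[OF h(7)] by simp
    qed
    moreover have "\<not> hits v \<tau> d t" if t: "t \<le> \<delta>" "t > \<tau> x" for t
    proof -
      have "(\<tau> x - t) * (\<tau> z - t) < 0" using t h(6) by (intro mult_neg_pos) auto
      then show ?thesis unfolding d(3) neg_mult_le_0[OF h(8)] by simp
    qed
    ultimately have "switch_below v \<tau> \<delta> (\<tau> x) c d"
      unfolding switch_below_def using c d h x by auto
    then show ?thesis by blast
  qed
  consider "v y * v z > 0" | "v x * v y > 0" "v x * v z < 0" | "v x * v z > 0" "v x * v y < 0"
    using v by (cases "v x > 0"; cases "v y > 0"; cases "v z > 0") (auto simp: zero_less_mult_iff mult_less_0_iff)
  then show ?thesis
  proof cases
    case 1
    obtain c where c: "c < 3" "{c, nxt c} = {y, z}" "\<And>v \<tau> t. hits v \<tau> c t \<longleftrightarrow> (v y * v z) * ((\<tau> y - t) * (\<tau> z - t)) \<le> 0"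
      by (rule edge_between[OF yz(1-3)]) (rule that)
    have "\<not> hits v \<tau> c t" if t: "t \<le> \<delta>" for t
    proof -
      have "(\<tau> y - t) * (\<tau> z - t) > 0" using t yz by (intro mult_pos_pos) auto
      then show ?thesis unfolding c(3) pos_mult_le_0[OF 1] by simp
    qed
    then show ?thesis using c(1) by blast
  next
    case 2
    then show ?thesis using sw[of y z] x yz by blast
  next
    case 3
    then show ?thesis using sw[of z y] x yz by blast
  qed
qed

text \<open>Two of the three parameters lie on the same side of \<open>\<delta>\<close>, and the
  reflection of the parameter line interchanges the sides.\<close>

lemma half_line_switch:
  assumes p: "proper v \<tau>" and \<delta>: "\<delta> \<notin> \<tau> ` {..<3}"
  shows "(\<exists>b<3. \<forall>t\<le>\<delta>. \<not> hits v \<tau> b t) \<or> (\<exists>b<3. \<forall>t\<ge>\<delta>. \<not> hits v \<tau> b t) \<or>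
    (\<exists>g bL bR. switch_below v \<tau> \<delta> g bL bR) \<or> (\<exists>g bL bR. switch_above v \<tau> \<delta> g bL bR)"
proof -
  have ne: "\<tau> 0 \<noteq> \<delta>" "\<tau> 1 \<noteq> \<delta>" "\<tau> 2 \<noteq> \<delta>" using \<delta> by auto
  have "\<exists>y<3. \<exists>z<3. y \<noteq> z \<and> (\<tau> y > \<delta> \<and> \<tau> z > \<delta> \<or> \<tau> y < \<delta> \<and> \<tau> z < \<delta>)"
  proof -
    consider "\<tau> 0 > \<delta> \<and> \<tau> 1 > \<delta> \<or> \<tau> 0 < \<delta> \<and> \<tau> 1 < \<delta>" | "\<tau> 0 > \<delta> \<and> \<tau> 2 > \<delta> \<or> \<tau> 0 < \<delta> \<and> \<tau> 2 < \<delta>"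
      | "\<tau> 1 > \<delta> \<and> \<tau> 2 > \<delta> \<or> \<tau> 1 < \<delta> \<and> \<tau> 2 < \<delta>" using ne by linarith
    then show ?thesis
    proof cases
      case 1
      then show ?thesis by (intro exI[of _ 0] exI[of _ "1::nat"] conjI) simp_all
    next
      case 2
      then show ?thesis by (intro exI[of _ 0] exI[of _ "2::nat"] conjI) simp_all
    next
      case 3
      then show ?thesis by (intro exI[of _ 1] exI[of _ "2::nat"] conjI) simp_all
    qed
  qed
  then obtain y z where yz: "y < 3" "z < 3" "y \<noteq> z" "\<tau> y > \<delta> \<and> \<tau> z > \<delta> \<or> \<tau> y < \<delta> \<and> \<tau> z < \<delta>" by blast
  show ?thesis
    using yz(4)
  proof
    assume "\<tau> y > \<delta> \<and> \<tau> z > \<delta>"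
    then show ?thesis using half_line_switch_below[OF p yz(1-3), of \<delta>] by blast
  next
    assume h: "\<tau> y < \<delta> \<and> \<tau> z < \<delta>"
    have "(\<exists>b<3. \<forall>t\<le>- \<delta>. \<not> hits v (\<lambda>x. - \<tau> x) b t) \<or> (\<exists>g bL bR. switch_below v (\<lambda>x. - \<tau> x) (- \<delta>) g bL bR)"
      by (rule half_line_switch_below[OF _ yz(1-3)]) (use h p proper_mirror in auto)
    then show ?thesis
    proof
      assume "\<exists>b<3. \<forall>t\<le>- \<delta>. \<not> hits v (\<lambda>x. - \<tau> x) b t"
      then obtain b where b: "b < 3" "\<And>t. t \<le> - \<delta> \<Longrightarrow> \<not> hits v \<tau> b (- t)" unfolding hits_mirror by blast
      have "\<not> hits v \<tau> b t" if "t \<ge> \<delta>" for t using b(2)[of "- t"] that by simp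
      then show ?thesis using b(1) by blast
    next
      assume "\<exists>g bL bR. switch_below v (\<lambda>x. - \<tau> x) (- \<delta>) g bL bR"
      then obtain g bL bR where "switch_below v (\<lambda>x. - \<tau> x) (- \<delta>) (- (- g)) bL bR" by auto
      then have "switch_above v \<tau> \<delta> (- g) bR bL" using switch_mirror[of v \<tau> \<delta> "- g"] by simp
      then show ?thesis by blast
    qed
  qed
qed

text \<open>The edge \<open>xy\<close> is only hit between \<open>\<tau> x\<close> and
  \<open>\<tau> y\<close>, and the edge \<open>wy\<close> is not hit between \<open>\<tau> w\<close>
  and \<open>\<tau> y\<close>. Outside the first interval, \<open>\<delta>\<close> bounds a
  half-line on which \<open>xy\<close> is missed; inside it, the two edges switch at
  \<open>\<tau> w\<close> below \<open>\<delta>\<close> and at \<open>\<tau> y\<close>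
  above.\<close>

lemma missed_switch_mixed:
  assumes p: "proper v \<tau>" and \<delta>: "\<delta> \<notin> \<tau> ` {..<3}" and o: "w < 3" "x < 3" "y < 3" "\<tau> w < \<tau> x" "\<tau> x < \<tau> y"
    and s: "v w * v x < 0" "v w * v y < 0" "v x * v y > 0"
  shows "(\<exists>c<3. (\<forall>t\<le>\<delta>. \<not> hits v \<tau> c t) \<or> (\<forall>t\<ge>\<delta>. \<not> hits v \<tau> c t)) \<or>
    (\<exists>g cL cR. switch_below v \<tau> \<delta> g cL cR) \<and> (\<exists>g cL cR. switch_above v \<tau> \<delta> g cL cR)"
proof -
  have ne: "x \<noteq> y" "w \<noteq> y" using o by auto
  obtain c where c: "c < 3" "{c, nxt c} = {x, y}" "\<And>v \<tau> t. hits v \<tau> c t \<longleftrightarrow> (v x * v y) * ((\<tau> x - t) * (\<tau> y - t)) \<le> 0"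
      "\<And>v. same_sign v c \<longleftrightarrow> v x * v y > 0" by (rule edge_between[OF o(2,3) ne(1)]) (rule that)
  obtain d where d: "d < 3" "{d, nxt d} = {w, y}" "\<And>v \<tau> t. hits v \<tau> d t \<longleftrightarrow> (v w * v y) * ((\<tau> w - t) * (\<tau> y - t)) \<le> 0"
      by (rule edge_between[OF o(1,3) ne(2)]) (rule that)
  have C: "\<not> hits v \<tau> c t" if "t < \<tau> x \<or> t > \<tau> y" for t
  proof -
    have "(\<tau> x - t) * (\<tau> y - t) > 0" using that o by (auto simp: zero_less_mult_iff)
    then show ?thesis unfolding c(3) pos_mult_le_0[OF s(3)] by simp
  qed
  have D: "\<not> hits v \<tau> d t" if "\<tau> w < t" "t < \<tau> y" for t
  proof -
    have "(\<tau> w - t) * (\<tau> y - t) < 0" using that by (auto simp: mult_less_0_iff)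
    then show ?thesis unfolding d(3) neg_mult_le_0[OF s(2)] by simp
  qed
  have "\<tau> x \<noteq> \<delta>" "\<tau> y \<noteq> \<delta>" using \<delta> o by auto
  then consider "\<delta> < \<tau> x" | "\<tau> y < \<delta>" | "\<tau> x < \<delta>" "\<delta> < \<tau> y" by linarith
  then show ?thesis
  proof cases
    case 1
    then have "\<forall>t\<le>\<delta>. \<not> hits v \<tau> c t" using C by auto
    then show ?thesis using c(1) by blast
  next
    case 2
    then have "\<forall>t\<ge>\<delta>. \<not> hits v \<tau> c t" using C by auto
    then show ?thesis using c(1) by blast
  next
    case 3
    have "switch_below v \<tau> \<delta> (\<tau> w) c d"
      unfolding switch_below_def using c(1,4) d(1) s(3) o 3 C D by auto
    moreover have "switch_above v \<tau> \<delta> (\<tau> y) d c"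
      unfolding switch_above_def using c(1,4) d(1) s(3) o 3 C D by auto
    ultimately show ?thesis by blast
  qed
qed

text \<open>If no edge is missed on a whole half-line, a missed triple switches on both sides of
  \<open>\<delta>\<close>, whereas \<open>half_line_switch\<close> only provides one side. If the
  missing plane has a parameter \<open>t\<close>, the signs of the heights are those of
  \<open>\<tau> x - t\<close> up to a global sign; unless all heights agree, the extreme vertices
  differ in sign and the middle one sides with one of them.\<close>

lemma missed_switch:
  assumes p: "proper v \<tau>" and m: "missed v \<tau>" and \<delta>: "\<delta> \<notin> \<tau> ` {..<3}"
  shows "(\<exists>c<3. (\<forall>t\<le>\<delta>. \<not> hits v \<tau> c t) \<or> (\<forall>t\<ge>\<delta>. \<not> hits v \<tau> c t)) \<or>
    (\<exists>g cL cR. switch_below v \<tau> \<delta> g cL cR) \<and> (\<exists>g cL cR. switch_above v \<tau> \<delta> g cL cR)"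
proof (cases "\<forall>x<3. \<forall>y<3. v x * v y > 0")
  case lin: True
  obtain d d' y where d: "d < 3" "d' < 3" "d \<noteq> d'" "y < 3" "\<And>t. hits v \<tau> d t \<Longrightarrow> t \<le> \<tau> y" "\<And>t. hits v \<tau> d' t \<Longrightarrow> \<tau> y \<le> t"
    by (rule linear_split[OF p lin]) (rule that)
  have nh: "t < \<tau> y \<Longrightarrow> \<not> hits v \<tau> d' t" "t > \<tau> y \<Longrightarrow> \<not> hits v \<tau> d t" for t using d(5,6)[of t] by auto
  have "same_sign v d" "same_sign v d'" using lin d(1,2) nxt_less unfolding same_sign_def by auto
  then have "switch_below v \<tau> \<delta> (\<tau> y) d' d" "switch_above v \<tau> \<delta> (\<tau> y) d' d"
    unfolding switch_below_def switch_above_def using d(1,2,4) nh by auto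
  then show ?thesis by blast
next
  case False
  then obtain t where t: "\<And>x y. x < 3 \<Longrightarrow> y < 3 \<Longrightarrow> (v x * (\<tau> x - t)) * (v y * (\<tau> y - t)) > 0"
    using m unfolding missed_def by blast
  have tt: "(v x * v y) * ((\<tau> x - t) * (\<tau> y - t)) > 0" if "x < 3" "y < 3" for x y
    using t[OF that] by (simp add: ac_simps)
  have ne: "\<tau> x \<noteq> t" if "x < 3" for x using tt[OF that that] by auto
  have v0: "v x \<noteq> 0" if "x < 3" for x using tt[OF that that] by auto
  have side: "v x * v y > 0 \<longleftrightarrow> (\<tau> x > t \<longleftrightarrow> \<tau> y > t)" if "x < 3" "y < 3" for x y
    using tt[OF that] ne[OF that(1)] ne[OF that(2)] by (auto simp: zero_less_mult_iff mult_less_0_iff)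
  have opp: "v x * v y < 0 \<longleftrightarrow> \<not> (\<tau> x > t \<longleftrightarrow> \<tau> y > t)" if "x < 3" "y < 3" for x y
    using side[OF that] v0[OF that(1)] v0[OF that(2)] by (auto simp: zero_less_mult_iff mult_less_0_iff)
  obtain x y z where s: "x < 3" "y < 3" "z < 3" "\<tau> x < \<tau> y" "\<tau> y < \<tau> z"
    using p sorted_triple unfolding proper_def by metis
  have all: "w = x \<or> w = y \<or> w = z" if "w < 3" for w
    using less_3_cases[OF that] less_3_cases[OF s(1)] less_3_cases[OF s(2)] less_3_cases[OF s(3)] s(4,5) by auto
  have "\<not> (\<tau> x > t)" if h: "\<tau> z > t"
  proof
    assume "\<tau> x > t"
    then have "\<tau> w > t" if "w < 3" for w using all[OF that] s by auto
    then show False using False side by blast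
  qed
  moreover have "\<tau> z > t"
  proof (rule ccontr)
    assume "\<not> \<tau> z > t"
    then have "\<not> \<tau> w > t" if "w < 3" for w using all[OF that] s by auto
    then show False using False side by blast
  qed
  ultimately have xz: "\<not> \<tau> x > t" "\<tau> z > t" by auto
  show ?thesis
  proof (cases "\<tau> y > t")
    case True
    show ?thesis
      by (rule missed_switch_mixed[OF p \<delta> s]) (use True xz side opp s in auto)
  next
    case f: False
    have *: "v z * v y < 0" "v z * v x < 0" "v y * v x > 0" using f xz side[OF s(2,1)] opp[OF s(3,2)] opp[OF s(3,1)] by auto
    have p': "proper v (\<lambda>x. - \<tau> x)" and \<delta>': "- \<delta> \<notin> (\<lambda>x. - \<tau> x) ` {..<3}" using p proper_mirror \<delta> by auto
    have "(\<exists>c<3. (\<forall>t\<le>- \<delta>. \<not> hits v (\<lambda>x. - \<tau> x) c t) \<or> (\<forall>t\<ge>- \<delta>. \<not> hits v (\<lambda>x. - \<tau> x) c t)) \<or>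
      (\<exists>g cL cR. switch_below v (\<lambda>x. - \<tau> x) (- \<delta>) g cL cR) \<and> (\<exists>g cL cR. switch_above v (\<lambda>x. - \<tau> x) (- \<delta>) g cL cR)"
      by (rule missed_switch_mixed[OF p' \<delta>' s(3,2,1) _ _ *]) (use s in auto)
    then show ?thesis
    proof (elim disjE exE conjE)
      fix c assume c: "c < 3" "\<forall>t\<le>- \<delta>. \<not> hits v (\<lambda>x. - \<tau> x) c t"
      have "\<not> hits v \<tau> c t" if "t \<ge> \<delta>" for t using spec[OF c(2), of "- t"] that unfolding hits_mirror by simp
      then show ?thesis using c(1) by blast
    next
      fix c assume c: "c < 3" "\<forall>t\<ge>- \<delta>. \<not> hits v (\<lambda>x. - \<tau> x) c t"
      have "\<not> hits v \<tau> c t" if "t \<le> \<delta>" for t using spec[OF c(2), of "- t"] that unfolding hits_mirror by simp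
      then show ?thesis using c(1) by blast
    next
      fix g cL cR g' cL' cR'
      assume "switch_below v (\<lambda>x. - \<tau> x) (- \<delta>) g cL cR" "switch_above v (\<lambda>x. - \<tau> x) (- \<delta>) g' cL' cR'"
      then have "switch_above v \<tau> \<delta> (- g) cR cL" "switch_below v \<tau> \<delta> (- g') cR' cL'"
        using switch_mirror[of v \<tau> \<delta> "- g"] switch_mirror'[of v \<tau> \<delta> "- g'"] by simp_all
      then show ?thesis by blast
    qed
  qed
qed

text \<open>Only planes with a finite parameter are excluded here. The reference plane is dealt with
  separately: it will miss the third triangle.\<close>

definition excl :: "(nat \<Rightarrow> real) \<Rightarrow> (nat \<Rightarrow> real) \<Rightarrow> (nat \<Rightarrow> real) \<Rightarrow> (nat \<Rightarrow> real) \<Rightarrow>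
    (nat \<Rightarrow> real) \<Rightarrow> (nat \<Rightarrow> real) \<Rightarrow> nat \<Rightarrow> nat \<Rightarrow> nat \<Rightarrow> bool" where
  "excl vb \<beta> vc \<gamma> vd \<delta> b c d \<longleftrightarrow> b < 3 \<and> c < 3 \<and> d < 3 \<and> \<not> (\<exists>t. hits vb \<beta> b t \<and> hits vc \<gamma> c t \<and> hits vd \<delta> d t)"

definition excl2 :: "(nat \<Rightarrow> real) \<Rightarrow> (nat \<Rightarrow> real) \<Rightarrow> (nat \<Rightarrow> real) \<Rightarrow> (nat \<Rightarrow> real) \<Rightarrow> bool" where
  "excl2 vc \<gamma> vd \<delta> \<longleftrightarrow> (\<exists>c<3. \<exists>d<3. \<not> (\<exists>t. hits vc \<gamma> c t \<and> hits vd \<delta> d t))"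

text \<open>Take the edge that is missed to the right of the smaller switching point and the edge of
  the other triple that is missed to the left of the larger one: no parameter of the half-line is
  left, and \<open>d\<close> confines the parameter to it. The second of these edges carries the
  condition \<open>same_sign\<close>.\<close>

lemma switch_below_excl:
  assumes B: "switch_below vb \<beta> y g bL bR" and C: "switch_below vc \<gamma> y h cL cR" and gh: "g \<noteq> h"
    and d: "d < 3" "\<And>t. hits vd \<delta> d t \<Longrightarrow> t \<le> y"
  obtains b c where "excl vb \<beta> vc \<gamma> vd \<delta> b c d" "same_sign vb b \<or> same_sign vc c"
proof (cases "g < h")
  case True
  have "excl vb \<beta> vc \<gamma> vd \<delta> bR cL d"
    unfolding excl_def
  proof (intro conjI notI)
    assume "\<exists>t. hits vb \<beta> bR t \<and> hits vc \<gamma> cL t \<and> hits vd \<delta> d t"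
    then obtain t where t: "hits vb \<beta> bR t" "hits vc \<gamma> cL t" "hits vd \<delta> d t" by blast
    have "t > g \<or> t < h" using True by linarith
    then show False using t d(2)[OF t(3)] B C unfolding switch_below_def by blast
  qed (use B C d(1) in \<open>auto simp: switch_below_def\<close>)
  moreover have "same_sign vc cL" using C unfolding switch_below_def by simp
  ultimately show ?thesis using that by blast
next
  case False
  have "excl vb \<beta> vc \<gamma> vd \<delta> bL cR d"
    unfolding excl_def
  proof (intro conjI notI)
    assume "\<exists>t. hits vb \<beta> bL t \<and> hits vc \<gamma> cR t \<and> hits vd \<delta> d t"
    then obtain t where t: "hits vb \<beta> bL t" "hits vc \<gamma> cR t" "hits vd \<delta> d t" by blast
    have "t < g \<or> t > h" using False gh by linarith
    then show False using t d(2)[OF t(3)] B C unfolding switch_below_def by blast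
  qed (use B C d(1) in \<open>auto simp: switch_below_def\<close>)
  moreover have "same_sign vb bL" using B unfolding switch_below_def by simp
  ultimately show ?thesis using that by blast
qed

lemma switch_above_excl:
  assumes B: "switch_above vb \<beta> y g bL bR" and C: "switch_above vc \<gamma> y h cL cR" and gh: "g \<noteq> h"
    and d: "d < 3" "\<And>t. hits vd \<delta> d t \<Longrightarrow> y \<le> t"
  obtains b c where "excl vb \<beta> vc \<gamma> vd \<delta> b c d" "same_sign vb b \<or> same_sign vc c"
proof (cases "g < h")
  case True
  have "excl vb \<beta> vc \<gamma> vd \<delta> bR cL d"
    unfolding excl_def
  proof (intro conjI notI)
    assume "\<exists>t. hits vb \<beta> bR t \<and> hits vc \<gamma> cL t \<and> hits vd \<delta> d t"
    then obtain t where t: "hits vb \<beta> bR t" "hits vc \<gamma> cL t" "hits vd \<delta> d t" by blast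
    have "t > g \<or> t < h" using True by linarith
    then show False using t d(2)[OF t(3)] B C unfolding switch_above_def by blast
  qed (use B C d(1) in \<open>auto simp: switch_above_def\<close>)
  moreover have "same_sign vb bR" using B unfolding switch_above_def by simp
  ultimately show ?thesis using that by blast
next
  case False
  have "excl vb \<beta> vc \<gamma> vd \<delta> bL cR d"
    unfolding excl_def
  proof (intro conjI notI)
    assume "\<exists>t. hits vb \<beta> bL t \<and> hits vc \<gamma> cR t \<and> hits vd \<delta> d t"
    then obtain t where t: "hits vb \<beta> bL t" "hits vc \<gamma> cR t" "hits vd \<delta> d t" by blast
    have "t < g \<or> t > h" using False gh by linarith
    then show False using t d(2)[OF t(3)] B C unfolding switch_above_def by blast
  qed (use B C d(1) in \<open>auto simp: switch_above_def\<close>)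
  moreover have "same_sign vc cR" using C unfolding switch_above_def by simp
  ultimately show ?thesis using that by blast
qed

locale three_triples =
  fixes vb \<beta> vc \<gamma> vd \<delta> :: "nat \<Rightarrow> real"
  assumes proper: "proper vb \<beta>" "proper vc \<gamma>" "proper vd \<delta>"
    and disjoint: "\<beta> ` {..<3} \<inter> \<gamma> ` {..<3} = {}" "\<beta> ` {..<3} \<inter> \<delta> ` {..<3} = {}" "\<gamma> ` {..<3} \<inter> \<delta> ` {..<3} = {}"
    and lin: "\<forall>x<3. \<forall>y<3. vd x * vd y > 0" and missed_c: "missed vc \<gamma>"
begin

abbreviation "pair \<equiv> excl2 vb \<beta> vd \<delta> \<or> excl2 vc \<gamma> vd \<delta>"

text \<open>The third triple splits the parameter line at \<open>\<delta> y\<close>. The first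
  triple may switch on one side only, but the missed second triple switches on both sides, so there
  is a common half-line on which the switching points can be compared.\<close>

lemma pair_or_word:
  "pair \<or> (\<exists>b c d. excl vb \<beta> vc \<gamma> vd \<delta> b c d \<and> (same_sign vb b \<or> same_sign vc c))"
proof -
  obtain d d' y where d: "d < 3" "d' < 3" "d \<noteq> d'" "y < 3" "\<And>t. hits vd \<delta> d t \<Longrightarrow> t \<le> \<delta> y" "\<And>t. hits vd \<delta> d' t \<Longrightarrow> \<delta> y \<le> t"
    by (rule linear_split[OF proper(3) lin]) (rule that)
  have y: "\<delta> y \<notin> \<beta> ` {..<3}" "\<delta> y \<notin> \<gamma> ` {..<3}" using disjoint d(4) by auto
  have pb: "excl2 vb \<beta> vd \<delta>" if "b < 3" "(\<forall>t\<le>\<delta> y. \<not> hits vb \<beta> b t) \<or> (\<forall>t\<ge>\<delta> y. \<not> hits vb \<beta> b t)" for b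
    unfolding excl2_def using that d by blast
  have pc: "excl2 vc \<gamma> vd \<delta>" if "c < 3" "(\<forall>t\<le>\<delta> y. \<not> hits vc \<gamma> c t) \<or> (\<forall>t\<ge>\<delta> y. \<not> hits vc \<gamma> c t)" for c
    unfolding excl2_def using that d by blast
  have ne: "g \<noteq> h" if "g \<in> \<beta> ` {..<3}" "h \<in> \<gamma> ` {..<3}" for g h using that disjoint by auto
  show ?thesis
    using missed_switch[OF proper(2) missed_c y(2)] half_line_switch[OF proper(1) y(1)]
  proof (elim disjE conjE)
    assume "\<exists>g bL bR. switch_below vb \<beta> (\<delta> y) g bL bR" "\<exists>g cL cR. switch_below vc \<gamma> (\<delta> y) g cL cR"
    then obtain g bL bR h cL cR where s: "switch_below vb \<beta> (\<delta> y) g bL bR" "switch_below vc \<gamma> (\<delta> y) h cL cR" by blast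
    have "g \<noteq> h" using s ne unfolding switch_below_def by blast
    then show ?thesis using switch_below_excl[OF s _ d(1,5)] by metis
  next
    assume "\<exists>g bL bR. switch_above vb \<beta> (\<delta> y) g bL bR" "\<exists>g cL cR. switch_above vc \<gamma> (\<delta> y) g cL cR"
    then obtain g bL bR h cL cR where s: "switch_above vb \<beta> (\<delta> y) g bL bR" "switch_above vc \<gamma> (\<delta> y) h cL cR" by blast
    have "g \<noteq> h" using s ne unfolding switch_above_def by blast
    then show ?thesis using switch_above_excl[OF s _ d(2,6)] by metis
  qed (use pb pc in blast)+
qed

text \<open>If the first triple is missed as well, both half-lines yield an excluded triple of
  edges. The two differ in \<open>d\<close>, because the two halves belong to different edges of the
  third triangle.\<close>

lemma pair_or_two_words:
  assumes missed_b: "missed vb \<beta>"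
  shows "pair \<or> (\<exists>b c d b' c' d'. excl vb \<beta> vc \<gamma> vd \<delta> b c d \<and> excl vb \<beta> vc \<gamma> vd \<delta> b' c' d' \<and> d \<noteq> d')"
proof -
  obtain d d' y where d: "d < 3" "d' < 3" "d \<noteq> d'" "y < 3" "\<And>t. hits vd \<delta> d t \<Longrightarrow> t \<le> \<delta> y" "\<And>t. hits vd \<delta> d' t \<Longrightarrow> \<delta> y \<le> t"
    by (rule linear_split[OF proper(3) lin]) (rule that)
  have y: "\<delta> y \<notin> \<beta> ` {..<3}" "\<delta> y \<notin> \<gamma> ` {..<3}" using disjoint d(4) by auto
  have pb: "excl2 vb \<beta> vd \<delta>" if "b < 3" "(\<forall>t\<le>\<delta> y. \<not> hits vb \<beta> b t) \<or> (\<forall>t\<ge>\<delta> y. \<not> hits vb \<beta> b t)" for b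
    unfolding excl2_def using that d by blast
  have pc: "excl2 vc \<gamma> vd \<delta>" if "c < 3" "(\<forall>t\<le>\<delta> y. \<not> hits vc \<gamma> c t) \<or> (\<forall>t\<ge>\<delta> y. \<not> hits vc \<gamma> c t)" for c
    unfolding excl2_def using that d by blast
  have ne: "g \<noteq> h" if "g \<in> \<beta> ` {..<3}" "h \<in> \<gamma> ` {..<3}" for g h using that disjoint by auto
  show ?thesis
    using missed_switch[OF proper(2) missed_c y(2)] missed_switch[OF proper(1) missed_b y(1)]
  proof (elim disjE conjE)
    assume a: "\<exists>g bL bR. switch_below vb \<beta> (\<delta> y) g bL bR" "\<exists>g cL cR. switch_below vc \<gamma> (\<delta> y) g cL cR"
      "\<exists>g bL bR. switch_above vb \<beta> (\<delta> y) g bL bR" "\<exists>g cL cR. switch_above vc \<gamma> (\<delta> y) g cL cR"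
    from a(1,2) obtain g bL bR h cL cR where s: "switch_below vb \<beta> (\<delta> y) g bL bR" "switch_below vc \<gamma> (\<delta> y) h cL cR" by blast
    have "g \<noteq> h" using s ne unfolding switch_below_def by blast
    then obtain b c where bc: "excl vb \<beta> vc \<gamma> vd \<delta> b c d" using switch_below_excl[OF s _ d(1,5)] by metis
    from a(3,4) obtain g bL bR h cL cR where s: "switch_above vb \<beta> (\<delta> y) g bL bR" "switch_above vc \<gamma> (\<delta> y) h cL cR" by blast
    have "g \<noteq> h" using s ne unfolding switch_above_def by blast
    then obtain b' c' where "excl vb \<beta> vc \<gamma> vd \<delta> b' c' d'" using switch_above_excl[OF s _ d(2,6)] by metis
    then show ?thesis using bc d(3) by blast
  qed (use pb pc in blast)+
qed

text \<open>Both triples split, at different parameters. An edge confined to the left of the smaller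
  one and an edge confined to the right of the larger one are never hit together.\<close>

lemma linear_pair:
  assumes "\<forall>x<3. \<forall>y<3. vc x * vc y > 0"
  shows "excl2 vc \<gamma> vd \<delta>"
proof -
  obtain d d' y where d: "d < 3" "d' < 3" "d \<noteq> d'" "y < 3" "\<And>t. hits vd \<delta> d t \<Longrightarrow> t \<le> \<delta> y" "\<And>t. hits vd \<delta> d' t \<Longrightarrow> \<delta> y \<le> t"
    by (rule linear_split[OF proper(3) lin]) (rule that)
  obtain c c' x where c: "c < 3" "c' < 3" "c \<noteq> c'" "x < 3" "\<And>t. hits vc \<gamma> c t \<Longrightarrow> t \<le> \<gamma> x" "\<And>t. hits vc \<gamma> c' t \<Longrightarrow> \<gamma> x \<le> t"
    by (rule linear_split[OF proper(2) assms]) (rule that)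
  have "\<gamma> x \<noteq> \<delta> y" using disjoint c(4) d(4) by auto
  then show ?thesis
  proof (cases "\<gamma> x < \<delta> y")
    case True
    then have "\<not> (\<exists>t. hits vc \<gamma> c t \<and> hits vd \<delta> d' t)" using c(5) d(6) by fastforce
    then show ?thesis unfolding excl2_def using c(1) d(2) by blast
  next
    case False
    then have "\<not> (\<exists>t. hits vc \<gamma> c' t \<and> hits vd \<delta> d t)" using c(6) d(5) \<open>\<gamma> x \<noteq> \<delta> y\<close> by fastforce
    then show ?thesis unfolding excl2_def using c(2) d(1) by blast
  qed
qed

end

section \<open>Triangles in general position\<close>

text \<open>No plane through the line of the edge \<open>e i\<close> meets the other three edges.\<close>
definition certified :: "(nat \<Rightarrow> nat \<Rightarrow> real^3) \<Rightarrow> nat \<Rightarrow> (nat \<Rightarrow> nat) \<Rightarrow> bool" where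
  "certified V i e \<longleftrightarrow> (\<forall>n. n \<noteq> 0 \<longrightarrow> n \<bullet> (V i (nxt (e i)) - V i (e i)) = 0 \<longrightarrow>
     (\<exists>k\<in>{1..4} - {i}. (n \<bullet> (V k (e k) - V i (e i))) * (n \<bullet> (V k (nxt (e k)) - V i (e i))) > 0))"

text \<open>The two shapes of a set of three choices (each with the index of its certificate) that can be discarded:
  a common tangent realising one of them still realises two choices outside the set.\<close>

definition fixed_triple :: "((nat \<Rightarrow> nat) \<times> nat) set \<Rightarrow> bool" where
  "fixed_triple R \<longleftrightarrow> (\<exists>i j k a c d. {i, j, k} \<subseteq> {1..4} \<and> distinct [i, j, k] \<and> a < 3 \<and> c < 3 \<and> d < 3 \<and>
     R = {(e, x). e \<in> choices \<and> x = i \<and> e i = a \<and> e j = c \<and> e k = d})"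

definition three_words :: "((nat \<Rightarrow> nat) \<times> nat) set \<Rightarrow> bool" where
  "three_words R \<longleftrightarrow> (\<exists>i i' x y z. {i, i'} \<subseteq> {1..4} \<and> {x, y, z} \<subseteq> choices \<and> z \<noteq> x \<and> z \<noteq> y \<and> x i \<noteq> y i \<and>
     R = {(x, i), (y, i), (z, i')})"

lemma same_sign_twice:
  assumes "k < 3" "k' < 3" "k \<noteq> k'" "same_sign v k" "same_sign v k'"
  shows "\<forall>x<3. \<forall>y<3. v x * v y > 0"
proof -
  have "(v 0 > 0 \<and> v 1 > 0 \<and> v 2 > 0) \<or> (v 0 < 0 \<and> v 1 < 0 \<and> v 2 < 0)"
    using less_3_cases[OF assms(1)] less_3_cases[OF assms(2)] assms(3-5) unfolding same_sign_def
    by (auto simp: zero_less_mult_iff)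
  then have "(\<forall>x<3. v x > 0) \<or> (\<forall>x<3. v x < 0)" using less_3_cases by metis
  then show ?thesis by (auto simp: mult_neg_neg)
qed

text \<open>The planes through a line form a projective line: \<open>N\<close> is its point at
  infinity and \<open>s\<close> the affine coordinate.\<close>

lemma normal_decomposition:
  fixes n w N :: "real^3"
  assumes w: "w \<noteq> 0" and N: "N \<noteq> 0" "N \<bullet> w = 0" and n: "n \<noteq> 0" "n \<bullet> w = 0"
  obtains \<beta> where "\<beta> \<noteq> 0" "n = \<beta> *\<^sub>R N" | \<alpha> s where "\<alpha> \<noteq> 0" "n = \<alpha> *\<^sub>R ((w \<times> N) - s *\<^sub>R N)"
proof -
  note t1 = that(1) and t2 = that(2)
  let ?M = "w \<times> N"
  have M0: "?M \<noteq> 0" by (rule cross_perp_nonzero[OF N(2,1) w])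
  have Mw: "?M \<bullet> w = 0" and MN: "?M \<bullet> N = 0" by (simp_all add: dot_cross_self)
  define \<alpha> where "\<alpha> = (n \<bullet> ?M) / (?M \<bullet> ?M)"
  define \<beta> where "\<beta> = (n \<bullet> N) / (N \<bullet> N)"
  define r where "r = n - \<alpha> *\<^sub>R ?M - \<beta> *\<^sub>R N"
  have rw: "w \<bullet> r = 0" using Mw N n unfolding r_def by (simp add: inner_diff_right inner_commute)
  have rN: "N \<bullet> r = 0" using MN N(1) unfolding r_def \<beta>_def by (simp add: inner_diff_right inner_commute)
  obtain c where c: "r = c *\<^sub>R ?M" using perp_two[OF rw rN M0] by metis
  have "r \<bullet> ?M = n \<bullet> ?M - \<alpha> * (?M \<bullet> ?M) - \<beta> * (?M \<bullet> N)"
    unfolding r_def by (simp add: inner_diff_left inner_commute[of N ?M])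
  then have "r \<bullet> ?M = 0" using MN M0 unfolding \<alpha>_def by simp
  then have "r = 0" using c M0 by simp
  then have dec: "n = \<alpha> *\<^sub>R ?M + \<beta> *\<^sub>R N" unfolding r_def by (simp add: algebra_simps)
  show ?thesis
  proof (cases "\<alpha> = 0")
    case True
    then have "n = \<beta> *\<^sub>R N" using dec by simp
    then show ?thesis using t1[of \<beta>] n(1) by auto
  next
    case False
    then have "n = \<alpha> *\<^sub>R (?M - (- \<beta> / \<alpha>) *\<^sub>R N)" using dec by (simp add: algebra_simps)
    then show ?thesis using t2[of \<alpha>] False by blast
  qed
qed

locale generic_triangles =
  fixes V :: "nat \<Rightarrow> nat \<Rightarrow> real^3"
  assumes generic: "\<And>i j k l a b c d. \<lbrakk>i \<in> {1..4}; j \<in> {1..4}; k \<in> {1..4}; l \<in> {1..4}; a < 3; b < 3; c < 3; d < 3;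
      distinct [(i, a), (j, b), (k, c), (l, d)]\<rbrakk> \<Longrightarrow> (V j b - V i a) \<bullet> ((V k c - V i a) \<times> (V l d - V i a)) \<noteq> 0"
    and hulls: "\<And>i j. \<lbrakk>i \<in> {1..4}; j \<in> {1..4}; i \<noteq> j\<rbrakk> \<Longrightarrow> convex hull (V i ` {..<3}) \<inter> convex hull (V j ` {..<3}) = {}"
begin

definition dir :: "nat \<Rightarrow> nat \<Rightarrow> real^3" where "dir i a = V i (nxt a) - V i a"

definition sep :: "nat \<Rightarrow> nat \<Rightarrow> nat \<Rightarrow> bool" where
  "sep i a j \<longleftrightarrow> (\<exists>n. n \<bullet> dir i a = 0 \<and> (\<forall>x<3. n \<bullet> (V j x - V i a) > 0))"

text \<open>Up to the length of the normal, the signed distance of a vertex of triangle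
  \<open>j\<close> from the plane of triangle \<open>i\<close>.\<close>

definition height :: "nat \<Rightarrow> nat \<Rightarrow> nat \<Rightarrow> real" where
  "height i j x = ((V i 1 - V i 0) \<times> (V i 2 - V i 0)) \<bullet> (V j x - V i 0)"

definition misses :: "nat \<Rightarrow> nat \<Rightarrow> bool" where
  "misses i j \<longleftrightarrow> (\<forall>x<3. \<forall>y<3. height i j x * height i j y > 0)"

lemma height_base:
  assumes "a < 3"
  shows "((V i 1 - V i 0) \<times> (V i 2 - V i 0)) \<bullet> (z - V i a) = ((V i 1 - V i 0) \<times> (V i 2 - V i 0)) \<bullet> (z - V i 0)"
proof -
  have "((V i 1 - V i 0) \<times> (V i 2 - V i 0)) \<bullet> (V i a - V i 0) = 0"
    using less_3_cases[OF assms] by (auto simp: dot_cross_self)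
  then show ?thesis by (simp add: inner_diff_right)
qed

lemma normal_perp_dir:
  assumes "a < 3"
  shows "((V i 1 - V i 0) \<times> (V i 2 - V i 0)) \<bullet> dir i a = 0"
  using height_base[OF assms, of i "V i (nxt a)"] height_base[OF nxt_less, of i "V i (nxt a)" a]
  unfolding dir_def by simp

lemma independent:
  assumes "i \<in> {1..4}" "a < 3" "j \<in> {1..4}" "j \<noteq> i" "x < 3" "k \<in> {1..4}" "k \<noteq> i" "y < 3" "(j, x) \<noteq> (k, y)"
  shows "dir i a \<bullet> ((V j x - V i a) \<times> (V k y - V i a)) \<noteq> 0"
  unfolding dir_def using assms nxt_neq[of a] by (intro generic) (auto simp: nxt_less)

lemma height_nonzero:
  assumes "i \<in> {1..4}" "j \<in> {1..4}" "j \<noteq> i" "x < 3"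
  shows "height i j x \<noteq> 0"
proof -
  have "(V j x - V i 0) \<bullet> ((V i 1 - V i 0) \<times> (V i 2 - V i 0)) \<noteq> 0"
    using assms by (intro generic) auto
  then show ?thesis unfolding height_def by (simp add: inner_commute)
qed

lemma dir_nonzero: "i \<in> {1..4} \<Longrightarrow> a < 3 \<Longrightarrow> dir i a \<noteq> 0"
proof -
  assume i: "i \<in> {1..4}" "a < 3"
  obtain j :: nat where j: "j \<in> {1..4}" "j \<noteq> i" using that[of 1] that[of 2] by (cases "i = 1") auto
  show ?thesis using independent[OF i j, of 0 j 1] j by auto
qed

lemma sep_if_misses:
  assumes i: "i \<in> {1..4}" "a < 3" and m: "misses i j"
  shows "sep i a j"
proof -
  let ?n = "(V i 1 - V i 0) \<times> (V i 2 - V i 0)"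
  have perp: "?n \<bullet> dir i a = 0" by (rule normal_perp_dir[OF i(2)])
  have h: "?n \<bullet> (V j x - V i a) = height i j x" for x using height_base[OF i(2)] unfolding height_def .
  show ?thesis
  proof (cases "height i j 0 > 0")
    case True
    have "height i j x > 0" if "x < 3" for x
    proof -
      have "height i j 0 * height i j x > 0" using m that unfolding misses_def by simp
      then show ?thesis using True by (simp add: zero_less_mult_iff)
    qed
    then show ?thesis unfolding sep_def using perp h by (intro exI[of _ ?n]) simp
  next
    case False
    have "height i j x < 0" if "x < 3" for x
    proof -
      have "height i j 0 * height i j x > 0" using m that unfolding misses_def by simp
      then show ?thesis using False by (simp add: zero_less_mult_iff)
    qed
    then show ?thesis unfolding sep_def using perp h by (intro exI[of _ "- ?n"]) simp
  qed
qed

text \<open>Otherwise the line of the edge is disjoint from the triangle \<open>j\<close> and can be separated from it.\<close>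

lemma same_sign_if_not_sep:
  assumes i: "i \<in> {1..4}" "a < 3" and j: "j \<in> {1..4}" "j \<noteq> i" and ns: "\<not> sep i a j"
  shows "same_sign (height j i) a"
proof (rule ccontr)
  assume "\<not> same_sign (height j i) a"
  moreover have "height j i a \<noteq> 0" "height j i (nxt a) \<noteq> 0"
    using height_nonzero[OF j(1) i(1)] j(2) i(2) nxt_less by auto
  ultimately have neg: "height j i a * height j i (nxt a) < 0"
    unfolding same_sign_def by (simp add: not_less less_le)
  let ?L = "affine hull {V i a, V i (nxt a)}" and ?T = "convex hull (V j ` {..<3})"
  let ?n = "(V j 1 - V j 0) \<times> (V j 2 - V j 0)"
  have L: "x \<in> ?L \<longleftrightarrow> (\<exists>s. x = V i a + s *\<^sub>R dir i a)" for x
    unfolding affine_hull_2_alt dir_def by auto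
  have plane: "?n \<bullet> (z - V j 0) = 0" if "z \<in> ?T" for z
  proof -
    have "convex {x. ?n \<bullet> x = ?n \<bullet> V j 0}" by (rule convex_hyperplane)
    moreover have "V j ` {..<3} \<subseteq> {x. ?n \<bullet> x = ?n \<bullet> V j 0}"
    proof
      fix x assume "x \<in> V j ` {..<3}"
      then obtain b where b: "b < 3" "x = V j b" by auto
      show "x \<in> {x. ?n \<bullet> x = ?n \<bullet> V j 0}"
        using height_base[OF b(1), of j x] unfolding b(2) by (simp add: inner_diff_right)
    qed
    ultimately have "?T \<subseteq> {x. ?n \<bullet> x = ?n \<bullet> V j 0}" by (rule hull_minimal[rotated])
    then show ?thesis using that by (auto simp: inner_diff_right)
  qed
  have "?L \<inter> ?T = {}"
  proof (rule ccontr)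
    assume "?L \<inter> ?T \<noteq> {}"
    then obtain z where z': "z \<in> ?T" "z \<in> ?L" by auto
    obtain s where z: "z \<in> ?T" "z = V i a + s *\<^sub>R dir i a" using z'(1) z'(2)[unfolded L] by auto
    have "z - V j 0 = (1 - s) *\<^sub>R (V i a - V j 0) + s *\<^sub>R (V i (nxt a) - V j 0)"
      unfolding z(2) dir_def by (simp add: algebra_simps)
    then have e: "(1 - s) * height j i a + s * height j i (nxt a) = 0"
      using plane[OF z(1)] unfolding height_def by (simp add: inner_add_right)
    define P where "P = height j i a"
    define Q where "Q = height j i (nxt a)"
    \<comment> \<open>Since \<open>P\<close> and \<open>Q\<close> have opposite signs,
      \<open>s\<close> lies in the unit interval. The line would then meet triangle \<open>j\<close>
      in a point of the edge itself, although the triangles are disjoint.\<close>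
    have "(1 - s) * (P * P) + s * (P * Q) = 0"
    proof -
      have "(1 - s) * (P * P) + s * (P * Q) = P * ((1 - s) * P + s * Q)" by (simp add: algebra_simps)
      then show ?thesis using e unfolding P_def Q_def by simp
    qed
    moreover have "P * P > 0" "P * Q < 0" using neg unfolding P_def Q_def by (auto simp: zero_less_mult_iff mult_less_0_iff)
    ultimately have s: "0 \<le> s" "s \<le> 1"
    proof -
      assume a: "(1 - s) * (P * P) + s * (P * Q) = 0" "P * P > 0" "P * Q < 0"
      show "0 \<le> s"
      proof (rule ccontr)
        assume "\<not> 0 \<le> s"
        then have "(1 - s) * (P * P) > 0" "s * (P * Q) > 0" using a by (auto intro: mult_pos_pos mult_neg_neg)
        then show False using a(1) by simp
      qed
      show "s \<le> 1"
      proof (rule ccontr)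
        assume "\<not> s \<le> 1"
        then have "(1 - s) * (P * P) < 0" "s * (P * Q) < 0" using a by (auto intro: mult_neg_pos mult_pos_neg)
        then show False using a(1) by simp
      qed
    qed
    have "z = (1 - s) *\<^sub>R V i a + s *\<^sub>R V i (nxt a)" unfolding z(2) dir_def by (simp add: algebra_simps)
    then have "z \<in> closed_segment (V i a) (V i (nxt a))" using s unfolding closed_segment_def by auto
    moreover have "closed_segment (V i a) (V i (nxt a)) \<subseteq> convex hull (V i ` {..<3})"
      by (rule closed_segment_subset) (use i nxt_less in \<open>auto intro!: hull_inc\<close>)
    ultimately show False using z(1) hulls[OF i(1) j(1)] j(2) by auto
  qed
  moreover have "compact ?T" by (intro finite_imp_compact_convex_hull) auto
  moreover have "?T \<noteq> {}" by (simp add: lessThan_empty_iff)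
  moreover have "convex ?L" "closed ?L" by (simp_all add: affine_imp_convex)
  ultimately obtain n b where nb: "\<forall>x\<in>?L. n \<bullet> x < b" "\<forall>x\<in>?T. n \<bullet> x > b"
    using separating_hyperplane_closed_compact[of ?L ?T] convex_convex_hull[of "V j ` {..<3}" ] by metis
  have Lb: "n \<bullet> V i a + s * (n \<bullet> dir i a) < b" for s
  proof -
    have "V i a + s *\<^sub>R dir i a \<in> ?L" using L by blast
    then have "n \<bullet> (V i a + s *\<^sub>R dir i a) < b" using nb(1) by (rule bspec[rotated])
    then show ?thesis by (simp add: inner_add_right)
  qed
  \<comment> \<open>A linear function that is bounded above on a whole line is constant on
    it.\<close>
  have "n \<bullet> dir i a = 0"
  proof (rule ccontr)
    assume "n \<bullet> dir i a \<noteq> 0"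
    then show False using Lb[of "(b - n \<bullet> V i a) / (n \<bullet> dir i a)"] by simp
  qed
  moreover have "n \<bullet> (V j x - V i a) > 0" if "x < 3" for x
  proof -
    have "V j x \<in> ?T" using that by (auto intro: hull_inc)
    then have "n \<bullet> V j x > b" using nb(2) by (rule bspec[rotated])
    then show ?thesis using Lb[of 0] by (simp add: inner_diff_right)
  qed
  ultimately show False using ns unfolding sep_def by blast
qed

text \<open>Each of the two edges lies strictly on one side of the plane of \<open>j\<close>, and
  two edges share a vertex and cover all three.\<close>

lemma misses_if_two_not_sep:
  assumes i: "i \<in> {1..4}" and j: "j \<in> {1..4}" "j \<noteq> i" and a: "a < 3" "a' < 3" "a \<noteq> a'" "\<not> sep i a j" "\<not> sep i a' j"
  shows "misses j i"
  unfolding misses_def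
  by (rule same_sign_twice[OF a(1-3)]) (use same_sign_if_not_sep[OF i _ j] a in auto)

text \<open>A plane that can serve as the reference plane: it avoids the vertices of the other
  triangles, which makes their parameters finite, and misses triangle \<open>k\<close>.\<close>

definition cut :: "nat \<Rightarrow> nat \<Rightarrow> real^3 \<Rightarrow> nat \<Rightarrow> bool" where
  "cut i a N k \<longleftrightarrow> N \<bullet> dir i a = 0 \<and> (\<forall>j\<in>{1..4} - {i}. \<forall>x<3. N \<bullet> (V j x - V i a) \<noteq> 0) \<and>
     (\<forall>x<3. \<forall>y<3. (N \<bullet> (V k x - V i a)) * (N \<bullet> (V k y - V i a)) > 0)"

lemma cut_if_misses:
  assumes i: "i \<in> {1..4}" "a < 3" and m: "misses i k"
  shows "cut i a ((V i 1 - V i 0) \<times> (V i 2 - V i 0)) k"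
proof -
  let ?n = "(V i 1 - V i 0) \<times> (V i 2 - V i 0)"
  have perp: "?n \<bullet> dir i a = 0" by (rule normal_perp_dir[OF i(2)])
  have h: "?n \<bullet> (V j x - V i a) = height i j x" for x j using height_base[OF i(2)] unfolding height_def .
  show ?thesis unfolding cut_def h using perp m height_nonzero[OF i(1)] unfolding misses_def by simp
qed

text \<open>The separating plane may contain vertices of other triangles. A small turn about the
  edge line moves it off these vertices and preserves the strict inequalities.\<close>

lemma cut_if_sep:
  assumes i: "i \<in> {1..4}" "a < 3" and k: "k \<in> {1..4}" "k \<noteq> i" and s: "sep i a k"
  obtains N where "cut i a N k"
proof -
  obtain n where n: "n \<bullet> dir i a = 0" "\<And>x. x < 3 \<Longrightarrow> n \<bullet> (V k x - V i a) > 0" using s unfolding sep_def by blast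
  have n0: "n \<noteq> 0" using n(2)[of 0] by auto
  let ?M = "dir i a \<times> n"
  \<comment> \<open>A vertex on which both normals vanish would lie on the edge line, against
    general position.\<close>
  have indep: "?M \<bullet> (V j x - V i a) \<noteq> 0" if h: "j \<in> {1..4} - {i}" "x < 3" "n \<bullet> (V j x - V i a) = 0" for j x
  proof
    let ?x = "V j x - V i a" and ?w = "dir i a"
    assume "?M \<bullet> ?x = 0"
    moreover have "?M \<bullet> ?x = n \<bullet> (?x \<times> ?w)" by (simp add: cross3_def inner_vec_def sum_3 algebra_simps)
    moreover have "n \<times> (?x \<times> ?w) = 0" using h(3) n(1) by (simp add: Lagrange)
    ultimately have z: "?x \<times> ?w = 0" using n0 norm_and_cross_eq_0[of n "?x \<times> ?w"] by auto
    obtain y where y: "y < 3" "y \<noteq> x" using h(2) by (metis nxt_less nxt_neq)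
    have "?w \<bullet> (?x \<times> (V j y - V i a)) = - ((?x \<times> ?w) \<bullet> (V j y - V i a))"
      by (simp add: cross3_def inner_vec_def sum_3 algebra_simps)
    then show False using independent[OF i, of j x j y] h y z by auto
  qed
  let ?N = "\<lambda>\<epsilon>. n + \<epsilon> *\<^sub>R ?M"
  have lim: "((\<lambda>\<epsilon>. ?N \<epsilon> \<bullet> z) \<longlongrightarrow> n \<bullet> z) (at 0)" for z :: "real^3"
    by (rule tendsto_eq_intros refl)+ simp
  have nz: "\<forall>\<^sub>F \<epsilon> in at 0. ?N \<epsilon> \<bullet> (V j x - V i a) \<noteq> 0" if h: "j \<in> {1..4} - {i}" "x < 3" for j x
  proof (cases "n \<bullet> (V j x - V i a) = 0")
    case True
    have "\<forall>\<^sub>F \<epsilon> in at (0::real). \<epsilon> \<noteq> 0" by (simp add: eventually_at_filter)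
    then show ?thesis by eventually_elim (use indep[OF h True] True in \<open>simp add: inner_add_left\<close>)
  next
    case False
    then show ?thesis by (rule tendsto_imp_eventually_ne[OF lim])
  qed
  have pos: "\<forall>\<^sub>F \<epsilon> in at 0. ?N \<epsilon> \<bullet> (V k x - V i a) > 0" if "x < 3" for x
    by (rule order_tendstoD(1)[OF lim n(2)[OF that]])
  have ev: "\<forall>\<^sub>F \<epsilon> in at 0. (\<forall>j\<in>{1..4} - {i}. \<forall>x\<in>{..<3}. ?N \<epsilon> \<bullet> (V j x - V i a) \<noteq> 0) \<and> (\<forall>x\<in>{..<3}. ?N \<epsilon> \<bullet> (V k x - V i a) > 0)"
    by (intro eventually_conj eventually_ball_finite ballI nz pos) auto
  obtain \<epsilon> where e: "\<forall>j\<in>{1..4} - {i}. \<forall>x\<in>{..<3}. ?N \<epsilon> \<bullet> (V j x - V i a) \<noteq> 0" "\<forall>x\<in>{..<3}. ?N \<epsilon> \<bullet> (V k x - V i a) > 0"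
    using eventually_happens'[OF at_neq_bot ev] by (elim exE conjE)
  have "?N \<epsilon> \<bullet> dir i a = 0" using n(1) by (simp add: inner_add_left dot_cross_self)
  then have "cut i a (?N \<epsilon>) k" unfolding cut_def using e by simp
  then show ?thesis by (rule that)
qed

end

section \<open>Certificates from the pencil of planes at one edge\<close>

definition solved :: "(nat \<Rightarrow> nat \<Rightarrow> real^3) \<Rightarrow> bool" where
  "solved V \<longleftrightarrow> (\<exists>R. (fixed_triple R \<or> three_words R) \<and> (\<forall>(e, x)\<in>R. certified V x e))"

lemma pos_scale:
  fixes c u v :: real
  assumes "(c * u) * (c * v) > 0"
  shows "u * v > 0"
proof (rule ccontr)
  assume "\<not> ?thesis"
  then have "(c * c) * (u * v) \<le> 0" by (simp add: mult_nonneg_nonpos)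
  then show False using assms by (simp add: ac_simps)
qed

lemma nonpos_scale:
  fixes c u v :: real
  assumes "\<not> (c * u) * (c * v) > 0" "c \<noteq> 0"
  shows "u * v \<le> 0"
proof (rule ccontr)
  assume "\<not> ?thesis"
  moreover have "c * c > 0" using assms(2) by (metis not_real_square_gt_zero)
  ultimately have "(c * c) * (u * v) > 0" by (simp add: mult_pos_pos)
  then show False using assms(1) by (simp add: ac_simps)
qed

lemma solved_three_words:
  assumes "i \<in> {1..4}" "i' \<in> {1..4}" "x \<in> choices" "y \<in> choices" "z \<in> choices" "x i \<noteq> y i" "z \<noteq> x" "z \<noteq> y"
    "certified V i x" "certified V i y" "certified V i' z"
  shows "solved V"
proof -
  have "three_words {(x, i), (y, i), (z, i')}"
    unfolding three_words_def using assms(1-8)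
    by (intro exI[of _ i] exI[of _ i'] exI[of _ x] exI[of _ y] exI[of _ z]) simp
  then show ?thesis unfolding solved_def using assms(9-11)
    by (intro exI[of _ "{(x, i), (y, i), (z, i')}"]) simp
qed

lemma quad_exists:
  assumes I: "{1..4} = {i, B, C, D}" "distinct [i, B, C, D]" and "a < 3" "b < 3" "c < 3" "d < 3"
  obtains e where "e \<in> choices" "e i = a" "e B = b" "e C = c" "e D = d"
proof (rule that)
  let ?e = "restrict (\<lambda>x. if x = i then a else if x = B then b else if x = C then c else d) {1..4}"
  show "?e \<in> choices" unfolding choices_def using assms(3-6) by (auto intro!: restrict_PiE)
  have "i \<in> {1..4}" "B \<in> {1..4}" "C \<in> {1..4}" "D \<in> {1..4}" unfolding I(1) by simp_all
  then show "?e i = a" "?e B = b" "?e C = c" "?e D = d" using I(2) by auto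
qed

text \<open>The pencil at the edge \<open>a\<close> of triangle \<open>i\<close>, written in heights
  \<open>val\<close> over the plane \<open>N\<close> and parameters \<open>tau\<close>. The triangle
  \<open>D\<close> is the one that the reference plane misses.\<close>

locale row = generic_triangles +
  fixes i a B C D :: nat and N :: "real^3"
  assumes indices: "{1..4} = {i, B, C, D}" "distinct [i, B, C, D]" and a: "a < 3" and cut: "cut i a N D"
begin

lemma mem: "i \<in> {1..4}" "B \<in> {1..4}" "C \<in> {1..4}" "D \<in> {1..4}"
  unfolding indices(1) by simp_all

lemma neq: "B \<noteq> i" "C \<noteq> i" "D \<noteq> i" "B \<noteq> C" "B \<noteq> D" "C \<noteq> D"
  using indices(2) by auto

definition val :: "nat \<Rightarrow> nat \<Rightarrow> real" where "val j x = N \<bullet> (V j x - V i a)"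

definition tau :: "nat \<Rightarrow> nat \<Rightarrow> real" where "tau j x = ((dir i a \<times> N) \<bullet> (V j x - V i a)) / val j x"

lemma N: "N \<noteq> 0" "N \<bullet> dir i a = 0"
proof -
  show "N \<bullet> dir i a = 0" using cut unfolding cut_def by simp
  have "(N \<bullet> (V D 0 - V i a)) * (N \<bullet> (V D 0 - V i a)) > 0" using cut unfolding cut_def by simp
  then show "N \<noteq> 0" by auto
qed

lemma val_nonzero: "j \<in> {1..4} \<Longrightarrow> j \<noteq> i \<Longrightarrow> x < 3 \<Longrightarrow> val j x \<noteq> 0"
  using cut unfolding cut_def val_def by simp

lemma val_D: "\<forall>x<3. \<forall>y<3. val D x * val D y > 0"
  using cut unfolding cut_def val_def by simp

text \<open>Equal parameters would put both vertices into one plane through the edge line. The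
  identity for cross products turns this into a vanishing determinant of four vertices.\<close>

lemma tau_neq:
  assumes j: "j \<in> {1..4}" "j \<noteq> i" "x < 3" and k: "k \<in> {1..4}" "k \<noteq> i" "y < 3" and ne: "(j, x) \<noteq> (k, y)"
  shows "tau j x \<noteq> tau k y"
proof
  let ?w = "dir i a" and ?x = "V j x - V i a" and ?y = "V k y - V i a"
  assume "tau j x = tau k y"
  then have "((?w \<times> N) \<bullet> ?x) * (N \<bullet> ?y) - ((?w \<times> N) \<bullet> ?y) * (N \<bullet> ?x) = 0"
    using val_nonzero[OF j] val_nonzero[OF k] unfolding tau_def val_def by (simp add: field_simps)
  moreover have "((?w \<times> N) \<bullet> ?x) * (N \<bullet> ?y) - ((?w \<times> N) \<bullet> ?y) * (N \<bullet> ?x) = ((?w \<times> N) \<times> N) \<bullet> (?x \<times> ?y)"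
    by (simp add: dot_cross mult.commute)
  moreover have "(?w \<times> N) \<times> N = - ((N \<bullet> N) *\<^sub>R ?w)"
    using N(2) by (simp add: cross_skew[of "?w \<times> N" N] Lagrange)
  ultimately have "(N \<bullet> N) * (?w \<bullet> (?x \<times> ?y)) = 0" by simp
  then show False using independent[OF mem(1) a j k ne] N(1) by simp
qed

lemma proper_row: "j \<in> {1..4} \<Longrightarrow> j \<noteq> i \<Longrightarrow> proper (val j) (tau j)"
  unfolding proper_def inj_on_def using val_nonzero tau_neq by (metis lessThan_iff prod.inject)

lemma tau_disjoint: "j \<in> {1..4} \<Longrightarrow> j \<noteq> i \<Longrightarrow> k \<in> {1..4} \<Longrightarrow> k \<noteq> i \<Longrightarrow> j \<noteq> k \<Longrightarrow> tau j ` {..<3} \<inter> tau k ` {..<3} = {}"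
  using tau_neq by fastforce

lemma normal_cases:
  assumes "n \<noteq> 0" "n \<bullet> dir i a = 0"
  obtains \<beta> where "\<beta> \<noteq> 0" "\<And>j x. n \<bullet> (V j x - V i a) = \<beta> * val j x"
    | \<alpha> s where "\<alpha> \<noteq> 0" "\<And>j x. j \<in> {1..4} \<Longrightarrow> j \<noteq> i \<Longrightarrow> x < 3 \<Longrightarrow> n \<bullet> (V j x - V i a) = \<alpha> * (val j x * (tau j x - s))"
proof -
  note t = that
  show ?thesis
  proof (rule normal_decomposition[OF dir_nonzero[OF mem(1) a] N assms])
    fix \<beta> assume "\<beta> \<noteq> 0" "n = \<beta> *\<^sub>R N"
    then show ?thesis by (intro t(1)[of \<beta>]) (simp_all add: val_def)
  next
    fix \<alpha> s assume n: "\<alpha> \<noteq> 0" "n = \<alpha> *\<^sub>R ((dir i a \<times> N) - s *\<^sub>R N)"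
    show ?thesis
    proof (rule t(2)[OF n(1), of s])
      fix j x assume j: "j \<in> {1..4}" "j \<noteq> i" "x < (3::nat)"
      have "(dir i a \<times> N) \<bullet> (V j x - V i a) = val j x * tau j x"
        using val_nonzero[OF j] unfolding tau_def by simp
      moreover have "n \<bullet> (V j x - V i a) = \<alpha> * ((dir i a \<times> N) \<bullet> (V j x - V i a) - s * val j x)"
        unfolding n(2) val_def by (simp only: inner_scaleR_left inner_diff_left)
      ultimately show "n \<bullet> (V j x - V i a) = \<alpha> * (val j x * (tau j x - s))" by (simp add: algebra_simps)
    qed
  qed
qed

lemma missed_if_sep:
  assumes j: "j \<in> {1..4}" "j \<noteq> i" and s: "sep i a j"
  shows "missed (val j) (tau j)"
proof -
  obtain n where n: "n \<bullet> dir i a = 0" "\<And>x. x < 3 \<Longrightarrow> n \<bullet> (V j x - V i a) > 0" using s unfolding sep_def by blast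
  have n0: "n \<noteq> 0" using n(2)[of 0] by auto
  have prod: "(n \<bullet> (V j x - V i a)) * (n \<bullet> (V j y - V i a)) > 0" if "x < 3" "y < 3" for x y
    using n(2)[OF that(1)] n(2)[OF that(2)] by simp
  show ?thesis
  proof (rule normal_cases[OF n0 n(1)])
    fix \<beta> assume b: "\<beta> \<noteq> 0" "\<And>j x. n \<bullet> (V j x - V i a) = \<beta> * val j x"
    have "val j x * val j y > 0" if "x < 3" "y < 3" for x y
      by (rule pos_scale[of \<beta>]) (use prod[OF that] b in simp)
    then show ?thesis unfolding missed_def by blast
  next
    fix \<alpha> s assume b: "\<alpha> \<noteq> 0" "\<And>j x. j \<in> {1..4} \<Longrightarrow> j \<noteq> i \<Longrightarrow> x < 3 \<Longrightarrow> n \<bullet> (V j x - V i a) = \<alpha> * (val j x * (tau j x - s))"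
    have "(val j x * (tau j x - s)) * (val j y * (tau j y - s)) > 0" if "x < 3" "y < 3" for x y
      by (rule pos_scale[of \<alpha>]) (use prod[OF that] b(2)[OF j that(1)] b(2)[OF j that(2)] in simp)
    then show ?thesis unfolding missed_def by blast
  qed
qed

text \<open>A plane of the pencil either is the reference plane, which misses \<open>D\<close>, or
  has a parameter \<open>s\<close>, at which one of the edges in \<open>J\<close> is missed.\<close>

lemma certified_if_not_hit:
  assumes e: "e \<in> choices" "e i = a" and J: "J \<subseteq> {1..4} - {i}" "D \<in> J" and nh: "\<not> (\<exists>t. \<forall>j\<in>J. hits (val j) (tau j) (e j) t)"
  shows "certified V i e"
  unfolding certified_def e(2)
proof (intro allI impI)
  fix n :: "real^3" assume n: "n \<noteq> 0" "n \<bullet> (V i (nxt a) - V i a) = 0"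
  have e3: "e j < 3" if "j \<in> {1..4}" for j using e(1) that unfolding choices_def by (auto simp: PiE_iff)
  show "\<exists>k\<in>{1..4} - {i}. (n \<bullet> (V k (e k) - V i a)) * (n \<bullet> (V k (nxt (e k)) - V i a)) > 0"
  proof (rule ccontr)
    assume "\<not> ?thesis"
    then have neg: "\<not> (n \<bullet> (V k (e k) - V i a)) * (n \<bullet> (V k (nxt (e k)) - V i a)) > 0" if "k \<in> {1..4}" "k \<noteq> i" for k
      using that by blast
    show False
    proof (rule normal_cases[OF n(1)])
      show "n \<bullet> dir i a = 0" using n(2) unfolding dir_def .
      fix \<beta> assume b: "\<beta> \<noteq> 0" "\<And>j x. n \<bullet> (V j x - V i a) = \<beta> * val j x"
      have "val D (e D) * val D (nxt (e D)) \<le> 0"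
        by (rule nonpos_scale[OF _ b(1)]) (use neg[OF mem(4) neq(3)] b(2) in simp)
      then show False using val_D e3[OF mem(4)] nxt_less[of "e D"] by (meson not_le)
    next
      fix \<alpha> s assume b: "\<alpha> \<noteq> 0" "\<And>j x. j \<in> {1..4} \<Longrightarrow> j \<noteq> i \<Longrightarrow> x < 3 \<Longrightarrow> n \<bullet> (V j x - V i a) = \<alpha> * (val j x * (tau j x - s))"
      have "hits (val j) (tau j) (e j) s" if "j \<in> J" for j
      proof -
        have j: "j \<in> {1..4}" "j \<noteq> i" using J(1) that by auto
        show ?thesis unfolding hits_def
          by (rule nonpos_scale[OF _ b(1)]) (use neg[OF j] b(2)[OF j e3[OF j(1)]] b(2)[OF j nxt_less] in simp)
      qed
      then show False using nh by blast
    qed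
  qed
qed

lemma excl_quad:
  assumes x: "excl (val B) (tau B) (val C) (tau C) (val D) (tau D) b c d"
  obtains e where "e \<in> choices" "e i = a" "certified V i e" "e B = b" "e C = c" "e D = d"
proof -
  have l: "b < 3" "c < 3" "d < 3" using x unfolding excl_def by auto
  obtain e where e: "e \<in> choices" "e i = a" "e B = b" "e C = c" "e D = d"
    by (rule quad_exists[OF indices a l])
  have "certified V i e"
  proof (rule certified_if_not_hit[OF e(1,2)])
    show "{B, C, D} \<subseteq> {1..4} - {i}" using mem neq by simp
    show "\<not> (\<exists>t. \<forall>j\<in>{B, C, D}. hits (val j) (tau j) (e j) t)"
      using x unfolding excl_def by (simp add: e(3-5))
  qed simp
  then show ?thesis using that e by blast
qed

text \<open>An excluded pair leaves the edge of the remaining triangle free and so certifies three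
  choices at once.\<close>

lemma excl2_solved:
  assumes j: "j \<in> {1..4}" "j \<noteq> i" "j \<noteq> D" and x: "excl2 (val j) (tau j) (val D) (tau D)"
  shows "solved V"
proof -
  obtain c d where cd: "c < 3" "d < 3" "\<not> (\<exists>t. hits (val j) (tau j) c t \<and> hits (val D) (tau D) d t)"
    using x unfolding excl2_def by blast
  define R where "R = {(e, x). e \<in> choices \<and> x = i \<and> e i = a \<and> e j = c \<and> e D = d}"
  have l: "{i, j, D} \<subseteq> {1..4}" "distinct [i, j, D]" using j mem(1,4) neq(3) by auto
  have "fixed_triple R" unfolding fixed_triple_def
    by (rule exI[of _ i], rule exI[of _ j], rule exI[of _ D], rule exI[of _ a], rule exI[of _ c], rule exI[of _ d])
      (intro conjI l a cd(1,2) R_def)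
  moreover have "certified V x e" if h: "(e, x) \<in> R" for e x
  proof -
    have e: "e \<in> choices" "x = i" "e i = a" "e j = c" "e D = d" using h unfolding R_def by auto
    show ?thesis unfolding e(2)
    proof (rule certified_if_not_hit[OF e(1,3)])
      show "{j, D} \<subseteq> {1..4} - {i}" using j mem neq by simp
      show "\<not> (\<exists>t. \<forall>x\<in>{j, D}. hits (val x) (tau x) (e x) t)"
        using cd(3) by (simp add: e(4,5))
    qed simp
  qed
  ultimately show ?thesis unfolding solved_def by (intro exI[of _ R]) auto
qed

lemma three_triples_row:
  assumes "missed (val C) (tau C)"
  shows "three_triples (val B) (tau B) (val C) (tau C) (val D) (tau D)"
proof
  show "proper (val B) (tau B)" "proper (val C) (tau C)" "proper (val D) (tau D)"
    using proper_row mem neq by simp_all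
  show "tau B ` {..<3} \<inter> tau C ` {..<3} = {}" "tau B ` {..<3} \<inter> tau D ` {..<3} = {}" "tau C ` {..<3} \<inter> tau D ` {..<3} = {}"
    by (rule tau_disjoint; use mem neq in simp)+
qed (rule val_D assms)+

lemma word:
  assumes s: "sep i a C" and ns: "\<not> solved V"
  obtains e where "e \<in> choices" "e i = a" "certified V i e" "same_sign (val B) (e B) \<or> same_sign (val C) (e C)"
proof -
  interpret three_triples "val B" "tau B" "val C" "tau C" "val D" "tau D"
    by (rule three_triples_row[OF missed_if_sep[OF mem(3) neq(2) s]])
  have "\<not> excl2 (val B) (tau B) (val D) (tau D)" "\<not> excl2 (val C) (tau C) (val D) (tau D)"
    using excl2_solved[OF mem(2) neq(1) neq(5)] excl2_solved[OF mem(3) neq(2) neq(6)] ns by blast+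
  then obtain b c d where x: "excl (val B) (tau B) (val C) (tau C) (val D) (tau D) b c d" "same_sign (val B) b \<or> same_sign (val C) c"
    using pair_or_word by blast
  show ?thesis by (rule excl_quad[OF x(1)]) (use that x(2) in blast)
qed

lemma two_words:
  assumes s: "sep i a C" "sep i a B" and ns: "\<not> solved V"
  obtains e e' where "e \<in> choices" "e i = a" "certified V i e" "e' \<in> choices" "e' i = a" "certified V i e'" "e \<noteq> e'"
proof -
  interpret three_triples "val B" "tau B" "val C" "tau C" "val D" "tau D"
    by (rule three_triples_row[OF missed_if_sep[OF mem(3) neq(2) s(1)]])
  have "\<not> excl2 (val B) (tau B) (val D) (tau D)" "\<not> excl2 (val C) (tau C) (val D) (tau D)"
    using excl2_solved[OF mem(2) neq(1) neq(5)] excl2_solved[OF mem(3) neq(2) neq(6)] ns by blast+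
  then obtain b c d b' c' d' where x: "excl (val B) (tau B) (val C) (tau C) (val D) (tau D) b c d"
    "excl (val B) (tau B) (val C) (tau C) (val D) (tau D) b' c' d'" "d \<noteq> d'"
    using pair_or_two_words[OF missed_if_sep[OF mem(2) neq(1) s(2)]] by blast
  obtain e where e: "e \<in> choices" "e i = a" "certified V i e" "e D = d" by (rule excl_quad[OF x(1)]) (rule that)
  obtain e' where e': "e' \<in> choices" "e' i = a" "certified V i e'" "e' D = d'" by (rule excl_quad[OF x(2)]) (rule that)
  show ?thesis using that e e' x(3) by metis
qed

lemma solved_if_linear:
  assumes l: "\<forall>x<3. \<forall>y<3. val C x * val C y > 0"
  shows "solved V"
proof -
  have "missed (val C) (tau C)" using l unfolding missed_def by blast
  then interpret three_triples "val B" "tau B" "val C" "tau C" "val D" "tau D" by (rule three_triples_row)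
  show ?thesis by (rule excl2_solved[OF mem(3) neq(2) neq(6) linear_pair[OF l]])
qed

end

context generic_triangles
begin

lemma word_sep:
  assumes I: "{1..4} = {i, B, C, D}" "distinct [i, B, C, D]" and a: "a < 3" and s: "sep i a C" "sep i a D" and ns: "\<not> solved V"
  obtains e where "e \<in> choices" "e i = a" "certified V i e"
proof -
  have m: "i \<in> {1..4}" "D \<in> {1..4}" "D \<noteq> i" unfolding I(1) using I(2) by auto
  obtain N where "cut i a N D" by (rule cut_if_sep[OF m(1) a m(2,3) s(2)])
  then interpret row V i a B C D N using I a by unfold_locales
  show ?thesis by (rule word[OF s(1) ns]) (rule that)
qed

lemma two_words_sep:
  assumes I: "{1..4} = {i, B, C, D}" "distinct [i, B, C, D]" and a: "a < 3" and s: "sep i a B" "sep i a C" "sep i a D" and ns: "\<not> solved V"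
  obtains e e' where "e \<in> choices" "e i = a" "certified V i e" "e' \<in> choices" "e' i = a" "certified V i e'" "e \<noteq> e'"
proof -
  have m: "i \<in> {1..4}" "D \<in> {1..4}" "D \<noteq> i" unfolding I(1) using I(2) by auto
  obtain N where "cut i a N D" by (rule cut_if_sep[OF m(1) a m(2,3) s(3)])
  then interpret row V i a B C D N using I a by unfold_locales
  show ?thesis by (rule two_words[OF s(2,1) ns]) (rule that)
qed

text \<open>If the plane of triangle \<open>i\<close> misses \<open>D\<close>, it serves as
  reference plane for all three edges of \<open>i\<close>. The heights then do not depend on the
  edge, which makes the conditions \<open>same_sign\<close> comparable between the rows.\<close>

lemma row_misses:
  assumes I: "{1..4} = {i, B, C, D}" "distinct [i, B, C, D]" and a: "a < 3" and m: "misses i D"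
  shows "row V i a B C D ((V i 1 - V i 0) \<times> (V i 2 - V i 0))"
    and "row.val V i a ((V i 1 - V i 0) \<times> (V i 2 - V i 0)) = height i"
proof -
  let ?n = "(V i 1 - V i 0) \<times> (V i 2 - V i 0)"
  have "i \<in> {1..4}" unfolding I(1) by simp
  then show "row V i a B C D ?n" using cut_if_misses[OF _ a m] I a by unfold_locales
  then interpret row V i a B C D ?n .
  show "val = height i" unfolding val_def height_def height_base[OF a] by simp
qed

lemma word_misses:
  assumes I: "{1..4} = {i, B, C, D}" "distinct [i, B, C, D]" and a: "a < 3" and s: "sep i a C" "misses i D" and ns: "\<not> solved V"
  obtains e where "e \<in> choices" "e i = a" "certified V i e" "same_sign (height i B) (e B) \<or> same_sign (height i C) (e C)"
proof -
  interpret row V i a B C D "(V i 1 - V i 0) \<times> (V i 2 - V i 0)" by (rule row_misses(1)[OF I a s(2)])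
  obtain e where e: "e \<in> choices" "e i = a" "certified V i e" "same_sign (val B) (e B) \<or> same_sign (val C) (e C)"
    by (rule word[OF s(1) ns])
  show ?thesis by (rule that[OF e(1-3)]) (rule e(4)[unfolded row_misses(2)[OF I a s(2)]])
qed

lemma solved_if_misses_two:
  assumes I: "{1..4} = {i, B, C, D}" "distinct [i, B, C, D]" and m: "misses i C" "misses i D"
  shows "solved V"
proof -
  have a: "0 < (3::nat)" by simp
  interpret row V i 0 B C D "(V i 1 - V i 0) \<times> (V i 2 - V i 0)" by (rule row_misses(1)[OF I a m(2)])
  show ?thesis by (rule solved_if_linear) (use m(1) in \<open>unfold row_misses(2)[OF I a m(2)] misses_def\<close>)
qed

end

section \<open>Three certified choices in general position\<close>

context generic_triangles
begin

lemma solved_rows: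
  assumes "i \<in> {1..4}" "\<And>a. a < 3 \<Longrightarrow> \<exists>e. e \<in> choices \<and> e i = a \<and> certified V i e"
  shows "solved V"
proof -
  obtain x where x: "x \<in> choices" "x i = 0" "certified V i x" using assms(2)[of 0] by auto
  obtain y where y: "y \<in> choices" "y i = 1" "certified V i y" using assms(2)[of 1] by auto
  obtain z where z: "z \<in> choices" "z i = 2" "certified V i z" using assms(2)[of 2] by auto
  have "z \<noteq> x" "z \<noteq> y" "x i \<noteq> y i" using x(2) y(2) z(2) by auto
  then show ?thesis using solved_three_words[OF assms(1,1) x(1) y(1) z(1) _ _ _ x(3) y(3) z(3)] by simp
qed

text \<open>Each other triangle \<open>j\<close> fails to be separable from at most one edge of
  \<open>i\<close>: two failures give \<open>misses j i\<close>, hence \<open>misses i j\<close>,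
  and then every edge is separable. If each edge separates from two triangles, each yields a choice.
  Otherwise some edge fails for two triangles \<open>C\<close> and \<open>D\<close>; the other two
  edges separate from both, one of them also from \<open>B\<close>, and this one yields two choices
  while the other yields the third.\<close>

lemma solved_if_light:
  assumes i: "i \<in> {1..4}" and light: "\<And>j. j \<in> {1..4} \<Longrightarrow> j \<noteq> i \<Longrightarrow> misses j i \<Longrightarrow> misses i j"
  shows "solved V"
proof (rule ccontr)
  assume ns: "\<not> solved V"
  have bad: "a = a'" if h: "j \<in> {1..4}" "j \<noteq> i" "a < 3" "a' < 3" "\<not> sep i a j" "\<not> sep i a' j" for j a a'
  proof (rule ccontr)
    assume "a \<noteq> a'"
    then have "misses j i" by (rule misses_if_two_not_sep[OF i h(1,2,3,4) _ h(5,6)])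
    then have "misses i j" by (rule light[OF h(1,2)])
    then show False using sep_if_misses[OF i h(3)] h(5) by blast
  qed
  have w: "\<exists>e. e \<in> choices \<and> e i = a \<and> certified V i e"
    if h: "a < 3" "j \<in> {1..4}" "j' \<in> {1..4}" "j \<noteq> i" "j' \<noteq> i" "j \<noteq> j'" "sep i a j" "sep i a j'" for a j j'
  proof -
    obtain k l where I: "{1..4} = {j, j', k, l}" "distinct [j, j', k, l]" by (rule four_indices[OF h(2,3,6)])
    have "i = k \<or> i = l" using i h(4,5) unfolding I(1) by auto
    then obtain B where B: "{1..4} = {i, B, j, j'}" "distinct [i, B, j, j']"
      using I that[of l] that[of k] by (elim disjE) (auto simp: insert_commute)
    show ?thesis by (rule word_sep[OF B h(1,7,8) ns]) blast
  qed
  show False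
  proof (cases "\<forall>a<3. \<exists>j\<in>{1..4}. \<exists>j'\<in>{1..4}. j \<noteq> i \<and> j' \<noteq> i \<and> j \<noteq> j' \<and> sep i a j \<and> sep i a j'")
    case True
    then have "\<exists>e. e \<in> choices \<and> e i = a \<and> certified V i e" if "a < 3" for a using w[OF that] that by blast
    then show False using solved_rows[OF i] ns by blast
  next
    case False
    then obtain a where a: "a < 3" "\<And>j j'. j \<in> {1..4} \<Longrightarrow> j' \<in> {1..4} \<Longrightarrow> j \<noteq> i \<Longrightarrow> j' \<noteq> i \<Longrightarrow> j \<noteq> j' \<Longrightarrow> \<not> (sep i a j \<and> sep i a j')"
      by blast
    obtain j0 :: nat where j0: "j0 \<in> {1..4}" "j0 \<noteq> i" using that[of 1] that[of 2] by (cases "i = 1") auto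
    obtain k l where "{1..4} = {i, j0, k, l}" "distinct [i, j0, k, l]" by (rule four_indices[OF i j0(1) j0(2)[symmetric]])
    then obtain B C D where I: "{1..4} = {i, B, C, D}" "distinct [i, B, C, D]" by blast
    have m: "B \<in> {1..4}" "C \<in> {1..4}" "D \<in> {1..4}" unfolding I(1) by simp_all
    have ne: "B \<noteq> i" "C \<noteq> i" "D \<noteq> i" "B \<noteq> C" "B \<noteq> D" "C \<noteq> D" using I(2) by auto
    have main: False if I: "{1..4} = {i, B, C, D}" "distinct [i, B, C, D]" and b: "\<not> sep i a C" "\<not> sep i a D" for B C D
    proof -
      have m: "B \<in> {1..4}" "C \<in> {1..4}" "D \<in> {1..4}" unfolding I(1) by simp_all
      have ne: "B \<noteq> i" "C \<noteq> i" "D \<noteq> i" "C \<noteq> D" using I(2) by auto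
      define a1 where "a1 = nxt a"
      define a2 where "a2 = nxt (nxt a)"
      have aa: "a1 < 3" "a2 < 3" "a1 \<noteq> a" "a2 \<noteq> a" "a1 \<noteq> a2"
        unfolding a1_def a2_def using nxt_less nxt_neq a(1) nxt_nxt[OF a(1)] by (auto intro: nxt_less)
      have CD: "sep i x C" "sep i x D" if "x < 3" "x \<noteq> a" for x
        using bad[OF m(2) ne(2) that(1) a(1) _ b(1)] bad[OF m(3) ne(3) that(1) a(1) _ b(2)] that(2) by blast+
      have fin: False if h: "x < 3" "y < 3" "x \<noteq> a" "y \<noteq> a" "x \<noteq> y" "sep i x B" for x y
      proof -
        obtain e e' where e: "e \<in> choices" "e i = x" "certified V i e" "e' \<in> choices" "e' i = x" "certified V i e'" "e \<noteq> e'"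
          by (rule two_words_sep[OF I h(1) h(6) CD[OF h(1,3)] ns])
        obtain f where f: "f \<in> choices" "f i = y" "certified V i f" by (rule word_sep[OF I h(2) CD[OF h(2,4)] ns])
        have "e i \<noteq> f i" "e' \<noteq> e" "e' \<noteq> f" using e f h(5) by auto
        then show False using solved_three_words[OF i i e(1) f(1) e(4) _ _ _ e(3) f(3) e(6)] ns by simp
      qed
      have "sep i a1 B \<or> sep i a2 B" using bad[OF m(1) ne(1) aa(1,2)] aa(5) by blast
      then show False using fin[OF aa(1,2) aa(3,4) aa(5)] fin[OF aa(2,1) aa(4,3) aa(5)[symmetric]] by blast
    qed
    have "\<not> sep i a C \<and> \<not> sep i a D \<or> \<not> sep i a B \<and> \<not> sep i a D \<or> \<not> sep i a B \<and> \<not> sep i a C"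
      using a(2)[OF m(1,2) ne(1,2,4)] a(2)[OF m(1,3) ne(1,3,5)] a(2)[OF m(2,3) ne(2,3,6)] by blast
    moreover have "{1..4} = {i, C, B, D}" "distinct [i, C, B, D]" "{1..4} = {i, D, B, C}" "distinct [i, D, B, C]"
      using I by auto
    ultimately show False using main[OF I] main[of C B D] main[of D B C] by blast
  qed
qed

text \<open>The case that remains when no triangle is light: every plane misses exactly one other triangle.\<close>

definition cyclic :: "nat \<Rightarrow> nat \<Rightarrow> nat \<Rightarrow> nat \<Rightarrow> bool" where
  "cyclic A B C D \<longleftrightarrow> {1..4} = {A, B, C, D} \<and> distinct [A, B, C, D] \<and> misses B A \<and> misses C B \<and> misses D C \<and> misses A D"

lemma cyclic_rotate: "cyclic A B C D \<Longrightarrow> cyclic B C D A"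
  unfolding cyclic_def by auto

text \<open>Let \<open>f i\<close> be a witness that \<open>i\<close> is not light. By
  \<open>uniq\<close> the map \<open>f\<close> is injective, and it has no fixed points and no
  2-cycles, so it is a 4-cycle of the indices.\<close>

lemma cyclic_exists:
  assumes ns: "\<not> solved V" and uniq: "\<And>i j j'. i \<in> {1..4} \<Longrightarrow> j \<in> {1..4} \<Longrightarrow> j' \<in> {1..4} \<Longrightarrow> j \<noteq> i \<Longrightarrow> j' \<noteq> i \<Longrightarrow> misses i j \<Longrightarrow> misses i j' \<Longrightarrow> j = j'"
  obtains A B C D where "cyclic A B C D"
proof -
  have "\<exists>j. j \<in> {1..4} \<and> j \<noteq> i \<and> misses j i \<and> \<not> misses i j" if "i \<in> {1..4}" for i
    using solved_if_light[OF that] ns by blast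
  then obtain f where f: "\<And>i. i \<in> {1..4} \<Longrightarrow> f i \<in> {1..4} \<and> f i \<noteq> i \<and> misses (f i) i \<and> \<not> misses i (f i)"
    by metis
  have inj: "i = i'" if "i \<in> {1..4}" "i' \<in> {1..4}" "f i = f i'" for i i'
    using uniq[of "f i" i i'] f[OF that(1)] f[OF that(2)] that by metis
  have two: "f (f i) \<noteq> i" if "i \<in> {1..4}" for i
    using f[OF that] f[of "f i"] by metis
  have A: "(1::nat) \<in> {1..4}" by simp
  define B where "B = f 1"
  define C where "C = f B"
  have B: "B \<in> {1..4}" "B \<noteq> 1" using f[OF A] unfolding B_def by auto
  have C: "C \<in> {1..4}" "C \<noteq> B" "C \<noteq> 1" using f[OF B(1)] two[OF A] unfolding C_def B_def by auto
  obtain k l where kl: "{1..4} = {1, B, k, l}" "distinct [1, B, k, l]" by (rule four_indices[OF A B(1) B(2)[symmetric]])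
  have "C = k \<or> C = l" using C unfolding kl(1) by auto
  then obtain D where D: "{1..4} = {1, B, C, D}" "distinct [1, B, C, D]"
    using kl that by (elim disjE) (auto simp: insert_commute)
  have Dm: "D \<in> {1..4}" "D \<noteq> 1" "D \<noteq> B" "D \<noteq> C" using D(2) unfolding D(1) by auto
  have fD: "f D = 1"
  proof -
    have "f D \<in> {1, B, C, D}" using f[OF Dm(1)] unfolding D(1) by blast
    moreover have "f D \<noteq> D" using f[OF Dm(1)] by blast
    moreover have "f D \<noteq> B" using inj[OF Dm(1) A] Dm(2) unfolding B_def by blast
    moreover have "f D \<noteq> C" using inj[OF Dm(1) B(1)] Dm(3) unfolding C_def by blast
    ultimately show ?thesis by blast
  qed
  have fC: "f C = D"
  proof -
    have "f C \<in> {1, B, C, D}" using f[OF C(1)] unfolding D(1) by blast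
    moreover have "f C \<noteq> C" using f[OF C(1)] by blast
    moreover have "f C \<noteq> B" using inj[OF C(1) A] C(3) unfolding B_def by blast
    moreover have "f C \<noteq> 1" using inj[OF C(1) Dm(1)] Dm(4) fD by metis
    ultimately show ?thesis by blast
  qed
  have "misses B 1" "misses C B" "misses D C" "misses 1 D"
    using f[OF A] f[OF B(1)] f[OF C(1)] f[OF Dm(1)] fD fC unfolding B_def[symmetric] C_def[symmetric] by auto
  then have "cyclic 1 B C D" unfolding cyclic_def using D by blast
  then show ?thesis by (rule that)
qed

lemma cyclic_row:
  assumes cy: "cyclic A B C D" and ns: "\<not> solved V" and a: "a < 3" "sep A a C"
  obtains e where "e \<in> choices" "e A = a" "certified V A e" "same_sign (height A B) (e B) \<or> same_sign (height A C) (e C)"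
proof -
  have I: "{1..4} = {A, B, C, D}" "distinct [A, B, C, D]" "misses A D" using cy unfolding cyclic_def by simp_all
  show ?thesis by (rule word_misses[OF I(1,2) a I(3) ns]) (rule that)
qed

text \<open>In the cyclic case exactly one edge of \<open>A\<close> cannot be separated from
  \<open>C\<close>, so the rows of \<open>A\<close> are sure to yield only two choices and the
  missing ones come from another triangle. They could coincide with those of \<open>A\<close>; the
  conditions \<open>same_sign\<close> prevent this. If one of them concerns \<open>C\<close>, it
  forces the edge \<open>kC\<close>, which the rows used for \<open>C\<close> avoid. If both concern
  \<open>B\<close>, they force the same edge of \<open>B\<close>, and a row of \<open>B\<close> at a
  different edge supplies the third choice.\<close>

lemma always_solved: "solved V"
proof (rule ccontr)
  assume ns: "\<not> solved V"
  have uniq: "j = j'" if h: "i \<in> {1..4}" "j \<in> {1..4}" "j' \<in> {1..4}" "j \<noteq> i" "j' \<noteq> i" "misses i j" "misses i j'" for i j j'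
  proof (rule ccontr)
    assume "j \<noteq> j'"
    then obtain k l where I: "{1..4} = {j, j', k, l}" "distinct [j, j', k, l]" by (rule four_indices[OF h(2,3)])
    have "i = k \<or> i = l" using h(1,4,5) unfolding I(1) by auto
    then obtain B where B: "{1..4} = {i, B, j, j'}" "distinct [i, B, j, j']"
      using I that[of l] that[of k] by (elim disjE) (auto simp: insert_commute)
    show False using solved_if_misses_two[OF B h(6,7)] ns by blast
  qed
  obtain A B C D where cy: "cyclic A B C D" by (rule cyclic_exists[OF ns uniq])
  have props: "A \<in> {1..4}" "B \<in> {1..4}" "C \<in> {1..4}" "D \<in> {1..4}" "C \<noteq> A" "\<not> misses C A" "\<not> misses A C" "\<not> misses A B"
    if cy: "cyclic A B C D" for A B C D
  proof -
    have I: "{1..4} = {A, B, C, D}" "distinct [A, B, C, D]" "misses B A" "misses C B" "misses D C" "misses A D"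
      using cy unfolding cyclic_def by auto
    show m: "A \<in> {1..4}" "B \<in> {1..4}" "C \<in> {1..4}" "D \<in> {1..4}" unfolding I(1) by simp_all
    have ne: "C \<noteq> A" "B \<noteq> A" "D \<noteq> A" "B \<noteq> C" "C \<noteq> D" "B \<noteq> D" using I(2) by auto
    show "C \<noteq> A" by (rule ne)
    show "\<not> misses C A" using uniq[OF m(3,1,2) _ _ _ I(4)] ne by auto
    show "\<not> misses A C" using uniq[OF m(1,3,4) _ _ _ I(6)] ne by auto
    show "\<not> misses A B" using uniq[OF m(1,2,4) _ _ _ I(6)] ne by auto
  qed
  have bad: "\<exists>k<3. \<not> sep A k C \<and> (\<forall>a<3. a \<noteq> k \<longrightarrow> sep A a C)" if cy: "cyclic A B C D" for A B C D
  proof -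
    note p = props[OF cy]
    have "\<exists>k<3. \<not> sep A k C"
    proof (rule ccontr)
      assume "\<not> ?thesis"
      then have s: "\<And>a. a < 3 \<Longrightarrow> sep A a C" by blast
      have "\<exists>e. e \<in> choices \<and> e A = a \<and> certified V A e" if "a < 3" for a
        by (rule cyclic_row[OF cy ns that s[OF that]]) blast
      then show False using solved_rows[OF p(1)] ns by blast
    qed
    then obtain k where k: "k < 3" "\<not> sep A k C" by blast
    have "sep A a C" if "a < 3" "a \<noteq> k" for a
      using misses_if_two_not_sep[OF p(1,3,5) that(1) k(1) that(2) _ k(2)] p(6) by blast
    then show ?thesis using k by blast
  qed
  have cy2: "cyclic B C D A" and cy3: "cyclic C D A B" using cy cyclic_rotate by blast+
  note p = props[OF cy]
  obtain kA where kA: "kA < 3" "\<And>a. a < 3 \<Longrightarrow> a \<noteq> kA \<Longrightarrow> sep A a C" using bad[OF cy] by blast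
  obtain kB where kB: "kB < 3" "\<And>a. a < 3 \<Longrightarrow> a \<noteq> kB \<Longrightarrow> sep B a D" using bad[OF cy2] by blast
  obtain kC where kC: "kC < 3" "\<not> sep C kC A" "\<And>a. a < 3 \<Longrightarrow> a \<noteq> kC \<Longrightarrow> sep C a A" using bad[OF cy3] by blast
  have two: "\<exists>a a'. a < 3 \<and> a' < 3 \<and> a \<noteq> k \<and> a' \<noteq> k \<and> a \<noteq> a'" if "k < (3::nat)" for k
    using nxt_less nxt_neq nxt_nxt[OF that] that by (metis nxt_less nxt_neq)
  have sideC: "c = kC" if "c < 3" "same_sign (height A C) c" for c
  proof (rule ccontr)
    assume ne: "c \<noteq> kC"
    have "same_sign (height A C) kC" by (rule same_sign_if_not_sep[OF p(3) kC(1) p(1) p(5)[symmetric] kC(2)])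
    then have "misses A C" unfolding misses_def by (intro same_sign_twice[OF that(1) kC(1) ne that(2)])
    then show False using p(7) by blast
  qed
  have sideB: "b = b'" if "b < 3" "b' < 3" "same_sign (height A B) b" "same_sign (height A B) b'" for b b'
    using same_sign_twice[OF that(1,2) _ that(3,4)] p(8) unfolding misses_def by blast
  have e3: "e j < 3" if "e \<in> choices" "j \<in> {1..4}" for e j using that unfolding choices_def by (auto simp: PiE_iff)
  obtain a a' where aa: "a < 3" "a' < 3" "a \<noteq> kA" "a' \<noteq> kA" "a \<noteq> a'" using two[OF kA(1)] by blast
  obtain w where w: "w \<in> choices" "w A = a" "certified V A w" "same_sign (height A B) (w B) \<or> same_sign (height A C) (w C)"
    by (rule cyclic_row[OF cy ns aa(1) kA(2)[OF aa(1,3)]])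
  obtain w' where w': "w' \<in> choices" "w' A = a'" "certified V A w'" "same_sign (height A B) (w' B) \<or> same_sign (height A C) (w' C)"
    by (rule cyclic_row[OF cy ns aa(2) kA(2)[OF aa(2,4)]])
  have notC: False if u: "u \<in> choices" "certified V A u" "same_sign (height A C) (u C)" for u
  proof -
    have uC: "u C = kC" by (rule sideC[OF e3[OF u(1) p(3)] u(3)])
    obtain c c' where cc: "c < 3" "c' < 3" "c \<noteq> kC" "c' \<noteq> kC" "c \<noteq> c'" using two[OF kC(1)] by blast
    obtain x where x: "x \<in> choices" "x C = c" "certified V C x" by (rule cyclic_row[OF cy3 ns cc(1) kC(3)[OF cc(1,3)]])
    obtain y where y: "y \<in> choices" "y C = c'" "certified V C y" by (rule cyclic_row[OF cy3 ns cc(2) kC(3)[OF cc(2,4)]])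
    have "x C \<noteq> y C" "u \<noteq> x" "u \<noteq> y" using x(2) y(2) uC cc by auto
    then show False using solved_three_words[OF p(3,1) x(1) y(1) u(1) _ _ _ x(3) y(3) u(2)] ns by simp
  qed
  have B: "same_sign (height A B) (w B)" "same_sign (height A B) (w' B)"
    using w(4) w'(4) notC[OF w(1,3)] notC[OF w'(1,3)] by blast+
  have ww: "w B = w' B" by (rule sideB[OF e3[OF w(1) p(2)] e3[OF w'(1) p(2)] B])
  \<comment> \<open>Two edges of \<open>B\<close> differ from \<open>kB\<close>, and at least one of
    them also differs from \<open>w B\<close>.\<close>
  obtain b where b: "b < 3" "b \<noteq> kB" "b \<noteq> w B" using two[OF kB(1)] by metis
  obtain z where z: "z \<in> choices" "z B = b" "certified V B z" by (rule cyclic_row[OF cy2 ns b(1) kB(2)[OF b(1,2)]])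
  have "w A \<noteq> w' A" "z \<noteq> w" "z \<noteq> w'" using w(2) w'(2) aa(5) z(2) b(3) ww by auto
  then show False using solved_three_words[OF p(1,2) w(1) w'(1) z(1) _ _ _ w(3) w'(3) z(3)] ns by simp
qed

end

section \<open>Perturbation to general position\<close>

text \<open>Moving the vertices towards the moment curve makes every determinant of four vertices a cubic whose
  leading coefficient is a Vandermonde determinant.\<close>

definition moment :: "nat \<Rightarrow> nat \<Rightarrow> real^3" where
  "moment i k = vector [real (3 * i + k), real (3 * i + k) ^ 2, real (3 * i + k) ^ 3]"

definition perturb :: "(nat \<Rightarrow> nat \<Rightarrow> real^3) \<Rightarrow> real \<Rightarrow> nat \<Rightarrow> nat \<Rightarrow> real^3" where
  "perturb V s i k = V i k + s *\<^sub>R moment i k"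

lemma vandermonde:
  fixes a b c d :: real
  shows "(vector [b, b ^ 2, b ^ 3] - vector [a, a ^ 2, a ^ 3] :: real^3) \<bullet>
     ((vector [c, c ^ 2, c ^ 3] - vector [a, a ^ 2, a ^ 3]) \<times> (vector [d, d ^ 2, d ^ 3] - vector [a, a ^ 2, a ^ 3])) =
     (b - a) * (c - a) * (d - a) * (c - b) * (d - b) * (d - c)"
  by (simp add: cross3_def inner_vec_def sum_3 power2_eq_square power3_eq_cube) algebra

lemma moment_det:
  assumes "a < 3" "b < 3" "c < 3" "d < 3" "distinct [(i, a), (j, b), (k, c), (l, d)]"
  shows "(moment j b - moment i a) \<bullet> ((moment k c - moment i a) \<times> (moment l d - moment i a)) \<noteq> 0"
proof -
  have inj: "real (3 * x + y) - real (3 * x' + y') \<noteq> 0" if "y < 3" "y' < 3" "(x, y) \<noteq> (x', y')" for x y x' y' :: nat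
  proof
    assume "real (3 * x + y) - real (3 * x' + y') = 0"
    then have "3 * x + y = 3 * x' + y'" by linarith
    then have "x = x' \<and> y = y'" using that(1,2) by presburger
    then show False using that(3) by simp
  qed
  show ?thesis
    unfolding moment_def vandermonde mult_eq_0_iff de_Morgan_disj
    by (intro conjI inj) (use assms in auto)
qed

lemma eventually_at_not_in_finite:
  fixes F :: "real set"
  assumes "finite F"
  shows "\<forall>\<^sub>F s in at 0. s \<notin> F"
  unfolding eventually_at_topological
proof (intro exI[of _ "- (F - {0})"] conjI)
  show "open (- (F - {0}))" by (intro open_Compl finite_imp_closed finite_Diff assms)
qed auto

lemma eventually_det_nonzero:
  fixes x0 x1 y0 y1 z0 z1 :: "real^3"
  assumes "x1 \<bullet> (y1 \<times> z1) \<noteq> 0"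
  shows "\<forall>\<^sub>F s in at 0. (x0 + s *\<^sub>R x1) \<bullet> ((y0 + s *\<^sub>R y1) \<times> (z0 + s *\<^sub>R z1)) \<noteq> 0"
proof -
  let ?p = "[: x0 \<bullet> (y0 \<times> z0), x1 \<bullet> (y0 \<times> z0) + x0 \<bullet> (y1 \<times> z0) + x0 \<bullet> (y0 \<times> z1),
     x1 \<bullet> (y1 \<times> z0) + x1 \<bullet> (y0 \<times> z1) + x0 \<bullet> (y1 \<times> z1), x1 \<bullet> (y1 \<times> z1) :]"
  have "(x0 + s *\<^sub>R x1) \<bullet> ((y0 + s *\<^sub>R y1) \<times> (z0 + s *\<^sub>R z1)) = poly ?p s" for s
    by (simp add: cross_add_left cross_add_right cross_mult_left cross_mult_right inner_add_left inner_add_right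
      algebra_simps)
  moreover have "finite {s. poly ?p s = 0}" by (rule poly_roots_finite) (use assms in simp)
  ultimately show ?thesis using eventually_at_not_in_finite[of "{s. poly ?p s = 0}"] by simp
qed

lemma perturb_tendsto: "((\<lambda>s. perturb V s i k) \<longlongrightarrow> V i k) (at 0)"
  unfolding perturb_def by (rule tendsto_eq_intros refl)+ simp

text \<open>Each determinant is a nonzero polynomial in \<open>s\<close> and has finitely many
  zeros. Disjointness persists because the compact hulls are strictly separated by a plane.\<close>

lemma eventually_generic:
  assumes "\<And>i j. i \<in> {1..4} \<Longrightarrow> j \<in> {1..4} \<Longrightarrow> i \<noteq> j \<Longrightarrow> convex hull (V i ` {..<3}) \<inter> convex hull (V j ` {..<3}) = {}"
  shows "\<forall>\<^sub>F s in at 0. generic_triangles (perturb V s)"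
proof -
  let ?W = "perturb V"
  have dets: "\<forall>\<^sub>F s in at 0. distinct [(i, a), (j, b), (k, c), (l, d)] \<longrightarrow>
      (?W s j b - ?W s i a) \<bullet> ((?W s k c - ?W s i a) \<times> (?W s l d - ?W s i a)) \<noteq> 0"
    if h: "a \<in> {..<3}" "b \<in> {..<3}" "c \<in> {..<3}" "d \<in> {..<3}" for i j k l a b c d
  proof (cases "distinct [(i, a), (j, b), (k, c), (l, d)]")
    case True
    have W: "?W s x y - ?W s i a = (V x y - V i a) + s *\<^sub>R (moment x y - moment i a)" for s x y
      unfolding perturb_def by (simp add: algebra_simps)
    have "(moment j b - moment i a) \<bullet> ((moment k c - moment i a) \<times> (moment l d - moment i a)) \<noteq> 0"
      by (rule moment_det) (use h True in auto)
    from eventually_det_nonzero[OF this, of "V j b - V i a" "V k c - V i a" "V l d - V i a"]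
    show ?thesis unfolding W by (rule eventually_mono) simp
  next
    case False
    then show ?thesis by (intro always_eventually allI impI) (erule (1) notE)
  qed
  have hulls: "\<forall>\<^sub>F s in at 0. i \<noteq> j \<longrightarrow> convex hull (?W s i ` {..<3}) \<inter> convex hull (?W s j ` {..<3}) = {}"
    if h: "i \<in> {1..4}" "j \<in> {1..4}" for i j
  proof (cases "i = j")
    case False
    let ?H = "\<lambda>i. convex hull (V i ` {..<3})"
    have "compact (?H i)" for i by (intro finite_imp_compact_convex_hull) auto
    then have "closed (?H i)" "compact (?H j)" by (simp_all add: compact_imp_closed)
    moreover have "?H j \<noteq> {}" by (simp add: lessThan_empty_iff)
    ultimately obtain n b where nb: "\<forall>x\<in>?H i. n \<bullet> x < b" "\<forall>x\<in>?H j. n \<bullet> x > b"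
      using separating_hyperplane_closed_compact[OF convex_convex_hull _ convex_convex_hull _ _ assms[OF h False]] by metis
    have lim: "((\<lambda>s. n \<bullet> ?W s x k) \<longlongrightarrow> n \<bullet> V x k) (at 0)" for x k
      by (intro tendsto_inner tendsto_const perturb_tendsto)
    have i: "\<forall>\<^sub>F s in at 0. n \<bullet> ?W s i k < b" if "k \<in> {..<3}" for k
      by (rule order_tendstoD(2)[OF lim]) (use nb(1) that in \<open>auto intro: hull_inc\<close>)
    have j: "\<forall>\<^sub>F s in at 0. n \<bullet> ?W s j k > b" if "k \<in> {..<3}" for k
      by (rule order_tendstoD(1)[OF lim]) (use nb(2) that in \<open>auto intro: hull_inc\<close>)
    have "\<forall>\<^sub>F s in at 0. (\<forall>k\<in>{..<3}. n \<bullet> ?W s i k < b) \<and> (\<forall>k\<in>{..<3}. n \<bullet> ?W s j k > b)"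
      by (intro eventually_conj eventually_ball_finite ballI i j) auto
    then show ?thesis
    proof (rule eventually_mono, intro impI)
      fix s assume s: "(\<forall>k\<in>{..<3}. n \<bullet> ?W s i k < b) \<and> (\<forall>k\<in>{..<3}. n \<bullet> ?W s j k > b)"
      have "convex hull (?W s i ` {..<3}) \<subseteq> {x. n \<bullet> x < b}"
        by (rule hull_minimal) (use s in \<open>auto simp: convex_halfspace_lt\<close>)
      moreover have "convex hull (?W s j ` {..<3}) \<subseteq> {x. n \<bullet> x > b}"
        by (rule hull_minimal) (use s in \<open>auto simp: convex_halfspace_gt\<close>)
      ultimately show "convex hull (?W s i ` {..<3}) \<inter> convex hull (?W s j ` {..<3}) = {}" by fastforce
    qed
  qed simp
  have "\<forall>\<^sub>F s in at 0. (\<forall>i\<in>{1..4}. \<forall>j\<in>{1..4}. \<forall>k\<in>{1..4}. \<forall>l\<in>{1..4}. \<forall>a\<in>{..<3}. \<forall>b\<in>{..<3}. \<forall>c\<in>{..<3}. \<forall>d\<in>{..<3}.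
      distinct [(i, a), (j, b), (k, c), (l, d)] \<longrightarrow>
      (?W s j b - ?W s i a) \<bullet> ((?W s k c - ?W s i a) \<times> (?W s l d - ?W s i a)) \<noteq> 0) \<and>
      (\<forall>i\<in>{1..4}. \<forall>j\<in>{1..4}. i \<noteq> j \<longrightarrow> convex hull (?W s i ` {..<3}) \<inter> convex hull (?W s j ` {..<3}) = {})"
    by (intro eventually_conj eventually_ball_finite ballI hulls dets finite_atLeastAtMost finite_lessThan)
  then show ?thesis
  proof (rule eventually_mono)
    fix s
    assume s: "(\<forall>i\<in>{1..4}. \<forall>j\<in>{1..4}. \<forall>k\<in>{1..4}. \<forall>l\<in>{1..4}. \<forall>a\<in>{..<3}. \<forall>b\<in>{..<3}. \<forall>c\<in>{..<3}. \<forall>d\<in>{..<3}.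
      distinct [(i, a), (j, b), (k, c), (l, d)] \<longrightarrow>
      (?W s j b - ?W s i a) \<bullet> ((?W s k c - ?W s i a) \<times> (?W s l d - ?W s i a)) \<noteq> 0) \<and>
      (\<forall>i\<in>{1..4}. \<forall>j\<in>{1..4}. i \<noteq> j \<longrightarrow> convex hull (?W s i ` {..<3}) \<inter> convex hull (?W s j ` {..<3}) = {})"
    show "generic_triangles (?W s)"
    proof
      fix i j k l a b c d :: nat
      assume h: "i \<in> {1..4}" "j \<in> {1..4}" "k \<in> {1..4}" "l \<in> {1..4}" "a < 3" "b < 3" "c < 3" "d < 3" "distinct [(i, a), (j, b), (k, c), (l, d)]"
      have h': "a \<in> {..<3}" "b \<in> {..<3}" "c \<in> {..<3}" "d \<in> {..<3}" using h by simp_all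
      show "(?W s j b - ?W s i a) \<bullet> ((?W s k c - ?W s i a) \<times> (?W s l d - ?W s i a)) \<noteq> 0"
        using conjunct1[OF s, THEN bspec, OF h(1), THEN bspec, OF h(2), THEN bspec, OF h(3), THEN bspec, OF h(4),
          THEN bspec, OF h'(1), THEN bspec, OF h'(2), THEN bspec, OF h'(3), THEN bspec, OF h'(4)] h(9) by (rule mp)
    next
      fix i j :: nat
      assume h: "i \<in> {1..4}" "j \<in> {1..4}" "i \<noteq> j"
      show "convex hull (?W s i ` {..<3}) \<inter> convex hull (?W s j ` {..<3}) = {}"
        using conjunct2[OF s, THEN bspec, OF h(1), THEN bspec, OF h(2)] h(3) by (rule mp)
    qed
  qed
qed

text \<open>The set \<open>R\<close> may depend on \<open>s\<close>, but there are finitely many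
  candidates, so one of them occurs for arbitrarily small \<open>s\<close>. This is enough to refute
  a statement that fails to be certified eventually.\<close>

lemma frequently_certified:
  assumes "\<And>i j. i \<in> {1..4} \<Longrightarrow> j \<in> {1..4} \<Longrightarrow> i \<noteq> j \<Longrightarrow> convex hull (V i ` {..<3}) \<inter> convex hull (V j ` {..<3}) = {}"
  obtains R where "fixed_triple R \<or> three_words R" "\<exists>\<^sub>F s in at 0. \<forall>(e, x)\<in>R. certified (perturb V s) x e"
proof -
  let ?A = "{R. fixed_triple R \<or> three_words R}"
  have "?A \<subseteq> Pow (Sigma choices (\<lambda>_. {1..4}))"
    unfolding fixed_triple_def three_words_def by fastforce
  moreover have "finite choices" unfolding choices_def by (intro finite_PiE) auto
  ultimately have fin: "finite ?A" by (meson finite_Pow_iff finite_SigmaI finite_atLeastAtMost finite_subset)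
  have "\<forall>\<^sub>F s in at 0. \<exists>R\<in>?A. \<forall>(e, x)\<in>R. certified (perturb V s) x e"
  proof (rule eventually_mono[OF eventually_generic[OF assms]])
    fix s assume "generic_triangles (perturb V s)"
    then have "solved (perturb V s)" by (rule generic_triangles.always_solved)
    then show "\<exists>R\<in>?A. \<forall>(e, x)\<in>R. certified (perturb V s) x e" unfolding solved_def by auto
  qed
  then have "\<exists>\<^sub>F s in at (0::real). \<exists>R\<in>?A. \<forall>(e, x)\<in>R. certified (perturb V s) x e"
    by (rule eventually_frequently[OF at_neq_bot])
  then have "\<exists>R\<in>?A. \<exists>\<^sub>F s in at (0::real). \<forall>(e, x)\<in>R. certified (perturb V s) x e"
    by (rule frequently_bex_finite[OF fin])
  then show ?thesis using that by auto
qed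

section \<open>Transversals of certified choices in the limit\<close>

context four_triangles
begin

lemma off_edge_line:
  assumes s: "edge_skew i a j b" and z: "z \<in> edge j b"
  shows "(V i (nxt a) - V i a) \<times> (z - V i a) \<noteq> 0"
proof
  let ?d = "V i (nxt a) - V i a" and ?e = "V j (nxt b) - V j b"
  assume 0: "?d \<times> (z - V i a) = 0"
  obtain u where u: "z = (1 - u) *\<^sub>R V j b + u *\<^sub>R V j (nxt b)" using z unfolding edge_def closed_segment_def by auto
  have "V j b - V i a = (z - V i a) - u *\<^sub>R ?e" unfolding u by (simp add: algebra_simps)
  moreover have "?e \<times> (w - u *\<^sub>R ?e) = ?e \<times> w" for w by (simp add: Cross3.right_diff_distrib[of ?e w] cross_mult_right)
  ultimately have "?d \<bullet> (?e \<times> (V j b - V i a)) = ?d \<bullet> (?e \<times> (z - V i a))" by metis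
  also have "\<dots> = - (?e \<bullet> (?d \<times> (z - V i a)))" by (simp add: cross3_def inner_vec_def sum_3 algebra_simps)
  finally show False using s 0 unfolding edge_skew_def by simp
qed

text \<open>If one end were in the plane, so would be the other, as \<open>q\<close> is an inner
  point of the edge. Then the two edges would be coplanar.\<close>

lemma strictly_separated_ends:
  assumes s: "edge_skew i a j b" and n: "n \<noteq> 0" "n \<bullet> (V i (nxt a) - V i a) = 0"
    and q: "q \<in> edge j b" "q \<noteq> V j b" "q \<noteq> V j (nxt b)" "n \<bullet> (q - V i a) = 0"
  shows "(n \<bullet> (V j b - V i a)) * (n \<bullet> (V j (nxt b) - V i a)) < 0"
proof -
  obtain u where u: "0 \<le> u" "u \<le> 1" "q = (1 - u) *\<^sub>R V j b + u *\<^sub>R V j (nxt b)"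
    using q(1) unfolding edge_def closed_segment_def by auto
  have u01: "u \<noteq> 0" "u \<noteq> 1" using q(2,3) unfolding u(3) by auto
  define A where "A = n \<bullet> (V j b - V i a)"
  define B where "B = n \<bullet> (V j (nxt b) - V i a)"
  have "q - V i a = (1 - u) *\<^sub>R (V j b - V i a) + u *\<^sub>R (V j (nxt b) - V i a)" unfolding u(3) by (simp add: algebra_simps)
  then have eq: "(1 - u) * A + u * B = 0" using q(4) unfolding A_def B_def by (simp add: inner_add_right)
  have "A * B \<le> 0" by (rule convex_zero_imp[OF u(1,2) eq])
  moreover have "A \<noteq> 0 \<and> B \<noteq> 0"
  proof (rule ccontr)
    assume "\<not> ?thesis"
    then have AB: "A = 0" "B = 0" using eq u01 by auto
    have "n \<bullet> (V j (nxt b) - V j b) = B - A" unfolding A_def B_def by (simp add: inner_diff_right)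
    then show False using det_zero_if_perp[OF n, of "V j (nxt b) - V j b" "V j b - V i a"] AB s
      unfolding edge_skew_def A_def by simp
  qed
  ultimately show ?thesis unfolding A_def B_def by (simp add: less_le)
qed

text \<open>The plane spanned by the edge line and the point \<open>y s\<close> tends to the plane containing \<open>L\<close>; it keeps meeting
  the edges whose interior is crossed by \<open>L\<close>.\<close>

lemma eventually_not_certified:
  assumes e: "e \<in> choices" "L \<in> edge_lines e" and i: "i \<in> {1..4}"
    and disj: "\<And>j. j \<in> {1..4} \<Longrightarrow> j \<noteq> i \<Longrightarrow> t i \<inter> t j = {}"
    and sk: "\<And>j. j \<in> {1..4} \<Longrightarrow> j \<noteq> i \<Longrightarrow> edge_skew i (e i) j (e j)"
    and m: "m \<in> {1..4}" "m \<noteq> i" and y: "(y \<longlongrightarrow> y0) (at 0)" "y0 \<in> L" "y0 \<in> edge m (e m)"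
    and J: "\<And>s j. j \<in> J \<Longrightarrow> y s = perturb V s j (e j) \<or> y s = perturb V s j (nxt (e j))"
    and off: "\<And>j. j \<in> {1..4} \<Longrightarrow> j \<noteq> i \<Longrightarrow> j \<notin> J \<Longrightarrow> V j (e j) \<notin> L \<and> V j (nxt (e j)) \<notin> L"
  shows "\<forall>\<^sub>F s in at 0. \<not> certified (perturb V s) i e"
proof -
  let ?W = "perturb V" and ?a = "e i"
  have e3: "e j < 3" if "j \<in> {1..4}" for j using e(1) that unfolding choices_def by (auto simp: PiE_iff)
  define f where "f = (\<lambda>s. (?W s i (nxt ?a) - ?W s i ?a) \<times> (y s - ?W s i ?a))"
  define n where "n = (V i (nxt ?a) - V i ?a) \<times> (y0 - V i ?a)"
  have n0: "n \<noteq> 0" unfolding n_def by (rule off_edge_line[OF sk[OF m] y(3)])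
  have lim: "(f \<longlongrightarrow> n) (at 0)"
    unfolding f_def n_def by (intro bounded_bilinear.tendsto[OF bilinear_conv_bounded_bilinear[THEN iffD1, OF bilinear_cross]] tendsto_diff perturb_tendsto y(1))
  have nd: "n \<bullet> (V i (nxt ?a) - V i ?a) = 0" unfolding n_def by (simp add: dot_cross_self)
  have L: "L \<in> lines" "\<And>j. j \<in> {1..4} \<Longrightarrow> L \<inter> edge j (e j) \<noteq> {}"
    using e(2) unfolding transversals_def edge_def by auto
  obtain p where p: "p \<in> L" "p \<in> edge i ?a" using L(2)[OF i] by auto
  have "p \<in> t i" "y0 \<in> t m" using edge_subset_t[OF i e3[OF i]] edge_subset_t[OF m(1) e3[OF m(1)]] p(2) y(3) by auto
  then have py: "p \<noteq> y0" using disj[OF m] by auto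
  have np: "n \<bullet> (p - V i ?a) = 0"
    by (rule plane_segment_mem[OF _ nd p(2)[unfolded edge_def]]) simp
  have ny: "n \<bullet> (y0 - V i ?a) = 0" unfolding n_def by (simp add: dot_cross_self)
  have plane: "n \<bullet> (z - V i ?a) = 0" if "z \<in> L" for z
    by (rule line_in_plane_two_points[OF L(1) p(1) y(2) py np ny that])
  have prod: "\<forall>\<^sub>F s in at 0. (f s \<bullet> (?W s j (e j) - ?W s i ?a)) * (f s \<bullet> (?W s j (nxt (e j)) - ?W s i ?a)) \<le> 0"
    if j: "j \<in> {1..4} - {i}" for j
  proof (cases "j \<in> J")
    case True
    \<comment> \<open>For an index in \<open>J\<close> the plane passes through an end of the
      perturbed edge by construction, so no limit argument is involved.\<close>
    have z: "f s \<bullet> (y s - ?W s i ?a) = 0" for s unfolding f_def by (simp add: dot_cross_self)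
    have "(f s \<bullet> (?W s j (e j) - ?W s i ?a)) * (f s \<bullet> (?W s j (nxt (e j)) - ?W s i ?a)) \<le> 0" for s
      using J[OF True, of s] z[of s] by auto
    then show ?thesis by simp
  next
    case False
    have j': "j \<in> {1..4}" "j \<noteq> i" using j by auto
    obtain q where q: "q \<in> L" "q \<in> edge j (e j)" using L(2)[OF j'(1)] by auto
    have "q \<noteq> V j (e j)" "q \<noteq> V j (nxt (e j))" using off[OF j' False] q(1) by auto
    then have neg: "(n \<bullet> (V j (e j) - V i ?a)) * (n \<bullet> (V j (nxt (e j)) - V i ?a)) < 0"
      by (rule strictly_separated_ends[OF sk[OF j'] n0 nd q(2) _ _ plane[OF q(1)]])
    have "((\<lambda>s. (f s \<bullet> (?W s j (e j) - ?W s i ?a)) * (f s \<bullet> (?W s j (nxt (e j)) - ?W s i ?a))) \<longlongrightarrow>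
       (n \<bullet> (V j (e j) - V i ?a)) * (n \<bullet> (V j (nxt (e j)) - V i ?a))) (at 0)"
      by (intro tendsto_mult tendsto_inner lim tendsto_diff perturb_tendsto)
    from order_tendstoD(2)[OF this neg] show ?thesis by (rule eventually_mono) simp
  qed
  have "\<forall>\<^sub>F s in at 0. f s \<noteq> 0 \<and>
      (\<forall>j\<in>{1..4} - {i}. (f s \<bullet> (?W s j (e j) - ?W s i ?a)) * (f s \<bullet> (?W s j (nxt (e j)) - ?W s i ?a)) \<le> 0)"
    by (intro eventually_conj eventually_ball_finite ballI prod tendsto_imp_eventually_ne[OF lim n0]) simp
  then show ?thesis
  proof (rule eventually_mono)
    fix s
    assume s: "f s \<noteq> 0 \<and> (\<forall>j\<in>{1..4} - {i}. (f s \<bullet> (?W s j (e j) - ?W s i ?a)) * (f s \<bullet> (?W s j (nxt (e j)) - ?W s i ?a)) \<le> 0)"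
    have "f s \<bullet> (?W s i (nxt ?a) - ?W s i ?a) = 0" unfolding f_def by (simp add: dot_cross_self)
    then show "\<not> certified (?W s) i e" unfolding certified_def using s by (meson not_le)
  qed
qed

end

context four_triangles
begin

text \<open>A plane through a line can be made to contain one further point. If at most one other
  triangle has an end of its chosen edge on \<open>L\<close>, the plane is led through that
  perturbed end, and the remaining edges are crossed in their interior and stay crossed. This
  contradicts the certificate for small \<open>s\<close>.\<close>

lemma two_other_ends:
  assumes e: "e \<in> choices" "L \<in> edge_lines e" and i: "i \<in> {1..4}"
    and disj: "\<And>j. j \<in> {1..4} \<Longrightarrow> j \<noteq> i \<Longrightarrow> t i \<inter> t j = {}"
    and sk: "\<And>j. j \<in> {1..4} \<Longrightarrow> j \<noteq> i \<Longrightarrow> edge_skew i (e i) j (e j)"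
    and freq: "\<exists>\<^sub>F s in at 0. certified (perturb V s) i e"
  obtains j j' where "j \<in> {1..4}" "j' \<in> {1..4}" "j \<noteq> i" "j' \<noteq> i" "j \<noteq> j'"
    "V j (e j) \<in> L \<or> V j (nxt (e j)) \<in> L" "V j' (e j') \<in> L \<or> V j' (nxt (e j')) \<in> L"
proof -
  let ?end = "\<lambda>j. V j (e j) \<in> L \<or> V j (nxt (e j)) \<in> L"
  have no: "\<not> (\<forall>\<^sub>F s in at 0. \<not> certified (perturb V s) i e)" using freq unfolding frequently_def .
  have "\<exists>j\<in>{1..4}. \<exists>j'\<in>{1..4}. j \<noteq> i \<and> j' \<noteq> i \<and> j \<noteq> j' \<and> ?end j \<and> ?end j'"
  proof (rule ccontr)
    assume one: "\<not> ?thesis"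
    show False
    proof (cases "\<exists>m\<in>{1..4}. m \<noteq> i \<and> ?end m")
      case True
      then obtain m where m: "m \<in> {1..4}" "m \<noteq> i" "?end m" by blast
      then obtain k where k: "k = e m \<or> k = nxt (e m)" "V m k \<in> L" by blast
      have "V m k \<in> edge m (e m)" using k(1) unfolding edge_def by auto
      moreover have "V j (e j) \<notin> L \<and> V j (nxt (e j)) \<notin> L" if "j \<in> {1..4}" "j \<noteq> i" "j \<notin> {m}" for j
        using one m that by blast
      ultimately have "\<forall>\<^sub>F s in at 0. \<not> certified (perturb V s) i e"
        by (intro eventually_not_certified[OF e i disj sk m(1,2) perturb_tendsto[of V m k] k(2), of "{m}"]) (use k(1) in auto)
      then show False using no by blast
    next
      case False
      have "(1::nat) \<in> {1..4}" "(2::nat) \<in> {1..4}" by auto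
      then obtain m :: nat where m: "m \<in> {1..4}" "m \<noteq> i" by (metis numeral_One numeral_eq_iff semiring_norm(85))
      then obtain q where q: "q \<in> L" "q \<in> edge m (e m)" using e(2) unfolding transversals_def edge_def by blast
      have "\<forall>\<^sub>F s in at 0. \<not> certified (perturb V s) i e"
        by (rule eventually_not_certified[OF e i disj sk m tendsto_const q, of "{}"]) (use False in auto)
      then show False using no by blast
    qed
  qed
  then show ?thesis using that by blast
qed

lemma certified_alternatives:
  assumes disj: "\<And>j. j \<in> {1..4} \<Longrightarrow> j \<noteq> i \<Longrightarrow> t i \<inter> t j = {}"
    and sk: "\<And>j a b. j \<in> {1..4} \<Longrightarrow> j \<noteq> i \<Longrightarrow> a < 3 \<Longrightarrow> b < 3 \<Longrightarrow> edge_skew i a j b"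
    and i: "i \<in> {1..4}" and L: "L \<in> lines" and e: "e \<in> choices_of L"
    and freq: "\<exists>\<^sub>F s in at 0. certified (perturb V s) i e"
  obtains j j' k k' where "j \<in> {1..4}" "j' \<in> {1..4}" "j \<noteq> i" "j' \<noteq> i" "j \<noteq> j'" "k \<noteq> e j" "k' \<noteq> e j'"
    "e(j := k) \<in> choices_of L" "e(j' := k') \<in> choices_of L" "e(j := k, j' := k') \<in> choices_of L"
proof -
  have eq: "e \<in> choices" using e choices_of_subset by auto
  have e3: "e j < 3" if "j \<in> {1..4}" for j using eq that unfolding choices_def by (auto simp: PiE_iff)
  have eL: "L \<in> edge_lines e" using choices_of_iff[OF L eq] e by simp
  obtain j j' where j: "j \<in> {1..4}" "j' \<in> {1..4}" "j \<noteq> i" "j' \<noteq> i" "j \<noteq> j'"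
    "V j (e j) \<in> L \<or> V j (nxt (e j)) \<in> L" "V j' (e j') \<in> L \<or> V j' (nxt (e j')) \<in> L"
    by (rule two_other_ends[OF eq eL i disj sk[OF _ _ e3[OF i] e3] freq])
  obtain k where k: "k < 3" "k \<noteq> e j" "k \<in> met_edges L j" by (rule vertex_other_edge[OF j(1) e3[OF j(1)] j(6)])
  obtain k' where k': "k' < 3" "k' \<noteq> e j'" "k' \<in> met_edges L j'" by (rule vertex_other_edge[OF j(2) e3[OF j(2)] j(7)])
  have u: "e(j := k) \<in> choices_of L" by (rule choices_of_update[OF e j(1) k(3)])
  have u': "e(j' := k') \<in> choices_of L" by (rule choices_of_update[OF e j(2) k'(3)])
  have u'': "e(j := k, j' := k') \<in> choices_of L" by (rule choices_of_update[OF u j(2) k'(3)])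
  show ?thesis by (rule that[OF j(1-5) k(2) k'(2) u u' u''])
qed

text \<open>The alternatives keep the index of the certificate and change two others. For a fixed
  triple, one of the changed indices is \<open>m\<close> or \<open>n\<close>, and changing it leaves
  the set. For three words, the alternatives of \<open>x\<close> keep \<open>x i\<close> and so
  differ from \<open>y\<close>, and at most one of the three is \<open>z\<close>; symmetrically for
  \<open>y\<close>. If only \<open>z\<close> is realised, its alternatives are realised by
  \<open>L\<close> while \<open>x\<close> and \<open>y\<close> are not.\<close>

lemma two_outside:
  assumes disj: "\<And>i j. i \<in> {1..4} \<Longrightarrow> j \<in> {1..4} \<Longrightarrow> i \<noteq> j \<Longrightarrow> t i \<inter> t j = {}"
    and sk: "\<And>i j a b. i \<in> {1..4} \<Longrightarrow> j \<in> {1..4} \<Longrightarrow> i \<noteq> j \<Longrightarrow> a < 3 \<Longrightarrow> b < 3 \<Longrightarrow> edge_skew i a j b"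
    and R: "fixed_triple R \<or> three_words R" and freq: "\<And>e i. (e, i) \<in> R \<Longrightarrow> \<exists>\<^sub>F s in at 0. certified (perturb V s) i e"
    and L: "L \<in> lines" and e: "e \<in> choices_of L" "e \<in> fst ` R"
  obtains f g where "f \<in> choices_of L - fst ` R" "g \<in> choices_of L - fst ` R" "f \<noteq> g"
  using R
proof
  note thes = that
  assume "fixed_triple R"
  then obtain i m n a c d where R: "{i, m, n} \<subseteq> {1..4}" "distinct [i, m, n]"
    "R = {(e, x). e \<in> choices \<and> x = i \<and> e i = a \<and> e m = c \<and> e n = d}"
    unfolding fixed_triple_def by blast
  have E: "f \<in> fst ` R \<Longrightarrow> f i = a \<and> f m = c \<and> f n = d" for f unfolding R(3) by auto
  have ei: "(e, i) \<in> R" using e(2) unfolding R(3) by auto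
  have i: "i \<in> {1..4}" "m \<in> {1..4}" "n \<in> {1..4}" "i \<noteq> m" using R(1,2) by auto
  obtain j j' k k' where j: "j \<in> {1..4}" "j' \<in> {1..4}" "j \<noteq> i" "j' \<noteq> i" "j \<noteq> j'" "k \<noteq> e j" "k' \<noteq> e j'"
    "e(j := k) \<in> choices_of L" "e(j' := k') \<in> choices_of L" "e(j := k, j' := k') \<in> choices_of L"
    by (rule certified_alternatives[OF disj[OF i(1)] sk[OF i(1)] i(1) L e(1) freq[OF ei]]) blast+
  obtain x y where xy: "{1..4} = {i, m, x, y}" "distinct [i, m, x, y]" by (rule four_indices[OF i(1,2,4)])
  have "n \<in> {i, m, x, y}" "j \<in> {i, m, x, y}" "j' \<in> {i, m, x, y}" using i(3) j(1,2) unfolding xy(1) by auto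
  then have "j = m \<or> j = n \<or> j' = m \<or> j' = n" using R(2) j(3-5) by auto
  then consider "j = m \<or> j = n" | "j' = m \<or> j' = n" by blast
  then show ?thesis
  proof cases
    case 1
    have out: "f \<notin> fst ` R" if "f j = k" for f using E[of f] E[OF e(2)] that 1 j(6) by auto
    have "e(j := k) \<noteq> e(j := k, j' := k')" using j(5,7) by (metis fun_upd_other fun_upd_same)
    then show ?thesis using thes[of "e(j := k)" "e(j := k, j' := k')"] j(5,8,10) out by simp
  next
    case 2
    have out: "f \<notin> fst ` R" if "f j' = k'" for f using E[of f] E[OF e(2)] that 2 j(7) by auto
    have "e(j' := k') \<noteq> e(j := k, j' := k')" using j(5,6) by (metis fun_upd_other fun_upd_same)
    then show ?thesis using thes[of "e(j' := k')" "e(j := k, j' := k')"] j(9,10) out by simp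
  qed
next
  note thes = that
  assume "three_words R"
  then obtain i i' x y z where R: "{i, i'} \<subseteq> {1..4}" "{x, y, z} \<subseteq> choices" "z \<noteq> x" "z \<noteq> y" "x i \<noteq> y i"
    "R = {(x, i), (y, i), (z, i')}" unfolding three_words_def by blast
  have E: "fst ` R = {x, y, z}" unfolding R(6) by simp
  have i: "i \<in> {1..4}" "i' \<in> {1..4}" using R(1) by auto
  have three: "\<exists>f1 f2 f3. f1 \<in> choices_of L \<and> f2 \<in> choices_of L \<and> f3 \<in> choices_of L \<and> distinct [w, f1, f2, f3] \<and>
      f1 h = w h \<and> f2 h = w h \<and> f3 h = w h" if h: "(w, h) \<in> R" "w \<in> choices_of L" for w h
  proof -
    have hi: "h \<in> {1..4}" using h(1) i unfolding R(6) by auto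
    obtain j j' k k' where j: "j \<in> {1..4}" "j' \<in> {1..4}" "j \<noteq> h" "j' \<noteq> h" "j \<noteq> j'" "k \<noteq> w j" "k' \<noteq> w j'"
      "w(j := k) \<in> choices_of L" "w(j' := k') \<in> choices_of L" "w(j := k, j' := k') \<in> choices_of L"
      by (rule certified_alternatives[OF disj[OF hi] sk[OF hi] hi L h(2) freq[OF h(1)]]) blast+
    have "w \<noteq> w(j := k)" "w \<noteq> w(j' := k')" "w \<noteq> w(j := k, j' := k')" "w(j := k) \<noteq> w(j' := k')"
      "w(j := k) \<noteq> w(j := k, j' := k')" "w(j' := k') \<noteq> w(j := k, j' := k')"
      using j(5-7) by (metis fun_upd_other fun_upd_same)+
    then show ?thesis using j
      by (intro exI[of _ "w(j := k)"] exI[of _ "w(j' := k')"] exI[of _ "w(j := k, j' := k')"]) simp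
  qed
  have first: ?thesis if w: "w \<in> choices_of L" "(w, i) \<in> R" "{w, w'} = {x, y}" "w i \<noteq> w' i" for w w'
  proof -
    obtain f1 f2 f3 where f: "f1 \<in> choices_of L" "f2 \<in> choices_of L" "f3 \<in> choices_of L" "distinct [w, f1, f2, f3]"
      "f1 i = w i" "f2 i = w i" "f3 i = w i" using three[OF w(2,1)] by blast
    have E': "fst ` R = {w, w', z}" unfolding E using w(3) by auto
    have ne: "f1 \<noteq> w'" "f2 \<noteq> w'" "f3 \<noteq> w'" using f(5-7) w(4) by auto
    consider "z \<noteq> f1" "z \<noteq> f2" | "z \<noteq> f1" "z \<noteq> f3" | "z \<noteq> f2" "z \<noteq> f3" using f(4) by auto
    then show ?thesis
    proof cases
      case 1
      show ?thesis by (rule thes[of f1 f2]) (use 1 f ne E' in auto)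
    next
      case 2
      show ?thesis by (rule thes[of f1 f3]) (use 2 f ne E' in auto)
    next
      case 3
      show ?thesis by (rule thes[of f2 f3]) (use 3 f ne E' in auto)
    qed
  qed
  show ?thesis
  proof (cases "x \<in> choices_of L \<or> y \<in> choices_of L")
    case True
    then show ?thesis
    proof
      assume "x \<in> choices_of L"
      then show ?thesis by (rule first[of x y]) (use R(5,6) in auto)
    next
      assume "y \<in> choices_of L"
      then show ?thesis by (rule first[of y x]) (use R(5,6) in auto)
    qed
  next
    case False
    have z: "z \<in> choices_of L" "(z, i') \<in> R" using e False R(6) unfolding E by auto
    obtain f1 f2 f3 where f: "f1 \<in> choices_of L" "f2 \<in> choices_of L" "distinct [z, f1, f2, f3]"
      using three[OF z(2,1)] by blast
    show ?thesis by (rule thes[of f1 f2]) (use f False E in auto)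
  qed
qed

lemma card_certified:
  assumes R: "fixed_triple R \<or> three_words R"
  shows "fst ` R \<subseteq> choices \<and> card (fst ` R) = 3"
  using R
proof
  assume "fixed_triple R"
  then obtain i m n a c d where R: "{i, m, n} \<subseteq> {1..4}" "distinct [i, m, n]" "a < 3" "c < 3" "d < 3"
    "R = {(e, x). e \<in> choices \<and> x = i \<and> e i = a \<and> e m = c \<and> e n = d}"
    unfolding fixed_triple_def by blast
  have i: "i \<in> {1..4}" "m \<in> {1..4}" "n \<in> {1..4}" "i \<noteq> m" "n \<noteq> i" "n \<noteq> m" using R(1,2) by auto
  let ?A = "\<lambda>x. if x = i then {a} else if x = m then {c} else if x = n then {d} else {..<3::nat}"
  have E: "fst ` R = {e \<in> choices. e i = a \<and> e m = c \<and> e n = d}" unfolding R(6) by force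
  also have "\<dots> = (\<Pi>\<^sub>E x\<in>{1..4}. ?A x)"
    unfolding choices_def using i R(3-5) by (auto simp: PiE_iff extensional_def split: if_splits)
  finally have "card (fst ` R) = (\<Prod>x\<in>{1..4}. card (?A x))" by (simp add: card_PiE)
  also have "\<dots> = 3"
  proof -
    obtain x y where xy: "{1..4} = {i, m, x, y}" "distinct [i, m, x, y]" by (rule four_indices[OF i(1,2,4)])
    have "n = x \<or> n = y" using i(3,5,6) unfolding xy(1) by auto
    moreover have "x \<noteq> i" "x \<noteq> m" "y \<noteq> i" "y \<noteq> m" "x \<noteq> y" using xy(2) by auto
    ultimately show ?thesis unfolding xy(1) using i(4) by (elim disjE) simp_all
  qed
  finally show ?thesis unfolding E by auto
next
  assume "three_words R"
  then obtain i i' x y z where R: "{x, y, z} \<subseteq> choices" "z \<noteq> x" "z \<noteq> y" "x i \<noteq> y i"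
    "R = {(x, i), (y, i), (z, i')}" unfolding three_words_def by blast
  have "x \<noteq> y" using R(4) by auto
  then show ?thesis using R(1-3) unfolding R(5) by simp
qed

text \<open>When all edges of different triangles are skew, each transversal lies in a piece of
  weight at least 2. Every realised choice then has load at least 2, so two choices outside the
  discarded set already give 4.\<close>

lemma disjoint_bound:
  assumes disj: "\<And>i j. i \<in> {1..4} \<Longrightarrow> j \<in> {1..4} \<Longrightarrow> i \<noteq> j \<Longrightarrow> t i \<inter> t j = {}"
  shows "card components \<le> 156"
proof (cases "\<forall>i\<in>{1..4}. \<forall>j\<in>{1..4}. i \<noteq> j \<longrightarrow> (\<forall>a<3. \<forall>b<3. edge_skew i a j b)")
  case False
  then obtain i j a b where h: "i \<in> {1..4}" "j \<in> {1..4}" "i \<noteq> j" "a < 3" "b < 3" "\<not> edge_skew i a j b" by blast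
  show ?thesis by (rule coplanar_edges_bound[OF disj h])
next
  case True
  then have sk: "edge_skew i a j b" if "i \<in> {1..4}" "j \<in> {1..4}" "i \<noteq> j" "a < 3" "b < 3" for i j a b
    using that by blast
  have V3: "V i ` {..<3} = {V i 0, V i 1, V i 2}" for i
  proof -
    have "{..<3::nat} = {0, 1, 2}" by auto
    then show ?thesis by simp
  qed
  have hulls: "convex hull (V i ` {..<3}) \<inter> convex hull (V j ` {..<3}) = {}"
    if "i \<in> {1..4}" "j \<in> {1..4}" "i \<noteq> j" for i j
    using disj[OF that] unfolding t_hull[OF that(1)] t_hull[OF that(2)] V3 .
  obtain R where R: "fixed_triple R \<or> three_words R" "\<exists>\<^sub>F s in at 0. \<forall>(e, x)\<in>R. certified (perturb V s) x e"
    by (rule frequently_certified[OF hulls])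
  have freq: "\<exists>\<^sub>F s in at 0. certified (perturb V s) i e" if "(e, i) \<in> R" for e i
    using R(2) by (rule frequently_elim1) (use that in auto)
  let ?E = "fst ` R"
  let ?p = "\<lambda>e i. V i (e i)" and ?q = "\<lambda>e i. V i (nxt (e i))"
  have "\<forall>e\<in>choices. \<exists>xs. covering {1..4} (?p e) (?q e) (edge_lines e) xs \<and> (\<Sum>x\<leftarrow>xs. snd x) \<le> 8"
  proof
    fix e assume e: "e \<in> choices"
    have "skew (?p e) (?q e) i j" if "i \<in> {1..4}" "j \<in> {1..4}" "i \<noteq> j" for i j
      using sk[OF that, of "e i" "e j"] e that(1,2) unfolding skew_def edge_skew_def choices_def by (auto simp: PiE_iff)
    then show "\<exists>xs. covering {1..4} (?p e) (?q e) (edge_lines e) xs \<and> (\<Sum>x\<leftarrow>xs. snd x) \<le> 8"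
      by (intro covering_skew[of _ 1 2 3 4]) auto
  qed
  then obtain xs where xs: "\<forall>e\<in>choices. covering {1..4} (?p e) (?q e) (edge_lines e) (xs e) \<and> (\<Sum>x\<leftarrow>xs e. snd x) \<le> 8"
    by (rule bchoice[THEN exE])
  have cap: "capped_by {1..4} (?p e) (?q e) (xs e)" if "e \<in> choices" for e
    using bspec[OF xs that] by (elim conjE) (rule covering_capped_by)
  have load2: "2 \<le> load xs K f" if h: "K \<in> components" "L \<in> K" "f \<in> choices_of L" for K L f
  proof -
    have f: "f \<in> choices" using h(3) choices_of_subset by auto
    have "L \<in> lines" using component_mem_tangents[OF h(1,2)] unfolding tangents_iff by simp
    then have "L \<in> edge_lines f" using choices_of_iff f h(3) by simp
    then obtain x where x: "x \<in> set (xs f)" "L \<in> fst x" "2 \<le> snd x"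
      using bspec[OF xs f] unfolding covering_def by fastforce
    have p: "pieces_of {1..4} (?p f) (?q f) (xs f)" using cap[OF f] unfolding capped_by_def by simp
    have "2 \<le> weight_at (xs f) L" using weight_at_ge[OF x(1,2)] x(3) by simp
    also have "\<dots> \<le> load xs K f" by (rule weight_le_load[where xs = xs and e = f, OF h(1) f p h(2)])
    finally show ?thesis .
  qed
  have "finite components \<and> 4 * card components \<le> 8 * card (choices - ?E) + 4 * length ([] :: (real^3) set set list)"
  proof (rule components_bound[where xs = xs])
    fix K assume K: "K \<in> components"
    have "4 \<le> (\<Sum>e\<in>choices - ?E. load xs K e)"
    proof (cases "\<exists>L\<in>K. \<exists>e\<in>?E. e \<in> choices_of L")
      case True
      then obtain L e where L: "L \<in> K" "e \<in> ?E" "e \<in> choices_of L" by (elim bexE)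
      have Ll: "L \<in> lines" using component_mem_tangents[OF K L(1)] unfolding tangents_iff by simp
      obtain f g where fg: "f \<in> choices_of L - ?E" "g \<in> choices_of L - ?E" "f \<noteq> g"
        by (rule two_outside[OF disj sk R(1) freq Ll L(3,2)])
      have "4 \<le> (\<Sum>e\<in>{f, g}. load xs K e)" using load2[OF K L(1), of f] load2[OF K L(1), of g] fg by simp
      also have "\<dots> \<le> (\<Sum>e\<in>choices - ?E. load xs K e)"
        by (rule sum_ge_subset) (use fg choices_of_subset[of L] finite_choices in auto)
      finally show ?thesis .
    next
      case False
      have "choices_of L \<subseteq> choices - ?E" if "L \<in> K" for L
        using False that choices_of_subset[of L] by auto
      then show ?thesis using load_total[OF K _ _, of "choices - ?E" xs] cap finite_choices by simp
    qed
    then show "(\<exists>Y\<in>set []. Y \<noteq> {} \<and> Y \<subseteq> K) \<or> 4 \<le> (\<Sum>e\<in>choices - ?E. load xs K e)" by (rule disjI2)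
  qed (use cap in \<open>auto simp: capped_by_def\<close>)
  moreover have "card (choices - ?E) = 78"
    using card_Diff_subset[OF finite_subset[OF _ finite_choices], of ?E] card_certified[OF R(1)] card_choices by simp
  ultimately show ?thesis by simp
qed

end

theorem theorem4:
  fixes t :: "nat \<Rightarrow> (real^3) set"
  assumes "\<forall>i\<in>{1..4}. triangle (t i)"
  shows "(finite (line_components (common_tangents {1..4} t)) \<and>
            card (line_components (common_tangents {1..4} t)) \<le> 162) \<and>
         (disjoint_family_on t {1..4} \<longrightarrow>
            card (line_components (common_tangents {1..4} t)) \<le> 156)"
proof -
  have "\<forall>i\<in>{1..4}. \<exists>v :: nat \<Rightarrow> real^3. \<not> collinear {v 0, v 1, v 2} \<and> t i = convex hull {v 0, v 1, v 2}"
  proof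
    fix i :: nat assume "i \<in> {1..4}"
    then obtain a b c where "\<not> collinear {a, b, c}" "t i = convex hull {a, b, c}"
      using assms unfolding triangle_def by blast
    then show "\<exists>v :: nat \<Rightarrow> real^3. \<not> collinear {v 0, v 1, v 2} \<and> t i = convex hull {v 0, v 1, v 2}"
      by (intro exI[of _ "\<lambda>k. if k = 0 then a else if k = 1 then b else c"]) simp
  qed
  then obtain V :: "nat \<Rightarrow> nat \<Rightarrow> real^3" where
    V: "\<forall>i\<in>{1..4}. \<not> collinear {V i 0, V i 1, V i 2} \<and> t i = convex hull {V i 0, V i 1, V i 2}"
    by (rule bchoice[THEN exE])
  interpret four_triangles t V by unfold_locales (use V in blast)+
  have "card components \<le> 156" if "disjoint_family_on t {1..4}"
    by (rule disjoint_bound) (use that in \<open>simp add: disjoint_family_on_def\<close>)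
  then show ?thesis using finite_components_162 unfolding line_components_def by blast
qed

end
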